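(* Let $u\in H^1_0(\Omega)$ be an eigenfunction of the Poisson eigenvalue problem $-\Delta u=\lambda u$ in $\Omega$, $u=0$ on $\partial\Omega$. Then $$u\in B^{\alpha}_{\tau}(L^{\tau}(\Omega))\qquad\text{for all }\alpha\ge0,\quad\text{where } \frac1\tau=\frac\alpha2+\frac12 .$$
   Context: $\Omega\subset\mathbb R^2$ is a bounded open polygonal domain with vertices $x^{(1)},\dots,x^{(d)}$ whose interior angles $\alpha_i$ at $x^{(i)}$ satisfy $0<\alpha_i<2\pi$ for $i=1,\dots,d$. $B^\alpha_\tau(L^\tau(\Omega))$ denotes the Besov space of smoothness $\alpha$ measured in $L^\tau(\Omega)$ with secondary (summability) index $\tau$ (a quasi-Banach space when $\tau<1$). *)

theory Defs
  imports "HOL-Analysis.Analysis"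
begin

subsection \<open>Polygonal domains\<close>

definition sector :: "real^2 \<Rightarrow> real \<Rightarrow> real \<Rightarrow> (real^2) set" where
  "sector x \<phi> \<theta> = {x + vector [\<rho> * cos t, \<rho> * sin t] |\<rho> t. 0 < \<rho> \<and> \<phi> < t \<and> t < \<phi> + \<theta>}"

definition local_angle :: "(real^2) set \<Rightarrow> real^2 \<Rightarrow> real \<Rightarrow> bool" where
  "local_angle \<Omega> x \<theta> \<longleftrightarrow> (\<exists>r>0. \<exists>\<phi>. \<Omega> \<inter> ball x r = sector x \<phi> \<theta> \<inter> ball x r)"

text \<open>
  The boundary is a finite union of segments joining vertices; near the vertex \<open>x i\<close> the domain is
  a sector of opening \<open>\<theta> i\<close>, its interior angle, and near every other boundary point it is a
  half-plane. In particular the domain lies on one side of its boundary. Several boundary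
  components (holes) are allowed, and so are vertices of angle \<open>\<pi>\<close>.
\<close>

definition polygonal_domain ::
  "(real^2) set \<Rightarrow> nat \<Rightarrow> (nat \<Rightarrow> real^2) \<Rightarrow> (nat \<Rightarrow> real) \<Rightarrow> bool" where
  "polygonal_domain \<Omega> d x \<theta> \<longleftrightarrow>
     open \<Omega> \<and> connected \<Omega> \<and> bounded \<Omega> \<and> \<Omega> \<noteq> {} \<and>
     inj_on x {1..d} \<and>
     (\<exists>E \<subseteq> x ` {1..d} \<times> x ` {1..d}. frontier \<Omega> = (\<Union>(a, b)\<in>E. closed_segment a b)) \<and>
     (\<forall>i\<in>{1..d}. x i \<in> frontier \<Omega> \<and> local_angle \<Omega> (x i) (\<theta> i)) \<and>
     (\<forall>y\<in>frontier \<Omega> - x ` {1..d}. local_angle \<Omega> y pi)"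

subsection \<open>Lebesgue spaces\<close>

text \<open>
  Elements of function spaces on \<open>\<Omega>\<close> are represented by functions on the whole space; values
  outside \<open>\<Omega>\<close> and on null sets are irrelevant. The exponent may be less than 1.
\<close>

definition Lp_space ::
  "real \<Rightarrow> 'a::euclidean_space set \<Rightarrow> ('a \<Rightarrow> 'b::euclidean_space) set" where
  "Lp_space p \<Omega> = {f \<in> borel_measurable (lebesgue_on \<Omega>).
     integrable (lebesgue_on \<Omega>) (\<lambda>x. norm (f x) powr p)}"

definition Lp_norm ::
  "real \<Rightarrow> 'a::euclidean_space set \<Rightarrow> ('a \<Rightarrow> 'b::euclidean_space) \<Rightarrow> real" where
  "Lp_norm p \<Omega> f = (LINT x|lebesgue_on \<Omega>. norm (f x) powr p) powr (1 / p)"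

definition locally_integrable_on ::
  "('a::euclidean_space \<Rightarrow> 'b::euclidean_space) \<Rightarrow> 'a set \<Rightarrow> bool" where
  "locally_integrable_on f \<Omega> \<longleftrightarrow> (\<forall>K. compact K \<and> K \<subseteq> \<Omega> \<longrightarrow> set_integrable lebesgue K f)"

subsection \<open>Sobolev spaces\<close>

definition partial :: "'a \<Rightarrow> ('a::euclidean_space \<Rightarrow> real) \<Rightarrow> 'a \<Rightarrow> real" where
  "partial b f x = frechet_derivative f (at x) b"

primrec k_times_cont_diff :: "nat \<Rightarrow> ('a::euclidean_space \<Rightarrow> real) \<Rightarrow> bool" where
  "k_times_cont_diff 0 f \<longleftrightarrow> continuous_on UNIV f"
| "k_times_cont_diff (Suc k) f \<longleftrightarrow>
     (\<forall>x. f differentiable (at x)) \<and> (\<forall>b\<in>Basis. k_times_cont_diff k (partial b f))"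

definition test_functions :: "'a::euclidean_space set \<Rightarrow> ('a \<Rightarrow> real) set" where
  "test_functions \<Omega> = {\<phi>. (\<forall>k. k_times_cont_diff k \<phi>) \<and>
     compact (closure {x. \<phi> x \<noteq> 0}) \<and> closure {x. \<phi> x \<noteq> 0} \<subseteq> \<Omega>}"

definition is_weak_grad ::
  "'a::euclidean_space set \<Rightarrow> ('a \<Rightarrow> real) \<Rightarrow> ('a \<Rightarrow> 'a) \<Rightarrow> bool" where
  "is_weak_grad \<Omega> u g \<longleftrightarrow> locally_integrable_on u \<Omega> \<and> locally_integrable_on g \<Omega> \<and>
     (\<forall>\<phi>\<in>test_functions \<Omega>. \<forall>b\<in>Basis.
        (LINT x|lebesgue_on \<Omega>. u x * partial b \<phi> x) =
        - (LINT x|lebesgue_on \<Omega>. (g x \<bullet> b) * \<phi> x))"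

text \<open>On an open set a weak gradient is unique up to null sets, so the choice is immaterial.\<close>

definition weak_grad :: "'a::euclidean_space set \<Rightarrow> ('a \<Rightarrow> real) \<Rightarrow> 'a \<Rightarrow> 'a" where
  "weak_grad \<Omega> u = (SOME g. is_weak_grad \<Omega> u g)"

definition H1 :: "'a::euclidean_space set \<Rightarrow> ('a \<Rightarrow> real) set" where
  "H1 \<Omega> = {u \<in> Lp_space 2 \<Omega>. (\<exists>g. is_weak_grad \<Omega> u g) \<and> weak_grad \<Omega> u \<in> Lp_space 2 \<Omega>}"

definition H1_norm :: "'a::euclidean_space set \<Rightarrow> ('a \<Rightarrow> real) \<Rightarrow> real" where
  "H1_norm \<Omega> u = sqrt ((Lp_norm 2 \<Omega> u)\<^sup>2 + (Lp_norm 2 \<Omega> (weak_grad \<Omega> u))\<^sup>2)"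

definition H1_0 :: "'a::euclidean_space set \<Rightarrow> ('a \<Rightarrow> real) set" where
  "H1_0 \<Omega> = {u \<in> H1 \<Omega>. \<exists>\<phi>. (\<forall>n::nat. \<phi> n \<in> test_functions \<Omega>) \<and>
     (\<lambda>n. H1_norm \<Omega> (\<lambda>x. u x - \<phi> n x)) \<longlonglongrightarrow> 0}"

text \<open>Variational form of \<open>- \<Delta> u = \<mu> u\<close> in \<open>\<Omega>\<close>, \<open>u = 0\<close> on the boundary.\<close>

definition dirichlet_eigenfunction ::
  "'a::euclidean_space set \<Rightarrow> real \<Rightarrow> ('a \<Rightarrow> real) \<Rightarrow> bool" where
  "dirichlet_eigenfunction \<Omega> \<mu> u \<longleftrightarrow>
     u \<in> H1_0 \<Omega> \<and> \<not> (AE x in lebesgue_on \<Omega>. u x = 0) \<and>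
     (\<forall>v\<in>H1_0 \<Omega>. (LINT x|lebesgue_on \<Omega>. weak_grad \<Omega> u x \<bullet> weak_grad \<Omega> v x) =
        \<mu> * (LINT x|lebesgue_on \<Omega>. u x * v x))"

subsection \<open>Besov spaces\<close>

definition finite_difference :: "nat \<Rightarrow> 'a::euclidean_space \<Rightarrow> ('a \<Rightarrow> real) \<Rightarrow> 'a \<Rightarrow> real" where
  "finite_difference r h f x =
     (\<Sum>k\<le>r. (-1) ^ (r - k) * real (r choose k) * f (x + real k *\<^sub>R h))"

definition diff_domain ::
  "nat \<Rightarrow> 'a::euclidean_space \<Rightarrow> 'a set \<Rightarrow> 'a set" where
  "diff_domain r h \<Omega> = {x. closed_segment x (x + real r *\<^sub>R h) \<subseteq> \<Omega>}"

definition modulus_of_smoothness ::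
  "nat \<Rightarrow> real \<Rightarrow> 'a::euclidean_space set \<Rightarrow> ('a \<Rightarrow> real) \<Rightarrow> real \<Rightarrow> real" where
  "modulus_of_smoothness r p \<Omega> f t =
     (SUP h\<in>{h. norm h \<le> t}. Lp_norm p (diff_domain r h \<Omega>) (finite_difference r h f))"

text \<open>
  The space \<open>B\<^sup>\<alpha>\<^sub>q(L\<^sup>p(\<Omega>))\<close> for \<open>\<alpha> \<ge> 0\<close> and \<open>0 < p, q < \<infinity>\<close>. The order of the
  differences is the smallest integer greater than \<open>\<alpha>\<close>. For \<open>f\<close> in \<open>L\<^sup>p\<close> the supremum above is
  over a bounded set, and for \<open>\<alpha> > 0\<close> integrating over \<open>(0, \<infinity>)\<close> instead of \<open>(0, 1]\<close> gives the
  same space. For \<open>\<alpha> = 0\<close> only \<open>(0, 1]\<close> makes sense, since the modulus need not vanish at infinity;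
  the resulting space is contained in \<open>L\<^sup>p\<close>.
\<close>

definition besov_space ::
  "real \<Rightarrow> real \<Rightarrow> real \<Rightarrow> 'a::euclidean_space set \<Rightarrow> ('a \<Rightarrow> real) set" where
  "besov_space \<alpha> q p \<Omega> = {f \<in> Lp_space p \<Omega>.
     set_integrable lborel {0<..1}
       (\<lambda>t. (t powr (- \<alpha>) * modulus_of_smoothness (nat \<lfloor>\<alpha>\<rfloor> + 1) p \<Omega> f t) powr q / t)}"

end

theory Submission
  imports Defs
begin

text \<open>
  Let \<open>w\<close> be \<open>u\<close> extended by \<open>0\<close>. Approximation by test functions and one integration by
  parts bound the integral of \<open>w\<^sup>2\<close> over any disc of radius \<open>t\<close> by \<open>C t\<close>; this replaces all
  corner regularity theory. Let \<open>\<rho>\<close> be the distance to the vertices. On the scale \<open>\<rho>\<close> the domain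
  looks like a disc or a half-plane, and in the second case the odd reflection of \<open>w\<close> is a weak
  solution across the boundary. Weak solutions \<open>f\<close> of the Helmholtz equation are reproduced by
  explicit smooth kernels: \<open>f y * cosh (sqrt \<mu> * s)\<close> is harmonic in \<open>(y, s)\<close>, and the mean value
  property in this extra variable is integrated in \<open>s\<close>. Differences of order \<open>r\<close> with step \<open>h\<close>,
  \<open>norm h\<close> small against \<open>\<rho>\<close>, fall on the kernel and are at most
  \<open>C * norm h ^ r * \<rho> powr (- r - 1/2)\<close>, the \<open>1/2\<close> being the gain from the bound on discs;
  in discs of radius comparable to \<open>norm h\<close> around the vertices that bound alone is enough.
  Since \<open>(\<alpha> + 1) * \<tau> = 2\<close>, the modulus of smoothness is \<open>O(t powr \<beta>)\<close> for some \<open>\<beta> > \<alpha>\<close>.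
\<close>

subsection \<open>Smooth functions\<close>

text \<open>The exponents balance with room to spare. A disc of radius \<rho> has area of order
  \<open>\<rho>\<^sup>2\<close> but carries square integral only \<open>O(\<rho>)\<close>, so
  \<open>w\<close> has on average at most the size \<open>\<rho> powr (- 1/2)\<close>. For
  \<open>norm h \<le> t\<close> the factor \<open>(t / \<rho>) ^ r\<close> in the difference bound
  may be weakened to \<open>(t / \<rho>) powr s\<close> with \<open>s \<le> r\<close>, and
  \<open>\<rho> powr (- (s + 1/2) * \<tau>)\<close> is locally integrable in the plane iff
  \<open>(s + 1/2) * \<tau> < 2\<close>. As \<open>(\<alpha> + 1) * \<tau> = 2\<close>, every
  \<open>s < \<alpha> + 1/2\<close> qualifies. The discs around the vertices contribute
  \<open>t powr (2 - \<tau> / 2)\<close>, against the critical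
  \<open>t powr (\<alpha> * \<tau>) = t powr (2 - \<tau>)\<close>. The obstacle is that no
  reflection exists at a vertex, so the radius of the kernel has to shrink in proportion to \<rho>.
  This is why kernels of all scales are considered, with constants uniform in the scale, and why the
  geometry is cast as flatness on balls of radius proportional to \<rho>. Independence of the scale
  is also what links \<open>w\<close> to its odd reflection: on tiny discs inside the domain the two
  coincide, and the reflection then carries the identity up to the scale \<rho>.\<close>

definition smooth :: "('a::euclidean_space \<Rightarrow> real) \<Rightarrow> bool" where
  "smooth f \<longleftrightarrow> (\<forall>k. k_times_cont_diff k f)"

text \<open>A function of one variable carried along with all its derivatives. With these as data,
  the chain rule leads from \<open>p n\<close> to \<open>p (Suc n)\<close> inside the same family,
  and a function defined by a parameter integral is handled by exhibiting the whole family at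
  once.\<close>

definition smooth_family :: "(nat \<Rightarrow> real \<Rightarrow> real) \<Rightarrow> bool" where
  "smooth_family p \<longleftrightarrow> (\<forall>n x. (p n has_real_derivative p (Suc n) x) (at x))"

definition laplacian :: "('a::euclidean_space \<Rightarrow> real) \<Rightarrow> 'a \<Rightarrow> real" where
  "laplacian f x = (\<Sum>b\<in>Basis. partial b (partial b f) x)"

lemma partialI: "(f has_derivative f') (at x) \<Longrightarrow> partial b f x = f' b"
  by (simp add: partial_def frechet_derivative_at[symmetric])

lemma k_times_cont_diff_continuous: "k_times_cont_diff k f \<Longrightarrow> continuous_on UNIV f"
  by (cases k) (auto simp: continuous_on_eq_continuous_at intro: differentiable_imp_continuous_within)

lemma k_times_cont_diff_SucD: "k_times_cont_diff (Suc k) f \<Longrightarrow> k_times_cont_diff k f"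
proof (induction k arbitrary: f)
  case 0 then show ?case using k_times_cont_diff_continuous[of "Suc 0" f] by simp
next
  case (Suc k)
  from Suc.prems[unfolded k_times_cont_diff.simps(2)[of "Suc k"]] Suc.IH
  show ?case unfolding k_times_cont_diff.simps(2)[of k] by blast
qed

lemma partial_add:
  assumes "f differentiable (at x)" "g differentiable (at x)"
  shows "partial b (\<lambda>x. f x + g x) x = partial b f x + partial b g x"
  unfolding partial_def[of b f] partial_def[of b g]
  by (rule partialI) (use assms in \<open>auto intro!: has_derivative_add simp: frechet_derivative_works[symmetric]\<close>)

lemma partial_mult:
  assumes "f differentiable (at x)" "g differentiable (at x)"
  shows "partial b (\<lambda>x. f x * g x) x = f x * partial b g x + partial b f x * g x"
  unfolding partial_def[of b f] partial_def[of b g]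
  by (rule partialI) (use assms in \<open>auto intro!: has_derivative_mult simp: frechet_derivative_works[symmetric]\<close>)

lemma partial_const [simp]: "partial b (\<lambda>x. c) = (\<lambda>x. 0)"
  by (rule ext, rule partialI) auto

lemma has_derivative_partial:
  assumes "f differentiable (at x)"
  shows "(f has_derivative (\<lambda>v. \<Sum>b\<in>Basis. (v \<bullet> b) * partial b f x)) (at x)"
proof -
  have d: "(f has_derivative frechet_derivative f (at x)) (at x)"
    using assms by (simp add: frechet_derivative_works[symmetric])
  then have l: "linear (frechet_derivative f (at x))"
    using has_derivative_linear by blast
  have "frechet_derivative f (at x) v = (\<Sum>b\<in>Basis. (v \<bullet> b) * partial b f x)" for v
  proof -
    have "frechet_derivative f (at x) v = frechet_derivative f (at x) (\<Sum>b\<in>Basis. (v \<bullet> b) *\<^sub>R b)"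
      by (simp add: euclidean_representation)
    also have "\<dots> = (\<Sum>b\<in>Basis. (v \<bullet> b) * partial b f x)"
      using l by (simp add: linear_sum linear_scale partial_def)
    finally show ?thesis .
  qed
  then have "frechet_derivative f (at x) = (\<lambda>v. \<Sum>b\<in>Basis. (v \<bullet> b) * partial b f x)" by blast
  then show ?thesis using d by simp
qed

lemma partial_compose:
  assumes "f differentiable (at x)" "(p has_real_derivative p') (at (f x))"
  shows "partial b (\<lambda>x. p (f x)) x = p' * partial b f x"
proof -
  have "((\<lambda>x. p (f x)) has_derivative (\<lambda>v. frechet_derivative f (at x) v * p')) (at x)"
    by (rule DERIV_compose_FDERIV[where f = p and g = f])
      (use assms in \<open>auto simp: frechet_derivative_works[symmetric]\<close>)
  from partialI[OF this] show ?thesis by (simp add: partial_def)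
qed

section \<open>Stability of continuous differentiability under sums, products, composition and
  affine maps\<close>

lemma k_times_cont_diff_const [simp]: "k_times_cont_diff k (\<lambda>x. c)"
  by (induction k arbitrary: c) auto

lemma k_times_cont_diff_add:
  "k_times_cont_diff k f \<Longrightarrow> k_times_cont_diff k g \<Longrightarrow> k_times_cont_diff k (\<lambda>x. f x + g x)"
proof (induction k arbitrary: f g)
  case (Suc k)
  then have "partial b (\<lambda>x. f x + g x) = (\<lambda>x. partial b f x + partial b g x)" for b
    by (auto simp: partial_add)
  then show ?case using Suc by (auto intro: differentiable_add)
qed (auto intro: continuous_on_add)

lemma k_times_cont_diff_mult:
  "k_times_cont_diff k f \<Longrightarrow> k_times_cont_diff k g \<Longrightarrow> k_times_cont_diff k (\<lambda>x. f x * g x)"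
proof (induction k arbitrary: f g)
  case (Suc k)
  then have "partial b (\<lambda>x. f x * g x) = (\<lambda>x. f x * partial b g x + partial b f x * g x)" for b
    by (auto simp: partial_mult)
  moreover have "k_times_cont_diff k f" "k_times_cont_diff k g"
    using Suc k_times_cont_diff_SucD by blast+
  ultimately show ?case using Suc by (auto intro!: k_times_cont_diff_add differentiable_mult)
qed (auto intro: continuous_on_mult)

lemma k_times_cont_diff_sum:
  "(\<And>i. i \<in> I \<Longrightarrow> k_times_cont_diff k (f i)) \<Longrightarrow> k_times_cont_diff k (\<lambda>x. \<Sum>i\<in>I. f i x)"
  by (induction I rule: infinite_finite_induct) (auto intro: k_times_cont_diff_add)

lemma k_times_cont_diff_compose:
  assumes p: "smooth_family p"
  shows "k_times_cont_diff k f \<Longrightarrow> k_times_cont_diff k (\<lambda>x. p n (f x))"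
proof (induction k arbitrary: n f)
  case 0
  have "continuous_on UNIV (p n)"
    using p by (auto simp: smooth_family_def continuous_on_eq_continuous_at intro: DERIV_isCont)
  then show ?case using 0 continuous_on_compose2[of UNIV "p n" UNIV f] by auto
next
  case (Suc k)
  have d: "(p n has_real_derivative p (Suc n) x) (at x)" for x
    using p by (simp add: smooth_family_def)
  from Suc have "partial b (\<lambda>x. p n (f x)) = (\<lambda>x. p (Suc n) (f x) * partial b f x)" for b
    by (intro ext partial_compose d) auto
  moreover have "(\<lambda>x. p n (f x)) differentiable at x" for x
  proof -
    have "f differentiable (at x)" using Suc by auto
    then obtain f' where "(f has_derivative f') (at x)" unfolding differentiable_def ..
    from DERIV_compose_FDERIV[OF d this] show ?thesis
      unfolding differentiable_def by auto
  qed
  moreover have "k_times_cont_diff k f" using Suc k_times_cont_diff_SucD by blast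
  ultimately show ?case using Suc by (auto intro!: k_times_cont_diff_mult)
qed

lemma partial_affine:
  fixes L :: "'a::euclidean_space \<Rightarrow> 'b::euclidean_space"
  assumes "linear L" "f differentiable (at (c + L x))"
  shows "partial b (\<lambda>x. f (c + L x)) x = (\<Sum>e\<in>Basis. (L b \<bullet> e) * partial e f (c + L x))"
    and "(\<lambda>x. f (c + L x)) differentiable (at x)"
proof -
  have L: "(L has_derivative L) (at x)"
    using assms(1) by (simp add: linear_imp_has_derivative)
  then have "((\<lambda>x. c + L x) has_derivative L) (at x)"
    by (auto intro: derivative_eq_intros)
  from has_derivative_compose[OF this has_derivative_partial[OF assms(2)]]
  have *: "((\<lambda>x. f (c + L x)) has_derivative (\<lambda>v. \<Sum>e\<in>Basis. (L v \<bullet> e) * partial e f (c + L x))) (at x)" .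
  from partialI[OF this] show "partial b (\<lambda>x. f (c + L x)) x = (\<Sum>e\<in>Basis. (L b \<bullet> e) * partial e f (c + L x))" .
  show "(\<lambda>x. f (c + L x)) differentiable (at x)" using * by (auto simp: differentiable_def)
qed

lemma k_times_cont_diff_affine:
  fixes L :: "'a::euclidean_space \<Rightarrow> 'b::euclidean_space"
  assumes L: "linear L"
  shows "k_times_cont_diff k f \<Longrightarrow> k_times_cont_diff k (\<lambda>x. f (c + L x))"
proof (induction k arbitrary: f)
  case 0
  have "continuous_on UNIV (\<lambda>x. c + L x)"
    by (intro continuous_on_add continuous_on_const linear_continuous_on linear_conv_bounded_linear[THEN iffD1] L)
  then show ?case using 0 continuous_on_compose2[of UNIV f UNIV "\<lambda>x. c + L x"] by simp
next
  case (Suc k)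
  then have "partial b (\<lambda>x. f (c + L x)) = (\<lambda>x. \<Sum>e\<in>Basis. (L b \<bullet> e) * partial e f (c + L x))" for b
    by (auto intro!: partial_affine L)
  with Suc show ?case
    by (auto intro!: partial_affine(2) L k_times_cont_diff_sum k_times_cont_diff_mult)
qed

lemma smooth_const [simp]: "smooth (\<lambda>x. c)" by (simp add: smooth_def)
lemma smooth_add: "smooth f \<Longrightarrow> smooth g \<Longrightarrow> smooth (\<lambda>x. f x + g x)"
  by (simp add: smooth_def k_times_cont_diff_add)
lemma smooth_mult: "smooth f \<Longrightarrow> smooth g \<Longrightarrow> smooth (\<lambda>x. f x * g x)"
  by (simp add: smooth_def k_times_cont_diff_mult)
lemma smooth_diff: "smooth f \<Longrightarrow> smooth g \<Longrightarrow> smooth (\<lambda>x. f x - g x)"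
  using smooth_add[of f "\<lambda>x. (- 1) * g x"] smooth_mult[of "\<lambda>x. - 1" g] by simp
lemma smooth_sum: "(\<And>i. i \<in> I \<Longrightarrow> smooth (f i)) \<Longrightarrow> smooth (\<lambda>x. \<Sum>i\<in>I. f i x)"
  by (simp add: smooth_def k_times_cont_diff_sum)
lemma smooth_prod: "(\<And>i. i \<in> I \<Longrightarrow> smooth (f i)) \<Longrightarrow> smooth (\<lambda>x. \<Prod>i\<in>I. f i x)"
  by (induction I rule: infinite_finite_induct) (auto intro: smooth_mult)
lemma smooth_compose: "smooth_family p \<Longrightarrow> smooth f \<Longrightarrow> smooth (\<lambda>x. p n (f x))"
  by (simp add: smooth_def k_times_cont_diff_compose)
lemma smooth_affine: "linear L \<Longrightarrow> smooth f \<Longrightarrow> smooth (\<lambda>x. f (c + L x))"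
  by (simp add: smooth_def k_times_cont_diff_affine)
lemma smooth_shift: "smooth f \<Longrightarrow> smooth (\<lambda>x. f (x + c))"
  using smooth_affine[of "\<lambda>x. x" f c] by (simp add: linear_id[unfolded id_def] add.commute)
lemma smooth_continuous: "smooth f \<Longrightarrow> continuous_on UNIV f"
  unfolding smooth_def using k_times_cont_diff_continuous by blast
lemma smooth_differentiable: "smooth f \<Longrightarrow> f differentiable (at x)"
  unfolding smooth_def using k_times_cont_diff.simps(2) by blast
lemma smooth_partial: "smooth f \<Longrightarrow> b \<in> Basis \<Longrightarrow> smooth (partial b f)"
  unfolding smooth_def using k_times_cont_diff.simps(2) by blast

lemma smooth_inner: "smooth (\<lambda>x. x \<bullet> a)"
  unfolding smooth_def
proof
  fix k
  have "partial b (\<lambda>x. x \<bullet> a) = (\<lambda>x. b \<bullet> a)" for b :: 'a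
    by (intro ext partialI) (auto intro!: derivative_eq_intros)
  then show "k_times_cont_diff k (\<lambda>x. x \<bullet> a)"
    by (cases k) (auto intro!: continuous_intros bounded_linear_imp_differentiable bounded_linear_inner_left)
qed

lemma smooth_inner_self: "smooth (\<lambda>x. x \<bullet> x)"
  by (subst euclidean_inner) (intro smooth_sum smooth_mult smooth_inner)

lemma laplacian_diff:
  assumes "smooth f" "smooth g"
  shows "laplacian (\<lambda>x. f x - g x) x = laplacian f x - laplacian g x"
proof -
  have *: "partial b (\<lambda>x. f x - g x) x = partial b f x - partial b g x"
    if "f differentiable (at x)" "g differentiable (at x)" for b x and f g :: "'a \<Rightarrow> real"
    unfolding partial_def[of b f] partial_def[of b g]
    by (rule partialI) (use that in \<open>auto intro!: has_derivative_diff simp: frechet_derivative_works[symmetric]\<close>)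
  have "partial b (\<lambda>x. f x - g x) = (\<lambda>x. partial b f x - partial b g x)" for b
    using assms by (intro ext * smooth_differentiable)
  then show ?thesis
    using assms by (simp add: laplacian_def * smooth_differentiable smooth_partial sum_subtractf)
qed

text \<open>Radial functions are written in terms of the squared distance, a polynomial in the
  coordinates; they are then smooth at the centre too, without a parity condition on the
  profile.\<close>

lemma partial_radial:
  assumes "smooth_family p"
  shows "partial b (\<lambda>x. p n ((x - z) \<bullet> (x - z))) = (\<lambda>x. 2 * ((x - z) \<bullet> b) * p (Suc n) ((x - z) \<bullet> (x - z)))"
proof
  fix x
  have d: "(p n has_real_derivative p (Suc n) x) (at x)" for x
    using assms by (simp add: smooth_family_def)
  have "((\<lambda>x. (x - z) \<bullet> (x - z)) has_derivative (\<lambda>v. 2 * ((x - z) \<bullet> v))) (at x)"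
    by (auto intro!: derivative_eq_intros simp: inner_commute)
  from partialI[OF DERIV_compose_FDERIV[OF d this]]
  show "partial b (\<lambda>x. p n ((x - z) \<bullet> (x - z))) x = 2 * ((x - z) \<bullet> b) * p (Suc n) ((x - z) \<bullet> (x - z))" by simp
qed

lemma smooth_radial:
  assumes "smooth_family p"
  shows "smooth (\<lambda>x. p n ((x - z) \<bullet> (x - z)))"
  using smooth_compose[OF assms smooth_shift[OF smooth_inner_self, of "-z"]] by simp

lemma laplacian_radial:
  fixes x z :: "'a::euclidean_space" and s :: real
  assumes "smooth_family p"
  defines s_def: "s \<equiv> (x - z) \<bullet> (x - z)"
  shows "laplacian (\<lambda>x. p n ((x - z) \<bullet> (x - z))) x = 2 * real DIM('a) * p (Suc n) s + 4 * s * p (Suc (Suc n)) s"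
proof -
  have d: "(\<lambda>x. (x - z) \<bullet> b) differentiable (at x)" for b
    using smooth_differentiable[OF smooth_shift[OF smooth_inner[of b], of "-z"]] by simp
  have e: "partial b (\<lambda>x. 2 * ((x - z) \<bullet> b)) x = 2 * (b \<bullet> b)" for b
    by (rule partialI) (auto intro!: derivative_eq_intros)
  have "partial b (partial b (\<lambda>x. p n ((x - z) \<bullet> (x - z)))) x =
    4 * ((x - z) \<bullet> b)\<^sup>2 * p (Suc (Suc n)) s + 2 * (b \<bullet> b) * p (Suc n) s" for b
    unfolding partial_radial[OF assms(1)]
    by (subst partial_mult) (auto intro!: differentiable_mult differentiable_const d smooth_differentiable[OF smooth_radial[OF assms(1)]]
       simp: e partial_radial[OF assms(1)] s_def power2_eq_square)
  then have "laplacian (\<lambda>x. p n ((x - z) \<bullet> (x - z))) x =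
    (\<Sum>b\<in>Basis. 4 * ((x - z) \<bullet> b)\<^sup>2 * p (Suc (Suc n)) s + 2 * p (Suc n) s)"
    unfolding laplacian_def by (intro sum.cong) (auto simp: inner_same_Basis)
  also have "(\<Sum>b\<in>Basis. ((x - z) \<bullet> b)\<^sup>2) = s"
    unfolding s_def by (simp add: power2_eq_square euclidean_inner[of "x - z" "x - z"])
  then have "(\<Sum>b\<in>(Basis::'a set). 4 * ((x - z) \<bullet> b)\<^sup>2 * p (Suc (Suc n)) s + 2 * p (Suc n) s) =
    2 * real DIM('a) * p (Suc n) s + 4 * s * p (Suc (Suc n)) s"
    by (simp add: sum.distrib sum_distrib_left[symmetric] sum_distrib_right[symmetric])
  finally show ?thesis .
qed

subsection \<open>Test functions\<close>

text \<open>The closure of the nonzero set gives way to any compact subset of \<Omega> outside which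
  the function vanishes; such sets are easily produced for products, differences and reflected
  functions.\<close>

lemma test_functions_iff:
  "\<phi> \<in> test_functions \<Omega> \<longleftrightarrow> smooth \<phi> \<and> (\<exists>K. compact K \<and> K \<subseteq> \<Omega> \<and> (\<forall>x. x \<notin> K \<longrightarrow> \<phi> x = 0))"
proof safe
  assume "\<phi> \<in> test_functions \<Omega>"
  then show "smooth \<phi>" "\<exists>K. compact K \<and> K \<subseteq> \<Omega> \<and> (\<forall>x. x \<notin> K \<longrightarrow> \<phi> x = 0)"
    by (auto simp: test_functions_def smooth_def intro!: exI[of _ "closure {x. \<phi> x \<noteq> 0}"])
      (metis (mono_tags, lifting) closure_subset mem_Collect_eq subsetD)
next
  fix K assume "smooth \<phi>" and K: "compact K" "K \<subseteq> \<Omega>" "\<forall>x. x \<notin> K \<longrightarrow> \<phi> x = 0"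
  then have "closure {x. \<phi> x \<noteq> 0} \<subseteq> K"
    by (intro closure_minimal) (auto intro: compact_imp_closed)
  moreover then have "compact (closure {x. \<phi> x \<noteq> 0})"
    using K(1) by (metis closed_closure compact_Int_closed inf.absorb_iff2)
  ultimately show "\<phi> \<in> test_functions \<Omega>"
    using K \<open>smooth \<phi>\<close> by (auto simp: test_functions_def smooth_def)
qed

lemma test_functionsI:
  "smooth \<phi> \<Longrightarrow> compact K \<Longrightarrow> K \<subseteq> \<Omega> \<Longrightarrow> (\<And>x. x \<notin> K \<Longrightarrow> \<phi> x = 0) \<Longrightarrow> \<phi> \<in> test_functions \<Omega>"
  by (auto simp: test_functions_iff)

lemma test_functionsE:
  assumes "\<phi> \<in> test_functions \<Omega>"
  obtains K where "smooth \<phi>" "compact K" "K \<subseteq> \<Omega>" "\<And>x. x \<notin> K \<Longrightarrow> \<phi> x = 0"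
  using assms by (auto simp: test_functions_iff)

lemma test_functions_smooth: "\<phi> \<in> test_functions \<Omega> \<Longrightarrow> smooth \<phi>"
  by (auto simp: test_functions_iff)

lemma partial_eq_0_outside:
  assumes "closed K" "\<And>x. x \<notin> K \<Longrightarrow> \<phi> x = 0" "x \<notin> K"
  shows "partial b \<phi> x = 0"
proof -
  have "((\<lambda>x. 0::real) has_derivative (\<lambda>v. 0)) (at x)" by simp
  then have "(\<phi> has_derivative (\<lambda>v. 0)) (at x)"
    by (rule has_derivative_transform_within_open[where s = "-K"]) (use assms in auto)
  from partialI[OF this] show ?thesis .
qed

lemma test_functions_partial:
  assumes "\<phi> \<in> test_functions \<Omega>" "b \<in> Basis"
  shows "partial b \<phi> \<in> test_functions \<Omega>"
proof -
  obtain K where K: "smooth \<phi>" "compact K" "K \<subseteq> \<Omega>" "\<And>x. x \<notin> K \<Longrightarrow> \<phi> x = 0"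
    using test_functionsE[OF assms(1)] by metis
  show ?thesis
    by (rule test_functionsI[OF smooth_partial[OF K(1) assms(2)] K(2,3)])
      (use K in \<open>auto intro!: partial_eq_0_outside[of K] compact_imp_closed\<close>)
qed

lemma test_functions_mult_smooth:
  assumes "\<phi> \<in> test_functions \<Omega>" "smooth f"
  shows "(\<lambda>x. \<phi> x * f x) \<in> test_functions \<Omega>" "(\<lambda>x. f x * \<phi> x) \<in> test_functions \<Omega>"
  using assms by (auto simp: test_functions_iff intro!: smooth_mult)

lemma test_functions_diff:
  assumes "\<phi> \<in> test_functions \<Omega>" "\<psi> \<in> test_functions \<Omega>"
  shows "(\<lambda>x. \<phi> x - \<psi> x) \<in> test_functions \<Omega>"
proof -
  obtain K where K: "smooth \<phi>" "compact K" "K \<subseteq> \<Omega>" "\<And>x. x \<notin> K \<Longrightarrow> \<phi> x = 0"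
    using test_functionsE[OF assms(1)] by metis
  obtain L where L: "smooth \<psi>" "compact L" "L \<subseteq> \<Omega>" "\<And>x. x \<notin> L \<Longrightarrow> \<psi> x = 0"
    using test_functionsE[OF assms(2)] by metis
  show ?thesis
    by (rule test_functionsI[of _ "K \<union> L"])
       (use K L in \<open>auto intro!: smooth_diff\<close>)
qed

lemma test_functions_bounded:
  assumes "\<phi> \<in> test_functions \<Omega>"
  obtains C where "C \<ge> 0" "\<And>x. \<bar>\<phi> x\<bar> \<le> C"
proof -
  obtain K where K: "smooth \<phi>" "compact K" "K \<subseteq> \<Omega>" "\<And>x. x \<notin> K \<Longrightarrow> \<phi> x = 0"
    using test_functionsE[OF assms] by metis
  have "bounded (\<phi> ` K)"
    by (intro compact_imp_bounded compact_continuous_image K continuous_on_subset[OF smooth_continuous]) auto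
  then obtain C where C: "C > 0" "\<forall>y\<in>\<phi> ` K. norm y \<le> C" by (auto simp: bounded_pos)
  show thesis
  proof (rule that[of C])
    show "\<bar>\<phi> x\<bar> \<le> C" for x using K(4)[of x] C by (cases "x \<in> K") auto
  qed (use C in auto)
qed

lemma test_functions_measurable [measurable]:
  "\<phi> \<in> test_functions \<Omega> \<Longrightarrow> \<phi> \<in> borel_measurable borel"
  by (intro borel_measurable_continuous_onI smooth_continuous test_functions_smooth)

lemma test_functions_integrable:
  assumes "\<phi> \<in> test_functions \<Omega>"
  shows "integrable lborel \<phi>"
proof -
  obtain K where K: "smooth \<phi>" "compact K" "K \<subseteq> \<Omega>" "\<And>x. x \<notin> K \<Longrightarrow> \<phi> x = 0"
    using test_functionsE[OF assms] by metis
  obtain C where "\<And>x. \<bar>\<phi> x\<bar> \<le> C" using test_functions_bounded[OF assms] by metis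
  then show ?thesis
    using K test_functions_measurable[OF assms] emeasure_bounded_finite[OF compact_imp_bounded[OF K(2)]]
    by (intro integrableI_bounded_set[of K _ _ C])
       (auto intro: borel_compact)
qed

lemma test_functions_laplacian:
  assumes "\<phi> \<in> test_functions \<Omega>"
  shows "laplacian \<phi> \<in> test_functions \<Omega>"
proof -
  obtain K where K: "smooth \<phi>" "compact K" "K \<subseteq> \<Omega>" "\<And>x. x \<notin> K \<Longrightarrow> \<phi> x = 0"
    using test_functionsE[OF assms] by metis
  have "smooth (laplacian \<phi>)" unfolding laplacian_def[abs_def]
    by (intro smooth_sum smooth_partial K)
  moreover have "laplacian \<phi> x = 0" if "x \<notin> K" for x
    unfolding laplacian_def using that K
    by (intro sum.neutral ballI partial_eq_0_outside[of K]) (auto intro!: compact_imp_closed partial_eq_0_outside[of K])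
  ultimately show ?thesis using K by (intro test_functionsI[of _ K]) auto
qed

subsection \<open>A smooth bump\<close>

text \<open>The classical \<open>exp (- (1 / x))\<close>: its derivatives are polynomials in
  \<open>1 / x\<close> times the same exponential, and the exponential decay forces all difference
  quotients at \<open>0\<close> to tend to \<open>0\<close>.\<close>

lemma ex_smooth_family_exp:
  "\<exists>p. smooth_family p \<and> p 0 = (\<lambda>x. if x > 0 then exp (- (1 / x)) else 0) \<and> (\<forall>n. \<forall>x\<le>0. p n x = 0)"
proof -
  \<comment> \<open>Differentiating \<open>poly q (1 / x) * exp (- (1 / x))\<close> brings out the
    factor \<open>1 / x ^ 2\<close> and replaces \<open>q\<close> by \<open>q - pderiv q\<close>;
    \<open>[:0, 0, 1:]\<close> is the square of the variable \<open>1 / x\<close>.\<close>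
  define q :: "nat \<Rightarrow> real poly" where "q n = ((\<lambda>p. [:0, 0, 1:] * (p - pderiv p)) ^^ n) 1" for n
  define p where "p n x = (if x > 0 then poly (q n) (1 / x) * exp (- (1 / x)) else 0)" for n and x :: real
  have q: "q (Suc n) = [:0, 0, 1:] * (q n - pderiv (q n))" for n
    by (simp add: q_def)
  have lim: "((\<lambda>y. poly r y * exp (- y)) \<longlongrightarrow> 0) at_top" for r :: "real poly"
  proof -
    have "((\<lambda>y. \<Sum>i\<le>degree r. coeff r i * (y ^ i / exp y)) \<longlongrightarrow> (\<Sum>i\<le>degree r. coeff r i * 0)) at_top"
      by (intro tendsto_intros tendsto_power_div_exp_0)
    then show ?thesis
      by (simp add: poly_altdef sum_distrib_right exp_minus divide_inverse mult.assoc)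
  qed
  have "(p n has_real_derivative p (Suc n) x) (at x)" for n x
  proof -
    consider "x < 0" | "x = 0" | "x > 0" by linarith
    then show ?thesis
    proof cases
      case 1
      have "((\<lambda>x. 0) has_real_derivative 0) (at x)" by simp
      then have "(p n has_real_derivative 0) (at x)"
        by (rule has_field_derivative_transform_within_open[where S = "{..<0}"]) (use 1 in \<open>auto simp: p_def\<close>)
      then show ?thesis using 1 by (simp add: p_def)
    next
      case 3
      have "((\<lambda>x. poly (q n) (1 / x) * exp (- (1 / x))) has_real_derivative
          (poly (pderiv (q n)) (1/x) * (- 1 / x^2)) * exp (- (1 / x)) + poly (q n) (1/x) * (exp (- (1 / x)) * (1 / x^2))) (at x)"
        using 3 by (auto intro!: derivative_eq_intros DERIV_chain2[OF poly_DERIV] simp: power2_eq_square)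
      then have "(p n has_real_derivative
          (poly (pderiv (q n)) (1/x) * (- 1 / x^2)) * exp (- (1 / x)) + poly (q n) (1/x) * (exp (- (1 / x)) * (1 / x^2))) (at x)"
        by (rule has_field_derivative_transform_within_open[where S = "{0<..}"]) (use 3 in \<open>auto simp: p_def\<close>)
      then show ?thesis using 3 by (simp add: p_def q power2_eq_square algebra_simps diff_divide_distrib)
    next
      case 2
      have "((\<lambda>h. p n h / h) \<longlongrightarrow> 0) (at_right 0)"
      proof -
        \<comment> \<open>Since \<open>p n 0 = 0\<close>, the difference quotient is
          \<open>p n h / h\<close>; dividing by \<open>h\<close> multiplies the polynomial by its
          variable \<open>1 / h\<close>.\<close>
        have "((\<lambda>h. poly ([:0, 1:] * q n) (inverse h) * exp (- inverse h)) \<longlongrightarrow> 0) (at_right 0)"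
          by (rule filterlim_compose[OF lim filterlim_inverse_at_top_right])
        then show ?thesis
          by (rule Lim_transform_eventually)
             (auto simp: eventually_at_right_field p_def field_simps intro!: exI[of _ 1])
      qed
      moreover have "((\<lambda>h. p n h / h) \<longlongrightarrow> 0) (at_left 0)"
        by (rule Lim_transform_eventually[OF tendsto_const])
           (auto simp: eventually_at_left_field p_def intro!: exI[of _ "-1"])
      ultimately have "((\<lambda>h. p n h / h) \<longlongrightarrow> 0) (at 0)"
        by (simp add: filterlim_at_split)
      then show ?thesis using 2 by (simp add: DERIV_def p_def)
    qed
  qed
  then show ?thesis
    by (intro exI[of _ p]) (auto simp: smooth_family_def p_def fun_eq_iff q_def)
qed

subsection \<open>Integration by parts and the fundamental lemma\<close>

lemma lborel_integral_shift:
  fixes f :: "'a::euclidean_space \<Rightarrow> 'b::{banach, second_countable_topology}"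
  assumes "f \<in> borel_measurable borel"
  shows "(LINT x|lborel. f (c + x)) = (LINT x|lborel. f x)"
  using integral_distr[of "(+) c" lborel borel f] assms by (simp add: lborel_distr_plus)

lemma lborel_integrable_shift:
  fixes f :: "'a::euclidean_space \<Rightarrow> 'b::{banach, second_countable_topology}"
  assumes "integrable lborel f"
  shows "integrable lborel (\<lambda>x. f (c + x))"
  using integrable_distr[of "(+) c" lborel borel f] assms by (simp add: lborel_distr_plus)

text \<open>Translation invariance makes the integral of every difference quotient vanish, and the
  mean value theorem supplies the majorant for dominated convergence, so no iterated integrals
  occur. Only the one partial derivative has to be continuous, which suits the arctan weight in
  \<open>strip_bound\<close>.\<close>

lemma integral_partial_eq_0:
  fixes f :: "'a::euclidean_space \<Rightarrow> real"
  assumes diff: "\<And>x. f differentiable (at x)" and cont: "continuous_on UNIV (partial b f)"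
    and K: "compact K" "\<And>x. x \<notin> K \<Longrightarrow> f x = 0"
  shows "(LINT x|lborel. partial b f x) = 0"
proof -
  have fc: "continuous_on UNIV f"
    using diff differentiable_imp_continuous_within by (auto simp: continuous_on_eq_continuous_within)
  have zero: "partial b f x = 0" if "x \<notin> K" for x
    by (rule partial_eq_0_outside[of K]) (use K that in \<open>auto intro: compact_imp_closed\<close>)
  have "bounded (partial b f ` K)"
    by (intro compact_imp_bounded compact_continuous_image K continuous_on_subset[OF cont]) auto
  then obtain C where C: "C > 0" "\<forall>y\<in>partial b f ` K. norm y \<le> C" by (auto simp: bounded_pos)
  have C': "\<bar>partial b f x\<bar> \<le> C" for x using C zero[of x] by (cases "x \<in> K") auto
  have d: "((\<lambda>s. f (x + s *\<^sub>R b)) has_real_derivative partial b f (x + s *\<^sub>R b)) (at s)" for x s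
  proof -
    let ?D = "frechet_derivative f (at (x + s *\<^sub>R b))"
    have D: "(f has_derivative ?D) (at (x + s *\<^sub>R b))"
      using diff by (simp add: frechet_derivative_works[symmetric])
    have "((\<lambda>s. x + s *\<^sub>R b) has_derivative (\<lambda>s. s *\<^sub>R b)) (at s)"
      by (auto intro!: derivative_eq_intros)
    from has_derivative_compose[OF this D]
    have "((\<lambda>s. f (x + s *\<^sub>R b)) has_derivative (\<lambda>r. ?D (r *\<^sub>R b))) (at s)" .
    moreover have "(\<lambda>r. ?D (r *\<^sub>R b)) = (*) (?D b)"
      using has_derivative_linear[OF D] by (auto simp: linear_scale)
    ultimately show ?thesis by (simp add: has_field_derivative_def partial_def)
  qed
  define g where "g n x = real (Suc n) * (f ((1 / real (Suc n)) *\<^sub>R b + x) - f x)" for n x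
  have [measurable]: "f \<in> borel_measurable borel" "partial b f \<in> borel_measurable borel"
    using fc cont by (auto intro: borel_measurable_continuous_onI)
  obtain M where M: "\<And>x. x \<in> K \<Longrightarrow> norm x \<le> M" using compact_imp_bounded[OF K(1)] by (auto simp: bounded_iff)
  \<comment> \<open>The steps in direction \<open>b\<close> are at most \<open>1\<close>, so the
    shifted supports stay within \<open>norm b\<close> of \<open>K\<close>.\<close>
  let ?B = "cball 0 (M + norm b) :: 'a set"
  have "bounded (f ` K)"
    by (intro compact_imp_bounded compact_continuous_image K continuous_on_subset[OF fc]) auto
  then obtain C1 where C1: "C1 > 0" "\<forall>y\<in>f ` K. norm y \<le> C1" by (auto simp: bounded_pos)
  have emB: "emeasure lborel ?B < top"
    using emeasure_bounded_finite[of ?B] by simp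
  have fint: "integrable lborel f"
  proof (rule integrableI_bounded_set[of ?B _ _ C1])
    show "AE x\<in>?B in lborel. norm (f x) \<le> C1" using C1 K(2) by (intro always_eventually) force
    have "norm x \<le> M + norm b" if "x \<in> K" for x using M[OF that] norm_ge_zero[of b] by linarith
    then show "AE x in lborel. x \<notin> ?B \<longrightarrow> f x = 0" using K(2) by force
  qed (use emB in auto)
  have "(LINT x|lborel. g n x) = 0" for n
    unfolding g_def using lborel_integral_shift[of f] lborel_integrable_shift[OF fint] fint
    by (simp del: of_nat_Suc)
  moreover have "(\<lambda>n. LINT x|lborel. g n x) \<longlonglongrightarrow> (LINT x|lborel. partial b f x)"
  proof (rule integral_dominated_convergence[where w="\<lambda>x. C * indicator ?B x"])
    show "integrable lborel (\<lambda>x. C * indicator ?B x)"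
      using emB by (intro integrable_mult_right integrable_real_indicator) auto
    show "AE x in lborel. (\<lambda>n. g n x) \<longlonglongrightarrow> partial b f x"
    proof (intro always_eventually allI)
      fix x
      have "((\<lambda>h. (f (x + h *\<^sub>R b) - f x) / h) \<longlongrightarrow> partial b f x) (at 0)"
        using d[of x 0] by (simp add: DERIV_def)
      moreover have "filterlim (\<lambda>n. 1 / real (Suc n)) (at 0) sequentially"
        unfolding filterlim_at using LIMSEQ_inverse_real_of_nat by (auto simp: inverse_eq_divide)
      ultimately have "(\<lambda>n. (f (x + (1 / real (Suc n)) *\<^sub>R b) - f x) / (1 / real (Suc n))) \<longlonglongrightarrow> partial b f x"
        by (rule filterlim_compose)
      then show "(\<lambda>n. g n x) \<longlonglongrightarrow> partial b f x"
        by (simp add: g_def add.commute mult.commute)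
    qed
    fix n
    show "AE x in lborel. norm (g n x) \<le> C * indicator ?B x"
    proof (intro always_eventually allI)
      fix x
      let ?h = "1 / real (Suc n)"
      have h: "0 < ?h" "?h \<le> 1" by auto
      obtain z where z: "0 < z" "z < ?h" "f (x + ?h *\<^sub>R b) - f (x + 0 *\<^sub>R b) = (?h - 0) * partial b f (x + z *\<^sub>R b)"
        using MVT2[of 0 ?h "\<lambda>s. f (x + s *\<^sub>R b)" "\<lambda>s. partial b f (x + s *\<^sub>R b)", OF h(1) d] by metis
      then have "g n x = partial b f (x + z *\<^sub>R b)"
        by (simp add: g_def add.commute field_simps)
      moreover have "x + z *\<^sub>R b \<notin> K" if "x \<notin> ?B"
      proof
        assume "x + z *\<^sub>R b \<in> K"
        then have "norm (x + z *\<^sub>R b) \<le> M" by (rule M)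
        moreover have "norm x \<le> norm (x + z *\<^sub>R b) + norm (z *\<^sub>R b)"
          using norm_triangle_ineq4[of "x + z *\<^sub>R b" "z *\<^sub>R b"] by simp
        moreover have "norm (z *\<^sub>R b) \<le> norm b"
          using z(1,2) h(2) by (auto intro!: mult_left_le_one_le order.strict_implies_order[OF less_le_trans[OF z(2) h(2)]])
        ultimately show False using that by simp
      qed
      ultimately show "norm (g n x) \<le> C * indicator ?B x"
        using C'[of "x + z *\<^sub>R b"] zero[of "x + z *\<^sub>R b"] by (auto split: split_indicator)
    qed
  qed (auto simp: g_def)
  ultimately show ?thesis by (simp add: LIMSEQ_const_iff)
qed

lemma test_functions_integral_partial:
  assumes "\<phi> \<in> test_functions \<Omega>" "b \<in> Basis"
  shows "(LINT x|lborel. partial b \<phi> x) = 0"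
proof -
  obtain K where K: "smooth \<phi>" "compact K" "K \<subseteq> \<Omega>" "\<And>x. x \<notin> K \<Longrightarrow> \<phi> x = 0"
    using test_functionsE[OF assms(1)] by metis
  show ?thesis
    using integral_partial_eq_0[OF smooth_differentiable[OF K(1)] smooth_continuous[OF smooth_partial[OF K(1) assms(2)]] K(2,4)] .
qed

lemma test_functions_integral_by_parts:
  assumes "\<phi> \<in> test_functions \<Omega>" "smooth \<psi>" "b \<in> Basis"
  shows "(LINT x|lborel. partial b \<phi> x * \<psi> x) = - (LINT x|lborel. \<phi> x * partial b \<psi> x)"
proof -
  have t: "(\<lambda>x. \<phi> x * \<psi> x) \<in> test_functions \<Omega>"
    by (rule test_functions_mult_smooth[OF assms(1,2)])
  have "partial b (\<lambda>x. \<phi> x * \<psi> x) = (\<lambda>x. \<phi> x * partial b \<psi> x + partial b \<phi> x * \<psi> x)"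
    using assms by (intro ext partial_mult smooth_differentiable) (auto dest: test_functions_smooth)
  moreover have "integrable lborel (\<lambda>x. \<phi> x * partial b \<psi> x)" "integrable lborel (\<lambda>x. partial b \<phi> x * \<psi> x)"
    using assms
    by (auto intro!: test_functions_integrable test_functions_mult_smooth(1)[of _ \<Omega>] test_functions_partial smooth_partial)
  ultimately show ?thesis
    using test_functions_integral_partial[OF t assms(3)] by simp
qed

definition bump_family :: "nat \<Rightarrow> real \<Rightarrow> real" where
  "bump_family = (SOME p. smooth_family p \<and> p 0 = (\<lambda>x. if x > 0 then exp (- (1 / x)) else 0) \<and> (\<forall>n. \<forall>x\<le>0. p n x = 0))"

lemma bump_family: "smooth_family bump_family"
  "bump_family 0 = (\<lambda>x. if x > 0 then exp (- (1 / x)) else 0)"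
  "x \<le> 0 \<Longrightarrow> bump_family n x = 0"
  using someI_ex[OF ex_smooth_family_exp] unfolding bump_family_def[symmetric] by auto

lemma bump_family_0_bounds: "0 \<le> bump_family 0 x" "bump_family 0 x \<le> 1"
  by (auto simp: bump_family)

text \<open>Dilating the variable turns the bump into the indicator of the positive half-line;
  products over the coordinates then approximate indicators of open boxes.\<close>

lemma bump_family_0_tendsto: "(\<lambda>n. bump_family 0 (real n * s)) \<longlonglongrightarrow> (if s > 0 then 1 else 0)"
proof (cases "s > 0")
  case True
  have "(\<lambda>n. exp (- ((1 / s) * (1 / real n)))) \<longlonglongrightarrow> exp (- ((1 / s) * 0))"
    by (intro tendsto_intros lim_1_over_n)
  moreover have "\<forall>\<^sub>F n in sequentially. exp (- ((1 / s) * (1 / real n))) = bump_family 0 (real n * s)"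
    using True by (intro eventually_sequentiallyI[of 1]) (auto simp: bump_family field_simps)
  ultimately show ?thesis using True by (simp add: Lim_transform_eventually)
next
  case False
  then have "bump_family 0 (real n * s) = 0" for n
    by (intro bump_family) (simp add: mult_nonneg_nonpos)
  then show ?thesis using False by simp
qed

text \<open>Dynkin's argument: open boxes are stable under intersection and generate the Borel sets,
  so all set integrals of \<open>g\<close> vanish, and a density is determined by its set
  integrals.\<close>

lemma integral_box_eq_0_imp_AE:
  fixes g :: "'a::euclidean_space \<Rightarrow> real"
  assumes g: "integrable lborel g" and box: "\<And>a b. (LINT x|lborel. indicator (box a b) x * g x) = 0"
  shows "AE x in lborel. g x = 0"
proof (rule density_unique_real[OF g integrable_zero])
  \<comment> \<open>Complements require the total integral, obtained by exhausting the space with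
    boxes.\<close>
  have tot: "(LINT x|lborel. g x) = 0"
  proof -
    let ?A = "\<lambda>n::nat. box (- (real n *\<^sub>R One)) (real n *\<^sub>R One) :: 'a set"
    have "(\<lambda>n. LINT x|lborel. indicator (?A n) x * g x) \<longlonglongrightarrow> (LINT x|lborel. g x)"
    proof (rule integral_dominated_convergence[where w="\<lambda>x. norm (g x)"])
      show "AE x in lborel. (\<lambda>n. indicat_real (?A n) x * g x) \<longlonglongrightarrow> g x"
      proof (intro always_eventually allI)
        fix x :: 'a
        obtain N where N: "x \<in> ?A N" using UN_box_eq_UNIV by blast
        have "x \<in> ?A n" if "N \<le> n" for n
          using N subset_box(4)[of "- (real N *\<^sub>R One)" "real N *\<^sub>R One" "- (real n *\<^sub>R One)" "real n *\<^sub>R One :: 'a"] that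
          by (auto simp: inner_Basis)
        then have "\<forall>\<^sub>F n in sequentially. g x = indicat_real (?A n) x * g x"
          by (intro eventually_sequentiallyI[of N]) simp
        then show "(\<lambda>n. indicat_real (?A n) x * g x) \<longlonglongrightarrow> g x"
          by (rule Lim_transform_eventually[OF tendsto_const])
      qed
    qed (use g in \<open>auto intro!: always_eventually mult_left_le_one_le split: split_indicator\<close>)
    then show ?thesis by (simp add: box LIMSEQ_const_iff)
  qed
  fix A :: "'a set" assume "A \<in> sets lborel"
  then have "A \<in> sigma_sets UNIV (range (\<lambda>(a, b). box a b))" by (simp add: borel_eq_box)
  moreover have I: "Int_stable (range (\<lambda>(a, b). box a b::'a set))" "range (\<lambda>(a, b). box a b) \<subseteq> Pow (UNIV :: 'a set)"
    by (auto simp: Int_stable_def box_Int_box)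
  ultimately have "set_lebesgue_integral lborel A g = 0"
  proof (induction rule: sigma_sets_induct_disjoint[OF I, consumes 1, case_names basic empty compl union])
    case (basic A)
    then show ?case using box by (auto simp: set_lebesgue_integral_def)
  next
    case (compl A)
    then have A: "A \<in> sets lborel" by (simp add: borel_eq_box)
    have "set_lebesgue_integral lborel (UNIV - A) g = (LINT x|lborel. g x - indicator A x * g x)"
      unfolding set_lebesgue_integral_def by (intro Bochner_Integration.integral_cong) (auto split: split_indicator)
    also have "\<dots> = 0"
      using A g compl integrable_mult_indicator[OF A g] by (simp add: tot set_lebesgue_integral_def)
    finally show ?case .
  next
    case (union A)
    then have A: "A i \<in> sets lborel" for i by (auto simp: borel_eq_box)
    have "set_integrable lborel (\<Union>i. A i) g"
      unfolding set_integrable_def by (rule integrable_mult_indicator[OF _ g]) (use A in auto)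
    then show ?case
      using lebesgue_integral_countable_add[of A lborel g] union A
      by (auto simp: disjoint_family_on_def)
  qed (auto simp: set_lebesgue_integral_def)
  then show "set_lebesgue_integral lborel A g = (LINT x:A|lborel. 0)"
    by (simp add: set_lebesgue_integral_def)
qed

lemma AE_lborel_iff_lebesgue: "(AE x in lebesgue. P x) \<longleftrightarrow> (AE x in lborel. P x)"
  by (simp add: AE_completion_iff)

text \<open>Products of one-dimensional bumps are test functions converging to the indicator of an
  open box whose closure lies in \<Omega>. Thus \<open>f\<close> has zero integral over all such
  boxes, and \<open>integral_box_eq_0_imp_AE\<close> applies on each of them.\<close>

lemma fundamental_lemma_variations:
  fixes f :: "'a::euclidean_space \<Rightarrow> real"
  assumes \<Omega>: "open \<Omega>" and f: "locally_integrable_on f \<Omega>"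
    and test: "\<And>\<phi>. \<phi> \<in> test_functions \<Omega> \<Longrightarrow> (LINT x|lebesgue_on \<Omega>. f x * \<phi> x) = 0"
  shows "AE x in lebesgue. x \<in> \<Omega> \<longrightarrow> f x = 0"
proof -
  have box0: "(LINT x|lebesgue. indicator (box c d) x * f x) = 0" if cd: "cbox c d \<subseteq> \<Omega>" for c d
  proof -
    define \<psi> where "\<psi> n x = (\<Prod>e\<in>Basis. bump_family 0 (real n * ((x - c) \<bullet> e)) * bump_family 0 (real n * ((d - x) \<bullet> e)))"
      for n :: nat and x :: 'a
    have sm: "smooth (\<psi> n)" for n
    proof -
      have 1: "smooth (\<lambda>x. real n * ((x - c) \<bullet> e))" for e :: 'a
        unfolding inner_diff_left by (intro smooth_mult smooth_diff smooth_const smooth_inner)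
      have 2: "smooth (\<lambda>x. real n * ((d - x) \<bullet> e))" for e :: 'a
        unfolding inner_diff_left by (intro smooth_mult smooth_diff smooth_const smooth_inner)
      show ?thesis unfolding \<psi>_def by (intro smooth_prod smooth_mult smooth_compose[OF bump_family(1), where n = 0] 1 2)
    qed
    have zero: "\<psi> n x = 0" if x: "x \<notin> box c d" for n x
    proof -
      from x obtain e where e: "e \<in> Basis" "x \<bullet> e \<le> c \<bullet> e \<or> d \<bullet> e \<le> x \<bullet> e"
        by (auto simp: mem_box not_less)
      then have "bump_family 0 (real n * ((x - c) \<bullet> e)) * bump_family 0 (real n * ((d - x) \<bullet> e)) = 0"
        by (auto simp: inner_diff_left mult_nonneg_nonpos intro!: bump_family(3))
      then show ?thesis unfolding \<psi>_def using e(1) by (intro prod_zero) auto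
    qed
    have t: "\<psi> n \<in> test_functions \<Omega>" for n
      by (rule test_functionsI[OF sm _ cd]) (use zero[of _ n] box_subset_cbox[of c d] in auto)
    have "0 \<le> \<psi> n x" "\<psi> n x \<le> 1" for n x
      unfolding \<psi>_def by (auto intro!: prod_nonneg prod_le_1 mult_nonneg_nonneg mult_le_one bump_family_0_bounds)
    then have b: "\<bar>\<psi> n x\<bar> \<le> indicator (cbox c d) x" for n x
      using zero[of x n] box_subset_cbox[of c d, THEN subsetD, of x] by (cases "x \<in> box c d") (auto simp: indicator_def)
    have lim: "(\<lambda>n. \<psi> n x) \<longlonglongrightarrow> indicator (box c d) x" for x
    proof -
      have "(\<lambda>n. \<psi> n x) \<longlonglongrightarrow> (\<Prod>e\<in>Basis. (if (x - c) \<bullet> e > 0 then 1 else 0) * (if (d - x) \<bullet> e > 0 then 1 else 0))"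
        unfolding \<psi>_def by (intro tendsto_intros bump_family_0_tendsto)
      moreover have "(\<Prod>e\<in>Basis. (if (x - c) \<bullet> e > 0 then 1 else 0) * (if (d - x) \<bullet> e > 0 then 1 else 0)) = indicat_real (box c d) x"
        by (auto simp: mem_box inner_diff_left split: split_indicator)
      ultimately show ?thesis by simp
    qed
    have fi: "integrable lebesgue (\<lambda>x. indicator (cbox c d) x * f x)"
      using f cd by (auto simp: locally_integrable_on_def set_integrable_def)
    have eq: "(LINT x|lebesgue. (indicator (cbox c d) x * f x) * \<psi> n x) = 0" for n
    proof -
      have "(LINT x|lebesgue. (indicator (cbox c d) x * f x) * \<psi> n x) = (LINT x|lebesgue_on \<Omega>. f x * \<psi> n x)"
      proof (subst integral_restrict_space)
        have "(indicator (cbox c d) x * f x) * \<psi> n x = indicator \<Omega> x *\<^sub>R (f x * \<psi> n x)" for x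
          using cd zero[of x n] box_subset_cbox[of c d] by (cases "x \<in> cbox c d") auto
        then show "(LINT x|lebesgue. (indicator (cbox c d) x * f x) * \<psi> n x) = (LINT x|lebesgue. indicator \<Omega> x *\<^sub>R (f x * \<psi> n x))"
          by (simp only:)
      qed (use \<Omega> in auto)
      then show ?thesis using test[OF t] by simp
    qed
    have "(\<lambda>n. LINT x|lebesgue. (indicator (cbox c d) x * f x) * \<psi> n x) \<longlonglongrightarrow> (LINT x|lebesgue. (indicator (cbox c d) x * f x) * indicator (box c d) x)"
    proof (rule integral_dominated_convergence[where w="\<lambda>x. norm (indicator (cbox c d) x * f x)"])
      have m\<psi>: "\<psi> n \<in> borel_measurable lebesgue" for n
        using borel_measurable_continuous_onI[OF smooth_continuous[OF sm]] by (intro measurable_completion) simp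
      have mf: "(\<lambda>x. indicator (cbox c d) x * f x) \<in> borel_measurable lebesgue" using fi by simp
      show "(\<lambda>x. (indicator (cbox c d) x * f x) * \<psi> n x) \<in> borel_measurable lebesgue" for n
        by (rule borel_measurable_times[OF mf m\<psi>])
      show "(\<lambda>x. (indicator (cbox c d) x * f x) * indicator (box c d) x) \<in> borel_measurable lebesgue"
        by (rule borel_measurable_times[OF mf borel_measurable_indicator]) simp
      show "AE x in lebesgue. (\<lambda>n. (indicator (cbox c d) x * f x) * \<psi> n x) \<longlonglongrightarrow> (indicator (cbox c d) x * f x) * indicator (box c d) x"
        by (intro always_eventually allI tendsto_intros lim)
      show "AE x in lebesgue. norm ((indicator (cbox c d) x * f x) * \<psi> n x) \<le> norm (indicator (cbox c d) x * f x)" for n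
      proof (intro always_eventually allI)
        fix x
        have "\<bar>\<psi> n x\<bar> \<le> 1" using order_trans[OF b indicator_le_1] .
        then show "norm ((indicator (cbox c d) x * f x) * \<psi> n x) \<le> norm (indicator (cbox c d) x * f x)"
          by (simp add: abs_mult mult_left_le)
      qed
    qed (use fi in auto)
    then have "(LINT x|lebesgue. (indicator (cbox c d) x * f x) * indicator (box c d) x) = 0" by (simp add: eq LIMSEQ_const_iff)
    moreover have "(indicator (cbox c d) x * f x) * indicator (box c d) x = indicator (box c d) x * f x" for x
      using box_subset_cbox[of c d] by (auto split: split_indicator)
    ultimately show ?thesis by (simp only:)
  qed
  have loc: "AE x in lebesgue. x \<in> box a b \<longrightarrow> f x = 0" if ab: "cbox a b \<subseteq> \<Omega>" for a b
  proof -
    have fi: "integrable lebesgue (\<lambda>x. indicator (cbox a b) x * f x)"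
      using f ab by (auto simp: locally_integrable_on_def set_integrable_def)
    have "integrable lebesgue (\<lambda>x. indicator (box a b) x *\<^sub>R (indicator (cbox a b) x * f x))"
      by (rule integrable_mult_indicator[OF _ fi]) auto
    moreover have "indicator (box a b) x *\<^sub>R (indicator (cbox a b) x * f x) = indicator (box a b) x * f x" for x
      using box_subset_cbox[of a b] by (auto split: split_indicator)
    ultimately have fi: "integrable lebesgue (\<lambda>x. indicator (box a b) x * f x)" by (simp only:)
    \<comment> \<open>\<open>f\<close> is measurable only for the completed measure, whereas the
      lemma on boxes concerns Borel functions; hence the change to a Borel representative.\<close>
    then obtain g where g[measurable]: "g \<in> borel_measurable lborel" and ae: "AE x in lborel. indicator (box a b) x * f x = g x"
      using completion_ex_borel_measurable_real[OF borel_measurable_integrable[OF fi]] by blast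
    have aeL: "AE x in lebesgue. indicator (box a b) x * f x = g x" using ae by (simp add: AE_lborel_iff_lebesgue)
    have gm: "g \<in> borel_measurable lebesgue" using g by (rule measurable_completion)
    have gi: "integrable lborel g"
      using integrable_cong_AE_imp[OF fi gm] aeL g by (simp add: integrable_completion eq_commute)
    have "AE x in lborel. g x = 0"
    proof (rule integral_box_eq_0_imp_AE[OF gi])
      fix c d :: 'a
      obtain p q where pq: "box a b \<inter> box c d = box p q" by (rule that[OF box_Int_box])
      have "box p q = {} \<or> cbox p q \<subseteq> cbox a b"
      proof (cases "box p q = {}")
        case False
        then have "cbox p q = closure (box p q)" by simp
        also have "\<dots> \<subseteq> cbox a b" using pq box_subset_cbox[of a b] by (intro closure_minimal) auto
        finally show ?thesis by simp
      qed auto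
      then have z: "(LINT x|lebesgue. indicator (box p q) x * f x) = 0"
        using box0[of p q] ab by auto
      have "(LINT x|lborel. indicator (box c d) x * g x) = (LINT x|lebesgue. indicator (box c d) x * g x)"
        by (rule integral_completion[symmetric]) simp
      also have "\<dots> = (LINT x|lebesgue. indicator (box p q) x * f x)"
      proof (rule integral_cong_AE)
        show "(\<lambda>x. indicator (box c d) x * g x) \<in> borel_measurable lebesgue"
          by (rule borel_measurable_times[OF borel_measurable_indicator gm]) simp
        have "(\<lambda>x. indicator (box c d) x * (indicator (box a b) x * f x)) \<in> borel_measurable lebesgue"
          by (rule borel_measurable_times[OF borel_measurable_indicator borel_measurable_integrable[OF fi]]) simp
        then show "(\<lambda>x. indicator (box p q) x * f x) \<in> borel_measurable lebesgue"
          by (simp add: pq[symmetric] indicator_inter_arith mult_ac)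
        show "AE x in lebesgue. indicator (box c d) x * g x = indicator (box p q) x * f x"
          using aeL by eventually_elim (simp add: pq[symmetric] indicator_inter_arith mult_ac)
      qed
      finally show "(LINT x|lborel. indicator (box c d) x * g x) = 0" using z by simp
    qed
    then have "AE x in lebesgue. g x = 0" by (simp add: AE_lborel_iff_lebesgue)
    with aeL show ?thesis by eventually_elim auto
  qed
  \<comment> \<open>Countably many closed boxes cover \<Omega>; vanishing is known on the open
    boxes, and their boundaries are null sets.\<close>
  obtain D where D: "countable D" "D \<subseteq> Pow \<Omega>" "\<And>X. X \<in> D \<Longrightarrow> \<exists>a b. X = cbox a b" "\<Union>D = \<Omega>"
    using open_countable_Union_open_cbox[OF \<Omega>] by metis
  have "AE x in lebesgue. \<forall>X\<in>D. x \<in> X \<longrightarrow> f x = 0"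
  proof (rule AE_ball_countable[THEN iffD2, OF D(1)], intro ballI)
    fix X assume X: "X \<in> D"
    then obtain a b where ab: "X = cbox a b" using D by blast
    have "AE x in lebesgue. x \<notin> cbox a b - box a b"
    proof (rule AE_not_in)
      show "cbox a b - box a b \<in> null_sets lebesgue"
        using negligible_frontier_interval[of a b] by (simp add: negligible_iff_null_sets)
    qed
    moreover have "AE x in lebesgue. x \<in> box a b \<longrightarrow> f x = 0"
      using loc[of a b] X ab D(2) by blast
    ultimately show "AE x in lebesgue. x \<in> X \<longrightarrow> f x = 0"
      unfolding ab by eventually_elim auto
  qed
  then show ?thesis by eventually_elim (use D(4) in auto)
qed

subsection \<open>Weak gradients\<close>

definition grad :: "('a::euclidean_space \<Rightarrow> real) \<Rightarrow> 'a \<Rightarrow> 'a" where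
  "grad f x = (\<Sum>b\<in>Basis. partial b f x *\<^sub>R b)"

lemma grad_inner_Basis: "b \<in> Basis \<Longrightarrow> grad f x \<bullet> b = partial b f x"
  by (simp add: grad_def inner_sum_left inner_Basis if_distrib sum.delta' cong: if_cong)

lemma inner_grad: "v \<bullet> grad f x = (\<Sum>b\<in>Basis. (v \<bullet> b) * partial b f x)"
  by (simp add: grad_def inner_sum_right mult.commute)

lemma grad_measurable [measurable]: "smooth f \<Longrightarrow> grad f \<in> borel_measurable borel"
  unfolding grad_def[abs_def]
  by (intro borel_measurable_sum borel_measurable_scaleR borel_measurable_const
      borel_measurable_continuous_onI smooth_continuous smooth_partial)

lemma grad_bounded:
  assumes "\<phi> \<in> test_functions \<Omega>"
  obtains C where "C \<ge> 0" "\<And>x. norm (grad \<phi> x) \<le> C"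
proof -
  have "\<exists>C. \<forall>x. \<bar>partial b \<phi> x\<bar> \<le> C" if "b \<in> Basis" for b
    using test_functions_bounded[OF test_functions_partial[OF assms that]] by metis
  then obtain C where C: "\<And>b x. b \<in> Basis \<Longrightarrow> \<bar>partial b \<phi> x\<bar> \<le> C b" by metis
  have "norm (grad \<phi> x) \<le> (\<Sum>b\<in>Basis. \<bar>C b\<bar>)" for x
    unfolding grad_def
    by (rule order_trans[OF norm_sum]) (auto intro!: sum_mono order_trans[OF C])
  then show thesis by (intro that[of "\<Sum>b\<in>Basis. \<bar>C b\<bar>"]) (auto intro: sum_nonneg)
qed

lemma grad_eq_0_outside:
  assumes "closed K" "\<And>x. x \<notin> K \<Longrightarrow> \<phi> x = 0" "x \<notin> K"
  shows "grad \<phi> x = 0"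
  unfolding grad_def using partial_eq_0_outside[OF assms] by simp

text \<open>The bridge between two settings: the function spaces are formulated with the completed
  measure restricted to \<Omega>, while the arguments use Borel functions on the whole space that
  vanish outside \<Omega>, where translations, reflections and Fubini's theorem are at hand.\<close>

lemma lebesgue_on_lborel:
  fixes F F' :: "'a::euclidean_space \<Rightarrow> 'b::euclidean_space"
  assumes \<Omega>: "\<Omega> \<in> sets borel" and F: "F \<in> borel_measurable (lebesgue_on \<Omega>)"
    and F': "F' \<in> borel_measurable borel" "\<And>x. x \<notin> \<Omega> \<Longrightarrow> F' x = 0"
    and ae: "AE x in lebesgue. x \<in> \<Omega> \<longrightarrow> F x = F' x"
  shows "integrable (lebesgue_on \<Omega>) F \<longleftrightarrow> integrable lborel F'"
    and "(LINT x|lebesgue_on \<Omega>. F x) = (LINT x|lborel. F' x)"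
proof -
  have S: "\<Omega> \<inter> space lebesgue \<in> sets lebesgue" using \<Omega> by auto
  have m: "(\<lambda>x. indicator \<Omega> x *\<^sub>R F x) \<in> borel_measurable lebesgue"
    using F borel_measurable_restrict_space_iff[OF S, of F] by simp
  have m': "F' \<in> borel_measurable lebesgue" using F'(1) by (intro measurable_completion) simp
  have ae': "AE x in lebesgue. indicator \<Omega> x *\<^sub>R F x = F' x"
    using ae by eventually_elim (use F'(2) in \<open>auto split: split_indicator\<close>)
  show "integrable (lebesgue_on \<Omega>) F \<longleftrightarrow> integrable lborel F'"
    using integrable_cong_AE[OF m m' ae'] F'(1)
    by (simp add: integrable_restrict_space[OF S] integrable_completion)
  show "(LINT x|lebesgue_on \<Omega>. F x) = (LINT x|lborel. F' x)"
    using integral_cong_AE[OF m m' ae'] F'(1)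
    by (simp add: integral_restrict_space[OF S] integral_completion)
qed

lemma borel_measurable_lebesgue_on:
  assumes "f \<in> borel_measurable borel"
  shows "f \<in> borel_measurable (lebesgue_on \<Omega>)"
  by (intro measurable_restrict_space1 measurable_completion) (use assms in simp)

lemma locally_integrable_on_times_test:
  fixes g :: "'a::euclidean_space \<Rightarrow> real"
  assumes \<Omega>: "open \<Omega>" and g: "locally_integrable_on g \<Omega>" and \<phi>: "\<phi> \<in> test_functions \<Omega>"
  shows "integrable (lebesgue_on \<Omega>) (\<lambda>x. g x * \<phi> x)"
proof -
  obtain K where K: "smooth \<phi>" "compact K" "K \<subseteq> \<Omega>" "\<And>x. x \<notin> K \<Longrightarrow> \<phi> x = 0"
    using test_functionsE[OF \<phi>] by metis
  obtain C where C: "C \<ge> 0" "\<And>x. \<bar>\<phi> x\<bar> \<le> C" using test_functions_bounded[OF \<phi>] by metis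
  have gi: "integrable lebesgue (\<lambda>x. indicator K x *\<^sub>R g x)"
    using g K by (auto simp: locally_integrable_on_def set_integrable_def)
  have \<phi>m: "\<phi> \<in> borel_measurable lebesgue"
    using test_functions_measurable[OF \<phi>] by (intro measurable_completion) simp
  have "integrable lebesgue (\<lambda>x. (indicator K x *\<^sub>R g x) * \<phi> x)"
  proof (rule Bochner_Integration.integrable_bound[OF integrable_mult_right[OF gi, of C]])
    show "(\<lambda>x. (indicator K x *\<^sub>R g x) * \<phi> x) \<in> borel_measurable lebesgue"
      by (rule borel_measurable_times[OF borel_measurable_integrable[OF gi] \<phi>m])
    show "AE x in lebesgue. norm ((indicator K x *\<^sub>R g x) * \<phi> x) \<le> norm (C * (indicator K x *\<^sub>R g x))"
    proof (intro always_eventually allI)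
      fix x
      have "\<bar>indicator K x *\<^sub>R g x\<bar> * \<bar>\<phi> x\<bar> \<le> \<bar>indicator K x *\<^sub>R g x\<bar> * C"
        using C by (intro mult_left_mono) auto
      then show "norm ((indicator K x *\<^sub>R g x) * \<phi> x) \<le> norm (C * (indicator K x *\<^sub>R g x))"
        using C(1) by (simp add: abs_mult mult_ac)
    qed
  qed
  moreover have "(indicator K x *\<^sub>R g x) * \<phi> x = indicator \<Omega> x *\<^sub>R (g x * \<phi> x)" for x
    using K(3)[THEN subsetD, of x] K(4)[of x] by (cases "x \<in> K") (auto split: split_indicator)
  ultimately have "integrable lebesgue (\<lambda>x. indicator \<Omega> x *\<^sub>R (g x * \<phi> x))" by (simp only:)
  then show ?thesis using \<Omega> by (subst integrable_restrict_space) auto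
qed

lemma locally_integrable_on_inner:
  "locally_integrable_on g \<Omega> \<Longrightarrow> locally_integrable_on (\<lambda>x. g x \<bullet> b) \<Omega>"
  unfolding locally_integrable_on_def set_integrable_def
proof (intro allI impI)
  fix K assume "\<forall>K. compact K \<and> K \<subseteq> \<Omega> \<longrightarrow> integrable lebesgue (\<lambda>x. indicat_real K x *\<^sub>R g x)" "compact K \<and> K \<subseteq> \<Omega>"
  then have "integrable lebesgue (\<lambda>x. (indicat_real K x *\<^sub>R g x) \<bullet> b)" by (intro integrable_inner_left) auto
  then show "integrable lebesgue (\<lambda>x. indicat_real K x *\<^sub>R (g x \<bullet> b))" by simp
qed

lemma locally_integrable_on_diff:
  "locally_integrable_on f \<Omega> \<Longrightarrow> locally_integrable_on g \<Omega> \<Longrightarrow> locally_integrable_on (\<lambda>x. f x - g x) \<Omega>"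
  unfolding locally_integrable_on_def by (intro allI impI set_integral_diff(1)) auto

text \<open>The difference of two weak gradients is tested component by component.\<close>

lemma weak_grad_unique:
  assumes \<Omega>: "open \<Omega>" and g: "is_weak_grad \<Omega> u g" and g': "is_weak_grad \<Omega> u g'"
  shows "AE x in lebesgue. x \<in> \<Omega> \<longrightarrow> g x = g' x"
proof -
  have "AE x in lebesgue. x \<in> \<Omega> \<longrightarrow> (g x - g' x) \<bullet> b = 0" if b: "b \<in> Basis" for b
  proof (rule fundamental_lemma_variations[OF \<Omega>])
    show "locally_integrable_on (\<lambda>x. (g x - g' x) \<bullet> b) \<Omega>"
      using g g' by (intro locally_integrable_on_inner locally_integrable_on_diff) (auto simp: is_weak_grad_def)
    fix \<phi> assume \<phi>: "\<phi> \<in> test_functions \<Omega>"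
    have "integrable (lebesgue_on \<Omega>) (\<lambda>x. (g x \<bullet> b) * \<phi> x)" "integrable (lebesgue_on \<Omega>) (\<lambda>x. (g' x \<bullet> b) * \<phi> x)"
      using g g' by (auto intro!: locally_integrable_on_times_test[OF \<Omega> locally_integrable_on_inner \<phi>] simp: is_weak_grad_def)
    moreover have "(LINT x|lebesgue_on \<Omega>. (g x \<bullet> b) * \<phi> x) = (LINT x|lebesgue_on \<Omega>. (g' x \<bullet> b) * \<phi> x)"
      using g g' \<phi> b by (auto simp: is_weak_grad_def)
    ultimately show "(LINT x|lebesgue_on \<Omega>. ((g x - g' x) \<bullet> b) * \<phi> x) = 0"
      by (simp add: inner_diff_left left_diff_distrib)
  qed
  then have "AE x in lebesgue. \<forall>b\<in>Basis. x \<in> \<Omega> \<longrightarrow> (g x - g' x) \<bullet> b = 0"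
    by (intro AE_finite_allI) auto
  then show ?thesis
  proof eventually_elim
    case (elim x)
    then show ?case by (auto intro!: euclidean_eqI[of "g x" "g' x"] simp: inner_diff_left)
  qed
qed

lemma locally_integrable_on_integrable:
  assumes "integrable lborel f"
  shows "locally_integrable_on f \<Omega>"
  unfolding locally_integrable_on_def set_integrable_def
  using assms
  by (auto intro!: integrable_mult_indicator borel_compact simp: integrable_completion)

lemma grad_integrable:
  "\<phi> \<in> test_functions \<Omega> \<Longrightarrow> integrable lborel (grad \<phi>)"
  unfolding grad_def[abs_def]
  by (intro Bochner_Integration.integrable_sum integrable_scaleR_left test_functions_integrable[OF test_functions_partial]) auto

lemma test_integral_lebesgue_on:
  assumes "open \<Omega>" "f \<in> borel_measurable borel" "\<And>x. x \<notin> \<Omega> \<Longrightarrow> f x = (0::real)"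
  shows "(LINT x|lebesgue_on \<Omega>. f x) = (LINT x|lborel. f x)"
  by (rule lebesgue_on_lborel(2)) (use assms in \<open>auto intro: borel_measurable_lebesgue_on\<close>)

lemma test_functions_zero_outside: "\<phi> \<in> test_functions \<Omega> \<Longrightarrow> x \<notin> \<Omega> \<Longrightarrow> \<phi> x = 0"
  unfolding test_functions_iff by blast

lemma is_weak_grad_test:
  assumes \<Omega>: "open \<Omega>" and \<phi>: "\<phi> \<in> test_functions \<Omega>"
  shows "is_weak_grad \<Omega> \<phi> (grad \<phi>)"
  unfolding is_weak_grad_def
proof (intro conjI ballI)
  show "locally_integrable_on \<phi> \<Omega>" "locally_integrable_on (grad \<phi>) \<Omega>"
    using \<phi> by (auto intro!: locally_integrable_on_integrable test_functions_integrable grad_integrable)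
  fix \<psi> b assume \<psi>: "\<psi> \<in> test_functions \<Omega>" and b: "b \<in> (Basis :: 'a set)"
  have s: "smooth \<phi>" "smooth \<psi>" using \<phi> \<psi> test_functions_smooth by auto
  have "(LINT x|lebesgue_on \<Omega>. \<phi> x * partial b \<psi> x) = (LINT x|lborel. \<phi> x * partial b \<psi> x)"
    using \<phi> \<psi> by (intro test_integral_lebesgue_on[OF \<Omega>] borel_measurable_times test_functions_measurable[of _ \<Omega>] test_functions_partial b)
        (auto simp: test_functions_zero_outside[OF \<phi>])
  also have "\<dots> = - (LINT x|lborel. partial b \<phi> x * \<psi> x)"
    using test_functions_integral_by_parts[OF \<phi> s(2) b] by simp
  also have "(LINT x|lborel. partial b \<phi> x * \<psi> x) = (LINT x|lebesgue_on \<Omega>. partial b \<phi> x * \<psi> x)"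
    using \<phi> \<psi> by (intro test_integral_lebesgue_on[OF \<Omega>, symmetric] borel_measurable_times test_functions_measurable[of _ \<Omega>] test_functions_partial b)
        (auto simp: test_functions_zero_outside[OF \<psi>])
  finally show "(LINT x|lebesgue_on \<Omega>. \<phi> x * partial b \<psi> x) = - (LINT x|lebesgue_on \<Omega>. grad \<phi> x \<bullet> b * \<psi> x)"
    by (simp add: grad_inner_Basis[OF b])
qed

lemma is_weak_grad_diff_test:
  assumes \<Omega>: "open \<Omega>" and u: "is_weak_grad \<Omega> u g" and \<phi>: "\<phi> \<in> test_functions \<Omega>"
  shows "is_weak_grad \<Omega> (\<lambda>x. u x - \<phi> x) (\<lambda>x. g x - grad \<phi> x)"
proof -
  note w = is_weak_grad_test[OF \<Omega> \<phi>]
  note l = u[unfolded is_weak_grad_def] w[unfolded is_weak_grad_def]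
  show ?thesis unfolding is_weak_grad_def
  proof (intro conjI ballI)
    show "locally_integrable_on (\<lambda>x. u x - \<phi> x) \<Omega>" "locally_integrable_on (\<lambda>x. g x - grad \<phi> x) \<Omega>"
      using l by (auto intro!: locally_integrable_on_diff)
    fix \<psi> b assume \<psi>: "\<psi> \<in> test_functions \<Omega>" and b: "b \<in> (Basis :: 'a set)"
    have "integrable (lebesgue_on \<Omega>) (\<lambda>x. u x * partial b \<psi> x)" "integrable (lebesgue_on \<Omega>) (\<lambda>x. \<phi> x * partial b \<psi> x)"
      using l by (auto intro!: locally_integrable_on_times_test[OF \<Omega>] test_functions_partial \<psi> b)
    moreover have "integrable (lebesgue_on \<Omega>) (\<lambda>x. (g x \<bullet> b) * \<psi> x)" "integrable (lebesgue_on \<Omega>) (\<lambda>x. (grad \<phi> x \<bullet> b) * \<psi> x)"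
      using l by (auto intro!: locally_integrable_on_times_test[OF \<Omega>] locally_integrable_on_inner \<psi> b)
    moreover have "(LINT x|lebesgue_on \<Omega>. u x * partial b \<psi> x) = - (LINT x|lebesgue_on \<Omega>. (g x \<bullet> b) * \<psi> x)"
      "(LINT x|lebesgue_on \<Omega>. \<phi> x * partial b \<psi> x) = - (LINT x|lebesgue_on \<Omega>. (grad \<phi> x \<bullet> b) * \<psi> x)"
      using l \<psi> b by auto
    ultimately show "(LINT x|lebesgue_on \<Omega>. (u x - \<phi> x) * partial b \<psi> x) = - (LINT x|lebesgue_on \<Omega>. (g x - grad \<phi> x) \<bullet> b * \<psi> x)"
      by (simp add: inner_diff_left left_diff_distrib)
  qed
qed

text \<open>The choice operator in \<open>weak_grad\<close> yields some weak gradient; uniqueness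
  identifies it with any explicitly known one.\<close>

lemma weak_grad_ae_eq:
  assumes "open \<Omega>" "is_weak_grad \<Omega> u g"
  shows "AE x in lebesgue. x \<in> \<Omega> \<longrightarrow> weak_grad \<Omega> u x = g x"
  using weak_grad_unique[OF assms(1) _ assms(2)] someI[of "is_weak_grad \<Omega> u", OF assms(2)]
  by (simp add: weak_grad_def)

lemma ex_borel_representative:
  fixes f :: "'a::euclidean_space \<Rightarrow> 'b::euclidean_space"
  assumes \<Omega>: "\<Omega> \<in> sets borel" and f: "f \<in> borel_measurable (lebesgue_on \<Omega>)"
  obtains g where "g \<in> borel_measurable borel" "\<And>x. x \<notin> \<Omega> \<Longrightarrow> g x = 0" "AE x in lebesgue. x \<in> \<Omega> \<longrightarrow> f x = g x"
proof -
  have S: "\<Omega> \<inter> space lebesgue \<in> sets lebesgue" using \<Omega> by auto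
  have m: "(\<lambda>x. indicator \<Omega> x *\<^sub>R f x) \<in> borel_measurable lebesgue"
    using f borel_measurable_restrict_space_iff[OF S, of f] by simp
  have "\<exists>h\<in>borel_measurable lborel. AE x in lborel. (indicator \<Omega> x *\<^sub>R f x) \<bullet> b = h x" for b
    by (rule completion_ex_borel_measurable_real) (intro borel_measurable_inner m borel_measurable_const)
  then obtain h where h: "\<And>b. h b \<in> borel_measurable lborel" "\<And>b. AE x in lborel. (indicator \<Omega> x *\<^sub>R f x) \<bullet> b = h b x"
    by metis
  define g where "g x = indicator \<Omega> x *\<^sub>R (\<Sum>b\<in>Basis. h b x *\<^sub>R b)" for x
  have "g \<in> borel_measurable borel"
    unfolding g_def[abs_def] using \<Omega> h(1) by (intro borel_measurable_scaleR borel_measurable_sum borel_measurable_const) auto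
  moreover have "g x = 0" if "x \<notin> \<Omega>" for x using that by (simp add: g_def)
  moreover have "AE x in lebesgue. x \<in> \<Omega> \<longrightarrow> f x = g x"
  proof -
    have "AE x in lborel. \<forall>b\<in>Basis. (indicator \<Omega> x *\<^sub>R f x) \<bullet> b = h b x"
      using h(2) by (intro AE_finite_allI) auto
    then have "AE x in lborel. x \<in> \<Omega> \<longrightarrow> f x = g x"
    proof eventually_elim
      case (elim x)
      have "(\<Sum>b\<in>Basis. h b x *\<^sub>R b) = (\<Sum>b\<in>Basis. ((indicator \<Omega> x *\<^sub>R f x) \<bullet> b) *\<^sub>R b)"
        using elim by (intro sum.cong) auto
      then show ?case by (auto simp: g_def euclidean_representation)
    qed
    then show ?thesis by (rule AE_completion)
  qed
  ultimately show thesis by (rule that)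
qed

section \<open>Elements of \<open>H1_0\<close> as functions on the whole space\<close>

lemma Lp_norm_2_sq:
  "(Lp_norm 2 \<Omega> f)\<^sup>2 = (LINT x|lebesgue_on \<Omega>. (norm (f x))\<^sup>2)"
proof -
  have "(LINT x|lebesgue_on \<Omega>. (norm (f x))\<^sup>2) \<ge> 0" by (intro integral_nonneg_AE) auto
  then show ?thesis by (simp add: Lp_norm_def powr_half_sqrt)
qed

lemma Lp_space_2_iff: "f \<in> Lp_space 2 \<Omega> \<longleftrightarrow> f \<in> borel_measurable (lebesgue_on \<Omega>) \<and> integrable (lebesgue_on \<Omega>) (\<lambda>x. (norm (f x))\<^sup>2)"
  by (simp add: Lp_space_def)

lemma weak_grad_measurable:
  assumes "open \<Omega>" "is_weak_grad \<Omega> u g" "g \<in> borel_measurable (lebesgue_on \<Omega>)"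
  shows "weak_grad \<Omega> u \<in> borel_measurable (lebesgue_on \<Omega>)"
proof -
  have S: "\<Omega> \<inter> space lebesgue \<in> sets lebesgue" using assms(1) by auto
  have m: "(\<lambda>x. indicator \<Omega> x *\<^sub>R g x) \<in> borel_measurable lebesgue"
    using assms(3) borel_measurable_restrict_space_iff[OF S, of g] by simp
  have "AE x in lebesgue. indicator \<Omega> x *\<^sub>R g x = indicator \<Omega> x *\<^sub>R weak_grad \<Omega> u x"
    using weak_grad_ae_eq[OF assms(1,2)] by eventually_elim (auto split: split_indicator)
  then have "(\<lambda>x. indicator \<Omega> x *\<^sub>R weak_grad \<Omega> u x) \<in> borel_measurable lebesgue"
    by (rule borel_measurable_AE[OF m])
  then show ?thesis using borel_measurable_restrict_space_iff[OF S, of "weak_grad \<Omega> u"] by simp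
qed

lemma test_functions_square_integrable:
  assumes "\<phi> \<in> test_functions \<Omega>"
  shows "integrable lborel (\<lambda>x. (\<phi> x)\<^sup>2)"
  unfolding power2_eq_square
  using assms by (intro test_functions_integrable test_functions_mult_smooth test_functions_smooth)

lemma norm_grad_sq: "(norm (grad f x))\<^sup>2 = (\<Sum>b\<in>Basis. (partial b f x)\<^sup>2)"
  unfolding power2_norm_eq_inner by (subst euclidean_inner) (simp add: grad_inner_Basis power2_eq_square)

lemma grad_square_integrable:
  assumes "\<phi> \<in> test_functions \<Omega>"
  shows "integrable lborel (\<lambda>x. (norm (grad \<phi> x))\<^sup>2)"
  unfolding norm_grad_sq
  using assms by (intro Bochner_Integration.integrable_sum test_functions_square_integrable[OF test_functions_partial])

text \<open>Makes test functions admissible in the variational equation. The approximating sequence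
  is constant; the remaining point is that its distance to \<phi> is zero although
  \<open>weak_grad\<close> of the zero function is known only almost everywhere.\<close>

lemma test_functions_H1_0:
  assumes \<Omega>: "open \<Omega>" and \<phi>: "\<phi> \<in> test_functions \<Omega>"
  shows "\<phi> \<in> H1_0 \<Omega>"
proof -
  have \<Omega>b: "\<Omega> \<in> sets borel" using \<Omega> by simp
  note w = is_weak_grad_test[OF \<Omega> \<phi>]
  obtain K where K: "smooth \<phi>" "compact K" "K \<subseteq> \<Omega>" "\<And>x. x \<notin> K \<Longrightarrow> \<phi> x = 0"
    using test_functionsE[OF \<phi>] by metis
  have g0: "grad \<phi> x = 0" if "x \<notin> \<Omega>" for x
    using that K by (intro grad_eq_0_outside[of K]) (auto intro: compact_imp_closed)
  have \<phi>m: "\<phi> \<in> borel_measurable borel" and gm: "grad \<phi> \<in> borel_measurable borel"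
    using \<phi> K(1) by auto
  have wm: "weak_grad \<Omega> \<phi> \<in> borel_measurable (lebesgue_on \<Omega>)"
    by (rule weak_grad_measurable[OF \<Omega> w borel_measurable_lebesgue_on[OF gm]])
  have "\<phi> \<in> Lp_space 2 \<Omega>"
    unfolding Lp_space_2_iff
  proof
    show "integrable (lebesgue_on \<Omega>) (\<lambda>x. (norm (\<phi> x))\<^sup>2)"
      using \<phi>m test_functions_zero_outside[OF \<phi>] test_functions_square_integrable[OF \<phi>]
      by (subst lebesgue_on_lborel(1)[OF \<Omega>b, where F'="\<lambda>x. (\<phi> x)\<^sup>2"]) (auto intro!: borel_measurable_lebesgue_on)
  qed (rule borel_measurable_lebesgue_on[OF \<phi>m])
  moreover have "weak_grad \<Omega> \<phi> \<in> Lp_space 2 \<Omega>"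
    unfolding Lp_space_2_iff
  proof
    have ae: "AE x in lebesgue. x \<in> \<Omega> \<longrightarrow> (norm (weak_grad \<Omega> \<phi> x))\<^sup>2 = (norm (grad \<phi> x))\<^sup>2"
      using weak_grad_ae_eq[OF \<Omega> w] by eventually_elim auto
    show "integrable (lebesgue_on \<Omega>) (\<lambda>x. (norm (weak_grad \<Omega> \<phi> x))\<^sup>2)"
      using wm gm g0 grad_square_integrable[OF \<phi>]
      by (subst lebesgue_on_lborel(1)[OF \<Omega>b _ _ _ ae]) auto
  qed (rule wm)
  ultimately have "\<phi> \<in> H1 \<Omega>" unfolding H1_def using w by auto
  moreover have "H1_norm \<Omega> (\<lambda>x. \<phi> x - \<phi> x) = 0"
  proof -
    have "is_weak_grad \<Omega> (\<lambda>x. \<phi> x - \<phi> x) (\<lambda>x. grad \<phi> x - grad \<phi> x)"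
      by (rule is_weak_grad_diff_test[OF \<Omega> w \<phi>])
    then have z: "is_weak_grad \<Omega> (\<lambda>x. 0) (\<lambda>x. 0)" by simp
    have ae: "AE x in lebesgue. x \<in> \<Omega> \<longrightarrow> (norm (weak_grad \<Omega> (\<lambda>x. 0) x))\<^sup>2 = 0"
      using weak_grad_ae_eq[OF \<Omega> z] by eventually_elim auto
    have "weak_grad \<Omega> (\<lambda>x. 0) \<in> borel_measurable (lebesgue_on \<Omega>)"
      by (rule weak_grad_measurable[OF \<Omega> z]) simp
    then have "(\<lambda>x. (norm (weak_grad \<Omega> (\<lambda>x. 0) x))\<^sup>2) \<in> borel_measurable (lebesgue_on \<Omega>)"
      by measurable
    from lebesgue_on_lborel(2)[OF \<Omega>b this _ _ ae]
    have "(LINT x|lebesgue_on \<Omega>. (norm (weak_grad \<Omega> (\<lambda>x. 0) x))\<^sup>2) = 0" by simp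
    then show ?thesis by (simp add: H1_norm_def Lp_norm_2_sq)
  qed
  ultimately show ?thesis unfolding H1_0_def using \<phi>
    by (auto intro!: exI[of _ "\<lambda>n. \<phi>"])
qed

text \<open>The passage from the definition of \<open>H1_0\<close> to the data of the locale
  \<open>H1_0_solution\<close>. The boundary condition survives as \<open>L\<^sup>2\<close>
  convergence, on the whole space, of test functions and their gradients to the zero extensions
  \<open>w\<close> and \<open>W\<close>.\<close>

lemma H1_0_representative:
  fixes u :: "'a::euclidean_space \<Rightarrow> real"
  assumes \<Omega>: "open \<Omega>" and u: "u \<in> H1_0 \<Omega>"
  obtains w W \<phi> where "w \<in> borel_measurable borel" "W \<in> borel_measurable borel"
    "\<And>x. x \<notin> \<Omega> \<Longrightarrow> w x = 0" "\<And>x. x \<notin> \<Omega> \<Longrightarrow> W x = 0"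
    "AE x in lebesgue. x \<in> \<Omega> \<longrightarrow> u x = w x" "AE x in lebesgue. x \<in> \<Omega> \<longrightarrow> weak_grad \<Omega> u x = W x"
    "integrable lborel (\<lambda>x. (w x)\<^sup>2)" "integrable lborel (\<lambda>x. (norm (W x))\<^sup>2)"
    "\<And>n::nat. \<phi> n \<in> test_functions \<Omega>"
    "(\<lambda>n. LINT x|lborel. (w x - \<phi> n x)\<^sup>2) \<longlonglongrightarrow> 0"
    "(\<lambda>n. LINT x|lborel. (norm (W x - grad (\<phi> n) x))\<^sup>2) \<longlonglongrightarrow> 0"
proof -
  have \<Omega>b: "\<Omega> \<in> sets borel" using \<Omega> by simp
  from u obtain \<phi> where H: "u \<in> Lp_space 2 \<Omega>" "\<exists>g. is_weak_grad \<Omega> u g" "weak_grad \<Omega> u \<in> Lp_space 2 \<Omega>"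
    and \<phi>: "\<And>n::nat. \<phi> n \<in> test_functions \<Omega>" and lim: "(\<lambda>n. H1_norm \<Omega> (\<lambda>x. u x - \<phi> n x)) \<longlonglongrightarrow> 0"
    by (auto simp: H1_0_def H1_def)
  have G: "is_weak_grad \<Omega> u (weak_grad \<Omega> u)" using H(2) unfolding weak_grad_def by (rule someI_ex)
  have um: "u \<in> borel_measurable (lebesgue_on \<Omega>)" and Gm: "weak_grad \<Omega> u \<in> borel_measurable (lebesgue_on \<Omega>)"
    using H by (auto simp: Lp_space_2_iff)
  obtain w where w: "w \<in> borel_measurable borel" "\<And>x. x \<notin> \<Omega> \<Longrightarrow> w x = 0" "AE x in lebesgue. x \<in> \<Omega> \<longrightarrow> u x = w x"
    using ex_borel_representative[OF \<Omega>b um] by metis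
  obtain W where W: "W \<in> borel_measurable borel" "\<And>x. x \<notin> \<Omega> \<Longrightarrow> W x = 0" "AE x in lebesgue. x \<in> \<Omega> \<longrightarrow> weak_grad \<Omega> u x = W x"
    using ex_borel_representative[OF \<Omega>b Gm] by metis
  have wi: "integrable lborel (\<lambda>x. (w x)\<^sup>2)"
  proof -
    have ae: "AE x in lebesgue. x \<in> \<Omega> \<longrightarrow> (norm (u x))\<^sup>2 = (w x)\<^sup>2" using w(3) by eventually_elim auto
    have "(\<lambda>x. (norm (u x))\<^sup>2) \<in> borel_measurable (lebesgue_on \<Omega>)" using um by measurable
    from lebesgue_on_lborel(1)[OF \<Omega>b this _ _ ae] H(1) w show ?thesis by (auto simp: Lp_space_2_iff)
  qed
  have Wi: "integrable lborel (\<lambda>x. (norm (W x))\<^sup>2)"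
  proof -
    have ae: "AE x in lebesgue. x \<in> \<Omega> \<longrightarrow> (norm (weak_grad \<Omega> u x))\<^sup>2 = (norm (W x))\<^sup>2" using W(3) by eventually_elim auto
    have "(\<lambda>x. (norm (weak_grad \<Omega> u x))\<^sup>2) \<in> borel_measurable (lebesgue_on \<Omega>)" using Gm by measurable
    from lebesgue_on_lborel(1)[OF \<Omega>b this _ _ ae] H(3) W show ?thesis by (auto simp: Lp_space_2_iff)
  qed
  have g0: "grad (\<phi> n) x = 0" if "x \<notin> \<Omega>" for x n
  proof -
    obtain K where K: "smooth (\<phi> n)" "compact K" "K \<subseteq> \<Omega>" "\<And>x. x \<notin> K \<Longrightarrow> \<phi> n x = 0"
      using test_functionsE[OF \<phi>] by metis
    show ?thesis using that K by (intro grad_eq_0_outside[of K]) (auto intro: compact_imp_closed)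
  qed
  have \<phi>m: "\<phi> n \<in> borel_measurable borel" and gm: "grad (\<phi> n) \<in> borel_measurable borel" for n
    using \<phi>[of n] test_functions_smooth[OF \<phi>[of n]] by auto
  have e1: "(Lp_norm 2 \<Omega> (\<lambda>x. u x - \<phi> n x))\<^sup>2 = (LINT x|lborel. (w x - \<phi> n x)\<^sup>2)" for n
    unfolding Lp_norm_2_sq
  proof (rule lebesgue_on_lborel(2)[OF \<Omega>b])
    show "AE x in lebesgue. x \<in> \<Omega> \<longrightarrow> (norm (u x - \<phi> n x))\<^sup>2 = (w x - \<phi> n x)\<^sup>2" using w(3) by eventually_elim auto
    show "(\<lambda>x. (norm (u x - \<phi> n x))\<^sup>2) \<in> borel_measurable (lebesgue_on \<Omega>)"
      using um borel_measurable_lebesgue_on[OF \<phi>m, of n] by measurable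
    show "(\<lambda>x. (w x - \<phi> n x)\<^sup>2) \<in> borel_measurable borel" using w(1) \<phi>m by measurable
  qed (use w(2) test_functions_zero_outside[OF \<phi>] in auto)
  have e2: "(Lp_norm 2 \<Omega> (weak_grad \<Omega> (\<lambda>x. u x - \<phi> n x)))\<^sup>2 = (LINT x|lborel. (norm (W x - grad (\<phi> n) x))\<^sup>2)" for n
    unfolding Lp_norm_2_sq
  proof (rule lebesgue_on_lborel(2)[OF \<Omega>b])
    note d = is_weak_grad_diff_test[OF \<Omega> G \<phi>, of n]
    show "AE x in lebesgue. x \<in> \<Omega> \<longrightarrow> (norm (weak_grad \<Omega> (\<lambda>x. u x - \<phi> n x) x))\<^sup>2 = (norm (W x - grad (\<phi> n) x))\<^sup>2"
      using weak_grad_ae_eq[OF \<Omega> d] W(3) by eventually_elim auto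
    have "weak_grad \<Omega> (\<lambda>x. u x - \<phi> n x) \<in> borel_measurable (lebesgue_on \<Omega>)"
      by (rule weak_grad_measurable[OF \<Omega> d borel_measurable_diff[OF Gm borel_measurable_lebesgue_on[OF gm]]])
    then show "(\<lambda>x. (norm (weak_grad \<Omega> (\<lambda>x. u x - \<phi> n x) x))\<^sup>2) \<in> borel_measurable (lebesgue_on \<Omega>)" by measurable
    show "(\<lambda>x. (norm (W x - grad (\<phi> n) x))\<^sup>2) \<in> borel_measurable borel" using W(1) gm by measurable
  qed (use W(2) g0 in auto)
  have s: "(\<lambda>n. (H1_norm \<Omega> (\<lambda>x. u x - \<phi> n x))\<^sup>2) \<longlonglongrightarrow> 0" using tendsto_power[OF lim, of 2] by simp
  have h: "(H1_norm \<Omega> (\<lambda>x. u x - \<phi> n x))\<^sup>2 = (LINT x|lborel. (w x - \<phi> n x)\<^sup>2) + (LINT x|lborel. (norm (W x - grad (\<phi> n) x))\<^sup>2)" for n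
    unfolding H1_norm_def by (simp add: e1 e2)
  have p: "(LINT x|lborel. (w x - \<phi> n x)\<^sup>2) \<ge> 0" "(LINT x|lborel. (norm (W x - grad (\<phi> n) x))\<^sup>2) \<ge> 0" for n
    by (auto intro!: integral_nonneg_AE)
  have l1: "(\<lambda>n. LINT x|lborel. (w x - \<phi> n x)\<^sup>2) \<longlonglongrightarrow> 0"
    using p h by (intro tendsto_sandwich[OF _ _ tendsto_const s]) (auto intro!: always_eventually)
  have l2: "(\<lambda>n. LINT x|lborel. (norm (W x - grad (\<phi> n) x))\<^sup>2) \<longlonglongrightarrow> 0"
    using p h by (intro tendsto_sandwich[OF _ _ tendsto_const s]) (auto intro!: always_eventually)
  show thesis using that[OF w(1) W(1) w(2) W(2) w(3) W(3) wi Wi \<phi> l1 l2] .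
qed

text \<open>Two choices of the element tested with: smooth functions for the equation, and
  \<open>u\<close> itself for the energy identity that decides the sign of \<mu>.\<close>

lemma dirichlet_eigenfunction_test:
  assumes \<Omega>: "open \<Omega>" and e: "dirichlet_eigenfunction \<Omega> \<mu> u"
    and w: "w \<in> borel_measurable borel" "\<And>x. x \<notin> \<Omega> \<Longrightarrow> w x = 0" "AE x in lebesgue. x \<in> \<Omega> \<longrightarrow> u x = w x"
    and W: "W \<in> borel_measurable borel" "\<And>x. x \<notin> \<Omega> \<Longrightarrow> W x = 0" "AE x in lebesgue. x \<in> \<Omega> \<longrightarrow> weak_grad \<Omega> u x = W x"
  shows "\<psi> \<in> test_functions \<Omega> \<Longrightarrow> (LINT x|lborel. W x \<bullet> grad \<psi> x) = \<mu> * (LINT x|lborel. w x * \<psi> x)"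
    and "(LINT x|lborel. W x \<bullet> W x) = \<mu> * (LINT x|lborel. w x * w x)"
proof -
  have \<Omega>b: "\<Omega> \<in> sets borel" using \<Omega> by simp
  have u0: "u \<in> H1_0 \<Omega>" and eq: "\<And>v. v \<in> H1_0 \<Omega> \<Longrightarrow> (LINT x|lebesgue_on \<Omega>. weak_grad \<Omega> u x \<bullet> weak_grad \<Omega> v x) =
        \<mu> * (LINT x|lebesgue_on \<Omega>. u x * v x)"
    using e by (auto simp: dirichlet_eigenfunction_def)
  have um: "u \<in> borel_measurable (lebesgue_on \<Omega>)" and Gm: "weak_grad \<Omega> u \<in> borel_measurable (lebesgue_on \<Omega>)"
    using u0 by (auto simp: Lp_space_2_iff H1_0_def H1_def)
  have "(LINT x|lebesgue_on \<Omega>. weak_grad \<Omega> u x \<bullet> weak_grad \<Omega> u x) = (LINT x|lborel. W x \<bullet> W x)"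
  proof (rule lebesgue_on_lborel(2)[OF \<Omega>b])
    show "AE x in lebesgue. x \<in> \<Omega> \<longrightarrow> weak_grad \<Omega> u x \<bullet> weak_grad \<Omega> u x = W x \<bullet> W x" using W(3) by eventually_elim auto
  qed (use Gm W in \<open>auto intro!: borel_measurable_inner\<close>)
  moreover have "(LINT x|lebesgue_on \<Omega>. u x * u x) = (LINT x|lborel. w x * w x)"
  proof (rule lebesgue_on_lborel(2)[OF \<Omega>b])
    show "AE x in lebesgue. x \<in> \<Omega> \<longrightarrow> u x * u x = w x * w x" using w(3) by eventually_elim auto
  qed (use um w in \<open>auto intro!: borel_measurable_times\<close>)
  ultimately show "(LINT x|lborel. W x \<bullet> W x) = \<mu> * (LINT x|lborel. w x * w x)"
    using eq[OF u0] by simp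
  assume \<psi>: "\<psi> \<in> test_functions \<Omega>"
  note wg = is_weak_grad_test[OF \<Omega> \<psi>]
  have gm: "grad \<psi> \<in> borel_measurable borel" and pm: "\<psi> \<in> borel_measurable borel" using test_functions_smooth[OF \<psi>] \<psi> by auto
  have wm: "weak_grad \<Omega> \<psi> \<in> borel_measurable (lebesgue_on \<Omega>)"
    by (rule weak_grad_measurable[OF \<Omega> wg borel_measurable_lebesgue_on[OF gm]])
  have "(LINT x|lebesgue_on \<Omega>. weak_grad \<Omega> u x \<bullet> weak_grad \<Omega> \<psi> x) = (LINT x|lborel. W x \<bullet> grad \<psi> x)"
  proof (rule lebesgue_on_lborel(2)[OF \<Omega>b])
    show "AE x in lebesgue. x \<in> \<Omega> \<longrightarrow> weak_grad \<Omega> u x \<bullet> weak_grad \<Omega> \<psi> x = W x \<bullet> grad \<psi> x"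
      using W(3) weak_grad_ae_eq[OF \<Omega> wg] by eventually_elim auto
  qed (use Gm wm gm W in \<open>auto intro!: borel_measurable_inner\<close>)
  moreover have "(LINT x|lebesgue_on \<Omega>. u x * \<psi> x) = (LINT x|lborel. w x * \<psi> x)"
  proof (rule lebesgue_on_lborel(2)[OF \<Omega>b])
    show "AE x in lebesgue. x \<in> \<Omega> \<longrightarrow> u x * \<psi> x = w x * \<psi> x" using w(3) by eventually_elim auto
  qed (use um w pm borel_measurable_lebesgue_on[OF pm, of \<Omega>] in \<open>auto intro!: borel_measurable_times\<close>)
  ultimately show "(LINT x|lborel. W x \<bullet> grad \<psi> x) = \<mu> * (LINT x|lborel. w x * \<psi> x)"
    using eq[OF test_functions_H1_0[OF \<Omega> \<psi>]] by simp
qed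

subsection \<open>Weak solutions with zero boundary values\<close>

text \<open>Takes the place of the Cauchy-Schwarz inequality on sets of finite measure; the free
  parameter \<open>e\<close> is optimised afterwards.\<close>

lemma abs_le_eps_square:
  fixes a e :: real assumes "e > 0" shows "\<bar>a\<bar> \<le> e + a\<^sup>2 / e"
proof (cases "\<bar>a\<bar> \<le> e")
  case True then show ?thesis using assms by (intro add_increasing2) auto
next
  case False
  then have "e * \<bar>a\<bar> \<le> \<bar>a\<bar> * \<bar>a\<bar>" using assms by (intro mult_right_mono) auto
  then have "\<bar>a\<bar> \<le> a\<^sup>2 / e" using assms by (simp add: pos_le_divide_eq power2_eq_square mult.commute)
  then show ?thesis using assms by simp
qed

lemma L2_imp_L1_bound:
  fixes f :: "'a::euclidean_space \<Rightarrow> real"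
  assumes m: "f \<in> borel_measurable borel" and i: "integrable lborel (\<lambda>x. (f x)\<^sup>2)"
    and S: "S \<in> sets borel" "emeasure lborel S < \<infinity>"
  shows "integrable lborel (\<lambda>x. \<bar>f x\<bar> * indicator S x)"
    and "e > 0 \<Longrightarrow> (LINT x|lborel. \<bar>f x\<bar> * indicator S x) \<le> e * measure lborel S + (LINT x|lborel. (f x)\<^sup>2) / e"
proof -
  have Si: "integrable lborel (indicat_real S)" using S by (intro integrable_real_indicator) auto
  have b: "\<bar>f x\<bar> * indicator S x \<le> e * indicator S x + (f x)\<^sup>2 / e" if "e > 0" for e x
    using abs_le_eps_square[OF that, of "f x"] that by (auto split: split_indicator)
  have bi: "integrable lborel (\<lambda>x. e * indicator S x + (f x)\<^sup>2 / e)" for e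
    using Si i by auto
  show ii: "integrable lborel (\<lambda>x. \<bar>f x\<bar> * indicator S x)"
    by (rule Bochner_Integration.integrable_bound[OF bi[of 1]])
      (use m S b[of 1] in \<open>auto intro!: always_eventually order_trans[OF b[of 1, simplified]] simp: abs_mult\<close>)
  show "(LINT x|lborel. \<bar>f x\<bar> * indicator S x) \<le> e * measure lborel S + (LINT x|lborel. (f x)\<^sup>2) / e" if "e > 0"
    using integral_mono[OF ii bi[of e] b[OF that]] Si i S by simp
qed

lemma L2_tendsto_imp_L1:
  fixes f :: "nat \<Rightarrow> 'a::euclidean_space \<Rightarrow> real"
  assumes m: "\<And>n. f n \<in> borel_measurable borel" and i: "\<And>n. integrable lborel (\<lambda>x. (f n x)\<^sup>2)"
    and S: "S \<in> sets borel" "emeasure lborel S < \<infinity>"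
    and lim: "(\<lambda>n. LINT x|lborel. (f n x)\<^sup>2) \<longlonglongrightarrow> 0"
  shows "(\<lambda>n. LINT x|lborel. \<bar>f n x\<bar> * indicator S x) \<longlonglongrightarrow> 0"
proof -
  define a where "a n = (LINT x|lborel. (f n x)\<^sup>2)" for n
  \<comment> \<open>The balanced choice is \<open>sqrt (a n)\<close>; the second summand keeps
    \<open>e n\<close> positive when \<open>a n = 0\<close>.\<close>
  define e where "e n = sqrt (a n) + 1 / real (Suc n)" for n
  have a: "a n \<ge> 0" for n unfolding a_def by (intro integral_nonneg_AE) auto
  have e: "e n > 0" for n unfolding e_def using a[of n] by (intro add_nonneg_pos) auto
  have "(\<lambda>n. sqrt (a n)) \<longlonglongrightarrow> 0" using tendsto_real_sqrt[OF lim] by (simp add: a_def)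
  moreover have "(\<lambda>n. 1 / real (Suc n)) \<longlonglongrightarrow> 0" using LIMSEQ_inverse_real_of_nat by (simp add: inverse_eq_divide)
  ultimately have "(\<lambda>n. (sqrt (a n) + 1 / real (Suc n)) * measure lborel S + sqrt (a n)) \<longlonglongrightarrow> (0 + 0) * measure lborel S + 0"
    by (intro tendsto_intros)
  then have l: "(\<lambda>n. e n * measure lborel S + sqrt (a n)) \<longlonglongrightarrow> 0" by (simp add: e_def)
  have ae: "a n / e n \<le> sqrt (a n)" for n
  proof -
    have "a n = sqrt (a n) * sqrt (a n)" using a by simp
    also have "\<dots> \<le> sqrt (a n) * e n" unfolding e_def using a by (intro mult_left_mono) auto
    finally show ?thesis using e[of n] by (simp add: pos_divide_le_eq)
  qed
  show ?thesis
  proof (rule tendsto_sandwich[OF _ _ tendsto_const l])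
    show "\<forall>\<^sub>F n in sequentially. 0 \<le> (LINT x|lborel. \<bar>f n x\<bar> * indicator S x)"
      by (intro always_eventually allI integral_nonneg_AE) auto
    show "\<forall>\<^sub>F n in sequentially. (LINT x|lborel. \<bar>f n x\<bar> * indicator S x) \<le> e n * measure lborel S + sqrt (a n)"
      using L2_imp_L1_bound(2)[OF m i S e] ae by (intro always_eventually allI) (smt (verit) a_def)
  qed
qed

lemma bump_family_1: "x > 0 \<Longrightarrow> bump_family (Suc 0) x = exp (- (1 / x)) / x\<^sup>2"
proof -
  assume x: "x > 0"
  have "((\<lambda>x. exp (- (1 / x))) has_real_derivative exp (- (1 / x)) / x\<^sup>2) (at x)"
    using x by (auto intro!: derivative_eq_intros simp: power2_eq_square)
  then have "(bump_family 0 has_real_derivative exp (- (1 / x)) / x\<^sup>2) (at x)"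
    by (rule has_field_derivative_transform_within_open[where S = "{0<..}"]) (use x in \<open>auto simp: bump_family\<close>)
  moreover have "(bump_family 0 has_real_derivative bump_family (Suc 0) x) (at x)"
    using bump_family(1) by (simp add: smooth_family_def)
  ultimately show ?thesis using DERIV_unique by blast
qed

lemma bump_family_1_nonneg: "bump_family (Suc 0) x \<ge> 0"
  by (cases "x > 0") (auto simp: bump_family_1 bump_family(3))

text \<open>When a function bounded by \<open>L * d\<close> is multiplied by
  \<open>bump_family 0 (n * d - 1)\<close>, the gradient of the cutoff contributes, up to constants,
  \<open>n * d * bump_family (Suc 0) (n * d - 1)\<close>: this is the expression here with
  \<open>s = n * d\<close>. The uniform bound serves domination, the other one convergence to
  \<open>0\<close> as \<open>n\<close> grows.\<close>

lemma bump_family_1_bounds: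
  assumes "s \<ge> 0"
  shows "s * bump_family (Suc 0) (s - 1) \<le> 2"
    and "s > 1 \<Longrightarrow> s * bump_family (Suc 0) (s - 1) \<le> 1 / (s - 1) + 1 / (s - 1)\<^sup>2"
proof -
  have *: "s * bump_family (Suc 0) (s - 1) = (1 / (s - 1) + (1 / (s - 1))\<^sup>2) * exp (- (1 / (s - 1)))" if "s > 1"
  proof -
    have "s / (s - 1)\<^sup>2 = 1 / (s - 1) + (1 / (s - 1))\<^sup>2"
      using that by (simp add: power2_eq_square divide_simps)
    then show ?thesis using that by (simp add: bump_family_1 flip: times_divide_eq_left)
  qed
  have "s * bump_family (Suc 0) (s - 1) \<le> 2" if "s > 1"
  proof -
    let ?y = "1 / (s - 1)"
    have y: "?y > 0" using that by simp
    have "1 + ?y + ?y\<^sup>2 / 2 \<le> exp ?y" using exp_lower_Taylor_quadratic[of ?y] y by simp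
    then have "?y + ?y\<^sup>2 \<le> 2 * exp ?y" using y by linarith
    then show ?thesis unfolding *[OF that] by (simp add: exp_minus divide_simps)
  qed
  then show "s * bump_family (Suc 0) (s - 1) \<le> 2" by (cases "s > 1") (auto simp: bump_family(3))
  show "s * bump_family (Suc 0) (s - 1) \<le> 1 / (s - 1) + 1 / (s - 1)\<^sup>2" if "s > 1"
    unfolding *[OF that] using that by (intro order_trans[OF mult_left_le]) (auto simp: power_divide)
qed

lemma filterlim_real_mult_minus_1:
  "d > 0 \<Longrightarrow> filterlim (\<lambda>n. real n * d - 1) at_top sequentially"
  using filterlim_tendsto_add_at_top[OF tendsto_const[of "-1"]
      filterlim_tendsto_pos_mult_at_top[OF tendsto_const[of d] _ filterlim_real_sequentially]]
  by (simp add: mult.commute add.commute)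

text \<open>The zero extensions of an eigenfunction and of its weak gradient, as Borel functions on
  the whole space. That \<open>W\<close> is the gradient of \<open>w\<close> and that
  \<open>w\<close> vanishes on the boundary are both encoded in the two limits, so that traces never
  enter. The sign of \<mu> is left open.\<close>

locale H1_0_solution =
  fixes \<Omega> :: "'a::euclidean_space set" and w :: "'a \<Rightarrow> real" and W :: "'a \<Rightarrow> 'a" and \<phi> :: "nat \<Rightarrow> 'a \<Rightarrow> real" and \<mu> :: real
  assumes \<Omega>: "open \<Omega>" "bounded \<Omega>"
    and w_m [measurable]: "w \<in> borel_measurable borel" and W_m [measurable]: "W \<in> borel_measurable borel"
    and w_0: "\<And>x. x \<notin> \<Omega> \<Longrightarrow> w x = 0" and W_0: "\<And>x. x \<notin> \<Omega> \<Longrightarrow> W x = 0"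
    and w_i: "integrable lborel (\<lambda>x. (w x)\<^sup>2)" and W_i: "integrable lborel (\<lambda>x. (norm (W x))\<^sup>2)"
    and \<phi>: "\<And>n. \<phi> n \<in> test_functions \<Omega>"
    and lim_w: "(\<lambda>n. LINT x|lborel. (w x - \<phi> n x)\<^sup>2) \<longlonglongrightarrow> 0"
    and lim_W: "(\<lambda>n. LINT x|lborel. (norm (W x - grad (\<phi> n) x))\<^sup>2) \<longlonglongrightarrow> 0"
    and eq: "\<And>\<psi>. \<psi> \<in> test_functions \<Omega> \<Longrightarrow> (LINT x|lborel. W x \<bullet> grad \<psi> x) = \<mu> * (LINT x|lborel. w x * \<psi> x)"
begin

lemma \<Omega>_sets: "\<Omega> \<in> sets borel" "emeasure lborel \<Omega> < \<infinity>"
  using \<Omega> emeasure_bounded_finite[of \<Omega>] by auto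

lemma grad_\<phi>_0: "x \<notin> \<Omega> \<Longrightarrow> grad (\<phi> n) x = 0"
proof -
  assume x: "x \<notin> \<Omega>"
  obtain K where K: "smooth (\<phi> n)" "compact K" "K \<subseteq> \<Omega>" "\<And>x. x \<notin> K \<Longrightarrow> \<phi> n x = 0"
    using test_functionsE[OF \<phi>] by metis
  show ?thesis using x K by (intro grad_eq_0_outside[of K]) (auto intro: compact_imp_closed)
qed

lemma \<phi>_m [measurable]: "\<phi> n \<in> borel_measurable borel" "grad (\<phi> n) \<in> borel_measurable borel"
  using \<phi>[of n] test_functions_smooth[OF \<phi>[of n]] by auto

lemma w_integrable: "integrable lborel w"
  using L2_imp_L1_bound(1)[OF w_m w_i \<Omega>_sets] w_0
  by (rule_tac Bochner_Integration.integrable_bound[where f = "\<lambda>x. \<bar>w x\<bar> * indicator \<Omega> x"])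
     (auto intro!: always_eventually split: split_indicator)

lemma norm_W_integrable: "integrable lborel (\<lambda>x. norm (W x))"
  using L2_imp_L1_bound(1)[of "\<lambda>x. norm (W x)" \<Omega>] W_i \<Omega>_sets W_0
  by (rule_tac Bochner_Integration.integrable_bound[where f = "\<lambda>x. \<bar>norm (W x)\<bar> * indicator \<Omega> x"])
     (auto intro!: always_eventually split: split_indicator)

lemma integrable_w_times:
  assumes "v \<in> borel_measurable borel" "\<And>x. \<bar>v x\<bar> \<le> C"
  shows "integrable lborel (\<lambda>x. w x * v x)"
proof (rule Bochner_Integration.integrable_bound[OF integrable_mult_right[OF w_integrable, of C]])
  show "(\<lambda>x. w x * v x) \<in> borel_measurable lborel" using assms(1) by simp
  have "\<bar>w x\<bar> * \<bar>v x\<bar> \<le> \<bar>w x\<bar> * \<bar>C\<bar>" for x using order_trans[OF assms(2) abs_ge_self] by (intro mult_left_mono) auto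
  then show "AE x in lborel. norm (w x * v x) \<le> norm (C * w x)"
    by (intro always_eventually allI) (simp add: abs_mult mult.commute)
qed

lemma integrable_W_inner:
  assumes "v \<in> borel_measurable borel" "\<And>x. norm (v x) \<le> C"
  shows "integrable lborel (\<lambda>x. W x \<bullet> v x)"
proof (rule Bochner_Integration.integrable_bound[OF integrable_mult_right[OF norm_W_integrable, of C]])
  show "(\<lambda>x. W x \<bullet> v x) \<in> borel_measurable lborel" using assms(1) by simp
  have "\<bar>W x \<bullet> v x\<bar> \<le> norm (W x) * \<bar>C\<bar>" for x
    using order_trans[OF assms(2) abs_ge_self] by (intro order_trans[OF Cauchy_Schwarz_ineq2] mult_left_mono) auto
  then show "AE x in lborel. norm (W x \<bullet> v x) \<le> norm (C * norm (W x))"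
    by (intro always_eventually allI) (simp add: abs_mult mult.commute)
qed

lemma w_diff_i: "integrable lborel (\<lambda>x. (w x - \<phi> n x)\<^sup>2)"
proof (rule Bochner_Integration.integrable_bound)
  show "integrable lborel (\<lambda>x. 2 * (w x)\<^sup>2 + 2 * (\<phi> n x)\<^sup>2)"
    using w_i test_functions_square_integrable[OF \<phi>] by auto
  have "(a - b)\<^sup>2 \<le> 2 * a\<^sup>2 + 2 * b\<^sup>2" for a b :: real
    using zero_le_power2[of "a + b"] by (simp add: power2_eq_square algebra_simps)
  then show "AE x in lborel. norm ((w x - \<phi> n x)\<^sup>2) \<le> norm (2 * (w x)\<^sup>2 + 2 * (\<phi> n x)\<^sup>2)"
    by (intro always_eventually allI) auto
qed measurable

lemma norm_diff_sq_le: "(norm (a - b))\<^sup>2 \<le> 2 * (norm a)\<^sup>2 + 2 * (norm (b::'a))\<^sup>2"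
proof -
  have "0 \<le> (a + b) \<bullet> (a + b)" by simp
  then show ?thesis by (simp add: power2_norm_eq_inner inner_diff inner_add inner_commute algebra_simps)
qed

lemma W_diff_i: "integrable lborel (\<lambda>x. (norm (W x - grad (\<phi> n) x))\<^sup>2)"
proof (rule Bochner_Integration.integrable_bound)
  show "integrable lborel (\<lambda>x. 2 * (norm (W x))\<^sup>2 + 2 * (norm (grad (\<phi> n) x))\<^sup>2)"
    using W_i grad_square_integrable[OF \<phi>] by auto
  show "AE x in lborel. norm ((norm (W x - grad (\<phi> n) x))\<^sup>2) \<le> norm (2 * (norm (W x))\<^sup>2 + 2 * (norm (grad (\<phi> n) x))\<^sup>2)"
    using norm_diff_sq_le by (intro always_eventually allI) auto
qed measurable

section \<open>Limits along the approximating test functions\<close>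

lemma tendsto_integral_w:
  assumes v: "v \<in> borel_measurable borel" "\<And>x. \<bar>v x\<bar> \<le> C"
  shows "(\<lambda>n. LINT x|lborel. \<phi> n x * v x) \<longlonglongrightarrow> (LINT x|lborel. w x * v x)"
proof -
  have C: "C \<ge> 0" using v(2) abs_ge_zero order_trans by blast
  have l: "(\<lambda>n. C * (LINT x|lborel. \<bar>w x - \<phi> n x\<bar> * indicator \<Omega> x)) \<longlonglongrightarrow> C * 0"
    by (intro tendsto_intros L2_tendsto_imp_L1 w_diff_i lim_w \<Omega>_sets) measurable
  have "(\<lambda>n. (LINT x|lborel. w x * v x) - (LINT x|lborel. \<phi> n x * v x)) \<longlonglongrightarrow> 0"
  proof (rule Lim_null_comparison[OF _ l[simplified]], intro always_eventually allI)
    fix n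
    have pi: "integrable lborel (\<lambda>x. \<phi> n x * v x)"
    proof (rule Bochner_Integration.integrable_bound[OF integrable_mult_right[OF test_functions_integrable[OF \<phi>], of C]])
      have "\<bar>\<phi> n x\<bar> * \<bar>v x\<bar> \<le> \<bar>\<phi> n x\<bar> * \<bar>C\<bar>" for x using order_trans[OF v(2) abs_ge_self] by (intro mult_left_mono) auto
      then show "AE x in lborel. norm (\<phi> n x * v x) \<le> norm (C * \<phi> n x)"
        by (intro always_eventually allI) (simp add: abs_mult mult.commute)
    qed (use v in simp)
    have "(LINT x|lborel. w x * v x) - (LINT x|lborel. \<phi> n x * v x) = (LINT x|lborel. (w x - \<phi> n x) * v x)"
      using integrable_w_times[OF v] pi by (simp add: left_diff_distrib)
    also have "norm \<dots> \<le> (LINT x|lborel. norm ((w x - \<phi> n x) * v x))" by (rule integral_norm_bound)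
    also have "\<dots> \<le> (LINT x|lborel. C * (\<bar>w x - \<phi> n x\<bar> * indicator \<Omega> x))"
    proof (rule integral_mono')
      show "integrable lborel (\<lambda>x. C * (\<bar>w x - \<phi> n x\<bar> * indicator \<Omega> x))"
        using L2_imp_L1_bound(1)[OF _ w_diff_i \<Omega>_sets] by simp
      show "norm ((w x - \<phi> n x) * v x) \<le> C * (\<bar>w x - \<phi> n x\<bar> * indicator \<Omega> x)" for x
        using v(2)[of x] w_0[of x] test_functions_zero_outside[OF \<phi>, of x n]
        by (cases "x \<in> \<Omega>") (auto simp: abs_mult mult.commute[of C] intro!: mult_left_mono)
      show "0 \<le> C * (\<bar>w x - \<phi> n x\<bar> * indicator \<Omega> x)" for x using C by simp
    qed
    finally show "norm ((LINT x|lborel. w x * v x) - (LINT x|lborel. \<phi> n x * v x)) \<le> C * (LINT x|lborel. \<bar>w x - \<phi> n x\<bar> * indicator \<Omega> x)"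
      by simp
  qed
  from tendsto_diff[OF tendsto_const[of "LINT x|lborel. w x * v x"] this] show ?thesis by simp
qed

lemma tendsto_integral_W:
  assumes v: "v \<in> borel_measurable borel" "\<And>x. norm (v x) \<le> C"
  shows "(\<lambda>n. LINT x|lborel. grad (\<phi> n) x \<bullet> v x) \<longlonglongrightarrow> (LINT x|lborel. W x \<bullet> v x)"
proof -
  have C: "C \<ge> 0" using v(2) norm_ge_zero order_trans by blast
  have l: "(\<lambda>n. C * (LINT x|lborel. \<bar>norm (W x - grad (\<phi> n) x)\<bar> * indicator \<Omega> x)) \<longlonglongrightarrow> C * 0"
    by (intro tendsto_intros L2_tendsto_imp_L1 W_diff_i lim_W \<Omega>_sets) measurable
  have "(\<lambda>n. (LINT x|lborel. W x \<bullet> v x) - (LINT x|lborel. grad (\<phi> n) x \<bullet> v x)) \<longlonglongrightarrow> 0"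
  proof (rule Lim_null_comparison[OF _ l[simplified]], intro always_eventually allI)
    fix n
    have pi: "integrable lborel (\<lambda>x. grad (\<phi> n) x \<bullet> v x)"
    proof (rule Bochner_Integration.integrable_bound[OF integrable_mult_right[OF integrable_norm[OF grad_integrable[OF \<phi>]], of C]])
      have "\<bar>grad (\<phi> n) x \<bullet> v x\<bar> \<le> norm (grad (\<phi> n) x) * \<bar>C\<bar>" for x
        using order_trans[OF v(2) abs_ge_self] by (intro order_trans[OF Cauchy_Schwarz_ineq2] mult_left_mono) auto
      then show "AE x in lborel. norm (grad (\<phi> n) x \<bullet> v x) \<le> norm (C * norm (grad (\<phi> n) x))"
        by (intro always_eventually allI) (simp add: abs_mult mult.commute)
    qed (use v in simp)
    have "(LINT x|lborel. W x \<bullet> v x) - (LINT x|lborel. grad (\<phi> n) x \<bullet> v x) = (LINT x|lborel. (W x - grad (\<phi> n) x) \<bullet> v x)"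
      using integrable_W_inner[OF v] pi by (simp add: inner_diff_left)
    also have "norm \<dots> \<le> (LINT x|lborel. norm ((W x - grad (\<phi> n) x) \<bullet> v x))" by (rule integral_norm_bound)
    also have "\<dots> \<le> (LINT x|lborel. C * (\<bar>norm (W x - grad (\<phi> n) x)\<bar> * indicator \<Omega> x))"
    proof (rule integral_mono')
      show "integrable lborel (\<lambda>x. C * (\<bar>norm (W x - grad (\<phi> n) x)\<bar> * indicator \<Omega> x))"
        using L2_imp_L1_bound(1)[OF _ W_diff_i \<Omega>_sets] by simp
      show "norm ((W x - grad (\<phi> n) x) \<bullet> v x) \<le> C * (\<bar>norm (W x - grad (\<phi> n) x)\<bar> * indicator \<Omega> x)" for x
      proof (cases "x \<in> \<Omega>")
        case True
        have "norm ((W x - grad (\<phi> n) x) \<bullet> v x) \<le> norm (W x - grad (\<phi> n) x) * C"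
          unfolding real_norm_def by (rule order_trans[OF Cauchy_Schwarz_ineq2 mult_left_mono[OF v(2)]]) auto
        then show ?thesis using True by (simp add: mult.commute)
      qed (simp add: W_0 grad_\<phi>_0)
      show "0 \<le> C * (\<bar>norm (W x - grad (\<phi> n) x)\<bar> * indicator \<Omega> x)" for x using C by simp
    qed
    finally show "norm ((LINT x|lborel. W x \<bullet> v x) - (LINT x|lborel. grad (\<phi> n) x \<bullet> v x)) \<le> C * (LINT x|lborel. norm (W x - grad (\<phi> n) x) * indicator \<Omega> x)"
      by simp
  qed
  from tendsto_diff[OF tendsto_const[of "LINT x|lborel. W x \<bullet> v x"] this] show ?thesis by simp
qed

text \<open>Since \<open>A\<close> is arbitrary, \<psi> may cross the boundary of \<Omega>. No
  boundary term arises, because the approximating functions have compact support in \<Omega>; thus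
  \<open>W\<close> is the distributional gradient of \<open>w\<close> on the whole space.\<close>

lemma integral_W_grad:
  assumes \<psi>: "\<psi> \<in> test_functions A"
  shows "(LINT x|lborel. W x \<bullet> grad \<psi> x) = - (LINT x|lborel. w x * laplacian \<psi> x)"
proof -
  have s: "smooth \<psi>" using \<psi> by (rule test_functions_smooth)
  obtain C where C: "\<And>x. norm (grad \<psi> x) \<le> C" using grad_bounded[OF \<psi>] by metis
  obtain D where D: "\<And>x. \<bar>laplacian \<psi> x\<bar> \<le> D" using test_functions_bounded[OF test_functions_laplacian[OF \<psi>]] by metis
  have *: "(LINT x|lborel. grad (\<phi> n) x \<bullet> grad \<psi> x) = - (LINT x|lborel. \<phi> n x * laplacian \<psi> x)" for n
  proof -
    have i1: "integrable lborel (\<lambda>x. partial b (\<phi> n) x * partial b \<psi> x)"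
      and i2: "integrable lborel (\<lambda>x. \<phi> n x * partial b (partial b \<psi>) x)" if "b \<in> Basis" for b
      using \<phi> s that by (auto intro!: test_functions_integrable[of _ \<Omega>] test_functions_mult_smooth(1) test_functions_partial smooth_partial)
    have "(LINT x|lborel. grad (\<phi> n) x \<bullet> grad \<psi> x) = (LINT x|lborel. (\<Sum>b\<in>Basis. partial b (\<phi> n) x * partial b \<psi> x))"
      unfolding inner_grad by (intro Bochner_Integration.integral_cong sum.cong) (auto simp: grad_inner_Basis)
    also have "\<dots> = (\<Sum>b\<in>Basis. LINT x|lborel. partial b (\<phi> n) x * partial b \<psi> x)"
      by (rule Bochner_Integration.integral_sum) (rule i1)
    also have "\<dots> = (\<Sum>b\<in>Basis. - (LINT x|lborel. \<phi> n x * partial b (partial b \<psi>) x))"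
      by (intro sum.cong refl test_functions_integral_by_parts[OF \<phi>] smooth_partial s) auto
    also have "\<dots> = - (LINT x|lborel. (\<Sum>b\<in>Basis. \<phi> n x * partial b (partial b \<psi>) x))"
      by (subst Bochner_Integration.integral_sum) (auto simp: sum_negf intro: i2)
    finally show ?thesis by (simp add: laplacian_def sum_distrib_left)
  qed
  have "(\<lambda>n. LINT x|lborel. grad (\<phi> n) x \<bullet> grad \<psi> x) \<longlonglongrightarrow> (LINT x|lborel. W x \<bullet> grad \<psi> x)"
    by (rule tendsto_integral_W[OF _ C]) (use s in simp)
  moreover have "(\<lambda>n. - (LINT x|lborel. \<phi> n x * laplacian \<psi> x)) \<longlonglongrightarrow> - (LINT x|lborel. w x * laplacian \<psi> x)"
    by (intro tendsto_minus tendsto_integral_w[OF _ D] test_functions_measurable[OF test_functions_laplacian[OF \<psi>]])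
  ultimately show ?thesis unfolding * by (rule LIMSEQ_unique)
qed

text \<open>Moves all derivatives onto \<psi>; in this very weak form the gradient of the solution
  has disappeared.\<close>

lemma weak_solution_if:
  assumes \<psi>: "\<psi> \<in> test_functions A"
    and e: "(LINT x|lborel. W x \<bullet> grad \<psi> x) = \<mu> * (LINT x|lborel. w x * \<psi> x)"
  shows "(LINT x|lborel. w x * (laplacian \<psi> x + \<mu> * \<psi> x)) = 0"
proof -
  obtain C where C: "\<And>x. \<bar>\<psi> x\<bar> \<le> C" using test_functions_bounded[OF \<psi>] by metis
  obtain D where D: "\<And>x. \<bar>laplacian \<psi> x\<bar> \<le> D" using test_functions_bounded[OF test_functions_laplacian[OF \<psi>]] by metis
  have "integrable lborel (\<lambda>x. w x * \<psi> x)" "integrable lborel (\<lambda>x. w x * laplacian \<psi> x)"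
    by (rule integrable_w_times[OF _ C] integrable_w_times[OF _ D];
        intro test_functions_measurable[OF \<psi>] test_functions_measurable[OF test_functions_laplacian[OF \<psi>]])+
  then have "(LINT x|lborel. w x * laplacian \<psi> x + \<mu> * (w x * \<psi> x)) = (LINT x|lborel. w x * laplacian \<psi> x) + \<mu> * (LINT x|lborel. w x * \<psi> x)"
    by simp
  then show ?thesis using e integral_W_grad[OF \<psi>] by (simp add: distrib_left mult.left_commute)
qed

lemma weak_solution_interior:
  assumes "\<psi> \<in> test_functions \<Omega>"
  shows "(LINT x|lborel. w x * (laplacian \<psi> x + \<mu> * \<psi> x)) = 0"
  using weak_solution_if[OF assms eq[OF assms]] .

text \<open>Integration by parts against \<open>arctan (((x - z) \<bullet> b) / t)\<close>, whose derivative in direction \<open>b\<close>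
  is at least \<open>1 / (2 t)\<close> on the ball.\<close>

lemma strip_bound:
  obtains C where "C > 0" "\<And>z t. t > 0 \<Longrightarrow> (LINT x|lborel. (w x)\<^sup>2 * indicator (ball z t) x) \<le> C * t"
proof -
  obtain b :: 'a where b: "b \<in> Basis" using nonempty_Basis by blast
  define Cw where "Cw = (LINT x|lborel. (w x)\<^sup>2)"
  define CW where "CW = (LINT x|lborel. (norm (W x))\<^sup>2)"
  \<comment> \<open>The summand \<open>1\<close> makes the constant positive even if both norms
    vanish.\<close>
  define M where "M = pi * (2 * Cw + 2 * CW) * 2 + 1"
  have pos: "Cw \<ge> 0" "CW \<ge> 0" unfolding Cw_def CW_def by (auto intro!: integral_nonneg_AE)
  \<comment> \<open>The right side contains only norms that converge along \<phi>, hence the bound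
    carries over to \<open>w\<close>.\<close>
  have pt: "(LINT x|lborel. (\<psi> x)\<^sup>2 * indicator (ball z t) x) \<le> pi * t * ((LINT x|lborel. (\<psi> x)\<^sup>2) + (LINT x|lborel. (norm (grad \<psi> x))\<^sup>2))"
    if \<psi>: "\<psi> \<in> test_functions \<Omega>" and t: "t > 0" for \<psi> z t
  proof -
    have s: "smooth \<psi>" using \<psi> by (rule test_functions_smooth)
    obtain K where K: "smooth \<psi>" "compact K" "K \<subseteq> \<Omega>" "\<And>x. x \<notin> K \<Longrightarrow> \<psi> x = 0"
      using test_functionsE[OF \<psi>] by metis
    \<comment> \<open>The factor \<open>t\<close> normalises the derivative to at most
      \<open>1\<close>, while \<open>g\<close> itself stays below \<open>pi / 2 * t\<close>; the
      latter is the source of the factor \<open>t\<close> in the claim.\<close>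
    define g where "g x = t * arctan (((x - z) \<bullet> b) / t)" for x
    define g' where "g' x = 1 / (1 + (((x - z) \<bullet> b) / t)\<^sup>2)" for x
    have gd: "(g has_derivative (\<lambda>v. (v \<bullet> b) * g' x)) (at x)" for x
    proof -
      have "((\<lambda>s. t * arctan (s / t)) has_real_derivative g' x) (at ((x - z) \<bullet> b))"
        unfolding g'_def using t by (auto intro!: derivative_eq_intros simp: inverse_eq_divide)
      moreover have "((\<lambda>x. (x - z) \<bullet> b) has_derivative (\<lambda>v. v \<bullet> b)) (at x)"
        by (auto intro!: derivative_eq_intros)
      ultimately show ?thesis unfolding g_def
        by (rule DERIV_compose_FDERIV[where f = "\<lambda>s. t * arctan (s / t)" and g = "\<lambda>x. (x - z) \<bullet> b"])
    qed
    have dg: "g differentiable (at x)" "partial b g x = g' x" for x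
      using gd[of x] partialI[OF gd, of b x] b by (auto simp: differentiable_def)
    have cg': "continuous_on UNIV g'" unfolding g'_def
    proof (intro continuous_intros ballI)
      show "1 + ((x - z) \<bullet> b / t)\<^sup>2 \<noteq> 0" for x using zero_le_power2[of "(x - z) \<bullet> b / t"] by linarith
      show "t \<noteq> 0" using t by simp
    qed
    have cg: "continuous_on UNIV g"
      using dg(1) differentiable_imp_continuous_within by (auto simp: continuous_on_eq_continuous_within)
    have gb: "\<bar>g x\<bar> \<le> pi / 2 * t" for x
      unfolding g_def using arctan_bounded[of "((x - z) \<bullet> b) / t"] t by (auto simp: abs_mult abs_le_iff)
    have g'b: "0 \<le> g' x" "g' x \<le> 1" for x unfolding g'_def by (auto simp: divide_le_eq_1 add_pos_nonneg)
    let ?f = "\<lambda>x. (\<psi> x * \<psi> x) * g x"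
    have sq: "smooth (\<lambda>x. \<psi> x * \<psi> x)" by (intro smooth_mult s)
    have p: "partial b ?f = (\<lambda>x. (\<psi> x)\<^sup>2 * g' x + 2 * (\<psi> x * partial b \<psi> x * g x))"
      using smooth_differentiable[OF s] dg smooth_differentiable[OF sq]
      by (intro ext) (simp add: partial_mult power2_eq_square algebra_simps)
    have cp: "continuous_on UNIV (partial b ?f)" unfolding p
      by (intro continuous_intros smooth_continuous s smooth_partial b cg cg')
    have zero: "(LINT x|lborel. partial b ?f x) = 0"
      by (rule integral_partial_eq_0[OF _ cp K(2)])
         (use dg(1) smooth_differentiable[OF sq] K(4) in \<open>auto intro: differentiable_mult\<close>)
    have m: "\<psi> \<in> borel_measurable borel" "partial b \<psi> \<in> borel_measurable borel" "g \<in> borel_measurable borel" "g' \<in> borel_measurable borel"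
      by (intro borel_measurable_continuous_onI smooth_continuous s smooth_partial b cg cg')+
    note m[measurable]
    have i1: "integrable lborel (\<lambda>x. (\<psi> x)\<^sup>2)" by (rule test_functions_square_integrable[OF \<psi>])
    have i2: "integrable lborel (\<lambda>x. (partial b \<psi> x)\<^sup>2)" by (rule test_functions_square_integrable[OF test_functions_partial[OF \<psi> b]])
    have i3: "integrable lborel (\<lambda>x. (norm (grad \<psi> x))\<^sup>2)" by (rule grad_square_integrable[OF \<psi>])
    have i4: "integrable lborel (\<lambda>x. (\<psi> x)\<^sup>2 * g' x)"
      by (rule Bochner_Integration.integrable_bound[OF i1]) (use g'b in \<open>auto intro!: always_eventually mult_left_le\<close>)
    have bd: "\<bar>2 * (\<psi> x * partial b \<psi> x * g x)\<bar> \<le> pi / 2 * t * ((\<psi> x)\<^sup>2 + (partial b \<psi> x)\<^sup>2)" for x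
    proof -
      have "2 * \<bar>\<psi> x\<bar> * \<bar>partial b \<psi> x\<bar> \<le> (\<psi> x)\<^sup>2 + (partial b \<psi> x)\<^sup>2"
        using sum_squares_bound[of "\<bar>\<psi> x\<bar>" "\<bar>partial b \<psi> x\<bar>"] by simp
      then have "(2 * \<bar>\<psi> x\<bar> * \<bar>partial b \<psi> x\<bar>) * \<bar>g x\<bar> \<le> ((\<psi> x)\<^sup>2 + (partial b \<psi> x)\<^sup>2) * (pi / 2 * t)"
        using gb[of x] by (intro mult_mono) auto
      then show ?thesis by (simp add: abs_mult mult_ac)
    qed
    have i5: "integrable lborel (\<lambda>x. pi / 2 * t * ((\<psi> x)\<^sup>2 + (partial b \<psi> x)\<^sup>2))" using i1 i2 by auto
    have i6: "integrable lborel (\<lambda>x. 2 * (\<psi> x * partial b \<psi> x * g x))"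
    proof (rule Bochner_Integration.integrable_bound[OF i5])
      show "AE x in lborel. norm (2 * (\<psi> x * partial b \<psi> x * g x)) \<le> norm (pi / 2 * t * ((\<psi> x)\<^sup>2 + (partial b \<psi> x)\<^sup>2))"
        using bd by (intro always_eventually allI) (metis abs_ge_self order_trans real_norm_def)
    qed measurable
    have "(LINT x|lborel. (\<psi> x)\<^sup>2 * g' x) = - (LINT x|lborel. 2 * (\<psi> x * partial b \<psi> x * g x))"
      using zero i4 i6 unfolding p by simp
    also have "\<dots> \<le> (LINT x|lborel. \<bar>2 * (\<psi> x * partial b \<psi> x * g x)\<bar>)"
      using integral_abs_bound[of lborel "\<lambda>x. 2 * (\<psi> x * partial b \<psi> x * g x)"] by linarith
    also have "\<dots> \<le> (LINT x|lborel. pi / 2 * t * ((\<psi> x)\<^sup>2 + (norm (grad \<psi> x))\<^sup>2))"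
    proof (rule integral_mono)
      show "integrable lborel (\<lambda>x. \<bar>2 * (\<psi> x * partial b \<psi> x * g x)\<bar>)" using i6 by (rule integrable_abs)
      show "integrable lborel (\<lambda>x. pi / 2 * t * ((\<psi> x)\<^sup>2 + (norm (grad \<psi> x))\<^sup>2))" using i1 i3 by auto
      fix x
      have "(partial b \<psi> x)\<^sup>2 \<le> (norm (grad \<psi> x))\<^sup>2"
        unfolding norm_grad_sq using b by (intro member_le_sum) auto
      then have "pi / 2 * t * ((\<psi> x)\<^sup>2 + (partial b \<psi> x)\<^sup>2) \<le> pi / 2 * t * ((\<psi> x)\<^sup>2 + (norm (grad \<psi> x))\<^sup>2)"
        using t by (intro mult_left_mono) auto
      then show "\<bar>2 * (\<psi> x * partial b \<psi> x * g x)\<bar> \<le> pi / 2 * t * ((\<psi> x)\<^sup>2 + (norm (grad \<psi> x))\<^sup>2)"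
        using bd[of x] by linarith
    qed
    also have "\<dots> = pi / 2 * t * ((LINT x|lborel. (\<psi> x)\<^sup>2) + (LINT x|lborel. (norm (grad \<psi> x))\<^sup>2))"
      using i1 i3 by simp
    finally have A: "(LINT x|lborel. (\<psi> x)\<^sup>2 * g' x) \<le> pi / 2 * t * ((LINT x|lborel. (\<psi> x)\<^sup>2) + (LINT x|lborel. (norm (grad \<psi> x))\<^sup>2))" .
    have "(LINT x|lborel. (\<psi> x)\<^sup>2 * indicator (ball z t) x) \<le> (LINT x|lborel. 2 * ((\<psi> x)\<^sup>2 * g' x))"
    proof (rule integral_mono')
      show "integrable lborel (\<lambda>x. 2 * ((\<psi> x)\<^sup>2 * g' x))" using i4 by auto
      show "0 \<le> 2 * ((\<psi> x)\<^sup>2 * g' x)" for x using g'b[of x] by simp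
      fix x
      show "(\<psi> x)\<^sup>2 * indicator (ball z t) x \<le> 2 * ((\<psi> x)\<^sup>2 * g' x)"
      proof (cases "x \<in> ball z t")
        case True
        have "\<bar>(x - z) \<bullet> b\<bar> \<le> norm (x - z)" using Basis_le_norm[OF b] .
        then have "\<bar>((x - z) \<bullet> b) / t\<bar> \<le> 1" using True t by (simp add: dist_norm norm_minus_commute)
        then have "(((x - z) \<bullet> b) / t)\<^sup>2 \<le> 1" by (simp add: abs_square_le_1)
        moreover have "1 \<le> 2 * (1 / (1 + q))" if "0 \<le> q" "q \<le> 1" for q :: real
          using that by (simp add: pos_le_divide_eq)
        ultimately have "1 \<le> 2 * g' x" unfolding g'_def by (metis zero_le_power2)
        then have "(\<psi> x)\<^sup>2 * 1 \<le> (\<psi> x)\<^sup>2 * (2 * g' x)" by (intro mult_left_mono) auto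
        then show ?thesis using True by (simp add: mult_ac)
      qed (use g'b[of x] in simp)
    qed
    then show ?thesis using A by simp
  qed
  have "(LINT x|lborel. (w x)\<^sup>2 * indicator (ball z t) x) \<le> 2 * M * t" if t: "t > 0" for z t
  proof -
    define a where "a n = (LINT x|lborel. (w x - \<phi> n x)\<^sup>2)" for n
    define c where "c n = (LINT x|lborel. (norm (W x - grad (\<phi> n) x))\<^sup>2)" for n
    \<comment> \<open>Passing between \<open>w\<close> and \<open>\<phi> n\<close> costs factors
      \<open>2\<close> and the error terms \<open>a n\<close> and \<open>c n\<close>, which
      disappear in the limit.\<close>
    have le: "(LINT x|lborel. (w x)\<^sup>2 * indicator (ball z t) x) \<le> 2 * (pi * t * ((2 * Cw + 2 * a n) + (2 * CW + 2 * c n))) + 2 * a n" for n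
    proof -
      have i: "integrable lborel (\<lambda>x. (\<phi> n x)\<^sup>2)" "integrable lborel (\<lambda>x. (norm (grad (\<phi> n) x))\<^sup>2)"
        by (rule test_functions_square_integrable[OF \<phi>] grad_square_integrable[OF \<phi>])+
      have ib: "integrable lborel (\<lambda>x. (\<phi> n x)\<^sup>2 * indicator (ball z t) x)"
      proof (rule Bochner_Integration.integrable_bound[OF i(1)])
        show "AE x in lborel. norm ((\<phi> n x)\<^sup>2 * indicator (ball z t) x) \<le> norm ((\<phi> n x)\<^sup>2)"
          by (auto intro!: always_eventually split: split_indicator)
        show "(\<lambda>x. (\<phi> n x)\<^sup>2 * indicator (ball z t) x) \<in> borel_measurable lborel"
          by (intro borel_measurable_times borel_measurable_power borel_measurable_indicator) (use \<phi>_m in auto)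
      qed
      have q: "p\<^sup>2 \<le> 2 * q\<^sup>2 + 2 * (p - q)\<^sup>2" for p q :: real
        using zero_le_power2[of "p - 2 * q"] by (simp add: power2_eq_square algebra_simps)
      have "(LINT x|lborel. (\<phi> n x)\<^sup>2) \<le> (LINT x|lborel. 2 * (w x)\<^sup>2 + 2 * (w x - \<phi> n x)\<^sup>2)"
        using q[of "\<phi> n _" "w _"] w_i w_diff_i i by (intro integral_mono) (auto simp: power2_commute)
      then have b1: "(LINT x|lborel. (\<phi> n x)\<^sup>2) \<le> 2 * Cw + 2 * a n"
        using w_i w_diff_i by (simp add: Cw_def a_def)
      have "(LINT x|lborel. (norm (grad (\<phi> n) x))\<^sup>2) \<le> (LINT x|lborel. 2 * (norm (W x))\<^sup>2 + 2 * (norm (W x - grad (\<phi> n) x))\<^sup>2)"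
      proof (intro integral_mono)
        show "(norm (grad (\<phi> n) x))\<^sup>2 \<le> 2 * (norm (W x))\<^sup>2 + 2 * (norm (W x - grad (\<phi> n) x))\<^sup>2" for x
          using norm_diff_sq_le[of "W x" "W x - grad (\<phi> n) x"] by simp
      qed (use W_i W_diff_i i in auto)
      then have b2: "(LINT x|lborel. (norm (grad (\<phi> n) x))\<^sup>2) \<le> 2 * CW + 2 * c n"
        using W_i W_diff_i by (simp add: CW_def c_def)
      have "(LINT x|lborel. (w x)\<^sup>2 * indicator (ball z t) x) \<le> (LINT x|lborel. 2 * ((\<phi> n x)\<^sup>2 * indicator (ball z t) x) + 2 * (w x - \<phi> n x)\<^sup>2)"
      proof (rule integral_mono')
        show "integrable lborel (\<lambda>x. 2 * ((\<phi> n x)\<^sup>2 * indicator (ball z t) x) + 2 * (w x - \<phi> n x)\<^sup>2)"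
          using ib w_diff_i by auto
        show "(w x)\<^sup>2 * indicator (ball z t) x \<le> 2 * ((\<phi> n x)\<^sup>2 * indicator (ball z t) x) + 2 * (w x - \<phi> n x)\<^sup>2" for x
          using q[of "w x" "\<phi> n x"] by (auto split: split_indicator)
      qed auto
      also have "\<dots> = 2 * (LINT x|lborel. (\<phi> n x)\<^sup>2 * indicator (ball z t) x) + 2 * a n"
        using ib w_diff_i by (simp add: a_def)
      also have "\<dots> \<le> 2 * (pi * t * ((LINT x|lborel. (\<phi> n x)\<^sup>2) + (LINT x|lborel. (norm (grad (\<phi> n) x))\<^sup>2))) + 2 * a n"
        using pt[OF \<phi> t] by simp
      also have "\<dots> \<le> 2 * (pi * t * ((2 * Cw + 2 * a n) + (2 * CW + 2 * c n))) + 2 * a n"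
        using b1 b2 t by (intro add_right_mono mult_left_mono add_mono) auto
      finally show ?thesis .
    qed
    have "(\<lambda>n. 2 * (pi * t * ((2 * Cw + 2 * a n) + (2 * CW + 2 * c n))) + 2 * a n) \<longlonglongrightarrow> 2 * (pi * t * ((2 * Cw + 2 * 0) + (2 * CW + 2 * 0))) + 2 * 0"
      unfolding a_def c_def by (intro tendsto_intros lim_w lim_W)
    then have "(LINT x|lborel. (w x)\<^sup>2 * indicator (ball z t) x) \<le> 2 * (pi * t * (2 * Cw + 2 * CW))"
      using le by (intro LIMSEQ_le_const) auto
    also have "\<dots> \<le> 2 * M * t"
    proof -
      have "pi * (2 * Cw + 2 * CW) \<le> M" unfolding M_def using pos pi_gt_zero by simp
      then have "pi * (2 * Cw + 2 * CW) * t \<le> M * t" using t by (intro mult_right_mono) auto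
      moreover have "2 * (pi * t * X) = 2 * (pi * X * t)" for X by simp
      ultimately show ?thesis by (simp only: mult.assoc mult_le_cancel_left_pos zero_less_numeral)
    qed
    finally show ?thesis .
  qed
  moreover have "2 * M > 0" unfolding M_def using pos by (simp add: add_nonneg_pos)
  ultimately show thesis using that by blast
qed

text \<open>A test function that crosses a flat piece of the boundary is admissible if it vanishes
  there at least linearly. The gradient of a truncation at distance \<open>1 / n\<close> from the
  hyperplane has a factor \<open>n\<close>, but it is multiplied by \<psi>; the product is bounded
  and tends to \<open>0\<close> pointwise, and \<open>norm (W x)\<close> is integrable, so dominated
  convergence applies.\<close>

lemma eq_one_sided:
  fixes \<psi> :: "'a \<Rightarrow> real"
  assumes B: "\<Omega> \<inter> B = {x \<in> B. (x - p) \<bullet> \<nu> > 0}" and \<psi>: "\<psi> \<in> test_functions B"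
    and L: "\<And>x. \<bar>\<psi> x\<bar> \<le> L * \<bar>(x - p) \<bullet> \<nu>\<bar>"
  shows "(LINT x|lborel. W x \<bullet> grad \<psi> x) = \<mu> * (LINT x|lborel. w x * \<psi> x)"
proof -
  obtain K where K: "smooth \<psi>" "compact K" "K \<subseteq> B" "\<And>x. x \<notin> K \<Longrightarrow> \<psi> x = 0"
    using test_functionsE[OF \<psi>] by metis
  have g0: "grad \<psi> x = 0" if "x \<notin> K" for x
    using that K by (intro grad_eq_0_outside[of K]) (auto intro: compact_imp_closed)
  define d where "d x = (x - p) \<bullet> \<nu>" for x
  \<comment> \<open>The shift by \<open>1\<close> makes the truncation vanish where
    \<open>n * d x \<le> 1\<close>, which keeps the support of the product inside \<Omega>.\<close>
  define \<eta> where "\<eta> n x = bump_family 0 (real n * d x - 1)" for n x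
  have sd: "smooth (\<lambda>x. real n * d x - 1)" for n
    unfolding d_def inner_diff_left by (intro smooth_diff smooth_mult smooth_const smooth_inner)
  have s\<eta>: "smooth (\<eta> n)" for n
    unfolding \<eta>_def by (rule smooth_compose[OF bump_family(1) sd])
  have \<eta>0: "\<eta> n x = 0" if "real n * d x \<le> 1" for n x
    unfolding \<eta>_def using that by (intro bump_family(3)) simp
  have t: "(\<lambda>x. \<psi> x * \<eta> n x) \<in> test_functions \<Omega>" for n
  proof (rule test_functionsI)
    show "smooth (\<lambda>x. \<psi> x * \<eta> n x)" by (intro smooth_mult K s\<eta>)
    have "continuous_on UNIV (\<lambda>x. real n * d x)" unfolding d_def by (intro continuous_intros)
    then have "closed {x. 1 \<le> real n * d x}" by (intro closed_Collect_le continuous_on_const)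
    then show "compact (K \<inter> {x. 1 \<le> real n * d x})" using K(2) by (rule compact_Int_closed[rotated])
    show "K \<inter> {x. 1 \<le> real n * d x} \<subseteq> \<Omega>"
    proof
      fix x assume x: "x \<in> K \<inter> {x. 1 \<le> real n * d x}"
      then have "0 < real n * d x" by auto
      then have "d x > 0" by (auto simp: zero_less_mult_iff)
      then have "x \<in> {x \<in> B. (x - p) \<bullet> \<nu> > 0}" using x K(3) by (auto simp: d_def)
      then show "x \<in> \<Omega>" using B by blast
    qed
    show "\<psi> x * \<eta> n x = 0" if "x \<notin> K \<inter> {x. 1 \<le> real n * d x}" for x using that K(4) \<eta>0[of n x] by force
  qed
  have \<eta>1: "\<bar>\<eta> n x\<bar> \<le> 1" for n x using bump_family_0_bounds[of "real n * d x - 1"] by (simp add: \<eta>_def)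
  have gr: "grad (\<lambda>x. \<psi> x * \<eta> n x) x = \<eta> n x *\<^sub>R grad \<psi> x + (\<psi> x * real n * bump_family (Suc 0) (real n * d x - 1)) *\<^sub>R \<nu>" for n x
  proof -
    have pd: "partial b (\<eta> n) x = bump_family (Suc 0) (real n * d x - 1) * (real n * (b \<bullet> \<nu>))" for b
    proof -
      have "partial b (\<lambda>x. real n * d x - 1) x = real n * (b \<bullet> \<nu>)"
        unfolding d_def by (rule partialI) (auto intro!: derivative_eq_intros)
      moreover have "(bump_family 0 has_real_derivative bump_family (Suc 0) (real n * d x - 1)) (at (real n * d x - 1))"
        using bump_family(1) by (simp add: smooth_family_def)
      ultimately show ?thesis unfolding \<eta>_def
        by (subst partial_compose[OF smooth_differentiable[OF sd]]) auto
    qed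
    have pp: "partial b (\<lambda>x. \<psi> x * \<eta> n x) x = \<psi> x * partial b (\<eta> n) x + partial b \<psi> x * \<eta> n x" for b
      by (intro partial_mult smooth_differentiable K s\<eta>)
    show ?thesis
    proof (rule euclidean_eqI)
      fix b :: 'a assume b: "b \<in> Basis"
      show "grad (\<lambda>x. \<psi> x * \<eta> n x) x \<bullet> b = (\<eta> n x *\<^sub>R grad \<psi> x + (\<psi> x * real n * bump_family (Suc 0) (real n * d x - 1)) *\<^sub>R \<nu>) \<bullet> b"
        unfolding grad_inner_Basis[OF b] pp pd inner_add_left inner_scaleR_left
        by (simp add: inner_commute[of \<nu> b])
    qed
  qed
  \<comment> \<open>Here the factor \<open>n\<close> is absorbed by the linear vanishing of
    \<psi>.\<close>
  have small: "\<bar>\<psi> x * real n * bump_family (Suc 0) (real n * d x - 1)\<bar> \<le> \<bar>L\<bar> * ((real n * d x) * bump_family (Suc 0) (real n * d x - 1))"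
    if "d x > 0" for n x
  proof -
    have "\<bar>\<psi> x\<bar> \<le> \<bar>L\<bar> * d x" using L[of x] that by (simp add: d_def) (metis abs_ge_self abs_of_pos mult_right_mono order_trans less_imp_le)
    then have "\<bar>\<psi> x\<bar> * (real n * bump_family (Suc 0) (real n * d x - 1)) \<le> (\<bar>L\<bar> * d x) * (real n * bump_family (Suc 0) (real n * d x - 1))"
      by (intro mult_right_mono mult_nonneg_nonneg bump_family_1_nonneg) auto
    then show ?thesis by (simp add: abs_mult bump_family_1_nonneg mult_ac)
  qed
  have dpos: "d x > 0" if "x \<in> \<Omega>" "x \<in> K" for x using that B K(3) unfolding d_def by blast
  obtain C where C: "C \<ge> 0" "\<And>x. norm (grad \<psi> x) \<le> C" using grad_bounded[OF \<psi>] by metis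
  obtain D where D: "D \<ge> 0" "\<And>x. \<bar>\<psi> x\<bar> \<le> D" using test_functions_bounded[OF \<psi>] by metis
  have lim\<eta>: "(\<lambda>n. \<eta> n x) \<longlonglongrightarrow> 1" if "d x > 0" for x
  proof -
    note F = filterlim_real_mult_minus_1[OF that]
    have "((\<lambda>n. exp (- inverse (real n * d x - 1))) \<longlongrightarrow> exp (- 0)) sequentially"
      by (intro tendsto_exp tendsto_minus tendsto_inverse_0_at_top F)
    moreover have "\<forall>\<^sub>F n in sequentially. exp (- inverse (real n * d x - 1)) = \<eta> n x"
      using filterlim_at_top_dense[THEN iffD1, OF F, rule_format, of 0]
      by eventually_elim (auto simp: \<eta>_def bump_family inverse_eq_divide)
    ultimately show ?thesis by (simp add: Lim_transform_eventually)
  qed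
  have lim1: "(\<lambda>n. (real n * d x) * bump_family (Suc 0) (real n * d x - 1)) \<longlonglongrightarrow> 0" if "d x > 0" for x
  proof -
    note F = filterlim_real_mult_minus_1[OF that]
    have i: "(\<lambda>n. inverse (real n * d x - 1)) \<longlonglongrightarrow> 0" by (rule tendsto_inverse_0_at_top[OF F])
    have "(\<lambda>n. inverse (real n * d x - 1) + (inverse (real n * d x - 1))\<^sup>2) \<longlonglongrightarrow> 0 + 0\<^sup>2"
      by (intro tendsto_intros i)
    then have u: "(\<lambda>n. inverse (real n * d x - 1) + (inverse (real n * d x - 1))\<^sup>2) \<longlonglongrightarrow> 0" by simp
    show ?thesis
    proof (rule tendsto_sandwich[OF _ _ tendsto_const u])
      show "\<forall>\<^sub>F n in sequentially. 0 \<le> (real n * d x) * bump_family (Suc 0) (real n * d x - 1)"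
        using that by (intro always_eventually allI mult_nonneg_nonneg bump_family_1_nonneg) auto
      show "\<forall>\<^sub>F n in sequentially. (real n * d x) * bump_family (Suc 0) (real n * d x - 1) \<le> inverse (real n * d x - 1) + (inverse (real n * d x - 1))\<^sup>2"
        using filterlim_at_top_dense[THEN iffD1, OF F, rule_format, of 0]
      proof eventually_elim
        case (elim n)
        then show ?case using bump_family_1_bounds(2)[of "real n * d x"]
          by (simp add: inverse_eq_divide power_divide)
      qed
    qed
  qed
  have m[measurable]: "\<psi> \<in> borel_measurable borel" "grad \<psi> \<in> borel_measurable borel" "\<eta> n \<in> borel_measurable borel"
    "(\<lambda>x. bump_family (Suc 0) (real n * d x - 1)) \<in> borel_measurable borel" for n
    using \<psi> K(1) by (auto intro!: borel_measurable_continuous_onI smooth_continuous s\<eta> smooth_compose[OF bump_family(1) sd])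
  have l1: "(\<lambda>n. LINT x|lborel. W x \<bullet> grad (\<lambda>x. \<psi> x * \<eta> n x) x) \<longlonglongrightarrow> (LINT x|lborel. W x \<bullet> grad \<psi> x)"
  proof (rule integral_dominated_convergence[where w="\<lambda>x. norm (W x) * (C + \<bar>L\<bar> * 2 * norm \<nu>)"])
    show "integrable lborel (\<lambda>x. norm (W x) * (C + \<bar>L\<bar> * 2 * norm \<nu>))"
      using norm_W_integrable by simp
    show "(\<lambda>x. W x \<bullet> grad (\<lambda>x. \<psi> x * \<eta> n x) x) \<in> borel_measurable lborel" for n unfolding gr by measurable
    show "(\<lambda>x. W x \<bullet> grad \<psi> x) \<in> borel_measurable lborel" by measurable
    show "AE x in lborel. (\<lambda>n. W x \<bullet> grad (\<lambda>x. \<psi> x * \<eta> n x) x) \<longlonglongrightarrow> W x \<bullet> grad \<psi> x"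
    proof (intro always_eventually allI)
      fix x
      show "(\<lambda>n. W x \<bullet> grad (\<lambda>x. \<psi> x * \<eta> n x) x) \<longlonglongrightarrow> W x \<bullet> grad \<psi> x"
      proof (cases "x \<in> \<Omega> \<and> x \<in> K")
        case False
        then show ?thesis by (auto simp: W_0 gr g0 K(4))
      next
        case True
        then have dx: "d x > 0" using dpos by auto
        have "(\<lambda>n. \<psi> x * real n * bump_family (Suc 0) (real n * d x - 1)) \<longlonglongrightarrow> 0"
          by (rule Lim_null_comparison[OF _ tendsto_mult_right_zero[OF lim1[OF dx], of "\<bar>L\<bar>"]])
             (use small[OF dx] in \<open>auto intro!: always_eventually\<close>)
        then have "(\<lambda>n. W x \<bullet> grad (\<lambda>x. \<psi> x * \<eta> n x) x) \<longlonglongrightarrow> W x \<bullet> (1 *\<^sub>R grad \<psi> x + 0 *\<^sub>R \<nu>)"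
          unfolding gr by (intro tendsto_intros lim\<eta> dx)
        then show ?thesis by simp
      qed
    qed
    fix n
    show "AE x in lborel. norm (W x \<bullet> grad (\<lambda>x. \<psi> x * \<eta> n x) x) \<le> norm (W x) * (C + \<bar>L\<bar> * 2 * norm \<nu>)"
    proof (intro always_eventually allI)
      fix x
      have gb: "norm (grad (\<lambda>x. \<psi> x * \<eta> n x) x) \<le> C + \<bar>L\<bar> * 2 * norm \<nu>" if "x \<in> \<Omega>" "x \<in> K"
      proof -
        have dx: "d x > 0" using dpos that by auto
        have "\<bar>\<psi> x * real n * bump_family (Suc 0) (real n * d x - 1)\<bar> \<le> \<bar>L\<bar> * 2"
          by (rule order_trans[OF small[OF dx] mult_left_mono[OF bump_family_1_bounds(1)]]) (use dx in auto)
        then have "norm ((\<psi> x * real n * bump_family (Suc 0) (real n * d x - 1)) *\<^sub>R \<nu>) \<le> \<bar>L\<bar> * 2 * norm \<nu>"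
          unfolding norm_scaleR by (intro mult_right_mono) auto
        moreover have "norm (\<eta> n x *\<^sub>R grad \<psi> x) \<le> 1 * C"
          unfolding norm_scaleR by (intro mult_mono \<eta>1 C) auto
        ultimately show ?thesis unfolding gr by (intro order_trans[OF norm_triangle_ineq]) simp
      qed
      show "norm (W x \<bullet> grad (\<lambda>x. \<psi> x * \<eta> n x) x) \<le> norm (W x) * (C + \<bar>L\<bar> * 2 * norm \<nu>)"
      proof (cases "x \<in> \<Omega> \<and> x \<in> K")
        case False
        then have "W x \<bullet> grad (\<lambda>x. \<psi> x * \<eta> n x) x = 0" by (auto simp: W_0 gr g0 K(4))
        then show ?thesis using C(1) by simp
      next
        case True
        then show ?thesis using gb
          unfolding real_norm_def by (intro order_trans[OF Cauchy_Schwarz_ineq2] mult_left_mono) auto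
      qed
    qed
  qed
  have l2: "(\<lambda>n. LINT x|lborel. W x \<bullet> grad (\<lambda>x. \<psi> x * \<eta> n x) x) = (\<lambda>n. \<mu> * (LINT x|lborel. w x * (\<psi> x * \<eta> n x)))"
    by (intro ext eq t)
  have l3: "(\<lambda>n. \<mu> * (LINT x|lborel. w x * (\<psi> x * \<eta> n x))) \<longlonglongrightarrow> \<mu> * (LINT x|lborel. w x * \<psi> x)"
  proof (intro tendsto_mult tendsto_const integral_dominated_convergence[where w="\<lambda>x. D * \<bar>w x\<bar>"])
    show "integrable lborel (\<lambda>x. D * \<bar>w x\<bar>)" using w_integrable by auto
    show "AE x in lborel. (\<lambda>n. w x * (\<psi> x * \<eta> n x)) \<longlonglongrightarrow> w x * \<psi> x"
    proof (intro always_eventually allI)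
      fix x
      show "(\<lambda>n. w x * (\<psi> x * \<eta> n x)) \<longlonglongrightarrow> w x * \<psi> x"
      proof (cases "x \<in> \<Omega> \<and> x \<in> K")
        case False
        then show ?thesis by (auto simp: w_0 K(4))
      next
        case True
        then have dx: "d x > 0" using dpos by auto
        have "(\<lambda>n. w x * (\<psi> x * \<eta> n x)) \<longlonglongrightarrow> w x * (\<psi> x * 1)" by (intro tendsto_intros lim\<eta> dx)
        then show ?thesis by simp
      qed
    qed
    show "AE x in lborel. norm (w x * (\<psi> x * \<eta> n x)) \<le> D * \<bar>w x\<bar>" for n
    proof (intro always_eventually allI)
      fix x
      have "\<bar>\<psi> x\<bar> * \<bar>\<eta> n x\<bar> \<le> D * 1" by (intro mult_mono D \<eta>1) auto
      then have "\<bar>w x\<bar> * (\<bar>\<psi> x\<bar> * \<bar>\<eta> n x\<bar>) \<le> \<bar>w x\<bar> * D" by (intro mult_left_mono) auto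
      then show "norm (w x * (\<psi> x * \<eta> n x)) \<le> D * \<bar>w x\<bar>" by (simp add: abs_mult mult.commute)
    qed
  qed measurable
  from l1[unfolded l2] l3 show ?thesis by (rule LIMSEQ_unique)
qed

end

subsection \<open>Reflection across a line\<close>

definition reflect :: "'a::euclidean_space \<Rightarrow> 'a \<Rightarrow> 'a \<Rightarrow> 'a" where
  "reflect p \<nu> x = x - (2 * ((x - p) \<bullet> \<nu>)) *\<^sub>R \<nu>"

context
  fixes p \<nu> :: "'a::euclidean_space"
  assumes \<nu>: "norm \<nu> = 1"
begin

lemma \<nu>\<nu>: "\<nu> \<bullet> \<nu> = 1" using \<nu> by (simp add: dot_square_norm)

lemma reflect_inner: "(reflect p \<nu> x - p) \<bullet> \<nu> = - ((x - p) \<bullet> \<nu>)"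
proof -
  have "reflect p \<nu> x - p = (x - p) - (2 * ((x - p) \<bullet> \<nu>)) *\<^sub>R \<nu>" by (simp add: reflect_def)
  then show ?thesis by (simp only: inner_diff_left[of "x - p"] inner_scaleR_left \<nu>\<nu>)
qed

lemma reflect_reflect: "reflect p \<nu> (reflect p \<nu> x) = x"
  unfolding reflect_def[of p \<nu> "reflect p \<nu> x"] reflect_inner by (simp add: reflect_def)

lemma orthogonal_transformation_reflect: "orthogonal_transformation (\<lambda>v. v - (2 * (v \<bullet> \<nu>)) *\<^sub>R \<nu>)"
  unfolding orthogonal_transformation_def
proof
  show "linear (\<lambda>v. v - (2 * (v \<bullet> \<nu>)) *\<^sub>R \<nu>)"
    by (rule linearI) (simp_all add: inner_add_left algebra_simps)
  show "\<forall>v w. (v - (2 * (v \<bullet> \<nu>)) *\<^sub>R \<nu>) \<bullet> (w - (2 * (w \<bullet> \<nu>)) *\<^sub>R \<nu>) = v \<bullet> w"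
  proof (intro allI)
    fix v w
    show "(v - (2 * (v \<bullet> \<nu>)) *\<^sub>R \<nu>) \<bullet> (w - (2 * (w \<bullet> \<nu>)) *\<^sub>R \<nu>) = v \<bullet> w"
      by (simp add: inner_diff_left inner_diff_right \<nu>\<nu> inner_commute[of \<nu> w])
  qed
qed

lemma reflect_affine: "reflect p \<nu> x = (2 * (p \<bullet> \<nu>)) *\<^sub>R \<nu> + (x - (2 * (x \<bullet> \<nu>)) *\<^sub>R \<nu>)"
  by (simp add: reflect_def inner_diff_left algebra_simps)

lemma dist_reflect: "dist (reflect p \<nu> x) (reflect p \<nu> y) = dist x y"
proof -
  have "reflect p \<nu> x - reflect p \<nu> y = (x - y) - (2 * ((x - y) \<bullet> \<nu>)) *\<^sub>R \<nu>"
    by (simp add: reflect_def inner_diff_left algebra_simps)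
  then show ?thesis
    using orthogonal_transformation_norm[OF orthogonal_transformation_reflect, of "x - y"] by (simp add: dist_norm)
qed

lemma reflect_center: "reflect p \<nu> p = p" by (simp add: reflect_def)

lemma reflect_continuous: "continuous_on A (reflect p \<nu>)"
  unfolding reflect_def by (intro continuous_intros)

lemma smooth_reflect: "smooth f \<Longrightarrow> smooth (\<lambda>x. f (reflect p \<nu> x))"
  unfolding reflect_affine
  by (rule smooth_affine[OF orthogonal_transformation_linear[OF orthogonal_transformation_reflect]])

text \<open>Invariance of the Laplacian under orthogonal maps: the matrix of second derivatives is
  conjugated by the linear part \<open>L\<close>, and summation over the basis vectors
  \<open>b\<close> collapses \<open>(b \<bullet> L e) * (b \<bullet> L e')\<close> to
  \<open>L e \<bullet> L e' = e \<bullet> e'\<close>.\<close>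

lemma laplacian_reflect:
  assumes f: "smooth f"
  shows "laplacian (\<lambda>x. f (reflect p \<nu> x)) x = laplacian f (reflect p \<nu> x)"
proof -
  define L where "L v = v - (2 * (v \<bullet> \<nu>)) *\<^sub>R \<nu>" for v
  define c where "c = (2 * (p \<bullet> \<nu>)) *\<^sub>R \<nu>"
  have S: "reflect p \<nu> x = c + L x" for x by (simp add: reflect_affine c_def L_def)
  have O: "orthogonal_transformation L" unfolding L_def by (rule orthogonal_transformation_reflect)
  then have L: "linear L" by (rule orthogonal_transformation_linear)
  \<comment> \<open>The linear part of a reflection is self-adjoint; moving \<open>L\<close> to the
    other argument makes the sum over \<open>b\<close> an inner product in coordinates.\<close>
  have sa: "L v \<bullet> e = v \<bullet> L e" for v e by (simp add: L_def inner_diff_left inner_diff_right inner_commute[of \<nu> e])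
  have p1: "partial b (\<lambda>x. g (c + L x)) = (\<lambda>x. \<Sum>e\<in>Basis. (L b \<bullet> e) * partial e g (c + L x))"
    and d1: "(\<lambda>x. g (c + L x)) differentiable (at x)"
    if "smooth g" for g :: "'a \<Rightarrow> real" and b x
    using partial_affine[OF L smooth_differentiable[OF that]] by auto
  have p2: "partial b (\<lambda>x. \<Sum>e\<in>Basis. (L b \<bullet> e) * partial e f (c + L x)) x =
      (\<Sum>e\<in>Basis. (L b \<bullet> e) * (\<Sum>e'\<in>Basis. (L b \<bullet> e') * partial e' (partial e f) (c + L x)))" for b
  proof -
    have "((\<lambda>x. \<Sum>e\<in>Basis. (L b \<bullet> e) * partial e f (c + L x)) has_derivative
       (\<lambda>v. \<Sum>e\<in>Basis. (L b \<bullet> e) * frechet_derivative (\<lambda>x. partial e f (c + L x)) (at x) v)) (at x)"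
      by (intro has_derivative_sum has_derivative_mult_right frechet_derivative_works[THEN iffD1] d1 smooth_partial f)
    from partialI[OF this, of b]
    have "partial b (\<lambda>x. \<Sum>e\<in>Basis. (L b \<bullet> e) * partial e f (c + L x)) x =
      (\<Sum>e\<in>Basis. (L b \<bullet> e) * partial b (\<lambda>x. partial e f (c + L x)) x)" by (simp add: partial_def)
    also have "\<dots> = (\<Sum>e\<in>Basis. (L b \<bullet> e) * (\<Sum>e'\<in>Basis. (L b \<bullet> e') * partial e' (partial e f) (c + L x)))"
      by (intro sum.cong refl) (simp add: p1[OF smooth_partial[OF f]])
    finally show ?thesis .
  qed
  have "laplacian (\<lambda>x. f (reflect p \<nu> x)) x =
      (\<Sum>b\<in>Basis. \<Sum>e\<in>Basis. \<Sum>e'\<in>Basis. (b \<bullet> L e) * (b \<bullet> L e') * partial e' (partial e f) (c + L x))"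
    unfolding laplacian_def S p1[OF f] p2 by (simp add: sum_distrib_left sa mult.assoc)
  also have "\<dots> = (\<Sum>e\<in>Basis. \<Sum>e'\<in>Basis. \<Sum>b\<in>Basis. (b \<bullet> L e) * (b \<bullet> L e') * partial e' (partial e f) (c + L x))"
    by (subst sum.swap, rule sum.cong[OF refl], subst sum.swap, rule refl)
  also have "\<dots> = (\<Sum>e\<in>Basis. \<Sum>e'\<in>Basis. (L e \<bullet> L e') * partial e' (partial e f) (c + L x))"
    by (simp add: sum_distrib_right[symmetric] euclidean_inner[of "L _" "L _"] inner_commute)
  also have "\<dots> = (\<Sum>e\<in>Basis. \<Sum>e'\<in>Basis. (e \<bullet> e') * partial e' (partial e f) (c + L x))"
    using O by (simp add: orthogonal_transformation_def)
  also have "\<dots> = (\<Sum>e\<in>Basis. partial e (partial e f) (c + L x))"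
    by (intro sum.cong refl) (simp add: inner_Basis if_distrib[where f = "\<lambda>c. c * _"] cong: if_cong)
  finally show ?thesis by (simp add: laplacian_def S)
qed

end

text \<open>The linear part of a reflection is orthogonal and hence preserves the measure; what is
  left is a translation.\<close>

lemma lborel_distr_reflect:
  fixes p \<nu> :: "real^2"
  assumes \<nu>: "norm \<nu> = 1"
  shows "distr lborel borel (reflect p \<nu>) = lborel"
proof -
  define L where "L v = v - (2 * (v \<bullet> \<nu>)) *\<^sub>R \<nu>" for v :: "real^2"
  have O: "orthogonal_transformation L" unfolding L_def by (rule orthogonal_transformation_reflect[OF \<nu>])
  have LL: "L (L v) = v" for v
    using reflect_reflect[OF \<nu>, of 0 v] by (simp add: reflect_def L_def)
  have Lm: "L \<in> borel_measurable borel"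
    unfolding L_def by (intro borel_measurable_continuous_onI continuous_intros)
  have "lborel = distr lborel borel L"
  proof (rule lborel_eqI)
    fix l u :: "real^2" assume lu: "\<And>b. b \<in> Basis \<Longrightarrow> l \<bullet> b \<le> u \<bullet> b"
    \<comment> \<open>\<open>L\<close> is its own inverse, so the preimage of a box is its image, to
      which the theorem on orthogonal images applies.\<close>
    have V: "L -` box l u = L ` box l u" using LL by (auto simp: image_iff) metis+
    have Vb: "L -` box l u \<in> sets borel" using measurable_sets[OF Lm, of "box l u"] by simp
    have lm: "box l u \<in> lmeasurable" by simp
    have "emeasure (distr lborel borel L) (box l u) = emeasure lborel (L -` box l u)"
      using Lm by (simp add: emeasure_distr)
    also have "\<dots> = emeasure lebesgue (L -` box l u)"
      using Vb by simp
    also have "\<dots> = ennreal (measure lebesgue (L ` box l u))"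
      unfolding V using measurable_orthogonal_image[OF O lm] by (rule emeasure_eq_measure2)
    also have "measure lebesgue (L ` box l u) = measure lebesgue (box l u)"
      by (rule measure_orthogonal_image[OF O lm])
    also have "ennreal (measure lebesgue (box l u)) = emeasure lborel (box l u)"
      using emeasure_eq_measure2[OF lm] by simp
    also have "\<dots> = (\<Prod>b\<in>Basis. (u - l) \<bullet> b)"
      using lu by (subst emeasure_lborel_box_eq) auto
    finally show "emeasure (distr lborel borel L) (box l u) = (\<Prod>b\<in>Basis. (u - l) \<bullet> b)" .
  qed simp
  moreover have "distr lborel borel (reflect p \<nu>) = distr (distr lborel borel L) borel ((+) ((2 * (p \<bullet> \<nu>)) *\<^sub>R \<nu>))"
  proof -
    have "reflect p \<nu> = (+) ((2 * (p \<bullet> \<nu>)) *\<^sub>R \<nu>) \<circ> L"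
      by (rule ext) (simp add: L_def reflect_affine[OF \<nu>])
    then show ?thesis using Lm by (subst distr_distr) auto
  qed
  ultimately show ?thesis by (simp add: lborel_distr_plus)
qed

lemma lborel_integral_reflect:
  fixes p \<nu> :: "real^2" and f :: "real^2 \<Rightarrow> real"
  assumes "norm \<nu> = 1" "f \<in> borel_measurable borel"
  shows "(LINT x|lborel. f (reflect p \<nu> x)) = (LINT x|lborel. f x)"
    and "integrable lborel (\<lambda>x. f (reflect p \<nu> x)) \<longleftrightarrow> integrable lborel f"
proof -
  have m: "reflect p \<nu> \<in> measurable lborel borel"
    using borel_measurable_continuous_onI[OF reflect_continuous[OF assms(1)]] by simp
  show "(LINT x|lborel. f (reflect p \<nu> x)) = (LINT x|lborel. f x)"
    using integral_distr[OF m, of f] assms by (simp add: lborel_distr_reflect)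
  show "integrable lborel (\<lambda>x. f (reflect p \<nu> x)) \<longleftrightarrow> integrable lborel f"
    using integrable_distr_eq[OF m, of f] assms by (simp add: lborel_distr_reflect)
qed

lemma test_functions_lipschitz:
  assumes "\<phi> \<in> test_functions \<Omega>"
  obtains C where "C \<ge> 0" "\<And>x y. \<bar>\<phi> x - \<phi> y\<bar> \<le> C * norm (x - y)"
proof -
  obtain C where C: "C \<ge> 0" "\<And>x. norm (grad \<phi> x) \<le> C" using grad_bounded[OF assms] by metis
  have "norm (\<phi> x - \<phi> y) \<le> C * norm (x - y)" for x y
  proof (rule differentiable_bound[of UNIV])
    show "(\<phi> has_derivative (\<lambda>v. v \<bullet> grad \<phi> x)) (at x within UNIV)" for x
      using has_derivative_partial[OF smooth_differentiable[OF test_functions_smooth[OF assms]]]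
      by (simp add: inner_grad)
    show "onorm (\<lambda>v. v \<bullet> grad \<phi> x) \<le> C" for x
    proof (rule onorm_le)
      fix v
      have "norm (v \<bullet> grad \<phi> x) \<le> norm v * norm (grad \<phi> x)" using Cauchy_Schwarz_ineq2 by simp
      also have "\<dots> \<le> norm v * C" using C by (intro mult_left_mono) auto
      finally show "norm (v \<bullet> grad \<phi> x) \<le> C * norm v" by (simp add: mult.commute)
    qed
  qed auto
  then show thesis using that C(1) by simp
qed

text \<open>The equation is demanded only in \<open>B\<close> and in the sense of distributions,
  while \<open>f\<close> is a globally integrable Borel function; convolutions with kernels are then
  defined at every point, whatever happens outside \<open>B\<close>.\<close>

definition weak_helmholtz :: "real \<Rightarrow> 'a::euclidean_space set \<Rightarrow> ('a \<Rightarrow> real) \<Rightarrow> bool" where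
  "weak_helmholtz \<mu> B f \<longleftrightarrow> f \<in> borel_measurable borel \<and> integrable lborel f \<and>
     (\<forall>\<psi>\<in>test_functions B. (LINT x|lborel. f x * (laplacian \<psi> x + \<mu> * \<psi> x)) = 0)"

lemma (in H1_0_solution) weak_helmholtz_w: "weak_helmholtz \<mu> \<Omega> w"
  unfolding weak_helmholtz_def using w_integrable weak_solution_interior by auto

text \<open>In the ball, \<open>w\<close> vanishes on one side of the line, so the difference is the
  odd extension of \<open>w\<close> across it. The reflection is transferred from \<open>w\<close>
  to the test function; the antisymmetric combination \<zeta> vanishes on the line, as
  \<open>eq_one_sided\<close> demands.\<close>

lemma weak_helmholtz_reflect:
  fixes \<Omega> :: "(real^2) set"
  assumes sol: "H1_0_solution \<Omega> w W \<phi> \<mu>" and \<nu>: "norm \<nu> = 1"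
    and B: "\<Omega> \<inter> ball p R = {x \<in> ball p R. (x - p) \<bullet> \<nu> > 0}"
  shows "weak_helmholtz \<mu> (ball p R) (\<lambda>x. w x - w (reflect p \<nu> x))"
proof -
  interpret H1_0_solution \<Omega> w W \<phi> \<mu> by (rule sol)
  note wi = w_integrable lborel_integral_reflect(2)[OF \<nu> w_m, of p, THEN iffD2, OF w_integrable]
  have rm[measurable]: "reflect p \<nu> \<in> borel_measurable borel"
    using borel_measurable_continuous_onI[OF reflect_continuous[OF \<nu>]] by simp
  have "(LINT x|lborel. (w x - w (reflect p \<nu> x)) * (laplacian \<psi> x + \<mu> * \<psi> x)) = 0"
    if \<psi>: "\<psi> \<in> test_functions (ball p R)" for \<psi>
  proof -
    have s: "smooth \<psi>" using \<psi> by (rule test_functions_smooth)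
    obtain K where K: "smooth \<psi>" "compact K" "K \<subseteq> ball p R" "\<And>x. x \<notin> K \<Longrightarrow> \<psi> x = 0"
      using test_functionsE[OF \<psi>] by metis
    have \<psi>S: "(\<lambda>x. \<psi> (reflect p \<nu> x)) \<in> test_functions (ball p R)"
    proof (rule test_functionsI[OF smooth_reflect[OF \<nu> s]])
      show "compact (reflect p \<nu> ` K)" by (intro compact_continuous_image reflect_continuous[OF \<nu>] K)
      show "reflect p \<nu> ` K \<subseteq> ball p R"
      proof
        fix y assume "y \<in> reflect p \<nu> ` K"
        then obtain x where "x \<in> K" "y = reflect p \<nu> x" by blast
        then show "y \<in> ball p R"
          using K(3) dist_reflect[OF \<nu>, of p p x] reflect_center[OF \<nu>, of p] by auto
      qed
      show "\<psi> (reflect p \<nu> x) = 0" if "x \<notin> reflect p \<nu> ` K" for x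
        using that K(4) reflect_reflect[OF \<nu>, of p x] by (metis image_eqI)
    qed
    define \<zeta> where "\<zeta> x = \<psi> x - \<psi> (reflect p \<nu> x)" for x
    have \<zeta>: "\<zeta> \<in> test_functions (ball p R)" unfolding \<zeta>_def by (rule test_functions_diff[OF \<psi> \<psi>S])
    obtain C where C: "C \<ge> 0" "\<And>x y. \<bar>\<psi> x - \<psi> y\<bar> \<le> C * norm (x - y)" using test_functions_lipschitz[OF \<psi>] by metis
    have "\<bar>\<zeta> x\<bar> \<le> (2 * C) * \<bar>(x - p) \<bullet> \<nu>\<bar>" for x
    proof -
      \<comment> \<open>A Lipschitz constant of \<psi> bounds \<zeta> by the distance from
        \<open>x\<close> to its mirror image, which is twice the distance to the line.\<close>
      have "x - reflect p \<nu> x = (2 * ((x - p) \<bullet> \<nu>)) *\<^sub>R \<nu>" by (simp add: reflect_def)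
      then have "norm (x - reflect p \<nu> x) = 2 * \<bar>(x - p) \<bullet> \<nu>\<bar>" using \<nu> by (simp add: abs_mult)
      then show ?thesis using C(2)[of x "reflect p \<nu> x"] by (simp add: \<zeta>_def)
    qed
    from eq_one_sided[OF B \<zeta> this]
    have z: "(LINT x|lborel. w x * (laplacian \<zeta> x + \<mu> * \<zeta> x)) = 0" by (rule weak_solution_if[OF \<zeta>])
    define g where "g x = laplacian \<psi> x + \<mu> * \<psi> x" for x
    have lt: "laplacian \<psi> \<in> test_functions (ball p R)" by (rule test_functions_laplacian[OF \<psi>])
    have gm: "g \<in> borel_measurable borel" unfolding g_def
      using test_functions_measurable[OF \<psi>] test_functions_measurable[OF lt] by simp
    have gSm: "(\<lambda>x. g (reflect p \<nu> x)) \<in> borel_measurable borel"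
      using measurable_compose[OF rm gm] .
    have wSm: "(\<lambda>x. w (reflect p \<nu> x)) \<in> borel_measurable borel"
      using measurable_compose[OF rm w_m] .
    obtain D1 D2 where D: "\<And>x. \<bar>\<psi> x\<bar> \<le> D1" "\<And>x. \<bar>laplacian \<psi> x\<bar> \<le> D2"
      using test_functions_bounded[OF \<psi>] test_functions_bounded[OF lt] by metis
    have gb: "\<bar>g x\<bar> \<le> D2 + \<bar>\<mu>\<bar> * D1" for x
    proof -
      have "\<bar>\<mu> * \<psi> x\<bar> \<le> \<bar>\<mu>\<bar> * D1" unfolding abs_mult by (intro mult_left_mono D) auto
      then show ?thesis using D(2)[of x] abs_triangle_ineq[of "laplacian \<psi> x" "\<mu> * \<psi> x"] unfolding g_def by linarith
    qed
    have i1: "integrable lborel (\<lambda>x. w x * g x)" by (rule integrable_w_times[OF gm gb])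
    have i2: "integrable lborel (\<lambda>x. w x * g (reflect p \<nu> x))" by (rule integrable_w_times[OF gSm gb])
    have i3: "integrable lborel (\<lambda>x. w (reflect p \<nu> x) * g x)"
      and e3: "(LINT x|lborel. w (reflect p \<nu> x) * g x) = (LINT x|lborel. w x * g (reflect p \<nu> x))"
      using lborel_integral_reflect[OF \<nu>, of "\<lambda>x. w x * g (reflect p \<nu> x)" p] i2 gSm
      by (auto simp: reflect_reflect[OF \<nu>])
    have "(LINT x|lborel. (w x - w (reflect p \<nu> x)) * g x) = (LINT x|lborel. w x * g x) - (LINT x|lborel. w (reflect p \<nu> x) * g x)"
      unfolding left_diff_distrib by (rule Bochner_Integration.integral_diff[OF i1 i3])
    also have "\<dots> = (LINT x|lborel. w x * g x - w x * g (reflect p \<nu> x))"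
      unfolding e3 by (rule Bochner_Integration.integral_diff[OF i1 i2, symmetric])
    also have "\<dots> = (LINT x|lborel. w x * (laplacian \<zeta> x + \<mu> * \<zeta> x))"
    proof (intro Bochner_Integration.integral_cong refl)
      fix x
      have L: "laplacian \<zeta> x = laplacian \<psi> x - laplacian \<psi> (reflect p \<nu> x)"
        unfolding \<zeta>_def using laplacian_diff[OF s smooth_reflect[OF \<nu> s]] laplacian_reflect[OF \<nu> s] by simp
      show "w x * g x - w x * g (reflect p \<nu> x) = w x * (laplacian \<zeta> x + \<mu> * \<zeta> x)"
        unfolding L by (simp add: g_def \<zeta>_def algebra_simps)
    qed
    finally show ?thesis using z by (simp add: g_def)
  qed
  moreover have "(\<lambda>x. w x - w (reflect p \<nu> x)) \<in> borel_measurable borel"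
    using borel_measurable_diff[OF w_m measurable_compose[OF rm w_m]] .
  ultimately show ?thesis unfolding weak_helmholtz_def using wi by auto
qed

subsection \<open>Finite differences of test functions\<close>

text \<open>Pascal's rule: the binomial coefficients of order \<open>Suc r\<close> split into those
  of the shifted and of the unshifted difference.\<close>

lemma finite_difference_Suc:
  "finite_difference (Suc r) h f x = finite_difference r h f (x + h) - finite_difference r h f x"
proof -
  define b where "b k = (-1) ^ (Suc r - k) * real (r choose k) * f (x + real k *\<^sub>R h)" for k
  have "(\<Sum>k\<le>Suc r. b k) = (\<Sum>k\<le>r. b k)" by (simp add: b_def)
  moreover have "(\<Sum>k\<le>Suc r. b k) = b 0 + (\<Sum>k\<le>r. b (Suc k))" by (rule sum.atMost_Suc_shift)
  moreover have "(\<Sum>k\<le>r. b k) = - finite_difference r h f x"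
    unfolding finite_difference_def sum_negf[symmetric] by (intro sum.cong) (auto simp: b_def Suc_diff_le)
  ultimately have *: "b 0 + (\<Sum>k\<le>r. b (Suc k)) = - finite_difference r h f x" by simp
  have "finite_difference (Suc r) h f x = b 0 + (\<Sum>k\<le>r. (-1) ^ (r - k) * real (Suc r choose Suc k) * f (x + real (Suc k) *\<^sub>R h))"
    unfolding finite_difference_def by (subst sum.atMost_Suc_shift) (simp add: b_def)
  also have "(\<Sum>k\<le>r. (-1) ^ (r - k) * real (Suc r choose Suc k) * f (x + real (Suc k) *\<^sub>R h)) =
      (\<Sum>k\<le>r. (-1) ^ (r - k) * real (r choose k) * f ((x + h) + real k *\<^sub>R h)) + (\<Sum>k\<le>r. b (Suc k))"
    unfolding sum.distrib[symmetric] b_def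
    by (intro sum.cong refl) (simp add: algebra_simps)
  finally show ?thesis using * by (simp add: finite_difference_def)
qed

lemma finite_difference_linear:
  "finite_difference r h (\<lambda>x. \<Sum>i\<in>I. c i * g i x) x = (\<Sum>i\<in>I. c i * finite_difference r h (g i) x)"
  unfolding finite_difference_def sum_distrib_left by (subst sum.swap) (simp add: mult_ac)

lemma has_derivative_grad: "smooth f \<Longrightarrow> (f has_derivative (\<lambda>v. v \<bullet> grad f x)) (at x)"
  using has_derivative_partial[OF smooth_differentiable] by (simp add: inner_grad)

text \<open>Each order is gained by the mean value theorem along the direction \<open>h\<close>: the
  derivative of a difference of order \<open>r\<close> is a combination of differences of order
  \<open>r\<close> of the partial derivatives, which are test functions again. This is why the
  induction generalises \<phi>.\<close>

lemma test_finite_difference_bound: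
  "\<phi> \<in> test_functions \<Omega> \<Longrightarrow> \<exists>C\<ge>0. \<forall>h x. \<bar>finite_difference r h \<phi> x\<bar> \<le> C * norm h ^ r"
proof (induction r arbitrary: \<phi>)
  case 0
  obtain C where "C \<ge> 0" "\<And>x. \<bar>\<phi> x\<bar> \<le> C" using test_functions_bounded[OF 0] by metis
  then show ?case by (auto simp: finite_difference_def intro!: exI[of _ C])
next
  case (Suc r)
  have s: "smooth \<phi>" using Suc.prems by (rule test_functions_smooth)
  have "\<forall>b\<in>Basis. \<exists>C\<ge>0. \<forall>h x. \<bar>finite_difference r h (partial b \<phi>) x\<bar> \<le> C * norm h ^ r"
    using Suc.IH[OF test_functions_partial[OF Suc.prems]] by blast
  then obtain C where C: "\<And>b. b \<in> Basis \<Longrightarrow> C b \<ge> 0"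
    "\<And>b h x. b \<in> Basis \<Longrightarrow> \<bar>finite_difference r h (partial b \<phi>) x\<bar> \<le> C b * norm h ^ r" by metis
  have "\<bar>finite_difference (Suc r) h \<phi> x\<bar> \<le> (\<Sum>b\<in>Basis. C b) * norm h ^ Suc r" for h x
  proof -
    define g where "g s = finite_difference r h \<phi> (x + s *\<^sub>R h)" for s
    define g' where "g' s = (\<Sum>b\<in>Basis. (h \<bullet> b) * finite_difference r h (partial b \<phi>) (x + s *\<^sub>R h))" for s
    have "(g has_real_derivative g' s) (at s)" for s
    proof -
      have 1: "((\<lambda>s. \<phi> (x + s *\<^sub>R h + real k *\<^sub>R h)) has_real_derivative h \<bullet> grad \<phi> (x + s *\<^sub>R h + real k *\<^sub>R h)) (at s)" for k
      proof -
        have "((\<lambda>s. x + s *\<^sub>R h + real k *\<^sub>R h) has_derivative (\<lambda>t. t *\<^sub>R h)) (at s)"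
          by (auto intro!: derivative_eq_intros)
        from has_derivative_compose[OF this has_derivative_grad[OF s]]
        show ?thesis by (rule has_derivative_imp_has_field_derivative) simp
      qed
      have "(g has_real_derivative (\<Sum>k\<le>r. (-1) ^ (r - k) * real (r choose k) * (h \<bullet> grad \<phi> (x + s *\<^sub>R h + real k *\<^sub>R h)))) (at s)"
        unfolding g_def finite_difference_def by (intro DERIV_sum DERIV_cmult 1)
      moreover have "(\<Sum>k\<le>r. (-1) ^ (r - k) * real (r choose k) * (h \<bullet> grad \<phi> (x + s *\<^sub>R h + real k *\<^sub>R h))) = g' s"
        unfolding g'_def inner_grad finite_difference_linear[symmetric] by (simp add: finite_difference_def)
      ultimately show ?thesis by simp
    qed
    then obtain z where z: "g 1 - g 0 = (1 - 0) * g' z"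
      using MVT2[of 0 1 g g'] by auto
    have "\<bar>g' z\<bar> \<le> (\<Sum>b\<in>Basis. norm h * (C b * norm h ^ r))"
      unfolding g'_def
      by (rule order_trans[OF sum_abs]) (auto intro!: sum_mono mult_mono Basis_le_norm C simp: abs_mult)
    also have "\<dots> = (\<Sum>b\<in>Basis. C b) * norm h ^ Suc r" by (simp add: sum_distrib_right sum_distrib_left mult_ac)
    finally show ?thesis using z by (simp add: finite_difference_Suc g_def)
  qed
  moreover have "(\<Sum>b\<in>Basis. C b) \<ge> 0" using C(1) by (rule sum_nonneg)
  ultimately show ?case by blast
qed

subsection \<open>A reproducing kernel for the Helmholtz equation\<close>

text \<open>Differentiation under the integral sign in a form that closes up: every derivative in
  \<open>s\<close> raises the index of \<open>p\<close> by one and produces another factor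
  \<open>g v\<close>, which the power \<open>g v ^ n\<close> collects.\<close>

lemma smooth_family_integral:
  fixes p :: "nat \<Rightarrow> real \<Rightarrow> real" and c g e :: "real \<Rightarrow> real"
  assumes p: "smooth_family p" and c: "continuous_on {l..u} c" and g: "continuous_on {l..u} g" and e: "continuous_on {l..u} e"
  shows "smooth_family (\<lambda>n s. integral {l..u} (\<lambda>v. c v * g v ^ n * p n (s * g v + e v)))"
  unfolding smooth_family_def
proof (intro allI)
  fix n s
  have d: "(p n has_real_derivative p (Suc n) x) (at x)" for n x using p by (simp add: smooth_family_def)
  have pc: "continuous_on UNIV (p n)" for n
    using d by (auto simp: continuous_on_eq_continuous_at intro: DERIV_isCont)
  have "((\<lambda>s. integral (cbox l u) (\<lambda>v. c v * g v ^ n * p n (s * g v + e v))) has_real_derivative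
      integral (cbox l u) (\<lambda>v. c v * g v ^ Suc n * p (Suc n) (s * g v + e v))) (at s within UNIV)"
  proof (rule leibniz_rule_field_derivative)
    show "((\<lambda>s. c v * g v ^ n * p n (s * g v + e v)) has_real_derivative c v * g v ^ Suc n * p (Suc n) (s * g v + e v)) (at s within UNIV)"
      for s v
    proof -
      have "((\<lambda>s. s * g v + e v) has_real_derivative g v) (at s)" by (auto intro!: derivative_eq_intros)
      from DERIV_cmult[OF DERIV_chain2[OF d this], of "c v * g v ^ n"] show ?thesis by (simp add: mult_ac)
    qed
    show "(\<lambda>v. c v * g v ^ n * p n (s * g v + e v)) integrable_on cbox l u" for s
      by (intro integrable_continuous continuous_intros continuous_on_compose2[OF pc]) (use c g e in auto)
    have "continuous_on (UNIV \<times> {l..u}) (\<lambda>q. c (snd q) * g (snd q) ^ Suc n * p (Suc n) (fst q * g (snd q) + e (snd q)))"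
      by (intro continuous_intros continuous_on_compose2[OF pc] continuous_on_compose2[OF c] continuous_on_compose2[OF g] continuous_on_compose2[OF e]) auto
    then show "continuous_on (UNIV \<times> cbox l u) (\<lambda>(s, v). c v * g v ^ Suc n * p (Suc n) (s * g v + e v))"
      by (simp add: split_beta)
  qed auto
  then show "((\<lambda>s. integral {l..u} (\<lambda>v. c v * g v ^ n * p n (s * g v + e v))) has_real_derivative
      integral {l..u} (\<lambda>v. c v * g v ^ Suc n * p (Suc n) (s * g v + e v))) (at s)" by simp
qed

text \<open>The bump read backwards, with the signs that the chain rule for \<open>1 - s\<close>
  produces. All members vanish for \<open>s \<ge> 1\<close>, and since member \<open>0\<close> is
  decreasing, \<open>- cutoff 1\<close> is a nonnegative profile.\<close>

definition cutoff :: "nat \<Rightarrow> real \<Rightarrow> real" where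
  "cutoff n s = (-1) ^ n * bump_family n (1 - s)"

lemma cutoff: "smooth_family cutoff" "s \<ge> 1 \<Longrightarrow> cutoff n s = 0" "cutoff (Suc 0) s \<le> 0"
proof -
  have "(bump_family n has_real_derivative bump_family (Suc n) x) (at x)" for n x
    using bump_family(1) by (simp add: smooth_family_def)
  then have "((\<lambda>s. bump_family n (1 - s)) has_real_derivative bump_family (Suc n) (1 - s) * - 1) (at s)" for n s
    by (rule DERIV_chain2) (auto intro!: derivative_eq_intros)
  from DERIV_cmult[OF this]
  have "((\<lambda>s. (-1) ^ n * bump_family n (1 - s)) has_real_derivative (-1) ^ n * (bump_family (Suc n) (1 - s) * - 1)) (at s)" for n s .
  then show "smooth_family cutoff" by (simp add: smooth_family_def cutoff_def[abs_def])
  show "s \<ge> 1 \<Longrightarrow> cutoff n s = 0" by (simp add: cutoff_def bump_family(3))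
  show "cutoff (Suc 0) s \<le> 0" by (simp add: cutoff_def bump_family_1_nonneg)
qed

lemma smooth_family_continuous: "smooth_family p \<Longrightarrow> continuous_on A (p n)"
  by (rule continuous_on_subset[of UNIV])
     (auto simp: smooth_family_def continuous_on_eq_continuous_at intro: DERIV_isCont)

lemma cutoff_continuous [continuous_intros]:
  "continuous_on A f \<Longrightarrow> continuous_on A (\<lambda>x. cutoff n (f x))"
  using continuous_on_compose2[OF smooth_family_continuous[OF cutoff(1), of UNIV]] by auto

text \<open>
  As a function of \<open>X\<close> in three-dimensional space, \<open>scale_int a b 0 (X \<bullet> X)\<close> has as its Laplacian
  the difference of two dilations of one radial profile, see \<open>scale_int_ode\<close>; below,
  \<open>potential\<close> integrates out the third variable against \<open>cosh\<close>. The redundant factors and summands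
  in these definitions match the pattern of \<open>smooth_family_integral\<close>.
\<close>

definition scale_int :: "real \<Rightarrow> real \<Rightarrow> nat \<Rightarrow> real \<Rightarrow> real" where
  "scale_int a b n s = integral {a..b} (\<lambda>v. (1/2) * (v\<^sup>2) ^ n * cutoff n (s * v\<^sup>2 + 0))"

lemma smooth_family_scale_int: "smooth_family (scale_int a b)"
  unfolding scale_int_def[abs_def]
  by (rule smooth_family_integral[OF cutoff(1)]) (intro continuous_intros)+

lemma scale_int_zero: "1 \<le> a \<Longrightarrow> s \<ge> 1 / a\<^sup>2 \<Longrightarrow> scale_int a b n s = 0"
proof -
  assume a: "1 \<le> a" "s \<ge> 1 / a\<^sup>2"
  have "0 \<le> s" using a(2) order_trans[of 0 "1 / a\<^sup>2" s] by simp
  have "cutoff n (s * v\<^sup>2 + 0) = 0" if "v \<in> {a..b}" for v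
  proof (rule cutoff(2))
    have "1 = (1 / a\<^sup>2) * a\<^sup>2" using a by simp
    also have "\<dots> \<le> s * v\<^sup>2" using a that \<open>0 \<le> s\<close> by (intro mult_mono power_mono) auto
    finally show "s * v\<^sup>2 + 0 \<ge> 1" by simp
  qed
  then have "scale_int a b n s = integral {a..b} (\<lambda>v. 0)"
    unfolding scale_int_def by (intro integral_cong) auto
  then show ?thesis by simp
qed

text \<open>For a function \<open>p (X \<bullet> X)\<close> in three dimensions the Laplacian is
  \<open>4 * s * p'' + 6 * p'\<close>. Under the integral, and thanks to the factor
  \<open>1/2\<close> in \<open>scale_int\<close>, this is the exact derivative in \<open>v\<close>
  of \<open>v ^ 3 * cutoff 1 (s * v\<^sup>2)\<close>. The end points give two dilated profiles, with
  the factor of a mass-preserving dilation in three dimensions.\<close>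

lemma scale_int_ode:
  assumes "a \<le> b"
  shows "4 * s * scale_int a b 2 s + 6 * scale_int a b 1 s = b^3 * cutoff 1 (s * b\<^sup>2) - a^3 * cutoff 1 (s * a\<^sup>2)"
proof -
  have d: "((\<lambda>v. v^3 * cutoff 1 (s * v\<^sup>2)) has_real_derivative 3 * v\<^sup>2 * cutoff 1 (s * v\<^sup>2) + 2 * s * v^4 * cutoff 2 (s * v\<^sup>2)) (at v within {a..b})" for v
  proof -
    have c: "(cutoff 1 has_real_derivative cutoff 2 (s * v\<^sup>2)) (at (s * v\<^sup>2))"
      using cutoff(1) by (simp add: smooth_family_def numeral_2_eq_2)
    have "((\<lambda>v. s * v\<^sup>2) has_real_derivative s * (2 * v)) (at v)" by (auto intro!: derivative_eq_intros)
    from c this have e: "((\<lambda>v. cutoff 1 (s * v\<^sup>2)) has_real_derivative cutoff 2 (s * v\<^sup>2) * (s * (2 * v))) (at v)"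
      by (rule DERIV_chain2)
    have "((\<lambda>v. v^3) has_real_derivative 3 * v\<^sup>2) (at v)" by (auto intro!: derivative_eq_intros)
    from DERIV_mult[OF this e]
    have "((\<lambda>v. v^3 * cutoff 1 (s * v\<^sup>2)) has_real_derivative 3 * v\<^sup>2 * cutoff 1 (s * v\<^sup>2) + 2 * s * v^4 * cutoff 2 (s * v\<^sup>2)) (at v)"
    proof (rule DERIV_cong)
      have "v * v^3 = v^4" by (simp add: power4_eq_xxxx power3_eq_cube)
      then have E: "2 * s * v^4 = s * (2 * v) * v^3" by (simp add: mult.assoc)
      show "3 * v\<^sup>2 * cutoff 1 (s * v\<^sup>2) + cutoff 2 (s * v\<^sup>2) * (s * (2 * v)) * v^3 =
        3 * v\<^sup>2 * cutoff 1 (s * v\<^sup>2) + 2 * s * v^4 * cutoff 2 (s * v\<^sup>2)"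
        unfolding E by (simp only: mult_ac)
    qed
    then show ?thesis by (rule has_field_derivative_at_within)
  qed
  have h1: "((\<lambda>v. 3 * v\<^sup>2 * cutoff 1 (s * v\<^sup>2) + 2 * s * v^4 * cutoff 2 (s * v\<^sup>2)) has_integral (b^3 * cutoff 1 (s * b\<^sup>2) - a^3 * cutoff 1 (s * a\<^sup>2))) {a..b}"
    using d by (intro fundamental_theorem_of_calculus[OF assms]) (auto simp: has_real_derivative_iff_has_vector_derivative[symmetric])
  have h2: "((\<lambda>v. (6 * ((1/2) * (v\<^sup>2) ^ 1 * cutoff 1 (s * v\<^sup>2 + 0)) + 4 * s * ((1/2) * (v\<^sup>2) ^ 2 * cutoff 2 (s * v\<^sup>2 + 0)))) has_integral
     (6 * scale_int a b 1 s + 4 * s * scale_int a b 2 s)) {a..b}"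
    unfolding scale_int_def
    by (intro has_integral_add has_integral_mult_right integrable_integral integrable_continuous_interval continuous_intros)
  have e: "(\<lambda>v. (6 * ((1/2) * (v\<^sup>2) ^ 1 * cutoff 1 (s * v\<^sup>2 + 0)) + 4 * s * ((1/2) * (v\<^sup>2) ^ 2 * cutoff 2 (s * v\<^sup>2 + 0))))
     = (\<lambda>v. 3 * v\<^sup>2 * cutoff 1 (s * v\<^sup>2) + 2 * s * v^4 * cutoff 2 (s * v\<^sup>2))"
    by (rule ext) (simp add: power2_eq_square power4_eq_xxxx)
  show ?thesis using has_integral_unique[OF h1 h2[unfolded e]] by simp
qed

locale helmholtz_kernel =
  fixes \<mu> :: real
  assumes \<mu>: "\<mu> \<ge> 0"
begin

definition ch :: "real \<Rightarrow> real" where "ch s = cosh (sqrt \<mu> * s)"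
text \<open>The derivative of \<open>ch\<close>, with the factor \<open>sqrt \<mu>\<close>
  included.\<close>

definition sh :: "real \<Rightarrow> real" where "sh s = sqrt \<mu> * sinh (sqrt \<mu> * s)"

lemma ch_deriv: "(ch has_real_derivative sh s) (at s)" "(sh has_real_derivative \<mu> * ch s) (at s)"
  unfolding ch_def[abs_def] sh_def[abs_def] using \<mu> by (auto intro!: derivative_eq_intros)

lemma ch_cont [continuous_intros]: "continuous_on A f \<Longrightarrow> continuous_on A (\<lambda>x. ch (f x))"
  "continuous_on A f \<Longrightarrow> continuous_on A (\<lambda>x. sh (f x))"
  unfolding ch_def sh_def by (intro continuous_intros; assumption)+

lemma ch_bounds: "1 \<le> ch s" "\<bar>s\<bar> \<le> 1 \<Longrightarrow> ch s \<le> ch 1"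
proof -
  show "1 \<le> ch s" unfolding ch_def by (rule cosh_real_ge_1)
  assume "\<bar>s\<bar> \<le> 1"
  then have "sqrt \<mu> * \<bar>s\<bar> \<le> sqrt \<mu> * 1" using \<mu> by (intro mult_left_mono) auto
  then have "cosh (sqrt \<mu> * \<bar>s\<bar>) \<le> cosh (sqrt \<mu> * 1)"
    using \<mu> by (subst cosh_real_nonneg_le_iff) auto
  moreover have "cosh (sqrt \<mu> * \<bar>s\<bar>) = cosh (sqrt \<mu> * s)"
    by (cases "s \<ge> 0") (auto simp: cosh_minus[of "sqrt \<mu> * s", symmetric] simp del: cosh_minus)
  ultimately show "ch s \<le> ch 1" by (simp add: ch_def)
qed

definition potential :: "real \<Rightarrow> real \<Rightarrow> nat \<Rightarrow> real \<Rightarrow> real" where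
  "potential a b n s = integral {-1..1} (\<lambda>t. ch t * 1 ^ n * scale_int a b n (s * 1 + t\<^sup>2))"

text \<open>Member \<open>0\<close> is the planar kernel: the dilated profile
  \<open>- (a ^ 3 * cutoff 1 (a\<^sup>2 * (s + t\<^sup>2)))\<close> of three variables, integrated
  over the third one against \<open>ch\<close>; see \<open>kernel_fam_unscaled\<close>. Rescaling
  the third variable by \<open>a\<close> leaves \<open>a\<^sup>2\<close> in front and the bounded
  weight \<open>ch (t / a)\<close>, so that estimates uniform in the scale can be read off.\<close>

definition kernel_fam :: "real \<Rightarrow> nat \<Rightarrow> real \<Rightarrow> real" where
  "kernel_fam a n s = integral {-1..1} (\<lambda>t. (a\<^sup>2 * ch (t / a)) * (a\<^sup>2) ^ n * - cutoff (Suc n) (s * a\<^sup>2 + t\<^sup>2))"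

lemma smooth_family_potential: "smooth_family (potential a b)"
  unfolding potential_def[abs_def]
  by (rule smooth_family_integral[OF smooth_family_scale_int]) (intro continuous_intros)+

lemma smooth_family_kernel: "smooth_family (kernel_fam a)"
proof -
  have "smooth_family (\<lambda>n s. - cutoff (Suc n) s)"
    using cutoff(1) by (auto simp: smooth_family_def intro: DERIV_minus)
  then show ?thesis unfolding kernel_fam_def[abs_def]
    by (cases "a = 0"; intro smooth_family_integral[where p = "\<lambda>n s. - cutoff (Suc n) s"])
       (auto intro!: continuous_intros)
qed

text \<open>Substituting \<open>t / a\<close> for \<open>t\<close>; the cutoff kills the difference of the integration ranges.\<close>

lemma kernel_fam_unscaled:
  assumes a: "1 \<le> a" and s: "s \<ge> 0"
  shows "kernel_fam a 0 s = integral {-1..1} (\<lambda>t. ch t * (- (a^3 * cutoff 1 ((s + t\<^sup>2) * a\<^sup>2))))"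
proof -
  define F where "F t = ch (t / a) * - cutoff 1 (s * a\<^sup>2 + t\<^sup>2)" for t
  have Fc: "continuous_on A F" for A unfolding F_def using a by (intro continuous_intros) auto
  have "integral {-1..1} F = integral {-a..a} (\<lambda>t. if t \<in> {-1..1} then F t else 0)"
  proof (rule integral_unique[symmetric])
    show "((\<lambda>t. if t \<in> {-1..1} then F t else 0) has_integral integral {-1..1} F) {-a..a}"
      using integrable_integral[OF integrable_continuous_interval[OF Fc]] a
      by (subst has_integral_restrict) auto
  qed
  also have "\<dots> = integral {-a..a} F"
  proof (rule integral_cong)
    fix t assume "t \<in> {-a..a}"
    have "cutoff 1 (s * a\<^sup>2 + t\<^sup>2) = 0" if "t \<notin> {-1..1}"
    proof (rule cutoff(2))
      have "1 \<le> \<bar>t\<bar>" using that by auto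
      then have "1 \<le> t\<^sup>2" using power_mono[of 1 "\<bar>t\<bar>" 2] by simp
      then show "1 \<le> s * a\<^sup>2 + t\<^sup>2" using s by (simp add: add_increasing)
    qed
    then show "(if t \<in> {-1..1} then F t else 0) = F t" by (simp add: F_def)
  qed
  finally have e1: "integral {-1..1} F = integral {-a..a} F" .
  have "(F has_integral integral {-a..a} F) {-a..a}"
    using integrable_integral[OF integrable_continuous_interval[OF Fc]] .
  from has_integral_stretch_real[OF this, of a]
  have "((\<lambda>t. F (a * t)) has_integral (1 / \<bar>a\<bar>) * integral {-a..a} F) ((\<lambda>t. t / a) ` {-a..a})"
    using a by simp
  moreover have "(\<lambda>t. t / a) ` {-a..a} = {-1..1}"
    using a image_divide_atLeastAtMost[of a "-a" a] by simp
  ultimately have "integral {-1..1} (\<lambda>t. F (a * t)) = (1 / a) * integral {-a..a} F"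
    using a by (simp add: integral_unique)
  then have e2: "integral {-1..1} F = a * integral {-1..1} (\<lambda>t. F (a * t))" using e1 a by simp
  have "kernel_fam a 0 s = a\<^sup>2 * integral {-1..1} F"
    unfolding kernel_fam_def F_def by (simp add: integral_mult_right[symmetric] mult_ac del: integral_mult_right)
  also have "\<dots> = a^3 * integral {-1..1} (\<lambda>t. F (a * t))" using e2 by (simp add: power2_eq_square power3_eq_cube)
  also have "\<dots> = integral {-1..1} (\<lambda>t. a^3 * F (a * t))" by simp
  also have "\<dots> = integral {-1..1} (\<lambda>t. ch t * (- (a^3 * cutoff 1 ((s + t\<^sup>2) * a\<^sup>2))))"
    using a by (intro integral_cong) (simp add: F_def power_mult_distrib algebra_simps)
  finally show ?thesis .
qed

text \<open>The planar form of \<open>scale_int_ode\<close>. The Laplacian in three variables is the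
  planar one plus the second derivative in \<open>t\<close>; two integrations by parts move the
  latter from \<open>scale_int\<close> to \<open>ch\<close>, where it becomes multiplication by
  \<mu>. The left side is the planar Helmholtz operator in radial form.\<close>

lemma potential_ode:
  assumes a: "1 \<le> a" "a \<le> b" and s: "s \<ge> 0"
  shows "4 * potential a b 1 s + 4 * s * potential a b 2 s + \<mu> * potential a b 0 s = kernel_fam a 0 s - kernel_fam b 0 s"
proof -
  define F where "F n t = scale_int a b n (s + t\<^sup>2)" for n t
  have Fc [continuous_intros]: "continuous_on A (F n)" for A n
    unfolding F_def by (intro continuous_on_compose2[OF smooth_family_continuous[OF smooth_family_scale_int, of UNIV]] continuous_intros) auto
  \<comment> \<open>The boundary terms vanish: at the end points the argument is at least
    \<open>1\<close>, hence at least \<open>1 / a\<^sup>2\<close>.\<close>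
  have F0: "F n t = 0" if "t = 1 \<or> t = -1" for n t
  proof -
    have "1 / a\<^sup>2 \<le> 1" using a by simp
    then show ?thesis unfolding F_def using that s by (intro scale_int_zero a(1)) auto
  qed
  have Fd: "(F n has_real_derivative 2 * t * F (Suc n) t) (at t)" for n t
  proof -
    have d: "(scale_int a b n has_real_derivative scale_int a b (Suc n) (s + t\<^sup>2)) (at (s + t\<^sup>2))"
      using smooth_family_scale_int by (simp add: smooth_family_def)
    have "((\<lambda>t. s + t\<^sup>2) has_real_derivative 2 * t) (at t)" by (auto intro!: derivative_eq_intros)
    from DERIV_chain2[OF d this] show ?thesis by (simp add: F_def[abs_def] mult_ac)
  qed
  have P: "potential a b n s = integral {-1..1} (\<lambda>t. ch t * F n t)" for n
    by (simp add: potential_def F_def)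
  have Pi: "((\<lambda>t. ch t * F n t) has_integral potential a b n s) {-1..1}" for n
    unfolding P by (intro integrable_integral integrable_continuous_interval continuous_intros)
  \<comment> \<open>The integrand of Green's formula: \<mu> times \<open>ch\<close> is the second
    derivative of \<open>ch\<close>, and \<open>2 * F 1 t + 4 * t\<^sup>2 * F 2 t\<close> is that of
    \<open>F 0\<close>. It has an explicit primitive with zero boundary values.\<close>
  let ?D = "\<lambda>t. \<mu> * ch t * F 0 t - ch t * (2 * F 1 t + 4 * t\<^sup>2 * F 2 t)"
  have "((\<lambda>t. sh t * F 0 t - ch t * (2 * t * F 1 t)) has_real_derivative ?D t) (at t)" for t
  proof -
    have "((\<lambda>t. 2 * t * F 1 t) has_real_derivative 2 * F 1 t + 2 * t * (2 * t * F 2 t)) (at t)"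
      using Fd[of 1 t] by (auto intro!: derivative_eq_intros simp: numeral_2_eq_2)
    from DERIV_diff[OF DERIV_mult[OF ch_deriv(2) Fd[of 0 t]] DERIV_mult[OF ch_deriv(1) this]]
    show ?thesis by (simp add: power2_eq_square algebra_simps)
  qed
  then have "(?D has_integral (sh 1 * F 0 1 - ch 1 * (2 * 1 * F 1 1)) - (sh (-1) * F 0 (-1) - ch (-1) * (2 * (-1) * F 1 (-1)))) {-1..1}"
    by (intro fundamental_theorem_of_calculus)
       (auto simp: has_real_derivative_iff_has_vector_derivative[symmetric] intro: has_field_derivative_at_within)
  then have D: "(?D has_integral 0) {-1..1}" by (simp add: F0)
  have "((\<lambda>t. 4 * (ch t * F 1 t) + 4 * s * (ch t * F 2 t) + \<mu> * (ch t * F 0 t) - ?D t) has_integral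
      4 * potential a b 1 s + 4 * s * potential a b 2 s + \<mu> * potential a b 0 s - 0) {-1..1}"
    by (intro has_integral_diff has_integral_add has_integral_mult_right Pi D)
  moreover have "4 * (ch t * F 1 t) + 4 * s * (ch t * F 2 t) + \<mu> * (ch t * F 0 t) - ?D t =
      ch t * (- (a^3 * cutoff 1 ((s + t\<^sup>2) * a\<^sup>2))) - ch t * (- (b^3 * cutoff 1 ((s + t\<^sup>2) * b\<^sup>2)))" for t
  proof -
    have "4 * (ch t * F 1 t) + 4 * s * (ch t * F 2 t) + \<mu> * (ch t * F 0 t) - ?D t =
      ch t * (4 * (s + t\<^sup>2) * scale_int a b 2 (s + t\<^sup>2) + 6 * scale_int a b 1 (s + t\<^sup>2))"
      by (simp add: F_def algebra_simps)
    then show ?thesis unfolding scale_int_ode[OF a(2)] by (simp add: algebra_simps)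
  qed
  ultimately have *: "((\<lambda>t. ch t * (- (a^3 * cutoff 1 ((s + t\<^sup>2) * a\<^sup>2))) - ch t * (- (b^3 * cutoff 1 ((s + t\<^sup>2) * b\<^sup>2)))) has_integral
      4 * potential a b 1 s + 4 * s * potential a b 2 s + \<mu> * potential a b 0 s) {-1..1}" by simp
  have i: "(\<lambda>t. ch t * (- (c^3 * cutoff 1 ((s + t\<^sup>2) * c\<^sup>2)))) integrable_on {-1..1}" for c
    by (intro integrable_continuous_interval continuous_intros)
  have b: "1 \<le> b" using a by simp
  show ?thesis
    using integral_unique[OF *] Henstock_Kurzweil_Integration.integral_diff[OF i[of a] i[of b]]
    by (simp only: kernel_fam_unscaled[OF a(1) s] kernel_fam_unscaled[OF b s])
qed

lemma kernel_fam_zero: "1 \<le> a \<Longrightarrow> s \<ge> 1 / a\<^sup>2 \<Longrightarrow> kernel_fam a n s = 0"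
proof -
  assume a: "1 \<le> a" "s \<ge> 1 / a\<^sup>2"
  then have "1 \<le> s * a\<^sup>2" by (simp add: pos_divide_le_eq)
  then have "cutoff (Suc n) (s * a\<^sup>2 + t\<^sup>2) = 0" for t by (intro cutoff(2) add_increasing2) auto
  then show ?thesis by (simp add: kernel_fam_def)
qed

lemma potential_zero: "1 \<le> a \<Longrightarrow> s \<ge> 1 / a\<^sup>2 \<Longrightarrow> potential a b n s = 0"
proof -
  assume a: "1 \<le> a" "s \<ge> 1 / a\<^sup>2"
  then have "scale_int a b n (s * 1 + t\<^sup>2) = 0" for t by (intro scale_int_zero) (auto intro: add_increasing2)
  then show ?thesis by (simp add: potential_def)
qed

definition kernel :: "real \<Rightarrow> real^2 \<Rightarrow> real" where
  "kernel a y = kernel_fam a 0 (y \<bullet> y)"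

lemma inner_self_ge: "1 \<le> a \<Longrightarrow> 1 / a \<le> norm y \<Longrightarrow> 1 / a\<^sup>2 \<le> y \<bullet> (y::real^2)"
  using power_mono[of "1 / a" "norm y" 2] by (simp add: power_divide dot_square_norm)

lemma kernel_zero: "1 \<le> a \<Longrightarrow> 1 / a \<le> norm y \<Longrightarrow> kernel a y = 0"
  unfolding kernel_def by (intro kernel_fam_zero inner_self_ge)

lemma kernel_test: "1 \<le> a \<Longrightarrow> cball (z::real^2) (1 / a) \<subseteq> B \<Longrightarrow> (\<lambda>y. kernel a (y - z)) \<in> test_functions B"
  using test_functionsI[OF smooth_radial[OF smooth_family_kernel] compact_cball, of z "1 / a" B]
    kernel_zero[of a "_ - z"] by (auto simp: dist_norm norm_minus_commute kernel_def)

lemma potential_test: "1 \<le> a \<Longrightarrow> cball (z::real^2) (1 / a) \<subseteq> B \<Longrightarrow> (\<lambda>y. potential a b 0 ((y - z) \<bullet> (y - z))) \<in> test_functions B"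
  using test_functionsI[OF smooth_radial[OF smooth_family_potential] compact_cball, of z "1 / a" B]
    potential_zero[OF _ inner_self_ge[of a "_ - z"]] by (auto simp: dist_norm norm_minus_commute)

section \<open>Convolution with the kernels and independence of the scale\<close>

definition conv :: "(real^2 \<Rightarrow> real) \<Rightarrow> real \<Rightarrow> real^2 \<Rightarrow> real" where
  "conv f a z = (LINT y|lborel. f y * kernel a (y - z))"

lemma integrable_times_test:
  assumes f: "integrable lborel f" and \<psi>: "\<psi> \<in> test_functions A"
  shows "integrable lborel (\<lambda>y. f y * \<psi> y)"
proof -
  obtain C where C: "C \<ge> 0" "\<And>x. \<bar>\<psi> x\<bar> \<le> C" using test_functions_bounded[OF \<psi>] by metis
  show ?thesis
  proof (rule Bochner_Integration.integrable_bound[OF integrable_mult_right[OF f, of C]])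
    show "(\<lambda>y. f y * \<psi> y) \<in> borel_measurable lborel"
      using borel_measurable_integrable[OF f] test_functions_measurable[OF \<psi>] by (intro borel_measurable_times) auto
    have "\<bar>f y\<bar> * \<bar>\<psi> y\<bar> \<le> \<bar>f y\<bar> * C" for y by (intro mult_left_mono C) auto
    then show "AE y in lborel. norm (f y * \<psi> y) \<le> norm (C * f y)"
      using C(1) by (intro always_eventually allI) (simp add: abs_mult mult.commute)
  qed
qed

text \<open>The difference of the two kernels is the image of a test function under the Helmholtz operator.\<close>

lemma conv_eq:
  assumes f: "weak_helmholtz \<mu> B f" and a: "1 \<le> a" "a \<le> b" and B: "cball z (1 / a) \<subseteq> B"
  shows "conv f a z = conv f b z"
proof -
  define \<Phi> where "\<Phi> y = potential a b 0 ((y - z) \<bullet> (y - z))" for y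
  have \<Phi>: "\<Phi> \<in> test_functions B" unfolding \<Phi>_def using potential_test[OF a(1) B] .
  have "1 / b \<le> 1 / a" using a by (intro divide_left_mono) auto
  then have Bb: "cball z (1 / b) \<subseteq> B" using B subset_cball by blast
  have e: "laplacian \<Phi> y + \<mu> * \<Phi> y = kernel a (y - z) - kernel b (y - z)" for y
  proof -
    have "laplacian \<Phi> y = 4 * potential a b 1 ((y - z) \<bullet> (y - z)) + 4 * ((y - z) \<bullet> (y - z)) * potential a b 2 ((y - z) \<bullet> (y - z))"
      unfolding \<Phi>_def laplacian_radial[OF smooth_family_potential] by (simp add: numeral_2_eq_2)
    then show ?thesis unfolding kernel_def \<Phi>_def using potential_ode[OF a, of "(y - z) \<bullet> (y - z)"] by simp
  qed
  have "(LINT y|lborel. f y * (laplacian \<Phi> y + \<mu> * \<Phi> y)) = 0"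
    using f \<Phi> by (auto simp: weak_helmholtz_def)
  then have "(LINT y|lborel. f y * kernel a (y - z) - f y * kernel b (y - z)) = 0"
    by (simp only: e right_diff_distrib)
  moreover have "integrable lborel (\<lambda>y. f y * kernel a (y - z))" "integrable lborel (\<lambda>y. f y * kernel b (y - z))"
    using f a by (auto simp: weak_helmholtz_def intro!: integrable_times_test kernel_test[OF _ B] kernel_test[OF _ Bb])
  ultimately show ?thesis by (simp add: conv_def)
qed

text \<open>The radial profile on a product space of dimension three. Through
  \<open>kernel_profile\<close>, estimates for the planar kernels of all scales follow from those
  for this one fixed test function.\<close>

definition profile :: "(real^2) \<times> real \<Rightarrow> real" where
  "profile q = - cutoff 1 (q \<bullet> q)"

lemma profile_test: "profile \<in> test_functions UNIV"
proof (rule test_functionsI[of _ "cball 0 1"])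
  have "smooth_family (\<lambda>n s. - cutoff (Suc n) s)"
    using cutoff(1) by (auto simp: smooth_family_def intro: DERIV_minus)
  from smooth_radial[OF this, of 0 0] show "smooth profile" by (simp add: profile_def[abs_def])
  fix q :: "(real^2) \<times> real" assume "q \<notin> cball 0 1"
  then have "1 \<le> norm q" by simp
  then have "1 \<le> q \<bullet> q" using power_mono[of 1 "norm q" 2] by (simp add: dot_square_norm)
  then show "profile q = 0" by (simp add: profile_def cutoff(2))
qed auto

lemma profile_nonneg: "profile q \<ge> 0" using cutoff(3) by (simp add: profile_def)

lemma profile_cont [continuous_intros]: "continuous_on A f \<Longrightarrow> continuous_on A (\<lambda>x. profile (f x))"
  unfolding profile_def by (intro continuous_intros; assumption)

lemma kernel_profile: "kernel a y = integral {-1..1} (\<lambda>t. a\<^sup>2 * ch (t / a) * profile (a *\<^sub>R y, t))"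
  unfolding kernel_def kernel_fam_def profile_def
  by (intro integral_cong) (simp add: power2_eq_square mult_ac)

text \<open>By \<open>kernel_profile\<close>, a step \<open>h\<close> for \<open>kernel a\<close> is
  a step \<open>(a *\<^sub>R h, 0)\<close> for the profile, so the bound for the profile applies
  with \<open>a * norm h\<close>; the prefactor \<open>a\<^sup>2\<close> accounts for the exponent
  \<open>r + 2\<close>.\<close>

lemma kernel_finite_difference:
  "\<exists>C\<ge>0. \<forall>a\<ge>1. \<forall>h y. \<bar>finite_difference r h (kernel a) y\<bar> \<le> C * a ^ (r + 2) * norm h ^ r"
proof -
  obtain C where C: "C \<ge> 0" "\<And>h q. \<bar>finite_difference r h profile q\<bar> \<le> C * norm h ^ r"
    using test_finite_difference_bound[OF profile_test] by metis
  have "\<bar>finite_difference r h (kernel a) y\<bar> \<le> (2 * ch 1 * C) * a ^ (r + 2) * norm h ^ r" if a: "a \<ge> 1" for a h y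
  proof -
    let ?g = "\<lambda>t. a\<^sup>2 * ch (t / a) * finite_difference r (a *\<^sub>R h, 0) profile (a *\<^sub>R y, t)"
    have "((\<lambda>t. \<Sum>k\<le>r. ((-1) ^ (r - k) * real (r choose k)) * (a\<^sup>2 * ch (t / a) * profile (a *\<^sub>R (y + real k *\<^sub>R h), t))) has_integral
       (\<Sum>k\<le>r. ((-1) ^ (r - k) * real (r choose k)) * kernel a (y + real k *\<^sub>R h))) {-1..1}"
      unfolding kernel_profile using a
      by (intro has_integral_sum has_integral_mult_right integrable_integral integrable_continuous_interval continuous_intros) auto
    moreover have "(\<Sum>k\<le>r. ((-1) ^ (r - k) * real (r choose k)) * (a\<^sup>2 * ch (t / a) * profile (a *\<^sub>R (y + real k *\<^sub>R h), t))) = ?g t" for t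
      unfolding finite_difference_def sum_distrib_left
      by (intro sum.cong refl) (simp add: algebra_simps scaleR_add_right)
    ultimately have hi: "(?g has_integral finite_difference r h (kernel a) y) {-1..1}"
      by (simp add: finite_difference_def)
    \<comment> \<open>The interval of integration has length \<open>2\<close>, and
      \<open>ch (t / a) \<le> ch 1\<close> because \<open>a \<ge> 1\<close>.\<close>
    have "norm (finite_difference r h (kernel a) y) \<le> (a\<^sup>2 * ch 1 * (C * (a * norm h) ^ r)) * measure lborel (cbox (-1) (1::real))"
    proof (rule has_integral_bound[OF _ hi[folded cbox_interval]])
      show "0 \<le> a\<^sup>2 * ch 1 * (C * (a * norm h) ^ r)" using a C(1) ch_bounds(1)[of 1] by auto
      fix t assume "t \<in> cbox (-1) (1::real)"
      then have t: "\<bar>t / a\<bar> \<le> 1" using a by (auto simp: abs_le_iff divide_le_eq le_divide_eq)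
      have "\<bar>finite_difference r (a *\<^sub>R h, 0) profile (a *\<^sub>R y, t)\<bar> \<le> C * (a * norm h) ^ r"
        using C(2)[of "(a *\<^sub>R h, 0)" "(a *\<^sub>R y, t)"] a by (simp add: norm_Pair)
      then show "norm (?g t) \<le> a\<^sup>2 * ch 1 * (C * (a * norm h) ^ r)"
        using ch_bounds(1)[of "t / a"] ch_bounds(2)[OF t] by (auto simp: abs_mult intro!: mult_mono)
    qed
    also have "\<dots> = (2 * ch 1 * C) * a ^ (r + 2) * norm h ^ r"
      by (simp add: power_mult_distrib power_add power2_eq_square mult_ac)
    finally show ?thesis by simp
  qed
  moreover have "2 * ch 1 * C \<ge> 0" using C(1) ch_bounds(1)[of 1] by simp
  ultimately show ?thesis by blast
qed

end

subsection \<open>Geometry of polygonal domains\<close>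

lemma real2_eq_iff: "(x::real^2) = y \<longleftrightarrow> x $ 1 = y $ 1 \<and> x $ 2 = y $ 2"
  by (auto simp: vec_eq_iff forall_2)

lemma inner_real2: "(x::real^2) \<bullet> y = x $ 1 * y $ 1 + x $ 2 * y $ 2"
  by (simp add: inner_vec_def sum_2)

text \<open>In coordinates rotated by \<phi> the sector consists of the polar angles between
  \<open>0\<close> and \<open>pi\<close>, which means a positive second coordinate;
  \<open>vector [- sin \<phi>, cos \<phi>]\<close> is the second rotated basis vector.\<close>

lemma sector_pi:
  "sector y \<phi> pi = {z. (z - y) \<bullet> vector [- sin \<phi>, cos \<phi>] > 0}"
proof (intro set_eqI iffI)
  fix z assume "z \<in> sector y \<phi> pi"
  then obtain \<rho> t where z: "z = y + vector [\<rho> * cos t, \<rho> * sin t]" "0 < \<rho>" "\<phi> < t" "t < \<phi> + pi"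
    by (auto simp: sector_def)
  have "(z - y) \<bullet> vector [- sin \<phi>, cos \<phi>] = \<rho> * sin (t - \<phi>)"
    by (simp add: z inner_real2 vector_2 sin_diff algebra_simps)
  moreover have "sin (t - \<phi>) > 0" using z by (intro sin_gt_zero) auto
  ultimately show "z \<in> {z. (z - y) \<bullet> vector [- sin \<phi>, cos \<phi>] > 0}" using z by simp
next
  fix z assume "z \<in> {z. (z - y) \<bullet> vector [- sin \<phi>, cos \<phi>] > 0}"
  define X Y where "X = (z - y) $ 1" and "Y = (z - y) $ 2"
  from \<open>z \<in> _\<close> have pos: "- sin \<phi> * X + cos \<phi> * Y > 0" by (simp add: inner_real2 vector_2 mult.commute X_def Y_def)
  \<comment> \<open>\<open>c\<close> and \<open>s\<close> are the coordinates with respect to the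
    rotated basis.\<close>
  define c where "c = cos \<phi> * X + sin \<phi> * Y"
  define s where "s = - sin \<phi> * X + cos \<phi> * Y"
  define \<rho> where "\<rho> = sqrt (c\<^sup>2 + s\<^sup>2)"
  have s: "s > 0" using pos by (simp add: s_def)
  have \<rho>: "\<rho> > 0" unfolding \<rho>_def using s by (simp add: add_nonneg_pos)
  have "(c / \<rho>)\<^sup>2 + (s / \<rho>)\<^sup>2 = 1"
  proof -
    have "(c / \<rho>)\<^sup>2 + (s / \<rho>)\<^sup>2 = (c\<^sup>2 + s\<^sup>2) / \<rho>\<^sup>2" by (simp add: power_divide add_divide_distrib)
    also have "\<rho>\<^sup>2 = c\<^sup>2 + s\<^sup>2" unfolding \<rho>_def by simp
    finally show ?thesis using \<rho> s by (simp add: sum_power2_eq_zero_iff)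
  qed
  then obtain u where u: "0 \<le> u" "u \<le> pi" "c / \<rho> = cos u" "s / \<rho> = sin u"
    using sincos_total_pi[of "s / \<rho>" "c / \<rho>"] s \<rho> by auto
  have "sin u > 0" using u s \<rho> by (metis divide_pos_pos)
  then have u': "0 < u" "u < pi" using u by (metis less_eq_real_def sin_zero sin_pi order_less_irrefl)+
  have c: "c = \<rho> * cos u" "s = \<rho> * sin u" using u \<rho> by (simp_all add: field_simps)
  have sc: "cos \<phi> * cos \<phi> + sin \<phi> * sin \<phi> = 1" using sin_cos_squared_add[of \<phi>] by (simp add: power2_eq_square)
  have "cos \<phi> * c - sin \<phi> * s = (cos \<phi> * cos \<phi> + sin \<phi> * sin \<phi>) * X"
    unfolding c_def s_def by algebra
  then have "X = \<rho> * cos (\<phi> + u)"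
    unfolding sc by (simp add: c cos_add right_diff_distrib mult.left_commute)
  then have 1: "(z - y) $ 1 = \<rho> * cos (\<phi> + u)" by (simp only: X_def)
  have "sin \<phi> * c + cos \<phi> * s = (cos \<phi> * cos \<phi> + sin \<phi> * sin \<phi>) * Y"
    unfolding c_def s_def by algebra
  then have "Y = \<rho> * sin (\<phi> + u)"
    unfolding sc by (simp add: c sin_add distrib_left mult.left_commute)
  then have 2: "(z - y) $ 2 = \<rho> * sin (\<phi> + u)" by (simp only: Y_def)
  have "z = y + vector [\<rho> * cos (\<phi> + u), \<rho> * sin (\<phi> + u)]"
    using 1 2 by (simp add: real2_eq_iff vector_2 algebra_simps)
  then show "z \<in> sector y \<phi> pi" unfolding sector_def using \<rho> u' by force
qed

lemma norm_vector_sin_cos: "norm (vector [- sin \<phi>, cos \<phi>] :: real^2) = 1"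
  by (simp add: norm_eq_sqrt_inner inner_real2 vector_2 power2_eq_square[symmetric])

lemma sector_cone:
  assumes "0 < l" "v + z \<in> sector v \<phi> \<theta>"
  shows "v + l *\<^sub>R z \<in> sector v \<phi> \<theta>"
proof -
  from assms(2) obtain \<rho> t where z: "z = vector [\<rho> * cos t, \<rho> * sin t]" "0 < \<rho>" "\<phi> < t" "t < \<phi> + \<theta>"
    by (auto simp: sector_def)
  have "l *\<^sub>R z = vector [(l * \<rho>) * cos t, (l * \<rho>) * sin t]"
    by (simp add: z(1) real2_eq_iff vector_2)
  then have "v + l *\<^sub>R z = v + vector [(l * \<rho>) * cos t, (l * \<rho>) * sin t]" by (simp only:)
  then show ?thesis unfolding sector_def mem_Collect_eq using z(2-4) assms(1) mult_pos_pos by blast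
qed

text \<open>The half-plane may contain the whole ball.\<close>

definition flat_on :: "(real^2) set \<Rightarrow> real^2 \<Rightarrow> real \<Rightarrow> bool" where
  "flat_on \<Omega> x r \<longleftrightarrow> (\<exists>\<nu> \<beta>. norm \<nu> = 1 \<and> \<Omega> \<inter> ball x r = {y \<in> ball x r. y \<bullet> \<nu> > \<beta>})"

lemma flat_on_mono:
  assumes "flat_on \<Omega> x r" "ball y s \<subseteq> ball x r"
  shows "flat_on \<Omega> y s"
proof -
  from assms(1) obtain \<nu> \<beta> where n: "norm \<nu> = 1" "\<Omega> \<inter> ball x r = {y \<in> ball x r. y \<bullet> \<nu> > \<beta>}"
    by (auto simp: flat_on_def)
  have "\<Omega> \<inter> ball y s = {z \<in> ball y s. z \<bullet> \<nu> > \<beta>}" using n(2) assms(2) by blast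
  then show ?thesis using n(1) by (auto simp: flat_on_def)
qed

text \<open>Near a vertex the domain is a cone, so a homothety centred at the vertex carries
  half-plane pictures to half-plane pictures and scales the radius. The cone property enters with
  the factor \<open>l\<close> and with \<open>1 / l\<close>, one for each inclusion.\<close>

lemma flat_on_scale:
  fixes v :: "real^2"
  assumes cone: "\<And>l z. 0 < l \<Longrightarrow> norm z < r \<Longrightarrow> norm (l *\<^sub>R z) < r \<Longrightarrow> v + z \<in> \<Omega> \<Longrightarrow> v + l *\<^sub>R z \<in> \<Omega>"
    and flat: "flat_on \<Omega> (v + z) s" and sub: "ball (v + z) s \<subseteq> ball v r" and l: "0 < l" "l \<le> 1"
  shows "flat_on \<Omega> (v + l *\<^sub>R z) (l * s)"
proof -
  from flat obtain \<nu> \<beta> where n: "norm \<nu> = 1" "\<Omega> \<inter> ball (v + z) s = {y \<in> ball (v + z) s. y \<bullet> \<nu> > \<beta>}"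
    by (auto simp: flat_on_def)
  \<comment> \<open>The inverse homothety, leading back to the ball around
    \<open>v + z\<close>.\<close>
  define g where "g y = v + (1 / l) *\<^sub>R (y - v)" for y
  have g: "g y \<in> ball (v + z) s \<longleftrightarrow> y \<in> ball (v + l *\<^sub>R z) (l * s)" for y
  proof -
    have e: "v + z - g y = (1 / l) *\<^sub>R (v + l *\<^sub>R z - y)" using l by (simp add: g_def algebra_simps)
    have "dist (v + z) (g y) = dist (v + l *\<^sub>R z) y / l" unfolding dist_norm e using l by simp
    then show ?thesis using l by (simp add: pos_divide_less_eq mult.commute)
  qed
  have gi: "g y \<bullet> \<nu> > \<beta> \<longleftrightarrow> y \<bullet> \<nu> > l * \<beta> + (1 - l) * (v \<bullet> \<nu>)" for y
  proof -
    have "l * (g y \<bullet> \<nu>) = y \<bullet> \<nu> - (1 - l) * (v \<bullet> \<nu>)"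
      using l by (simp add: g_def inner_add_left inner_diff_left algebra_simps)
    moreover have "g y \<bullet> \<nu> > \<beta> \<longleftrightarrow> l * (g y \<bullet> \<nu>) > l * \<beta>" using l by simp
    ultimately show ?thesis by linarith
  qed
  have m: "g y \<in> \<Omega> \<longleftrightarrow> y \<in> \<Omega>" if "g y \<in> ball (v + z) s" for y
  proof -
    have "g y \<in> ball v r" using that sub by blast
    then have 1: "norm ((1 / l) *\<^sub>R (y - v)) < r" by (simp add: g_def dist_norm)
    have 2: "norm (y - v) < r"
    proof -
      have "norm (y - v) \<le> norm ((1 / l) *\<^sub>R (y - v))"
        using l by (simp add: pos_le_divide_eq mult_left_le)
      then show ?thesis using 1 by linarith
    qed
    show ?thesis
      using cone[of "1 / l" "y - v"] cone[of l "(1 / l) *\<^sub>R (y - v)"] 1 2 l by (auto simp: g_def)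
  qed
  have "\<Omega> \<inter> ball (v + l *\<^sub>R z) (l * s) = {y \<in> ball (v + l *\<^sub>R z) (l * s). y \<bullet> \<nu> > l * \<beta> + (1 - l) * (v \<bullet> \<nu>)}"
    using n(2) g gi m by blast
  then show ?thesis using n(1) unfolding flat_on_def by blast
qed

lemma polygonal_domainD:
  assumes "polygonal_domain \<Omega> d x \<theta>"
  shows "open \<Omega>" "bounded \<Omega>" "\<Omega> \<noteq> {}"
    "\<exists>E \<subseteq> x ` {1..d} \<times> x ` {1..d}. frontier \<Omega> = (\<Union>(a, b)\<in>E. closed_segment a b)"
    "\<And>v. v \<in> x ` {1..d} \<Longrightarrow> v \<in> frontier \<Omega> \<and> (\<exists>\<theta>. local_angle \<Omega> v \<theta>)"
    "\<And>y. y \<in> frontier \<Omega> - x ` {1..d} \<Longrightarrow> local_angle \<Omega> y pi"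
  using assms unfolding polygonal_domain_def by blast+

lemma flat_on_pointwise:
  assumes "polygonal_domain \<Omega> d x \<theta>" "y \<in> closure \<Omega>" "y \<notin> x ` {1..d}"
  shows "\<exists>r>0. flat_on \<Omega> y r"
proof (cases "y \<in> \<Omega>")
  case True
  have "open \<Omega>" by (rule polygonal_domainD(1)[OF assms(1)])
  then obtain r where r: "r > 0" "ball y r \<subseteq> \<Omega>"
    using True by (meson open_contains_ball)
  \<comment> \<open>At an interior point any direction will do, with an offset so low that the
    half-plane contains the whole ball.\<close>
  define \<nu> :: "real^2" where "\<nu> = axis 1 1"
  have \<nu>: "norm \<nu> = 1" by (simp add: \<nu>_def)
  have "z \<bullet> \<nu> > y \<bullet> \<nu> - r" if "z \<in> ball y r" for z
  proof -
    have "(y - z) \<bullet> \<nu> \<le> norm (y - z) * norm \<nu>" by (rule norm_cauchy_schwarz)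
    then show ?thesis using that \<nu> by (simp add: dist_norm inner_diff_left)
  qed
  then have "\<Omega> \<inter> ball y r = {z \<in> ball y r. z \<bullet> \<nu> > y \<bullet> \<nu> - r}" using r(2) by blast
  then show ?thesis using r(1) \<nu> unfolding flat_on_def by blast
next
  case False
  have "open \<Omega>" by (rule polygonal_domainD(1)[OF assms(1)])
  then have "y \<in> frontier \<Omega> - x ` {1..d}" using assms False by (auto simp: frontier_def interior_open)
  then have "local_angle \<Omega> y pi" by (rule polygonal_domainD(6)[OF assms(1)])
  then obtain r \<phi> where r: "r > 0" "\<Omega> \<inter> ball y r = sector y \<phi> pi \<inter> ball y r" by (auto simp: local_angle_def)
  have "\<Omega> \<inter> ball y r = {z \<in> ball y r. z \<bullet> vector [- sin \<phi>, cos \<phi>] > y \<bullet> vector [- sin \<phi>, cos \<phi>]}"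
  proof -
    have "z \<in> sector y \<phi> pi \<longleftrightarrow> z \<bullet> vector [- sin \<phi>, cos \<phi>] > y \<bullet> vector [- sin \<phi>, cos \<phi>]" for z
      unfolding sector_pi by (simp add: inner_diff_left)
    then show ?thesis using r(2) by blast
  qed
  then show ?thesis using r(1) norm_vector_sin_cos unfolding flat_on_def by blast
qed

text \<open>The radius \<open>e\<close> is a Lebesgue number of the covering by flat balls.\<close>

lemma flat_on_compact:
  assumes "compact K" "\<And>y. y \<in> K \<Longrightarrow> \<exists>r>0. flat_on \<Omega> y r"
  shows "\<exists>e>0. \<forall>y\<in>K. flat_on \<Omega> y e"
proof (cases "K = {}")
  case False
  from assms(2) obtain r where r: "\<And>y. y \<in> K \<Longrightarrow> r y > 0 \<and> flat_on \<Omega> y (r y)" by metis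
  have "K \<subseteq> \<Union>((\<lambda>y. ball y (r y)) ` K)" using r by force
  then obtain e where e: "e > 0" "\<And>y. y \<in> K \<Longrightarrow> \<exists>b\<in>(\<lambda>y. ball y (r y)) ` K. ball y e \<subseteq> b"
    by (rule Heine_Borel_lemma[OF assms(1)]) auto
  have "flat_on \<Omega> y e" if y: "y \<in> K" for y
    using e(2)[OF y] r flat_on_mono by blast
  then show ?thesis using e(1) by blast
qed (auto intro: exI[of _ 1])

text \<open>A bounded nonempty set has nonempty frontier, hence there is at least one segment
  between vertices. This guards against the convention that \<open>infdist\<close> to the empty set
  is \<open>0\<close>.\<close>

lemma polygonal_vertices_nonempty:
  assumes "polygonal_domain \<Omega> d x \<theta>"
  shows "x ` {1..d} \<noteq> {}"
proof
  assume e: "x ` {1..d} = {}"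
  obtain E where E: "E \<subseteq> x ` {1..d} \<times> x ` {1..d}" "frontier \<Omega> = (\<Union>(a, b)\<in>E. closed_segment a b)"
    using polygonal_domainD(4)[OF assms] by blast
  then have "frontier \<Omega> = {}" using e by auto
  then have "\<Omega> = {} \<or> \<Omega> = UNIV" by (simp add: frontier_eq_empty)
  then show False using polygonal_domainD(2,3)[OF assms] by auto
qed

text \<open>Away from the vertices a common radius exists by compactness. A point close to a vertex
  is the image, under a homothety towards that vertex, of a point on a fixed circle, which belongs
  to the compact part; the homothety makes the radius proportional to the distance.\<close>

lemma polygonal_flat_on:
  assumes P: "polygonal_domain \<Omega> d x \<theta>"
  defines "V \<equiv> x ` {1..d}"
  shows "\<exists>c>0. \<forall>y\<in>\<Omega>. flat_on \<Omega> y (c * infdist y V)"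
proof -
  have op: "open \<Omega>" and bd: "bounded \<Omega>" and fin: "finite V" and ne: "V \<noteq> {}"
    using polygonal_domainD(1,2)[OF P] polygonal_vertices_nonempty[OF P] by (auto simp: V_def)
  have VF: "v \<in> frontier \<Omega>" if "v \<in> V" for v using polygonal_domainD(5)[OF P] that unfolding V_def by blast
  have "\<exists>r>0. \<exists>\<phi> \<theta>. \<Omega> \<inter> ball v r = sector v \<phi> \<theta> \<inter> ball v r" if "v \<in> V" for v
    using polygonal_domainD(5)[OF P] that unfolding V_def local_angle_def by blast
  then obtain r0 where r0: "\<And>v. v \<in> V \<Longrightarrow> r0 v > 0 \<and> (\<exists>\<phi> \<theta>. \<Omega> \<inter> ball v (r0 v) = sector v \<phi> \<theta> \<inter> ball v (r0 v))"
    by metis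
  obtain sep where sep: "sep > 0" "\<And>v w. v \<in> V \<Longrightarrow> w \<in> V \<Longrightarrow> v \<noteq> w \<Longrightarrow> sep \<le> dist v w"
  proof -
    have "\<forall>v. \<exists>d>0. \<forall>w\<in>V. w \<noteq> v \<longrightarrow> d \<le> dist v w" using finite_set_avoid[OF fin] by blast
    then obtain dd where dd: "\<And>v. dd v > 0 \<and> (\<forall>w\<in>V. w \<noteq> v \<longrightarrow> dd v \<le> dist v w)" by metis
    show thesis
    proof (rule that[of "Min (dd ` V)"])
      have "\<forall>a\<in>dd ` V. 0 < a" using dd by blast
      then show "Min (dd ` V) > 0" using fin ne by (subst Min_gr_iff) simp_all
      show "Min (dd ` V) \<le> dist v w" if "v \<in> V" "w \<in> V" "v \<noteq> w" for v w
      proof -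
        have "Min (dd ` V) \<le> dd v" by (rule Min_le) (use fin that in auto)
        also have "dd v \<le> dist v w" using dd[of v, THEN conjunct2] that by auto
        finally show ?thesis .
      qed
    qed
  qed
  \<comment> \<open>At most half of the separation: a point at distance \<open>r / 2\<close> from
    one vertex then has distance at least \<open>sep - r / 2\<close>, hence at least
    \<open>r / 2\<close>, from all others.\<close>
  define r where "r = min (sep / 2) (Min (r0 ` V))"
  have "\<forall>a\<in>r0 ` V. 0 < a" by (intro ballI, elim imageE, hypsubst, rule r0[THEN conjunct1])
  moreover have "finite (r0 ` V)" "r0 ` V \<noteq> {}" using fin ne by auto
  ultimately have "Min (r0 ` V) > 0" using Min_gr_iff[of "r0 ` V" 0] by blast
  then have r: "r > 0" "r \<le> sep / 2" using sep(1) by (simp_all add: r_def)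
  have rr0: "r \<le> r0 v" if "v \<in> V" for v
    unfolding r_def by (rule min.coboundedI2) (use that fin in auto)
  have cone: "v + l *\<^sub>R z \<in> \<Omega>" if "v \<in> V" "0 < l" "norm z < r" "norm (l *\<^sub>R z) < r" "v + z \<in> \<Omega>" for v l z
  proof -
    obtain \<phi> \<theta> where s: "\<Omega> \<inter> ball v (r0 v) = sector v \<phi> \<theta> \<inter> ball v (r0 v)" using r0[OF \<open>v \<in> V\<close>] by blast
    have b: "v + z \<in> ball v (r0 v)" "v + l *\<^sub>R z \<in> ball v (r0 v)"
      using that rr0[OF that(1)] by (simp_all add: dist_norm)
    then have "v + z \<in> sector v \<phi> \<theta>" using s that(5) by blast
    then have "v + l *\<^sub>R z \<in> sector v \<phi> \<theta>" by (rule sector_cone[OF that(2)])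
    then show ?thesis using s b by blast
  qed
  define K1 where "K1 = closure \<Omega> - (\<Union>v\<in>V. ball v (r / 2))"
  have "compact K1" unfolding K1_def using bd by (intro compact_diff) (auto simp: compact_closure)
  moreover have "\<exists>r>0. flat_on \<Omega> y r" if "y \<in> K1" for y
    using that r(1) by (intro flat_on_pointwise[OF P]) (auto simp: K1_def V_def)
  ultimately obtain e where e: "e > 0" "\<And>y. y \<in> K1 \<Longrightarrow> flat_on \<Omega> y e" using flat_on_compact by metis
  obtain B where B: "\<And>y. y \<in> \<Omega> \<Longrightarrow> norm y \<le> B" using bd by (auto simp: bounded_iff)
  obtain v0 where v0: "v0 \<in> V" using ne by blast
  define D where "D = B + norm v0 + 1"
  have D: "infdist y V \<le> D" "D > 0" if "y \<in> \<Omega>" for y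
  proof -
    have "infdist y V \<le> dist y v0" by (rule infdist_le[OF v0])
    also have "\<dots> \<le> norm y + norm v0" by (simp add: dist_norm norm_triangle_ineq4)
    finally show "infdist y V \<le> D" using B[OF that] by (simp add: D_def)
    show "D > 0" using B[OF that] norm_ge_zero[of y] norm_ge_zero[of v0] unfolding D_def by linarith
  qed
  have Dp: "D > 0" using D(2) polygonal_domainD(3)[OF P] by blast
  \<comment> \<open>The bound \<open>r / 2\<close> keeps the ball of radius \<open>e1\<close> around
    a point of the circle inside \<open>ball v r\<close>, where the cone property holds.\<close>
  define e1 where "e1 = min e (r / 2)"
  have e1: "e1 > 0" using e r by (simp add: e1_def)
  \<comment> \<open>The first bound serves points far from the vertices, whose distance is at most
    \<open>D\<close>; the second one matches the homothety factor \<open>l\<close>, the distance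
    divided by \<open>r / 2\<close>.\<close>
  define c where "c = min (e1 / D) (e1 / (r / 2))"
  have c: "c > 0" using e1 Dp r by (simp add: c_def)
  have "flat_on \<Omega> y (c * infdist y V)" if y: "y \<in> \<Omega>" for y
  proof (cases "\<exists>v\<in>V. y \<in> ball v (r / 2)")
    case False
    then have "y \<in> K1" using y closure_subset by (auto simp: K1_def)
    moreover have "c * infdist y V \<le> e"
    proof -
      have "c * infdist y V \<le> (e1 / D) * D" using D[OF y] e1 infdist_nonneg by (intro mult_mono) (auto simp: c_def)
      then show ?thesis using Dp by (simp add: e1_def)
    qed
    ultimately show ?thesis using e(2) flat_on_mono subset_ball by blast
  next
    case True
    then obtain v where v: "v \<in> V" "dist v y < r / 2" by auto
    have "v \<notin> \<Omega>" using VF[OF v(1)] op by (auto simp: frontier_def interior_open)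
    then have vy: "y \<noteq> v" using y by auto
    define l where "l = norm (y - v) / (r / 2)"
    define z where "z = (1 / l) *\<^sub>R (y - v)"
    have l: "0 < l" "l \<le> 1" using vy v(2) r by (auto simp: l_def dist_norm norm_minus_commute)
    have yz: "y = v + l *\<^sub>R z" using l by (simp add: z_def)
    have nz: "norm z = r / 2"
    proof -
      have "norm z = norm (y - v) / l" using l by (simp add: z_def)
      then show ?thesis using vy r by (simp add: l_def)
    qed
    have zO: "v + z \<in> \<Omega>"
      unfolding z_def using l v y nz r by (intro cone) (auto simp: dist_norm norm_minus_commute z_def[symmetric])
    have "v + z \<in> K1"
    proof -
      have "v + z \<notin> ball w (r / 2)" if "w \<in> V" for w
      proof (cases "w = v")
        case True then show ?thesis using nz by (simp add: dist_norm)
      next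
        case False
        then have "sep \<le> dist v w" using sep(2) v that by auto
        also have "\<dots> \<le> dist v (v + z) + dist (v + z) w" by (rule dist_triangle)
        also have "dist v (v + z) = r / 2" using nz by (simp add: dist_norm)
        finally show ?thesis using r by (simp add: dist_commute)
      qed
      then show ?thesis using zO closure_subset by (auto simp: K1_def)
    qed
    then have "flat_on \<Omega> (v + z) e1" using e(2) flat_on_mono[OF _ subset_ball[of e1 e]] by (auto simp: e1_def)
    moreover have "ball (v + z) e1 \<subseteq> ball v r"
    proof
      fix u assume "u \<in> ball (v + z) e1"
      then have "dist (v + z) u < r / 2" by (simp add: e1_def)
      moreover have "dist v u \<le> dist v (v + z) + dist (v + z) u" by (rule dist_triangle)
      moreover have "dist v (v + z) = r / 2" using nz by (simp add: dist_norm)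
      ultimately show "u \<in> ball v r" by simp
    qed
    ultimately have "flat_on \<Omega> (v + l *\<^sub>R z) (l * e1)"
      using flat_on_scale[of r v \<Omega> z e1 l] cone[OF v(1)] l by blast
    moreover have "c * infdist y V \<le> l * e1"
    proof -
      have "infdist y V \<le> norm (y - v)" using infdist_le[OF v(1), of y] by (simp add: dist_norm)
      then have "c * infdist y V \<le> (e1 / (r / 2)) * norm (y - v)"
        using e1 r infdist_nonneg by (intro mult_mono) (auto simp: c_def)
      then show ?thesis by (simp add: l_def mult_ac)
    qed
    ultimately show ?thesis using yz flat_on_mono subset_ball by metis
  qed
  then show ?thesis using c by blast
qed

text \<open>If the boundary line is at distance at least \<open>R\<close>, the ball lies inside.
  Otherwise \<open>p\<close> is the foot of the perpendicular from \<open>x\<close>, and the ball of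
  radius \<open>3 * R\<close> around it fits into the one of radius \<open>4 * R\<close> around
  \<open>x\<close>. This leaves space for kernels of radius \<open>R / 2\<close> at points within
  \<open>R / 2\<close> of \<open>x\<close>.\<close>

lemma flat_on_dichotomy:
  assumes "open \<Omega>" "x \<in> \<Omega>" "flat_on \<Omega> x (4 * R)" "R > 0"
  obtains "ball x R \<subseteq> \<Omega>"
  | p \<nu> where "norm \<nu> = 1" "dist x p < R" "\<Omega> \<inter> ball p (3 * R) = {y \<in> ball p (3 * R). (y - p) \<bullet> \<nu> > 0}"
proof -
  obtain \<nu> \<beta> where n: "norm \<nu> = 1" "\<Omega> \<inter> ball x (4 * R) = {y \<in> ball x (4 * R). y \<bullet> \<nu> > \<beta>}"
    using assms(3) by (auto simp: flat_on_def)
  have "x \<in> \<Omega> \<inter> ball x (4 * R)" using assms(2,4) by simp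
  then have xi: "x \<bullet> \<nu> > \<beta>" unfolding n(2) by simp
  show thesis
  proof (cases "x \<bullet> \<nu> - \<beta> \<ge> R")
    case True
    have "ball x R \<subseteq> \<Omega>"
    proof
      fix y assume y: "y \<in> ball x R"
      have "(x - y) \<bullet> \<nu> \<le> norm (x - y) * norm \<nu>" by (rule norm_cauchy_schwarz)
      then have "y \<bullet> \<nu> > \<beta>" using y True n(1) by (simp add: dist_norm inner_diff_left)
      moreover have "y \<in> ball x (4 * R)" using y assms(4) by simp
      ultimately show "y \<in> \<Omega>" using n(2) by blast
    qed
    then show ?thesis by (rule that(1))
  next
    case False
    define p where "p = x - (x \<bullet> \<nu> - \<beta>) *\<^sub>R \<nu>"
    have "\<nu> \<bullet> \<nu> = 1" using n(1) by (simp add: dot_square_norm)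
    then have p\<nu>: "p \<bullet> \<nu> = \<beta>" by (simp add: p_def inner_diff_left)
    have d: "dist x p < R" using False xi n(1) by (simp add: p_def dist_norm)
    have sub: "ball p (3 * R) \<subseteq> ball x (4 * R)"
    proof
      fix y assume "y \<in> ball p (3 * R)"
      then show "y \<in> ball x (4 * R)" using d dist_triangle[of x y p] by simp
    qed
    have "\<Omega> \<inter> ball p (3 * R) = {y \<in> ball p (3 * R). (y - p) \<bullet> \<nu> > 0}"
    proof (intro set_eqI)
      fix y
      show "y \<in> \<Omega> \<inter> ball p (3 * R) \<longleftrightarrow> y \<in> {y \<in> ball p (3 * R). (y - p) \<bullet> \<nu> > 0}"
      proof (cases "y \<in> ball p (3 * R)")
        case True
        then have "y \<in> ball x (4 * R)" using sub by blast
        then have "y \<in> \<Omega> \<longleftrightarrow> y \<bullet> \<nu> > \<beta>" using n(2) by blast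
        then show ?thesis using True p\<nu> by (simp add: inner_diff_left)
      qed blast
    qed
    then show ?thesis by (rule that(2)[OF n(1) d])
  qed
qed

lemma lborel_integral_affine:
  fixes f :: "'a::euclidean_space \<Rightarrow> real"
  assumes "c \<noteq> 0" "f \<in> borel_measurable borel"
  shows "(LINT x|lborel. f x) = \<bar>c\<bar> ^ DIM('a) * (LINT x|lborel. f (t + c *\<^sub>R x))"
proof -
  have "(LINT x|lborel. f x) = integral\<^sup>L (density (distr lborel borel (\<lambda>x. t + c *\<^sub>R x)) (\<lambda>_. ennreal (\<bar>c\<bar> ^ DIM('a)))) f"
    using lborel_affine[OF assms(1), of t] by (simp add: ennreal_power)
  also have "\<dots> = (LINT x|distr lborel borel (\<lambda>x. t + c *\<^sub>R x). \<bar>c\<bar> ^ DIM('a) *\<^sub>R f x)"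
    using assms(2) by (intro integral_density) auto
  also have "\<dots> = (LINT x|lborel. \<bar>c\<bar> ^ DIM('a) *\<^sub>R f (t + c *\<^sub>R x))"
    using assms(2) by (intro integral_distr) auto
  finally show ?thesis by simp
qed

lemma compact_in_open_cball:
  assumes "compact K" "open S" "K \<subseteq> S"
  obtains e :: real where "e > 0" "\<And>z::'a::euclidean_space. z \<in> K \<Longrightarrow> cball z e \<subseteq> S"
proof (cases "K = {}")
  case True then show ?thesis using that[of 1] by simp
next
  case False
  obtain e where e: "e > 0" "{x. infdist x K \<le> e} \<subseteq> S"
    using compact_in_open_separated[OF False assms] by metis
  have "cball z e \<subseteq> S" if "z \<in> K" for z
  proof
    fix x assume "x \<in> cball z e"
    then have "infdist x K \<le> e" using infdist_le[OF that, of x] by (simp add: dist_commute)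
    then show "x \<in> S" using e by blast
  qed
  then show ?thesis using that e(1) by blast
qed

subsection \<open>The smooth representative\<close>

context helmholtz_kernel
begin

lemma ch_mono: "\<bar>s\<bar> \<le> x \<Longrightarrow> ch s \<le> ch x"
proof -
  assume *: "\<bar>s\<bar> \<le> x"
  then have "sqrt \<mu> * \<bar>s\<bar> \<le> sqrt \<mu> * x" using \<mu> by (intro mult_left_mono) auto
  moreover have "0 \<le> x" using * by linarith
  ultimately have "cosh (sqrt \<mu> * \<bar>s\<bar>) \<le> cosh (sqrt \<mu> * x)"
    using \<mu> by (subst cosh_real_nonneg_le_iff) auto
  moreover have "cosh (sqrt \<mu> * \<bar>s\<bar>) = cosh (sqrt \<mu> * s)"
    by (cases "s \<ge> 0") (auto simp: cosh_minus[of "sqrt \<mu> * s", symmetric] simp del: cosh_minus)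
  ultimately show "ch s \<le> ch x" by (simp add: ch_def)
qed

text \<open>The limit of \<open>kernel a ((1 / a) *\<^sub>R v) / a\<^sup>2\<close> as
  \<open>a\<close> tends to infinity, when the weight \<open>ch (t / a)\<close> tends to
  \<open>1\<close>. Its integral \<open>mass\<close> is the constant by which the convolutions have
  to be divided.\<close>

definition limit_kernel :: "real^2 \<Rightarrow> real" where
  "limit_kernel v = integral {-1..1} (\<lambda>t. profile (v, t))"

definition mass :: real where "mass = (LINT v|lborel. limit_kernel v)"

lemma limit_kernel_test: "limit_kernel \<in> test_functions UNIV"
proof -
  have f: "smooth_family (\<lambda>n s. - cutoff (Suc n) s)"
    using cutoff(1) by (auto simp: smooth_family_def intro: DERIV_minus)
  have "smooth_family (\<lambda>n s. integral {-1..1} (\<lambda>t. 1 * 1 ^ n * - cutoff (Suc n) (s * 1 + t\<^sup>2)))"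
    by (rule smooth_family_integral[OF f]) (intro continuous_intros)+
  from smooth_radial[OF this, of 0 0]
  have s: "smooth limit_kernel"
    by (simp add: limit_kernel_def[abs_def] profile_def power2_eq_square)
  show ?thesis
  proof (rule test_functionsI[OF s, of "cball 0 1"])
    fix v :: "real^2" assume "v \<notin> cball 0 1"
    then have "1 \<le> norm v" by simp
    then have "1 \<le> v \<bullet> v" using power_mono[of 1 "norm v" 2] by (simp add: dot_square_norm)
    then have "profile (v, t) = 0" for t by (simp add: profile_def cutoff(2) add_increasing2)
    then show "limit_kernel v = 0" by (simp add: limit_kernel_def)
  qed auto
qed

lemma profile_integrable: "continuous_on {-1..1} c \<Longrightarrow> (\<lambda>t. c t * profile (v, t)) integrable_on {-1..1}"
  by (intro integrable_continuous_interval continuous_intros)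

lemma limit_kernel_nonneg: "limit_kernel v \<ge> 0"
  unfolding limit_kernel_def using profile_integrable[of "\<lambda>_. 1" v]
  by (intro Henstock_Kurzweil_Integration.integral_nonneg) (auto intro: profile_nonneg)

text \<open>The weight lies between \<open>1\<close> and \<open>ch (1 / a)\<close> on the interval
  of integration; this yields both the limit of the rescaled kernels and an integrable
  majorant.\<close>

lemma kernel_bounds:
  assumes a: "a \<ge> 1"
  shows "limit_kernel (a *\<^sub>R y) \<le> kernel a y / a\<^sup>2" "kernel a y / a\<^sup>2 \<le> ch (1 / a) * limit_kernel (a *\<^sub>R y)"
proof -
  have cc: "continuous_on {-1..1} (\<lambda>t. ch (t / a))" using a by (intro continuous_intros) auto
  have k: "kernel a y = a\<^sup>2 * integral {-1..1} (\<lambda>t. ch (t / a) * profile (a *\<^sub>R y, t))"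
    unfolding kernel_profile by (subst integral_mult_right[symmetric]) (simp add: mult.assoc)
  then have k: "kernel a y / a\<^sup>2 = integral {-1..1} (\<lambda>t. ch (t / a) * profile (a *\<^sub>R y, t))" using a by simp
  show "limit_kernel (a *\<^sub>R y) \<le> kernel a y / a\<^sup>2"
    unfolding k limit_kernel_def using profile_integrable[of "\<lambda>_. 1" "a *\<^sub>R y"] profile_integrable[OF cc]
  proof (intro integral_le)
    show "profile (a *\<^sub>R y, t) \<le> ch (t / a) * profile (a *\<^sub>R y, t)" for t
      using mult_right_mono[OF ch_bounds(1) profile_nonneg] by simp
  qed auto
  have "integral {-1..1} (\<lambda>t. ch (t / a) * profile (a *\<^sub>R y, t)) \<le> integral {-1..1} (\<lambda>t. ch (1 / a) * profile (a *\<^sub>R y, t))"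
    using profile_integrable[of "\<lambda>_. ch (1 / a)" "a *\<^sub>R y"] profile_integrable[OF cc]
  proof (intro integral_le)
    fix t :: real assume "t \<in> {-1..1}"
    then have "\<bar>t / a\<bar> \<le> 1 / a" using a by (simp add: divide_right_mono abs_le_iff)
    then show "ch (t / a) * profile (a *\<^sub>R y, t) \<le> ch (1 / a) * profile (a *\<^sub>R y, t)"
      by (intro mult_right_mono ch_mono profile_nonneg)
  qed auto
  then show "kernel a y / a\<^sup>2 \<le> ch (1 / a) * limit_kernel (a *\<^sub>R y)" by (simp add: k limit_kernel_def)
qed

lemma mass_pos: "mass > 0"
proof -
  have lb: "exp (-2) * indicator (ball 0 (1/2)) v \<le> limit_kernel v" for v :: "real^2"
  proof (cases "v \<in> ball 0 (1/2)")
    case True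
    then have "norm v < 1 / 2" by simp
    then have v: "v \<bullet> v \<le> 1 / 4" using power_mono[of "norm v" "1/2" 2] by (simp add: dot_square_norm power_divide)
    \<comment> \<open>Where \<open>norm v\<close> and the modulus of \<open>t\<close> are at most
      \<open>1/2\<close>, the argument \<open>x = 1 - (v, t) \<bullet> (v, t)\<close> of the bump
      lies between \<open>1/2\<close> and \<open>1\<close>, hence the constant
      \<open>exp (-2)\<close>. The interval of such \<open>t\<close> has length
      \<open>1\<close>.\<close>
    have p: "exp (-2) \<le> profile (v, t)" if "t \<in> {-1/2..1/2}" for t
    proof -
      have "\<bar>t\<bar> \<le> 1 / 2" using that by auto
      then have "t\<^sup>2 \<le> 1 / 4" using power_mono[of "\<bar>t\<bar>" "1/2" 2] by (simp add: power_divide)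
      then have s: "(v, t) \<bullet> (v, t) \<le> 1 / 2" using v by (simp add: power2_eq_square)
      define x where "x = 1 - (v, t) \<bullet> (v, t)"
      have x: "x \<ge> 1 / 2" "x \<le> 1" unfolding x_def using s inner_ge_zero[of "(v, t)"] by linarith+
      have "1 / x \<le> 2" using x by (simp add: divide_le_eq)
      then have 1: "exp (-2) \<le> exp (- (1 / x))" by simp
      also have "\<dots> \<le> exp (- (1 / x)) / x\<^sup>2"
        using x by (simp add: pos_le_divide_eq power_le_one mult_left_le)
      also have "\<dots> = profile (v, t)" using x by (simp add: profile_def cutoff_def bump_family_1 x_def)
      finally show ?thesis .
    qed
    have "exp (-2) = integral {-1/2..1/2} (\<lambda>t::real. exp (-2 :: real))" by simp
    also have "\<dots> \<le> integral {-1/2..1/2} (\<lambda>t. profile (v, t))"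
      by (intro integral_le p integrable_continuous_interval continuous_intros)
    also have "\<dots> \<le> limit_kernel v" unfolding limit_kernel_def
      by (intro integral_subset_le integrable_continuous_interval continuous_intros) (auto intro: profile_nonneg)
    finally show ?thesis using True by simp
  qed (simp add: limit_kernel_nonneg)
  have em: "emeasure lborel (ball (0::real^2) (1/2)) < \<infinity>" using emeasure_bounded_finite[of "ball 0 (1/2)"] by simp
  have "0 < exp (-2) * measure lborel (ball (0::real^2) (1/2))"
    by (intro mult_pos_pos) (simp_all add: content_ball_pos)
  also have "\<dots> = (LINT v|lborel. exp (-2) * indicator (ball (0::real^2) (1/2)) v)" using em by simp
  also have "\<dots> \<le> mass" unfolding mass_def
    using em lb by (intro integral_mono test_functions_integrable[OF limit_kernel_test] integrable_mult_right integrable_real_indicator) auto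
  finally show ?thesis .
qed

lemma kernel_continuous: "continuous_on UNIV (kernel a)"
  using smooth_continuous[OF smooth_radial[OF smooth_family_kernel, of a 0 0]] by (simp add: kernel_def[abs_def])

lemma kernel_measurable [measurable]: "kernel a \<in> borel_measurable borel"
  by (intro borel_measurable_continuous_onI kernel_continuous)

lemma kernel_bounded:
  assumes "a \<ge> 1" obtains C where "C \<ge> 0" "\<And>y. \<bar>kernel a y\<bar> \<le> C"
  using test_functions_bounded[OF kernel_test[OF assms, of 0 UNIV]] by auto

text \<open>The kernels form an approximate identity up to the factor \<open>mass\<close>.
  Substituting \<open>z = y - (1 / real (Suc n)) *\<^sub>R v\<close> turns the shrinking kernels
  into functions with a fixed majorant, while the argument of \<psi> tends to
  \<open>y\<close>.\<close>

lemma smoothed_test: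
  assumes \<psi>: "\<psi> \<in> test_functions A"
  shows "(\<lambda>n. LINT z|lborel. kernel (real (Suc n)) (y - z) * \<psi> z) \<longlonglongrightarrow> mass * \<psi> y"
    and "\<exists>C\<ge>0. \<forall>n y. \<bar>LINT z|lborel. kernel (real (Suc n)) (y - z) * \<psi> z\<bar> \<le> C"
proof -
  obtain D where D: "D \<ge> 0" "\<And>x. \<bar>\<psi> x\<bar> \<le> D" using test_functions_bounded[OF \<psi>] by metis
  have [measurable]: "\<psi> \<in> borel_measurable borel" "limit_kernel \<in> borel_measurable borel"
    using \<psi> limit_kernel_test by (auto intro: test_functions_measurable)
  have c\<psi>: "continuous_on UNIV \<psi>" using \<psi> by (intro smooth_continuous test_functions_smooth)
  have qi: "integrable lborel limit_kernel" by (rule test_functions_integrable[OF limit_kernel_test])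
  define F where "F n y v = kernel (real (Suc n)) ((1 / real (Suc n)) *\<^sub>R v) / (real (Suc n))\<^sup>2 * \<psi> (y - (1 / real (Suc n)) *\<^sub>R v)" for n y v
  have Fm [measurable]: "F n y \<in> borel_measurable borel" for n y
    unfolding F_def
    by (intro borel_measurable_continuous_onI continuous_intros
         continuous_on_compose2[OF kernel_continuous] continuous_on_compose2[OF c\<psi>]) auto
  have eq: "(LINT z|lborel. kernel (real (Suc n)) (y - z) * \<psi> z) = (LINT v|lborel. F n y v)" for n y
  proof -
    have m: "(\<lambda>z. kernel (real (Suc n)) (y - z) * \<psi> z) \<in> borel_measurable borel" by measurable
    have "(LINT z|lborel. kernel (real (Suc n)) (y - z) * \<psi> z) =
       (1 / real (Suc n))\<^sup>2 * (LINT v|lborel. kernel (real (Suc n)) (y - (y + (- (1 / real (Suc n))) *\<^sub>R v)) * \<psi> (y + (- (1 / real (Suc n))) *\<^sub>R v))"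
      using lborel_integral_affine[OF _ m, of "- (1 / real (Suc n))" y] by simp
    also have "\<dots> = (LINT v|lborel. (1 / real (Suc n))\<^sup>2 * (kernel (real (Suc n)) (y - (y + (- (1 / real (Suc n))) *\<^sub>R v)) * \<psi> (y + (- (1 / real (Suc n))) *\<^sub>R v)))"
      by simp
    also have "\<dots> = (LINT v|lborel. F n y v)"
      by (intro Bochner_Integration.integral_cong refl) (simp add: F_def power_divide del: of_nat_Suc)
    finally show ?thesis .
  qed
  have kb: "limit_kernel v \<le> kernel (real (Suc n)) ((1 / real (Suc n)) *\<^sub>R v) / (real (Suc n))\<^sup>2"
     "kernel (real (Suc n)) ((1 / real (Suc n)) *\<^sub>R v) / (real (Suc n))\<^sup>2 \<le> ch (1 / real (Suc n)) * limit_kernel v" for n v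
    using kernel_bounds[of "real (Suc n)" "(1 / real (Suc n)) *\<^sub>R v"] by auto
  have bd: "\<bar>F n y v\<bar> \<le> ch 1 * D * limit_kernel v" for n y v
  proof -
    have "ch (1 / real (Suc n)) \<le> ch 1" by (rule ch_mono) simp
    then have "kernel (real (Suc n)) ((1 / real (Suc n)) *\<^sub>R v) / (real (Suc n))\<^sup>2 \<le> ch 1 * limit_kernel v"
      using kb(2)[where n=n and v=v] mult_right_mono[OF _ limit_kernel_nonneg, of "ch (1 / real (Suc n))" "ch 1" v] by linarith
    moreover have "0 \<le> kernel (real (Suc n)) ((1 / real (Suc n)) *\<^sub>R v) / (real (Suc n))\<^sup>2"
      using kb(1)[where n=n and v=v] limit_kernel_nonneg[of v] by linarith
    ultimately have "\<bar>kernel (real (Suc n)) ((1 / real (Suc n)) *\<^sub>R v) / (real (Suc n))\<^sup>2\<bar> * \<bar>\<psi> (y - (1 / real (Suc n)) *\<^sub>R v)\<bar> \<le> (ch 1 * limit_kernel v) * D"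
      using D by (intro mult_mono) auto
    then show ?thesis by (simp only: F_def abs_mult mult_ac)
  qed
  have bi: "integrable lborel (\<lambda>v. ch 1 * D * limit_kernel v)" using qi by simp
  have lim0: "(\<lambda>n. 1 / real (Suc n)) \<longlonglongrightarrow> 0" using LIMSEQ_inverse_real_of_nat by (simp add: inverse_eq_divide)
  have "(\<lambda>n. LINT v|lborel. F n y v) \<longlonglongrightarrow> (LINT v|lborel. limit_kernel v * \<psi> y)"
  proof (rule integral_dominated_convergence[OF _ _ bi])
    show "AE v in lborel. (\<lambda>n. F n y v) \<longlonglongrightarrow> limit_kernel v * \<psi> y"
    proof (intro always_eventually allI)
      fix v
      have ch0: "(\<lambda>n. ch (1 / real (Suc n)) * limit_kernel v) \<longlonglongrightarrow> 1 * limit_kernel v"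
      proof (intro tendsto_intros)
        have "isCont ch 0" using ch_deriv(1) DERIV_isCont by blast
        from isCont_tendsto_compose[OF this lim0] show "(\<lambda>n. ch (1 / real (Suc n))) \<longlonglongrightarrow> 1" by (simp add: ch_def)
      qed
      have "(\<lambda>n. kernel (real (Suc n)) ((1 / real (Suc n)) *\<^sub>R v) / (real (Suc n))\<^sup>2) \<longlonglongrightarrow> limit_kernel v"
        by (rule tendsto_sandwich[OF _ _ tendsto_const ch0[simplified mult_1]]) (use kb in \<open>auto intro!: always_eventually simp del: of_nat_Suc\<close>)
      moreover have "(\<lambda>n. \<psi> (y - (1 / real (Suc n)) *\<^sub>R v)) \<longlonglongrightarrow> \<psi> y"
      proof -
        have "(\<lambda>n. y - (1 / real (Suc n)) *\<^sub>R v) \<longlonglongrightarrow> y - 0 *\<^sub>R v" by (intro tendsto_intros lim0)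
        then show ?thesis using continuous_on_tendsto_compose[OF c\<psi>] by simp
      qed
      ultimately show "(\<lambda>n. F n y v) \<longlonglongrightarrow> limit_kernel v * \<psi> y" unfolding F_def by (rule tendsto_mult)
    qed
    show "AE v in lborel. norm (F n y v) \<le> ch 1 * D * limit_kernel v" for n using bd by (intro always_eventually allI) simp
  qed simp_all
  then show "(\<lambda>n. LINT z|lborel. kernel (real (Suc n)) (y - z) * \<psi> z) \<longlonglongrightarrow> mass * \<psi> y"
    by (simp add: eq mass_def del: of_nat_Suc)
  have "\<bar>LINT z|lborel. kernel (real (Suc n)) (y - z) * \<psi> z\<bar> \<le> ch 1 * D * mass" for n y
  proof -
    have "\<bar>LINT v|lborel. F n y v\<bar> \<le> (LINT v|lborel. \<bar>F n y v\<bar>)" by (rule integral_abs_bound)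
    also have "\<dots> \<le> (LINT v|lborel. ch 1 * D * limit_kernel v)"
      by (rule integral_mono'[OF bi bd]) (use D(1) ch_bounds(1)[of 1] limit_kernel_nonneg in auto)
    finally show ?thesis by (simp add: eq mass_def del: of_nat_Suc)
  qed
  moreover have "0 \<le> ch 1 * D * mass" using D(1) ch_bounds(1)[of 1] mass_pos by simp
  ultimately show "\<exists>C\<ge>0. \<forall>n y. \<bar>LINT z|lborel. kernel (real (Suc n)) (y - z) * \<psi> z\<bar> \<le> C" by blast
qed

lemma conv_measurable [measurable]:
  assumes [measurable]: "f \<in> borel_measurable borel"
  shows "conv f a \<in> borel_measurable borel"
  unfolding conv_def[abs_def] by measurable

lemma conv_bounded:
  assumes f: "integrable lborel f" and a: "a \<ge> 1"
  shows "\<exists>C\<ge>0. \<forall>z. \<bar>conv f a z\<bar> \<le> C"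
proof -
  obtain C where C: "C \<ge> 0" "\<And>y. \<bar>kernel a y\<bar> \<le> C" using kernel_bounded[OF a] by metis
  have "\<bar>conv f a z\<bar> \<le> C * (LINT y|lborel. \<bar>f y\<bar>)" for z
  proof -
    have "\<bar>conv f a z\<bar> \<le> (LINT y|lborel. \<bar>f y * kernel a (y - z)\<bar>)" unfolding conv_def by (rule integral_abs_bound)
    also have "\<dots> \<le> (LINT y|lborel. C * \<bar>f y\<bar>)"
    proof (rule integral_mono')
      show "integrable lborel (\<lambda>y. C * \<bar>f y\<bar>)" using f by auto
      show "\<bar>f y * kernel a (y - z)\<bar> \<le> C * \<bar>f y\<bar>" for y
        using mult_left_mono[OF C(2), of "\<bar>f y\<bar>" "y - z"] by (simp add: abs_mult mult.commute)
    qed (use C in auto)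
    finally show ?thesis by simp
  qed
  moreover have "0 \<le> C * (LINT y|lborel. \<bar>f y\<bar>)" using C(1) by (intro mult_nonneg_nonneg integral_nonneg_AE) auto
  ultimately show ?thesis by blast
qed

text \<open>Shifts the smoothing from the merely integrable \<open>f\<close> to the test function,
  where it converges pointwise and boundedly.\<close>

lemma conv_test_swap:
  assumes f: "integrable lborel f" "f \<in> borel_measurable borel" and \<psi>: "\<psi> \<in> test_functions A" and a: "a \<ge> 1"
  shows "(LINT z|lborel. conv f a z * \<psi> z) = (LINT y|lborel. f y * (LINT z|lborel. kernel a (y - z) * \<psi> z))"
proof -
  obtain C where C: "C \<ge> 0" "\<And>y. \<bar>kernel a y\<bar> \<le> C" using kernel_bounded[OF a] by metis
  note f(2)[measurable] test_functions_measurable[OF \<psi>, measurable]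
  have \<psi>i: "integrable lborel \<psi>" by (rule test_functions_integrable[OF \<psi>])
  have bi: "integrable (lborel \<Otimes>\<^sub>M lborel) (\<lambda>(y, z). f y * \<psi> z)"
  proof (rule lborel_pair.Fubini_integrable)
    show "(\<lambda>(y, z). f y * \<psi> z) \<in> borel_measurable (lborel \<Otimes>\<^sub>M lborel)" by measurable
    show "integrable lborel (\<lambda>y. LINT z|lborel. norm (case (y, z) of (y, z) \<Rightarrow> f y * \<psi> z))"
      using f(1) by (simp add: abs_mult)
    show "AE y in lborel. integrable lborel (\<lambda>z. case (y, z) of (y, z) \<Rightarrow> f y * \<psi> z)" using \<psi>i by simp
  qed
  have i: "integrable (lborel \<Otimes>\<^sub>M lborel) (\<lambda>(y, z). f y * kernel a (y - z) * \<psi> z)"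
  proof (rule Bochner_Integration.integrable_bound[OF integrable_mult_right[OF bi, of C]])
    show "(\<lambda>(y, z). f y * kernel a (y - z) * \<psi> z) \<in> borel_measurable (lborel \<Otimes>\<^sub>M lborel)" by measurable
    show "AE p in lborel \<Otimes>\<^sub>M lborel. norm (case p of (y, z) \<Rightarrow> f y * kernel a (y - z) * \<psi> z) \<le> norm (C * (case p of (y, z) \<Rightarrow> f y * \<psi> z))"
    proof (intro always_eventually allI)
      fix p :: "(real^2) \<times> (real^2)"
      obtain y z where p: "p = (y, z)" by (cases p)
      have "\<bar>kernel a (y - z)\<bar> * \<bar>f y * \<psi> z\<bar> \<le> C * \<bar>f y * \<psi> z\<bar>" by (intro mult_right_mono C) auto
      then show "norm (case p of (y, z) \<Rightarrow> f y * kernel a (y - z) * \<psi> z) \<le> norm (C * (case p of (y, z) \<Rightarrow> f y * \<psi> z))"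
        using C(1) by (simp add: p abs_mult mult_ac)
    qed
  qed
  have "(LINT z|lborel. conv f a z * \<psi> z) = (LINT z|lborel. (LINT y|lborel. f y * kernel a (y - z) * \<psi> z))"
    unfolding conv_def by simp
  also have "\<dots> = (LINT y|lborel. (LINT z|lborel. f y * kernel a (y - z) * \<psi> z))"
    by (rule lborel_pair.Fubini_integral[OF i])
  also have "\<dots> = (LINT y|lborel. f y * (LINT z|lborel. kernel a (y - z) * \<psi> z))"
    by (simp add: mult.assoc)
  finally show ?thesis .
qed

text \<open>By \<open>conv_eq\<close> the sequence is eventually constant at every point of an open
  set where \<open>f\<close> solves the equation, but the scale from which this holds depends on the
  point. Taking the limit avoids a choice of scale and keeps the function Borel; where there is no
  convergence the value is arbitrary.\<close>

definition smooth_rep :: "(real^2 \<Rightarrow> real) \<Rightarrow> real^2 \<Rightarrow> real" where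
  "smooth_rep f z = lim (\<lambda>n. conv f (real (Suc n)) z) / mass"

lemma smooth_rep_eq:
  assumes f: "weak_helmholtz \<mu> B f" and a: "1 \<le> a" and B: "cball z (1 / a) \<subseteq> B"
  shows "smooth_rep f z = conv f a z / mass"
proof -
  have "\<forall>\<^sub>F n in sequentially. conv f a z = conv f (real (Suc n)) z"
  proof (rule eventually_sequentiallyI[of "nat \<lceil>a\<rceil>"])
    fix n assume "nat \<lceil>a\<rceil> \<le> n"
    then have "a \<le> real (Suc n)" by linarith
    then show "conv f a z = conv f (real (Suc n)) z" by (rule conv_eq[OF f a _ B])
  qed
  then have "(\<lambda>n. conv f (real (Suc n)) z) \<longlonglongrightarrow> conv f a z" by (rule Lim_transform_eventually[OF tendsto_const])
  then show ?thesis by (simp add: smooth_rep_def limI)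
qed

lemma smooth_rep_measurable: "f \<in> borel_measurable borel \<Longrightarrow> smooth_rep f \<in> borel_measurable borel"
  unfolding smooth_rep_def[abs_def]
  by (intro borel_measurable_divide borel_measurable_const borel_measurable_lim_metric conv_measurable)

text \<open>On the support of a test function one scale works throughout, so the integral of
  \<open>conv f (real (Suc n))\<close> against it is eventually constant and equal to
  \<open>mass\<close> times that of \<open>smooth_rep f\<close>; on the other hand it tends to
  \<open>mass\<close> times that of \<open>f\<close>.\<close>

lemma smooth_rep_ae:
  assumes f: "weak_helmholtz \<mu> \<Omega> f" and \<Omega>: "open \<Omega>"
  shows "AE x in lebesgue. x \<in> \<Omega> \<longrightarrow> smooth_rep f x = f x"
proof -
  have fi: "integrable lborel f" and fm: "f \<in> borel_measurable borel" using f by (auto simp: weak_helmholtz_def)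
  have Um: "smooth_rep f \<in> borel_measurable borel" by (rule smooth_rep_measurable[OF fm])
  have loc: "\<exists>a\<ge>1. \<forall>z\<in>K. cball z (1 / a) \<subseteq> \<Omega>" if K: "compact K" "K \<subseteq> \<Omega>" for K
  proof -
    obtain e where e: "e > 0" "\<And>z. z \<in> K \<Longrightarrow> cball z e \<subseteq> \<Omega>" using compact_in_open_cball[OF K(1) \<Omega> K(2)] by metis
    have "1 / max 1 (1 / e) \<le> e" using e(1) by (auto simp: max_def divide_simps)
    then have "\<forall>z\<in>K. cball z (1 / max 1 (1 / e)) \<subseteq> \<Omega>" using e(2) subset_cball by blast
    then show ?thesis by (intro exI[of _ "max 1 (1 / e)"]) auto
  qed
  have "AE x in lebesgue. x \<in> \<Omega> \<longrightarrow> smooth_rep f x - f x = 0"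
  proof (rule fundamental_lemma_variations[OF \<Omega>])
    have "locally_integrable_on (smooth_rep f) \<Omega>"
      unfolding locally_integrable_on_def
    proof (intro allI impI)
      fix K assume "compact K \<and> K \<subseteq> \<Omega>"
      then have K: "compact K" "K \<subseteq> \<Omega>" by auto
      obtain a where a: "a \<ge> 1" "\<And>z. z \<in> K \<Longrightarrow> cball z (1 / a) \<subseteq> \<Omega>" using loc[OF K] by metis
      obtain C where C: "C \<ge> 0" "\<And>z. \<bar>conv f a z\<bar> \<le> C" using conv_bounded[OF fi a(1)] by metis
      have "integrable lborel (\<lambda>x. indicator K x *\<^sub>R smooth_rep f x)"
      proof (rule integrableI_bounded_set[of K _ _ "C / mass"])
        show "K \<in> sets lborel" using K by (simp add: borel_compact)
        show "(\<lambda>x. indicator K x *\<^sub>R smooth_rep f x) \<in> borel_measurable lborel"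
          using Um K by (intro borel_measurable_scaleR borel_measurable_indicator) (auto simp: borel_compact)
        show "emeasure lborel K < \<infinity>" using emeasure_bounded_finite[OF compact_imp_bounded[OF K(1)]] by simp
        have "\<bar>smooth_rep f x\<bar> \<le> C / mass" if "x \<in> K" for x
          using smooth_rep_eq[OF f a(1) a(2)[OF that]] C(2)[of x] mass_pos by (simp add: abs_divide divide_right_mono)
        then show "AE x\<in>K in lborel. norm (indicator K x *\<^sub>R smooth_rep f x) \<le> C / mass" by (intro always_eventually) simp
      qed auto
      then have "integrable lebesgue (\<lambda>x. indicator K x *\<^sub>R smooth_rep f x)"
        by (subst integrable_completion) auto
      then show "set_integrable lebesgue K (smooth_rep f)" unfolding set_integrable_def .
    qed
    then show "locally_integrable_on (\<lambda>x. smooth_rep f x - f x) \<Omega>"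
      by (intro locally_integrable_on_diff locally_integrable_on_integrable[OF fi])
    fix \<psi> assume \<psi>: "\<psi> \<in> test_functions \<Omega>"
    obtain K where K: "smooth \<psi>" "compact K" "K \<subseteq> \<Omega>" "\<And>x. x \<notin> K \<Longrightarrow> \<psi> x = 0"
      using test_functionsE[OF \<psi>] by metis
    obtain a where a: "a \<ge> 1" "\<And>z. z \<in> K \<Longrightarrow> cball z (1 / a) \<subseteq> \<Omega>" using loc[OF K(2,3)] by metis
    have pm: "\<psi> \<in> borel_measurable borel" by (rule test_functions_measurable[OF \<psi>])
    have ce: "smooth_rep f z * \<psi> z = conv f b z * \<psi> z / mass" if "b \<ge> a" for b z
    proof (cases "z \<in> K")
      case True
      have "1 / b \<le> 1 / a" using a(1) that by (intro divide_left_mono) auto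
      then have "cball z (1 / b) \<subseteq> \<Omega>" using a(2)[OF True] subset_cball by blast
      then show ?thesis using smooth_rep_eq[OF f, of b z] that a(1) by simp
    qed (simp add: K)
    have ci: "integrable lborel (\<lambda>z. conv f a z * \<psi> z)"
    proof -
      obtain C where C: "C \<ge> 0" "\<And>z. \<bar>conv f a z\<bar> \<le> C" using conv_bounded[OF fi a(1)] by metis
      show ?thesis
      proof (rule Bochner_Integration.integrable_bound[OF integrable_mult_right[OF test_functions_integrable[OF \<psi>], of C]])
        show "(\<lambda>z. conv f a z * \<psi> z) \<in> borel_measurable lborel" using conv_measurable[OF fm] pm by simp
        show "AE z in lborel. norm (conv f a z * \<psi> z) \<le> norm (C * \<psi> z)"
          using mult_right_mono[OF C(2), of "\<bar>\<psi> _\<bar>"] C(1) by (intro always_eventually allI) (simp add: abs_mult)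
      qed
    qed
    then have Ui: "integrable lborel (\<lambda>z. smooth_rep f z * \<psi> z)" unfolding ce[OF order_refl] by simp
    have fpi: "integrable lborel (\<lambda>z. f z * \<psi> z)" by (rule integrable_times_test[OF fi \<psi>])
    have l1: "(\<lambda>n. LINT z|lborel. conv f (real (Suc n)) z * \<psi> z) \<longlonglongrightarrow> (LINT y|lborel. f y * (mass * \<psi> y))"
    proof -
      obtain C where C: "C \<ge> 0" "\<And>n y. \<bar>LINT z|lborel. kernel (real (Suc n)) (y - z) * \<psi> z\<bar> \<le> C"
        using smoothed_test(2)[OF \<psi>] by metis
      have m[measurable]: "(\<lambda>y. LINT z|lborel. kernel a (y - z) * \<psi> z) \<in> borel_measurable borel" for a
        using pm by measurable
      have "(\<lambda>n. LINT y|lborel. f y * (LINT z|lborel. kernel (real (Suc n)) (y - z) * \<psi> z)) \<longlonglongrightarrow> (LINT y|lborel. f y * (mass * \<psi> y))"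
      proof (rule integral_dominated_convergence[where w="\<lambda>y. C * \<bar>f y\<bar>"])
        show "(\<lambda>y. f y * (mass * \<psi> y)) \<in> borel_measurable lborel" using fm pm by simp
        show "(\<lambda>y. f y * (LINT z|lborel. kernel (real (Suc n)) (y - z) * \<psi> z)) \<in> borel_measurable lborel" for n
          using borel_measurable_times[OF fm m] by simp
        show "integrable lborel (\<lambda>y. C * \<bar>f y\<bar>)" using fi by auto
        show "AE y in lborel. (\<lambda>n. f y * (LINT z|lborel. kernel (real (Suc n)) (y - z) * \<psi> z)) \<longlonglongrightarrow> f y * (mass * \<psi> y)"
          by (intro always_eventually allI tendsto_mult tendsto_const smoothed_test(1)[OF \<psi>])
        show "AE y in lborel. norm (f y * (LINT z|lborel. kernel (real (Suc n)) (y - z) * \<psi> z)) \<le> C * \<bar>f y\<bar>" for n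
        proof (intro always_eventually allI)
          fix y
          show "norm (f y * (LINT z|lborel. kernel (real (Suc n)) (y - z) * \<psi> z)) \<le> C * \<bar>f y\<bar>"
            using mult_left_mono[OF C(2)[of n y], of "\<bar>f y\<bar>"] by (simp add: abs_mult mult.commute del: of_nat_Suc)
        qed
      qed
      moreover have "(LINT z|lborel. conv f (real (Suc n)) z * \<psi> z) = (LINT y|lborel. f y * (LINT z|lborel. kernel (real (Suc n)) (y - z) * \<psi> z))" for n
        by (rule conv_test_swap[OF fi fm \<psi>]) simp
      ultimately show ?thesis by (simp only:)
    qed
    have "\<forall>\<^sub>F n in sequentially. (LINT z|lborel. conv f (real (Suc n)) z * \<psi> z) = mass * (LINT z|lborel. smooth_rep f z * \<psi> z)"
    proof (rule eventually_sequentiallyI[of "nat \<lceil>a\<rceil>"])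
      fix n assume "nat \<lceil>a\<rceil> \<le> n"
      then have "a \<le> real (Suc n)" by linarith
      then have "conv f (real (Suc n)) z * \<psi> z = mass * (smooth_rep f z * \<psi> z)" for z
        using ce[of "real (Suc n)" z] mass_pos by (simp del: of_nat_Suc)
      then have "(LINT z|lborel. conv f (real (Suc n)) z * \<psi> z) = (LINT z|lborel. mass * (smooth_rep f z * \<psi> z))"
        by (simp only:)
      then show "(LINT z|lborel. conv f (real (Suc n)) z * \<psi> z) = mass * (LINT z|lborel. smooth_rep f z * \<psi> z)"
        by (simp only: integral_mult_right_zero)
    qed
    then have l2: "(\<lambda>n. LINT z|lborel. conv f (real (Suc n)) z * \<psi> z) \<longlonglongrightarrow> mass * (LINT z|lborel. smooth_rep f z * \<psi> z)"
      by (rule tendsto_eventually)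
    have "mass * (LINT z|lborel. smooth_rep f z * \<psi> z) = mass * (LINT y|lborel. f y * \<psi> y)"
      using LIMSEQ_unique[OF l2 l1] by (simp add: mult.left_commute)
    then have "(LINT z|lborel. smooth_rep f z * \<psi> z) = (LINT y|lborel. f y * \<psi> y)" using mass_pos by simp
    then have z: "(LINT x|lborel. (smooth_rep f x - f x) * \<psi> x) = 0"
      using Ui fpi by (simp add: left_diff_distrib)
    have "(LINT x|lebesgue_on \<Omega>. (smooth_rep f x - f x) * \<psi> x) = (LINT x|lborel. (smooth_rep f x - f x) * \<psi> x)"
      using Um fm pm test_functions_zero_outside[OF \<psi>]
      by (intro test_integral_lebesgue_on[OF \<Omega>]) auto
    then show "(LINT x|lebesgue_on \<Omega>. (smooth_rep f x - f x) * \<psi> x) = 0" using z by simp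
  qed
  then show ?thesis by eventually_elim auto
qed

text \<open>The kernel of scale \<open>2 / R\<close> has radius \<open>R / 2\<close>, and the shifts
  move it by less than \<open>R / 2\<close>; thus only the values of \<open>f\<close> in
  \<open>ball x R\<close> enter. The constant is the same for all \<open>f\<close>, \<open>x\<close>
  and \<open>R\<close>.\<close>

lemma conv_finite_difference:
  "\<exists>C\<ge>0. \<forall>f x R h. integrable lborel f \<longrightarrow> 0 < R \<longrightarrow> R \<le> 1 \<longrightarrow> real r * norm h < R / 2 \<longrightarrow>
     \<bar>finite_difference r h (conv f (2 / R)) x\<bar> \<le> C * (2 / R) ^ (r + 2) * norm h ^ r * (LINT y|lborel. \<bar>f y\<bar> * indicator (ball x R) y)"
proof -
  obtain C where C: "C \<ge> 0" "\<And>a h y. a \<ge> 1 \<Longrightarrow> \<bar>finite_difference r h (kernel a) y\<bar> \<le> C * a ^ (r + 2) * norm h ^ r"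
    using kernel_finite_difference by metis
  have "\<bar>finite_difference r h (conv f (2 / R)) x\<bar> \<le> C * (2 / R) ^ (r + 2) * norm h ^ r * (LINT y|lborel. \<bar>f y\<bar> * indicator (ball x R) y)"
    if f: "integrable lborel f" and R: "0 < R" "R \<le> 1" and h: "real r * norm h < R / 2" for f x R and h :: "real^2"
  proof -
    define a where "a = 2 / R"
    have a: "a \<ge> 1" using R by (simp add: a_def)
    have "cball z (1 / a) \<subseteq> UNIV" for z by simp
    note ki = integrable_times_test[OF f kernel_test[OF a this]]
    \<comment> \<open>Shifting the centre by \<open>h\<close> shifts the argument of the kernel by
      \<open>- h\<close>.\<close>
    have e: "finite_difference r h (conv f a) x = (LINT y|lborel. f y * finite_difference r (- h) (kernel a) (y - x))"
    proof -
      have "finite_difference r h (conv f a) x = (\<Sum>k\<le>r. LINT y|lborel. (-1) ^ (r - k) * real (r choose k) * (f y * kernel a (y - (x + real k *\<^sub>R h))))"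
        unfolding finite_difference_def conv_def by simp
      also have "\<dots> = (LINT y|lborel. (\<Sum>k\<le>r. (-1) ^ (r - k) * real (r choose k) * (f y * kernel a (y - (x + real k *\<^sub>R h)))))"
        by (rule Bochner_Integration.integral_sum[symmetric]) (intro integrable_mult_right ki)
      also have "\<dots> = (LINT y|lborel. f y * finite_difference r (- h) (kernel a) (y - x))"
        unfolding finite_difference_def sum_distrib_left
        by (intro Bochner_Integration.integral_cong refl sum.cong) (simp add: algebra_simps)
      finally show ?thesis .
    qed
    have z: "finite_difference r (- h) (kernel a) (y - x) = 0" if "y \<notin> ball x R" for y
    proof -
      have "kernel a (y - x + real k *\<^sub>R (- h)) = 0" if "k \<le> r" for k
      proof (rule kernel_zero[OF a])
        have "R \<le> norm (y - x)" using \<open>y \<notin> ball x R\<close> by (simp add: dist_norm norm_minus_commute)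
        moreover have "norm (real k *\<^sub>R h) \<le> real r * norm h" using that by (auto intro: mult_right_mono)
        moreover have "norm (y - x) \<le> norm (y - x + real k *\<^sub>R (- h)) + norm (real k *\<^sub>R h)"
          using norm_triangle_ineq[of "y - x + real k *\<^sub>R (- h)" "real k *\<^sub>R h"] by simp
        ultimately show "1 / a \<le> norm (y - x + real k *\<^sub>R (- h))" using h R by (simp add: a_def)
      qed
      then show ?thesis unfolding finite_difference_def by simp
    qed
    let ?B = "C * a ^ (r + 2) * norm h ^ r"
    have "\<bar>finite_difference r h (conv f a) x\<bar> \<le> (LINT y|lborel. \<bar>f y * finite_difference r (- h) (kernel a) (y - x)\<bar>)"
      unfolding e by (rule integral_abs_bound)
    also have "\<dots> \<le> (LINT y|lborel. ?B * (\<bar>f y\<bar> * indicator (ball x R) y))"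
    proof (rule integral_mono')
      have "integrable lborel (\<lambda>y. indicator (ball x R) y *\<^sub>R \<bar>f y\<bar>)" using f by (intro integrable_mult_indicator) auto
      then show "integrable lborel (\<lambda>y. ?B * (\<bar>f y\<bar> * indicator (ball x R) y))" by (simp add: mult.commute)
      show "\<bar>f y * finite_difference r (- h) (kernel a) (y - x)\<bar> \<le> ?B * (\<bar>f y\<bar> * indicator (ball x R) y)" for y
      proof (cases "y \<in> ball x R")
        case True
        have "\<bar>f y\<bar> * \<bar>finite_difference r (- h) (kernel a) (y - x)\<bar> \<le> \<bar>f y\<bar> * ?B"
          using C(2)[OF a, of "- h" "y - x"] by (intro mult_left_mono) auto
        then show ?thesis using True by (simp add: abs_mult mult.commute)
      qed (simp add: z)
      show "0 \<le> ?B * (\<bar>f y\<bar> * indicator (ball x R) y)" for y using C(1) a by simp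
    qed
    finally show ?thesis by (simp add: a_def)
  qed
  then show ?thesis using C(1) by blast
qed

end

subsection \<open>Elementary estimates\<close>

text \<open>Comparing the sum with its largest term covers all positive exponents at once, also
  those below \<open>1\<close>, where the triangle inequality fails.\<close>

lemma sum_powr_le:
  fixes a :: "'i \<Rightarrow> real"
  assumes \<tau>: "\<tau> > 0" and I: "finite I" and a: "\<And>i. i \<in> I \<Longrightarrow> a i \<ge> 0"
  shows "(\<Sum>i\<in>I. a i) powr \<tau> \<le> real (card I) powr \<tau> * (\<Sum>i\<in>I. a i powr \<tau>)"
proof (cases "I = {}")
  case False
  define M where "M = Max (a ` I)"
  have "M \<in> a ` I" unfolding M_def using False I by (intro Max_in) auto
  then obtain j where j: "j \<in> I" "M = a j" by blast
  have M: "a i \<le> M" if "i \<in> I" for i unfolding M_def using that I by auto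
  have "(\<Sum>i\<in>I. a i) \<le> real (card I) * M" using sum_bounded_above[of I a M] M by simp
  then have "(\<Sum>i\<in>I. a i) powr \<tau> \<le> (real (card I) * M) powr \<tau>"
    using \<tau> a by (intro powr_mono2) (auto intro: sum_nonneg)
  also have "\<dots> = real (card I) powr \<tau> * a j powr \<tau>" using a[OF j(1)] j by (simp add: powr_mult)
  also have "\<dots> \<le> real (card I) powr \<tau> * (\<Sum>i\<in>I. a i powr \<tau>)"
    using I j by (intro mult_left_mono member_le_sum) auto
  finally show ?thesis .
qed simp

text \<open>Stands in for Hoelder's inequality: values up to the threshold \<open>l\<close> are
  bounded by it, and above it the exponent \<open>\<tau> - 2\<close> is not positive. The threshold
  is chosen where the lemma is applied.\<close>

lemma powr_le_split:
  fixes a l :: real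
  assumes "l > 0" "0 < \<tau>" "\<tau> \<le> 2" "a \<ge> 0"
  shows "a powr \<tau> \<le> l powr \<tau> + l powr (\<tau> - 2) * a\<^sup>2"
proof (cases "a \<le> l")
  case True
  then have "a powr \<tau> \<le> l powr \<tau>" using assms by (intro powr_mono2) auto
  then show ?thesis by (simp add: add_increasing2)
next
  case False
  have "a powr \<tau> = a powr ((\<tau> - 2) + 2)" by simp
  also have "\<dots> = a powr (\<tau> - 2) * a powr 2" by (rule powr_add)
  finally have e: "a powr \<tau> = a powr (\<tau> - 2) * a\<^sup>2" using assms by simp
  have "a powr (\<tau> - 2) * a\<^sup>2 \<le> l powr (\<tau> - 2) * a\<^sup>2"
    using False assms by (intro mult_right_mono powr_mono2') auto
  then show ?thesis unfolding e by (simp add: add_increasing)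
qed

lemma ennreal_le_suminf: "(F :: nat \<Rightarrow> ennreal) j \<le> suminf F"
  using sum_le_suminf[of F "{j}"] by simp

text \<open>Dyadic rings instead of polar coordinates: between the radii
  \<open>M * (1/2) ^ Suc j\<close> and \<open>M * (1/2) ^ j\<close> the power is at most its value
  at the inner radius, the area is at most that of the outer disc, and the resulting series is
  geometric with ratio \<open>(1/2) powr (2 - \<gamma>)\<close>.\<close>

lemma integrable_norm_powr:
  fixes v :: "real^2"
  assumes \<gamma>: "0 \<le> \<gamma>" "\<gamma> < 2" and M: "M > 0"
  shows "integrable lborel (\<lambda>x. indicator (ball v M) x * norm (x - v) powr (- \<gamma>))"
proof (rule integrableI_bounded)
  define m where "m = unit_ball_vol (real DIM(real^2))"
  define c where "c j = (M * (1/2) ^ Suc j) powr (- \<gamma>) * (m * (M * (1/2) ^ j)\<^sup>2)" for j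
  have m: "m \<ge> 0" by (simp add: m_def)
  have cp: "c j \<ge> 0" for j using m by (simp add: c_def)
  have "summable c"
  proof -
    have ceq: "c j = ((M / 2) powr (- \<gamma>) * m * M\<^sup>2) * ((1/2) powr (2 - \<gamma>)) ^ j" for j
    proof -
      have 1: "((1/2::real) ^ j) powr (- \<gamma>) = ((1/2) powr (- \<gamma>)) ^ j"
        by (simp add: powr_power powr_realpow[symmetric] powr_powr mult.commute)
      have 2: "((1/2::real) ^ j)\<^sup>2 = ((1/2) powr 2) ^ j" by (simp add: power_mult[symmetric] mult.commute)
      have "(M * (1/2) ^ Suc j) powr (- \<gamma>) = ((M / 2) * (1/2) ^ j) powr (- \<gamma>)" by simp
      also have "\<dots> = (M / 2) powr (- \<gamma>) * ((1/2) powr (- \<gamma>)) ^ j" using M by (subst powr_mult) (simp_all add: 1)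
      finally have "c j = ((M / 2) powr (- \<gamma>) * ((1/2) powr (- \<gamma>)) ^ j) * (m * (M\<^sup>2 * ((1/2) powr 2) ^ j))"
        unfolding c_def power_mult_distrib[of M] 2 by simp
      also have "\<dots> = ((M / 2) powr (- \<gamma>) * m * M\<^sup>2) * ((1/2) powr (- \<gamma>) * (1/2) powr 2) ^ j"
        by (simp add: power_mult_distrib mult_ac)
      also have "(1/2::real) powr (- \<gamma>) * (1/2) powr 2 = (1/2) powr (- \<gamma> + 2)" by (rule powr_add[symmetric])
      also have "- \<gamma> + 2 = 2 - \<gamma>" by simp
      finally show ?thesis .
    qed
    have "(1/2::real) powr (2 - \<gamma>) < 1" using \<gamma> by (simp add: powr_def ln_div mult_less_0_iff)
    then have "summable (\<lambda>j. ((M / 2) powr (- \<gamma>) * m * M\<^sup>2) * ((1/2) powr (2 - \<gamma>)) ^ j)"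
      by (intro summable_mult summable_geometric) simp
    then show ?thesis by (simp only: ceq[symmetric])
  qed
  let ?f = "\<lambda>x. indicator (ball v M) x * norm (x - v) powr (- \<gamma>)"
  let ?g = "\<lambda>j x. (M * (1/2) ^ Suc j) powr (- \<gamma>) * indicator (ball v (M * (1/2) ^ j)) x"
  have pt: "ennreal (?f x) \<le> (\<Sum>j. ennreal (?g j x))" for x
  proof (cases "x \<in> ball v M \<and> x \<noteq> v")
    case True
    define d where "d = norm (x - v)"
    have d: "0 < d" "d < M" using True by (auto simp: d_def dist_norm norm_minus_commute)
    obtain n where n: "(1/2::real) ^ n < d / M" using real_arch_pow_inv[of "d / M" "1/2"] d M by auto
    define P where "P j \<longleftrightarrow> M * (1/2) ^ Suc j \<le> d" for j
    have "M * (1/2) ^ Suc n \<le> M * (1/2) ^ n" using M by simp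
    also have "\<dots> < d" using n M by (simp add: pos_less_divide_eq mult.commute)
    finally have "P n" by (simp add: P_def)
    \<comment> \<open>The index of the ring containing \<open>x\<close>; minimality gives the upper
      bound on \<open>d\<close>.\<close>
    define j where "j = (LEAST j. P j)"
    have j: "M * (1/2) ^ Suc j \<le> d" using LeastI[of P, OF \<open>P n\<close>] by (simp add: j_def P_def)
    have "d < M * (1/2) ^ j"
    proof (cases j)
      case (Suc i)
      then have "\<not> P i" using not_less_Least[of i P] by (simp add: j_def[symmetric])
      then show ?thesis by (simp add: P_def Suc)
    qed (use d in simp)
    then have xb: "x \<in> ball v (M * (1/2) ^ j)" by (simp add: d_def dist_norm norm_minus_commute)
    have "?f x \<le> ?g j x"
      using True xb j M \<gamma> d by (auto simp: d_def[symmetric] intro!: powr_mono2')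
    then have "ennreal (?f x) \<le> ennreal (?g j x)" by (rule ennreal_leI)
    also have "\<dots> \<le> (\<Sum>i. ennreal (?g i x))"
      by (rule ennreal_le_suminf)
    finally show ?thesis .
  qed auto
  have ball_sets: "ball v s \<in> sets lborel" for s by simp
  have gi: "(\<integral>\<^sup>+x. ennreal (?g j x) \<partial>lborel) = ennreal (c j)" for j
  proof -
    have "emeasure lborel (ball v (M * (1/2) ^ j)) = ennreal (m * (M * (1/2) ^ j)\<^sup>2)"
      using M by (subst emeasure_ball) (auto simp: m_def)
    moreover have "(\<integral>\<^sup>+x. ennreal (?g j x) \<partial>lborel) =
        (\<integral>\<^sup>+x. ennreal ((M * (1/2) ^ Suc j) powr (- \<gamma>)) * indicator (ball v (M * (1/2) ^ j)) x \<partial>lborel)"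
      by (intro nn_integral_cong) (auto split: split_indicator)
    ultimately show ?thesis
      unfolding c_def using m by (simp only: nn_integral_cmult_indicator[OF ball_sets]) (simp add: ennreal_mult')
  qed
  have "(\<integral>\<^sup>+x. ennreal (?f x) \<partial>lborel) \<le> (\<integral>\<^sup>+x. (\<Sum>j. ennreal (?g j x)) \<partial>lborel)"
    by (intro nn_integral_mono pt)
  also have "\<dots> = (\<Sum>j. ennreal (c j))"
  proof (subst nn_integral_suminf)
    show "(\<lambda>x. ennreal (?g j x)) \<in> borel_measurable lborel" for j
      by (rule measurable_compose[OF _ measurable_ennreal]) (intro borel_measurable_times borel_measurable_const borel_measurable_indicator ball_sets)
  qed (simp only: gi)
  also have "\<dots> < \<infinity>" using ennreal_suminf_neq_top[OF \<open>summable c\<close> cp] by (simp add: less_top)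
  finally show "(\<integral>\<^sup>+x. ennreal (norm (?f x)) \<partial>lborel) < \<infinity>" by simp
  show "?f \<in> borel_measurable lborel"
    by (intro borel_measurable_times borel_measurable_indicator ball_sets powr_real_measurable) measurable
qed

lemma measure_ball_scale:
  fixes x :: "real^2"
  assumes "R \<ge> 0"
  shows "measure lborel (ball x R) = measure lborel (ball (0::real^2) 1) * R\<^sup>2"
  using content_ball[OF assms, of x] content_ball[of 1 "0::real^2"] by simp

subsection \<open>Differences of the smooth representative\<close>

text \<open>At scale \<open>R\<close> the function is the convolution of \<open>w\<close>, or of its
  odd extension, with the kernel of scale \<open>2 / R\<close>. The square integral over
  \<open>ball x R\<close> is \<open>O(R)\<close>, hence the integral of the modulus is
  \<open>O(R powr (3/2))\<close>; together with \<open>R powr (- (real r + 2))\<close> from the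
  kernel this gives the exponent \<open>- (real r + 1/2)\<close>.\<close>

lemma difference_estimate:
  fixes \<Omega> :: "(real^2) set"
  assumes sol: "H1_0_solution \<Omega> w W \<phi> \<mu>" and \<mu>: "\<mu> \<ge> 0"
    and C: "C > 0" "\<And>z t. t > 0 \<Longrightarrow> (LINT x|lborel. (w x)\<^sup>2 * indicator (ball z t) x) \<le> C * t"
  shows "\<exists>E\<ge>0. \<forall>x R h. x \<in> \<Omega> \<longrightarrow> 0 < R \<longrightarrow> R \<le> 1 \<longrightarrow> flat_on \<Omega> x (4 * R) \<longrightarrow> real r * norm h < R / 2 \<longrightarrow>
     (\<forall>k\<le>r. x + real k *\<^sub>R h \<in> \<Omega>) \<longrightarrow>
     \<bar>finite_difference r h (helmholtz_kernel.smooth_rep \<mu> w) x\<bar> \<le> E * norm h ^ r * R powr (- (real r + 1/2))"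
proof -
  interpret S: H1_0_solution \<Omega> w W \<phi> \<mu> by (rule sol)
  interpret K: helmholtz_kernel \<mu> by unfold_locales (rule \<mu>)
  from K.conv_finite_difference[of r] obtain D where D0: "D \<ge> 0 \<and> (\<forall>f x R h. integrable lborel f \<longrightarrow> 0 < R \<longrightarrow> R \<le> 1 \<longrightarrow> real r * norm h < R / 2 \<longrightarrow>
     \<bar>finite_difference r h (K.conv f (2 / R)) x\<bar> \<le> D * (2 / R) ^ (r + 2) * norm h ^ r * (LINT y|lborel. \<bar>f y\<bar> * indicator (ball x R) y))"
    by (rule exE)
  note D = D0[THEN conjunct1] D0[THEN conjunct2, rule_format]
  define m where "m = measure lborel (ball (0::real^2) 1)"
  define E where "E = D * 2 ^ (r + 2) * (m + 4 * C) / K.mass"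
  have E: "E \<ge> 0" using D(1) C(1) K.mass_pos by (simp add: E_def m_def)
  have w2: "integrable lborel (\<lambda>y. (w y)\<^sup>2 * indicator (ball z R) y)" for z R
    using integrable_mult_indicator[OF _ S.w_i, of "ball z R"] by (simp add: mult.commute)
  have "\<bar>finite_difference r h (K.smooth_rep w) x\<bar> \<le> E * norm h ^ r * R powr (- (real r + 1/2))"
    if x: "x \<in> \<Omega>" and R: "0 < R" "R \<le> 1" and flat: "flat_on \<Omega> x (4 * R)" and h: "real r * norm h < R / 2"
      and seg: "\<forall>k\<le>r. x + real k *\<^sub>R h \<in> \<Omega>" for x R h
  proof -
    define a where "a = 2 / R"
    have a: "1 \<le> a" "1 / a = R / 2" using R by (simp_all add: a_def)
    \<comment> \<open>One function \<open>f\<close> covers both cases: \<open>w\<close> itself in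
      the interior, the odd extension at the boundary. The constant \<open>4 * C\<close> is the
      larger of the two.\<close>
    have "\<exists>f. integrable lborel f \<and> f \<in> borel_measurable borel \<and>
       (\<forall>z\<in>\<Omega>. norm (z - x) < R / 2 \<longrightarrow> K.smooth_rep w z = K.conv f a z / K.mass) \<and>
       integrable lborel (\<lambda>y. (f y)\<^sup>2 * indicator (ball x R) y) \<and>
       (LINT y|lborel. (f y)\<^sup>2 * indicator (ball x R) y) \<le> 4 * C * R"
    proof (rule flat_on_dichotomy[OF S.\<Omega>(1) x flat R(1)])
      assume B: "ball x R \<subseteq> \<Omega>"
      have "K.smooth_rep w z = K.conv w a z / K.mass" if "norm (z - x) < R / 2" for z
      proof (rule K.smooth_rep_eq[OF S.weak_helmholtz_w a(1)])
        show "cball z (1 / a) \<subseteq> \<Omega>"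
        proof
          fix y assume "y \<in> cball z (1 / a)"
          then have "dist z y \<le> R / 2" by (simp add: a)
          then have "dist x y < R" using that dist_triangle[of x y z] by (simp add: dist_norm norm_minus_commute)
          then show "y \<in> \<Omega>" using B by auto
        qed
      qed
      moreover have "(LINT y|lborel. (w y)\<^sup>2 * indicator (ball x R) y) \<le> 4 * C * R"
      proof -
        have "C * R \<le> 4 * C * R" using C(1) R(1) by simp
        then show ?thesis using C(2)[OF R(1), of x] by linarith
      qed
      ultimately show ?thesis using S.w_integrable S.w_m w2 by blast
    next
      fix p \<nu>
      assume \<nu>: "norm \<nu> = 1" and p: "dist x p < R" and B: "\<Omega> \<inter> ball p (3 * R) = {y \<in> ball p (3 * R). (y - p) \<bullet> \<nu> > 0}"
      define f where "f y = w y - w (reflect p \<nu> y)" for y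
      have f: "weak_helmholtz \<mu> (ball p (3 * R)) f"
        unfolding f_def by (rule weak_helmholtz_reflect[OF sol \<nu> B])
      have fm: "f \<in> borel_measurable borel" and fi: "integrable lborel f" using f by (auto simp: weak_helmholtz_def)
      have w0: "w (reflect p \<nu> y) = 0" if "y \<in> \<Omega>" "y \<in> ball p (3 * R)" for y
      proof (rule S.w_0)
        have "(y - p) \<bullet> \<nu> > 0" using that B by blast
        then have "\<not> (reflect p \<nu> y - p) \<bullet> \<nu> > 0" using reflect_inner[OF \<nu>, of p y] by simp
        moreover have "reflect p \<nu> y \<in> ball p (3 * R)"
          using that(2) dist_reflect[OF \<nu>, of p p y] reflect_center[OF \<nu>, of p] by simp
        ultimately show "reflect p \<nu> y \<notin> \<Omega>" using B by blast
      qed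
      have "K.smooth_rep w z = K.conv f a z / K.mass" if z: "z \<in> \<Omega>" "norm (z - x) < R / 2" for z
      proof -
        have sub: "cball z (R / 2) \<subseteq> ball p (3 * R)"
        proof
          fix y assume "y \<in> cball z (R / 2)"
          then have "dist z y \<le> R / 2" by simp
          moreover have "dist x z < R / 2" using z(2) by (simp add: dist_norm norm_minus_commute)
          ultimately have "dist p y < 2 * R"
            using dist_triangle[of p y x] dist_triangle[of x y z] p by (simp add: dist_commute)
          then show "y \<in> ball p (3 * R)" using R by simp
        qed
        obtain e where e: "e > 0" "ball z e \<subseteq> \<Omega>" using S.\<Omega>(1) z(1) by (meson open_contains_ball)
        \<comment> \<open>\<open>w\<close> solves the equation only inside \<Omega>, whereas a
          kernel of radius \<open>R / 2\<close> at \<open>z\<close> may reach across the line. With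
          the smaller radius \<open>1 / b\<close> the kernel stays in \<Omega>, where
          \<open>w\<close> and \<open>f\<close> agree; afterwards \<open>conv_eq\<close> for
          \<open>f\<close> returns to the scale \<open>a\<close>.\<close>
        define b where "b = max a (2 / e)"
        have b: "a \<le> b" "1 \<le> b" using a by (auto simp: b_def)
        have "2 / e \<le> b" by (simp add: b_def)
        then have "2 \<le> b * e" using e(1) by (simp add: pos_divide_le_eq)
        then have be: "1 / b < e" using b(2) by (simp add: pos_divide_less_eq mult.commute)
        have ba: "1 / b \<le> R / 2" unfolding a(2)[symmetric] using a(1) b by (intro divide_left_mono) auto
        have sub\<Omega>: "cball z (1 / b) \<subseteq> \<Omega>" using e(2) be by (auto simp: subset_eq)
        have "K.smooth_rep w z = K.conv w b z / K.mass"
          by (rule K.smooth_rep_eq[OF S.weak_helmholtz_w b(2) sub\<Omega>])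
        also have "K.conv w b z = K.conv f b z"
          unfolding K.conv_def
        proof (intro Bochner_Integration.integral_cong refl)
          fix y
          show "w y * K.kernel b (y - z) = f y * K.kernel b (y - z)"
          proof (cases "y \<in> cball z (1 / b)")
            case True
            then have "y \<in> cball z (R / 2)" using ba by simp
            then have "y \<in> \<Omega>" "y \<in> ball p (3 * R)" using True sub\<Omega> sub by blast+
            then show ?thesis by (simp add: f_def w0)
          next
            case False
            then have "1 / b \<le> norm (y - z)" by (simp add: dist_norm norm_minus_commute)
            then show ?thesis using K.kernel_zero[OF b(2)] by simp
          qed
        qed
        also have "\<dots> = K.conv f a z"
          using K.conv_eq[OF f a(1) b(1)] sub a(2) by simp
        finally show ?thesis .
      qed
      \<comment> \<open>The reflected ball is a ball around the reflected centre; the bound on discs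
        applies to it as well, being uniform in the centre.\<close>
      moreover have i2: "integrable lborel (\<lambda>y. (w (reflect p \<nu> y))\<^sup>2 * indicator (ball x R) y)"
        and e2: "(LINT y|lborel. (w (reflect p \<nu> y))\<^sup>2 * indicator (ball x R) y) = (LINT y|lborel. (w y)\<^sup>2 * indicator (ball (reflect p \<nu> x) R) y)"
      proof -
        have ind: "indicator (ball (reflect p \<nu> x) R) (reflect p \<nu> y) = (indicator (ball x R) y :: real)" for y
          by (simp add: indicator_def dist_reflect[OF \<nu>])
        have m: "(\<lambda>y. (w y)\<^sup>2 * indicator (ball (reflect p \<nu> x) R) y) \<in> borel_measurable borel"
          using w2[of "reflect p \<nu> x" R] by simp
        show "integrable lborel (\<lambda>y. (w (reflect p \<nu> y))\<^sup>2 * indicator (ball x R) y)"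
          using lborel_integral_reflect(2)[OF \<nu> m, of p] w2[of "reflect p \<nu> x" R] by (simp add: ind)
        show "(LINT y|lborel. (w (reflect p \<nu> y))\<^sup>2 * indicator (ball x R) y) = (LINT y|lborel. (w y)\<^sup>2 * indicator (ball (reflect p \<nu> x) R) y)"
          using lborel_integral_reflect(1)[OF \<nu> m, of p] by (simp add: ind)
      qed
      have q: "(s - t)\<^sup>2 \<le> 2 * s\<^sup>2 + 2 * t\<^sup>2" for s t :: real
        using zero_le_power2[of "s + t"] by (simp add: power2_eq_square algebra_simps)
      have bi: "integrable lborel (\<lambda>y. 2 * ((w y)\<^sup>2 * indicator (ball x R) y) + 2 * ((w (reflect p \<nu> y))\<^sup>2 * indicator (ball x R) y))"
        using w2 i2 by auto
      have le: "(f y)\<^sup>2 * indicator (ball x R) y \<le> 2 * ((w y)\<^sup>2 * indicator (ball x R) y) + 2 * ((w (reflect p \<nu> y))\<^sup>2 * indicator (ball x R) y)" for y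
        using q[of "w y" "w (reflect p \<nu> y)"] by (auto simp: f_def split: split_indicator)
      have i3: "integrable lborel (\<lambda>y. (f y)\<^sup>2 * indicator (ball x R) y)"
      proof (rule Bochner_Integration.integrable_bound[OF bi])
        show "(\<lambda>y. (f y)\<^sup>2 * indicator (ball x R) y) \<in> borel_measurable lborel"
          using fm by (intro borel_measurable_times borel_measurable_power borel_measurable_indicator) simp_all
        show "AE y in lborel. norm ((f y)\<^sup>2 * indicator (ball x R) y) \<le> norm (2 * ((w y)\<^sup>2 * indicator (ball x R) y) + 2 * ((w (reflect p \<nu> y))\<^sup>2 * indicator (ball x R) y))"
          using le by (intro always_eventually allI) (auto intro: order_trans[OF _ abs_ge_self] simp: abs_mult)
      qed
      moreover have "(LINT y|lborel. (f y)\<^sup>2 * indicator (ball x R) y) \<le> 4 * C * R"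
      proof -
        have "(LINT y|lborel. (f y)\<^sup>2 * indicator (ball x R) y) \<le> 2 * (LINT y|lborel. (w y)\<^sup>2 * indicator (ball x R) y) + 2 * (LINT y|lborel. (w (reflect p \<nu> y))\<^sup>2 * indicator (ball x R) y)"
          using integral_mono[OF i3 bi le] w2 i2 by simp
        also have "\<dots> \<le> 2 * (C * R) + 2 * (C * R)" unfolding e2 by (intro add_mono mult_left_mono C(2) R) auto
        finally show ?thesis by simp
      qed
      ultimately show ?thesis using fm fi by blast
    qed
    then obtain f where fi: "integrable lborel f" and fm: "f \<in> borel_measurable borel"
      and fe: "\<And>z. z \<in> \<Omega> \<Longrightarrow> norm (z - x) < R / 2 \<Longrightarrow> K.smooth_rep w z = K.conv f a z / K.mass"
      and f2: "integrable lborel (\<lambda>y. (f y)\<^sup>2 * indicator (ball x R) y)"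
      and fC: "(LINT y|lborel. (f y)\<^sup>2 * indicator (ball x R) y) \<le> 4 * C * R" by blast
    have pts: "norm (x + real k *\<^sub>R h - x) < R / 2" if "k \<le> r" for k
    proof -
      have "norm (real k *\<^sub>R h) \<le> real r * norm h" using that by (auto intro: mult_right_mono)
      then show ?thesis using h by simp
    qed
    have "finite_difference r h (K.smooth_rep w) x = finite_difference r h (K.conv f a) x / K.mass"
      unfolding finite_difference_def sum_divide_distrib using seg pts by (intro sum.cong refl) (simp add: fe)
    then have 1: "\<bar>finite_difference r h (K.smooth_rep w) x\<bar> = \<bar>finite_difference r h (K.conv f a) x\<bar> / K.mass"
      using K.mass_pos by (simp add: abs_divide)
    have L1: "(LINT y|lborel. \<bar>f y\<bar> * indicator (ball x R) y) \<le> (m + 4 * C) * R powr (3/2)"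
    proof -
      \<comment> \<open>The expected size of \<open>f\<close>, whose square integral is
        \<open>O(R)\<close> over an area of order \<open>R\<^sup>2\<close>; with this choice both
        terms are of order \<open>R powr (3/2)\<close>.\<close>
      define e where "e = R powr (- (1/2))"
      have e: "e > 0" using R by (simp add: e_def)
      have sq: "(\<lambda>y. (f y * indicator (ball x R) y)\<^sup>2) = (\<lambda>y. (f y)\<^sup>2 * indicator (ball x R) y)"
        by (auto simp: power_mult_distrib fun_eq_iff split: split_indicator)
      have ab: "(\<lambda>y. \<bar>f y * indicator (ball x R) y\<bar> * indicator (ball x R) y) = (\<lambda>y. \<bar>f y\<bar> * indicator (ball x R) y)"
        by (auto simp: fun_eq_iff split: split_indicator)
      have m1: "(\<lambda>y. f y * indicator (ball x R) y) \<in> borel_measurable borel"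
        using fm by (intro borel_measurable_times borel_measurable_indicator) simp_all
      have i1: "integrable lborel (\<lambda>y. (f y * indicator (ball x R) y)\<^sup>2)" unfolding sq by (rule f2)
      have fin: "emeasure lborel (ball x R) < \<infinity>" using emeasure_bounded_finite[of "ball x R"] by simp
      have "(LINT y|lborel. \<bar>f y * indicator (ball x R) y\<bar> * indicator (ball x R) y) \<le> e * measure lborel (ball x R) + (LINT y|lborel. (f y * indicator (ball x R) y)\<^sup>2) / e"
        using L2_imp_L1_bound(2)[OF m1 i1 _ fin e] by simp
      then have "(LINT y|lborel. \<bar>f y\<bar> * indicator (ball x R) y) \<le> e * (m * R\<^sup>2) + (LINT y|lborel. (f y)\<^sup>2 * indicator (ball x R) y) / e"
        unfolding sq ab measure_ball_scale[OF less_imp_le[OF R(1)]] m_def .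
      also have "\<dots> \<le> e * (m * R\<^sup>2) + 4 * C * R / e" using fC e by (intro add_left_mono divide_right_mono) auto
      also have "e * (m * R\<^sup>2) = m * R powr (3/2)"
      proof -
        have "e * R\<^sup>2 = R powr (- (1/2)) * R powr 2" using R by (simp add: e_def)
        also have "\<dots> = R powr (- (1/2) + 2)" by (rule powr_add[symmetric])
        finally have "e * R\<^sup>2 = R powr (3/2)" by simp
        then show ?thesis by (simp add: mult.left_commute)
      qed
      also have "4 * C * R / e = 4 * C * R powr (3/2)"
      proof -
        have "R / e = R powr 1 / R powr (- (1/2))" using R by (simp add: e_def)
        also have "\<dots> = R powr (1 - - (1/2))" by (rule powr_diff[symmetric])
        finally have "R / e = R powr (3/2)" by simp
        then show ?thesis by (metis times_divide_eq_right)
      qed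
      finally show ?thesis by (simp add: distrib_right)
    qed
    have "\<bar>finite_difference r h (K.conv f a) x\<bar> \<le> D * (2 / R) ^ (r + 2) * norm h ^ r * ((m + 4 * C) * R powr (3/2))"
      unfolding a_def using D(1) R by (intro order_trans[OF D(2)[OF fi R h]] mult_left_mono L1) auto
    also have "\<dots> = (D * 2 ^ (r + 2) * (m + 4 * C)) * norm h ^ r * (R powr (3/2) / R ^ (r + 2))"
      by (simp add: power_divide mult_ac)
    also have "R powr (3/2) / R ^ (r + 2) = R powr (- (real r + 1/2))"
    proof -
      have "R ^ (r + 2) = R powr (real r + 2)" using R powr_realpow[of R "r + 2"] by (simp add: add.commute)
      then have "R powr (3/2) / R ^ (r + 2) = R powr (3/2 - (real r + 2))" by (simp only: powr_diff)
      also have "3/2 - (real r + 2) = - (real r + 1/2)" by simp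
      finally show ?thesis .
    qed
    finally have 2: "\<bar>finite_difference r h (K.conv f a) x\<bar> \<le> (D * 2 ^ (r + 2) * (m + 4 * C)) * norm h ^ r * R powr (- (real r + 1/2))" .
    show ?thesis unfolding 1 E_def using divide_right_mono[OF 2, of K.mass] K.mass_pos by (simp add: mult_ac)
  qed
  then show ?thesis using E by blast
qed

section \<open>Integration of the difference bounds over the domain\<close>

lemma AE_lborel_shift:
  fixes c :: "'a::euclidean_space"
  assumes "AE x in lborel. P x"
  shows "AE x in lborel. P (c + x)"
proof -
  have "AE x in distr lborel borel ((+) c). P x" using assms unfolding lborel_distr_plus .
  from AE_distrD[OF _ this] show ?thesis by simp
qed

lemma segment_point:
  fixes x h :: "'a::euclidean_space"
  assumes "k \<le> r" "r > 0"
  shows "x + real k *\<^sub>R h \<in> closed_segment x (x + real r *\<^sub>R h)"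
  unfolding closed_segment_def using assms
  by (auto intro!: exI[of _ "real k / real r"] simp: algebra_simps)

lemma diff_domain_points:
  assumes "x \<in> diff_domain r h \<Omega>" "k \<le> r" "r > 0"
  shows "x + real k *\<^sub>R h \<in> \<Omega>"
  using segment_point[OF assms(2,3), of x h] assms(1) by (auto simp: diff_domain_def)

text \<open>Provides measurability of the region over which differences are integrated. A compact
  segment in \<Omega> keeps a positive distance from the complement, so it may be translated a
  little.\<close>

lemma open_diff_domain:
  fixes \<Omega> :: "'a::euclidean_space set"
  assumes "open \<Omega>"
  shows "open (diff_domain r h \<Omega>)"
  unfolding open_contains_ball
proof
  fix x assume "x \<in> diff_domain r h \<Omega>"
  then have "closed_segment x (x + real r *\<^sub>R h) \<subseteq> \<Omega>" by (simp add: diff_domain_def)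
  then obtain e where e: "e > 0" "\<And>z. z \<in> closed_segment x (x + real r *\<^sub>R h) \<Longrightarrow> cball z e \<subseteq> \<Omega>"
    using compact_in_open_cball[OF compact_segment assms] by metis
  have "ball x e \<subseteq> diff_domain r h \<Omega>"
  proof
    fix y assume y: "y \<in> ball x e"
    have "closed_segment y (y + real r *\<^sub>R h) \<subseteq> \<Omega>"
    proof
      fix z assume "z \<in> closed_segment y (y + real r *\<^sub>R h)"
      then have "z + (x - y) \<in> closed_segment (y + (x - y)) (y + real r *\<^sub>R h + (x - y))"
        using closed_segment_translation[of "x - y" y "y + real r *\<^sub>R h"] by (auto simp: add.commute)
      then have "z + (x - y) \<in> closed_segment x (x + real r *\<^sub>R h)" by (simp add: algebra_simps)
      then have "cball (z + (x - y)) e \<subseteq> \<Omega>" by (rule e(2))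
      moreover have "z \<in> cball (z + (x - y)) e" using y by (simp add: dist_norm norm_minus_commute)
      ultimately show "z \<in> \<Omega>" by blast
    qed
    then show "y \<in> diff_domain r h \<Omega>" by (simp add: diff_domain_def)
  qed
  then show "\<exists>e>0. ball x e \<subseteq> diff_domain r h \<Omega>" using e(1) by blast
qed

lemma infdist_finite_attained:
  fixes x :: "'a::metric_space"
  assumes "finite V" "V \<noteq> {}"
  obtains v where "v \<in> V" "infdist x V = dist x v"
proof -
  have "infdist x V = Min (dist x ` V)"
    using assms by (simp add: infdist_notempty cInf_eq_Min)
  moreover have "Min (dist x ` V) \<in> dist x ` V" using assms by (intro Min_in) auto
  ultimately show thesis using that by auto
qed

text \<open>The distance is attained at one of the finitely many points, so its power is one of the
  summands of an integrable majorant.\<close>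

lemma integrable_infdist_powr:
  fixes V :: "(real^2) set"
  assumes V: "finite V" "V \<noteq> {}" and S: "bounded S" "S \<in> sets borel" and \<gamma>: "0 \<le> \<gamma>" "\<gamma> < 2"
  shows "integrable lborel (\<lambda>x. indicator S x * infdist x V powr (- \<gamma>))"
proof -
  obtain B where B: "\<And>x. x \<in> S \<Longrightarrow> norm x \<le> B" using S(1) by (auto simp: bounded_iff)
  obtain B' where B': "\<And>v. v \<in> V \<Longrightarrow> norm v \<le> B'" using finite_imp_bounded[OF V(1)] by (auto simp: bounded_iff)
  \<comment> \<open>Large enough for \<open>S\<close> to lie in the ball of radius \<open>M\<close>
    around every point of \<open>V\<close>.\<close>
  define M where "M = \<bar>B\<bar> + \<bar>B'\<bar> + 1"
  have M: "M > 0" by (simp add: M_def)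
  let ?g = "\<lambda>x. \<Sum>v\<in>V. indicator (ball v M) x * norm (x - v) powr (- \<gamma>)"
  have gi: "integrable lborel ?g"
    by (intro Bochner_Integration.integrable_sum integrable_norm_powr \<gamma> M)
  show ?thesis
  proof (rule Bochner_Integration.integrable_bound[OF gi])
    have "continuous_on UNIV (\<lambda>x. infdist x V)" by (intro continuous_intros)
    then have m: "(\<lambda>x. infdist x V) \<in> borel_measurable borel" by (rule borel_measurable_continuous_onI)
    show "(\<lambda>x. indicator S x * infdist x V powr (- \<gamma>)) \<in> borel_measurable lborel"
      using m S(2) by (intro borel_measurable_times borel_measurable_indicator powr_real_measurable) simp_all
    show "AE x in lborel. norm (indicator S x * infdist x V powr (- \<gamma>)) \<le> norm (?g x)"
    proof (intro always_eventually allI)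
      fix x
      have g0: "0 \<le> ?g x" by (intro sum_nonneg) auto
      show "norm (indicator S x * infdist x V powr (- \<gamma>)) \<le> norm (?g x)"
      proof (cases "x \<in> S")
        case True
        obtain v where v: "v \<in> V" "infdist x V = dist x v" using infdist_finite_attained[OF V] by metis
        have "dist v x \<le> norm v + norm x" by (simp add: dist_norm norm_triangle_ineq4)
        then have "x \<in> ball v M" using B[OF True] B'[OF v(1)] by (simp add: M_def)
        then have "indicator S x * infdist x V powr (- \<gamma>) = indicator (ball v M) x * norm (x - v) powr (- \<gamma>)"
          using True v by (simp add: dist_norm)
        also have "\<dots> \<le> ?g x" using V(1) v(1) by (intro member_le_sum) auto
        finally show ?thesis using g0 by simp
      qed (use g0 in simp)
    qed
  qed
qed

text \<open>Serves the discs around the vertices, where the differences are estimated term by term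
  without any cancellation.\<close>

lemma near_vertices_bound:
  fixes V :: "(real^2) set" and w :: "real^2 \<Rightarrow> real"
  assumes V: "finite V" "V \<noteq> {}" and w: "w \<in> borel_measurable borel" and wi: "integrable lborel (\<lambda>x. (w x)\<^sup>2)"
    and C: "\<And>z t. t > 0 \<Longrightarrow> (LINT x|lborel. (w x)\<^sup>2 * indicator (ball z t) x) \<le> C * t"
    and \<tau>: "0 < \<tau>" "\<tau> \<le> 2"
  defines "m \<equiv> measure lborel (ball (0::real^2) 1)"
  assumes t: "t > 0" and A: "A > 0"
  shows "integrable lborel (\<lambda>x. \<bar>w x\<bar> powr \<tau> * indicator {x. infdist x V < A * t} x)"
    and "(LINT x|lborel. \<bar>w x\<bar> powr \<tau> * indicator {x. infdist x V < A * t} x) \<le> real (card V) * (m * A\<^sup>2 + C * A) * t powr (2 - \<tau> / 2)"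
proof -
  \<comment> \<open>The size of \<open>w\<close> suggested by a square integral \<open>O(t)\<close>
    over an area of order \<open>t\<^sup>2\<close>; both terms of \<open>powr_le_split\<close> then
    integrate to the order \<open>t powr (2 - \<tau> / 2)\<close>.\<close>
  define l where "l = t powr (- (1/2))"
  have l: "l > 0" using t by (simp add: l_def)
  have bs: "ball v s \<in> sets borel" for v :: "real^2" and s by simp
  have fin: "emeasure lborel (ball v (A * t)) < \<infinity>" for v :: "real^2" using emeasure_bounded_finite[of "ball v (A * t)"] by simp
  have w2: "integrable lborel (\<lambda>x. (w x)\<^sup>2 * indicator (ball v (A * t)) x)" for v
    using integrable_mult_indicator[OF _ wi, of "ball v (A * t)"] by (simp add: mult.commute)
  have ib: "integrable lborel (\<lambda>x. indicator (ball v (A * t)) x :: real)" for v :: "real^2"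
    using fin by (intro integrable_real_indicator) auto
  let ?g = "\<lambda>x. \<Sum>v\<in>V. l powr \<tau> * indicator (ball v (A * t)) x + l powr (\<tau> - 2) * ((w x)\<^sup>2 * indicator (ball v (A * t)) x)"
  have gi: "integrable lborel ?g" using w2 ib by (intro Bochner_Integration.integrable_sum Bochner_Integration.integrable_add integrable_mult_right)
  have pt: "\<bar>w x\<bar> powr \<tau> * indicator {x. infdist x V < A * t} x \<le> ?g x" for x
  proof (cases "infdist x V < A * t")
    case True
    obtain v where v: "v \<in> V" "infdist x V = dist x v" using infdist_finite_attained[OF V] by metis
    have xb: "x \<in> ball v (A * t)" using True v by (simp add: dist_commute)
    have "\<bar>w x\<bar> powr \<tau> \<le> l powr \<tau> + l powr (\<tau> - 2) * (w x)\<^sup>2" using powr_le_split[OF l \<tau>, of "\<bar>w x\<bar>"] by simp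
    then have "\<bar>w x\<bar> powr \<tau> * indicator {x. infdist x V < A * t} x \<le> l powr \<tau> * indicator (ball v (A * t)) x + l powr (\<tau> - 2) * ((w x)\<^sup>2 * indicator (ball v (A * t)) x)"
      using True xb by simp
    also have "\<dots> \<le> ?g x"
      by (rule member_le_sum[OF v(1), where f = "\<lambda>v. l powr \<tau> * indicator (ball v (A * t)) x + l powr (\<tau> - 2) * ((w x)\<^sup>2 * indicator (ball v (A * t)) x)"])
         (use V(1) in auto)
    finally show ?thesis .
  next
    case False
    then show ?thesis by (simp add: sum_nonneg)
  qed
  have "continuous_on UNIV (\<lambda>x. infdist x V)" by (intro continuous_intros)
  then have "open {x. infdist x V < A * t}" by (intro open_Collect_less continuous_on_const)
  then have sm: "{x. infdist x V < A * t} \<in> sets borel" by simp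
  show i: "integrable lborel (\<lambda>x. \<bar>w x\<bar> powr \<tau> * indicator {x. infdist x V < A * t} x)"
  proof (rule Bochner_Integration.integrable_bound[OF gi])
    show "(\<lambda>x. \<bar>w x\<bar> powr \<tau> * indicator {x. infdist x V < A * t} x) \<in> borel_measurable lborel"
      using w sm by (intro borel_measurable_times borel_measurable_indicator powr_real_measurable) simp_all
    show "AE x in lborel. norm (\<bar>w x\<bar> powr \<tau> * indicator {x. infdist x V < A * t} x) \<le> norm (?g x)"
    proof (intro always_eventually allI)
      fix x
      have "0 \<le> \<bar>w x\<bar> powr \<tau> * indicator {x. infdist x V < A * t} x" by simp
      with pt[of x] show "norm (\<bar>w x\<bar> powr \<tau> * indicator {x. infdist x V < A * t} x) \<le> norm (?g x)" unfolding real_norm_def by linarith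
    qed
  qed
  have At: "A * t > 0" using A t by simp
  have "(LINT x|lborel. \<bar>w x\<bar> powr \<tau> * indicator {x. infdist x V < A * t} x) \<le> (LINT x|lborel. ?g x)"
    by (rule integral_mono[OF i gi pt])
  also have "\<dots> = (\<Sum>v\<in>V. l powr \<tau> * measure lborel (ball v (A * t)) + l powr (\<tau> - 2) * (LINT x|lborel. (w x)\<^sup>2 * indicator (ball v (A * t)) x))"
  proof -
    have "(LINT x|lborel. ?g x) = (\<Sum>v\<in>V. LINT x|lborel. l powr \<tau> * indicator (ball v (A * t)) x + l powr (\<tau> - 2) * ((w x)\<^sup>2 * indicator (ball v (A * t)) x))"
      by (rule Bochner_Integration.integral_sum) (intro Bochner_Integration.integrable_add integrable_mult_right w2 ib)
    also have "\<dots> = (\<Sum>v\<in>V. (LINT x|lborel. l powr \<tau> * indicator (ball v (A * t)) x) + (LINT x|lborel. l powr (\<tau> - 2) * ((w x)\<^sup>2 * indicator (ball v (A * t)) x)))"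
      by (intro sum.cong refl Bochner_Integration.integral_add integrable_mult_right w2 ib)
    finally show ?thesis by simp
  qed
  also have "\<dots> \<le> (\<Sum>v\<in>V. l powr \<tau> * (m * (A * t)\<^sup>2) + l powr (\<tau> - 2) * (C * (A * t)))"
  proof (intro sum_mono add_mono)
    fix v assume "v \<in> V"
    show "l powr \<tau> * measure lborel (ball v (A * t)) \<le> l powr \<tau> * (m * (A * t)\<^sup>2)"
      using measure_ball_scale[OF less_imp_le[OF At], of v] unfolding m_def by (simp only: order_refl)
    show "l powr (\<tau> - 2) * (LINT x|lborel. (w x)\<^sup>2 * indicator (ball v (A * t)) x) \<le> l powr (\<tau> - 2) * (C * (A * t))"
      by (rule mult_left_mono[OF C[OF At] powr_ge_zero])
  qed
  also have "\<dots> = real (card V) * (l powr \<tau> * (m * (A * t)\<^sup>2) + l powr (\<tau> - 2) * (C * (A * t)))" by simp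
  also have "l powr \<tau> * (m * (A * t)\<^sup>2) = m * A\<^sup>2 * t powr (2 - \<tau> / 2)"
  proof -
    have "l powr \<tau> * t\<^sup>2 = t powr (- (1/2) * \<tau>) * t powr 2" using t by (simp add: l_def powr_powr)
    also have "\<dots> = t powr (- (1/2) * \<tau> + 2)" by (rule powr_add[symmetric])
    also have "- (1/2) * \<tau> + 2 = 2 - \<tau> / 2" by simp
    finally have e: "l powr \<tau> * t\<^sup>2 = t powr (2 - \<tau> / 2)" .
    have "l powr \<tau> * (m * (A * t)\<^sup>2) = m * A\<^sup>2 * (l powr \<tau> * t\<^sup>2)" by (simp only: power_mult_distrib mult_ac)
    then show ?thesis unfolding e .
  qed
  also have "l powr (\<tau> - 2) * (C * (A * t)) = C * A * t powr (2 - \<tau> / 2)"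
  proof -
    have "l powr (\<tau> - 2) * t = t powr (- (1/2) * (\<tau> - 2)) * t powr 1" using t by (simp add: l_def powr_powr)
    also have "\<dots> = t powr (- (1/2) * (\<tau> - 2) + 1)" by (rule powr_add[symmetric])
    also have "- (1/2) * (\<tau> - 2) + 1 = 2 - \<tau> / 2" by (simp add: field_simps)
    finally have e: "l powr (\<tau> - 2) * t = t powr (2 - \<tau> / 2)" .
    have "l powr (\<tau> - 2) * (C * (A * t)) = C * A * (l powr (\<tau> - 2) * t)" by (simp only: mult_ac)
    then show ?thesis unfolding e .
  qed
  finally show "(LINT x|lborel. \<bar>w x\<bar> powr \<tau> * indicator {x. infdist x V < A * t} x) \<le> real (card V) * (m * A\<^sup>2 + C * A) * t powr (2 - \<tau> / 2)"
    by (simp add: distrib_right mult.assoc)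
qed

text \<open>Where the distance \<open>d\<close> to the vertices exceeds a multiple of
  \<open>t\<close>, the pointwise estimate is integrated. There \<open>t / d \<le> 1\<close>, so the
  exponent \<open>r\<close> may be lowered to \<open>s\<close>: this gives away decay in
  \<open>t\<close>, but it makes the power of \<open>d\<close> integrable. Stating the result with a
  majorant \<open>G\<close> postpones the passage to \<open>Lp_norm\<close>.\<close>

lemma integrated_difference_bound:
  fixes \<Omega> V :: "(real^2) set"
  assumes sol: "H1_0_solution \<Omega> w W \<phi> \<mu>" and \<mu>: "\<mu> \<ge> 0"
    and V: "finite V" "V \<noteq> {}" "V \<inter> \<Omega> = {}"
    and c: "c > 0" "\<And>y. y \<in> \<Omega> \<Longrightarrow> flat_on \<Omega> y (c * infdist y V)"
    and \<tau>: "0 < \<tau>" "\<tau> \<le> 2" and r: "r > 0" and s: "0 \<le> s" "s \<le> real r" "(s + 1/2) * \<tau> < 2"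
  shows "\<exists>K\<ge>0. \<forall>t h. 0 < t \<longrightarrow> norm h \<le> t \<longrightarrow> (\<exists>G. integrable lborel G \<and> (\<forall>x. 0 \<le> G x) \<and>
     (\<forall>x\<in>diff_domain r h \<Omega>. \<bar>finite_difference r h (\<lambda>x. indicator \<Omega> x * helmholtz_kernel.smooth_rep \<mu> w x) x\<bar> powr \<tau> \<le> G x) \<and>
     (LINT x|lborel. G x) \<le> K * (t powr (s * \<tau>) + t powr (2 - \<tau> / 2)))"
proof -
  interpret S: H1_0_solution \<Omega> w W \<phi> \<mu> by (rule sol)
  interpret K: helmholtz_kernel \<mu> by unfold_locales (rule \<mu>)
  \<comment> \<open>The difference estimate holds for \<open>smooth_rep\<close> at every point of
    \<Omega>, whereas the integral bounds are inherited from \<open>w\<close> almost everywhere;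
    \<open>U\<close> enjoys both.\<close>
  define U where "U x = indicator \<Omega> x * K.smooth_rep w x" for x
  have Um: "U \<in> borel_measurable borel"
    unfolding U_def[abs_def] using K.smooth_rep_measurable[OF S.w_m] S.\<Omega>(1) by (intro borel_measurable_times borel_measurable_indicator) auto
  have "AE x in lebesgue. U x = w x"
    using K.smooth_rep_ae[OF S.weak_helmholtz_w S.\<Omega>(1)] by eventually_elim (auto simp: U_def S.w_0 split: split_indicator)
  then have Uw: "AE x in lborel. U x = w x" by (simp add: AE_lborel_iff_lebesgue)
  obtain C where C: "C > 0" "\<And>z t. t > 0 \<Longrightarrow> (LINT x|lborel. (w x)\<^sup>2 * indicator (ball z t) x) \<le> C * t" using S.strip_bound by metis
  have w2U: "integrable lborel (\<lambda>x. (U x)\<^sup>2)"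
    by (rule integrable_cong_AE_imp[OF S.w_i]) (use Um Uw in \<open>auto elim: eventually_mono\<close>)
  have CU: "(LINT x|lborel. (U x)\<^sup>2 * indicator (ball z t) x) \<le> C * t" if "t > 0" for z t
  proof -
    have "(LINT x|lborel. (U x)\<^sup>2 * indicator (ball z t) x) = (LINT x|lborel. (w x)\<^sup>2 * indicator (ball z t) x)"
    proof (rule integral_cong_AE)
      show "AE x in lborel. (U x)\<^sup>2 * indicator (ball z t) x = (w x)\<^sup>2 * indicator (ball z t) x" using Uw by eventually_elim simp
    qed (use Um S.w_m in \<open>auto intro!: borel_measurable_times borel_measurable_indicator\<close>)
    then show ?thesis using C(2)[OF that] by simp
  qed
  from difference_estimate[OF sol \<mu> C, of r] obtain E where E0: "E \<ge> 0 \<and> (\<forall>x R h. x \<in> \<Omega> \<longrightarrow> 0 < R \<longrightarrow> R \<le> 1 \<longrightarrow> flat_on \<Omega> x (4 * R) \<longrightarrow> real r * norm h < R / 2 \<longrightarrow>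
     (\<forall>k\<le>r. x + real k *\<^sub>R h \<in> \<Omega>) \<longrightarrow>
     \<bar>finite_difference r h (K.smooth_rep w) x\<bar> \<le> E * norm h ^ r * R powr (- (real r + 1/2)))"
    by (rule exE)
  note E = E0[THEN conjunct1] E0[THEN conjunct2, rule_format]
  obtain B where B: "\<And>y. y \<in> \<Omega> \<Longrightarrow> norm y \<le> B" using S.\<Omega>(2) by (auto simp: bounded_iff)
  obtain v0 where v0: "v0 \<in> V" using V(2) by blast
  define D where "D = \<bar>B\<bar> + norm v0 + 1"
  have D0: "D > 0" using norm_ge_zero[of v0] unfolding D_def by linarith
  have D: "infdist y V \<le> D" if "y \<in> \<Omega>" for y
  proof -
    have "infdist y V \<le> dist y v0" by (rule infdist_le[OF v0])
    also have "\<dots> \<le> norm y + norm v0" by (simp add: dist_norm norm_triangle_ineq4)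
    finally show ?thesis using B[OF that] by (simp add: D_def)
  qed
  have dpos: "infdist y V > 0" if "y \<in> \<Omega>" for y
  proof -
    obtain v where v: "v \<in> V" "infdist y V = dist y v" using infdist_finite_attained[OF V(1,2)] by metis
    have "v \<noteq> y" using v(1) that V(3) by blast
    then show ?thesis using v(2) by simp
  qed
  \<comment> \<open>With \<open>R = c' * d\<close>, the three bounds ensure, in this order,
    \<open>A \<ge> 1\<close> below, flatness on the ball of radius \<open>4 * R\<close>, and
    \<open>R \<le> 1\<close>.\<close>
  define c' where "c' = min 1 (min (c / 4) (1 / D))"
  have c': "0 < c'" "c' \<le> 1" "4 * c' \<le> c" "c' * D \<le> 1"
  proof -
    show "0 < c'" "c' \<le> 1" "4 * c' \<le> c" using c(1) D0 by (auto simp: c'_def)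
    have "c' \<le> 1 / D" by (simp add: c'_def)
    then show "c' * D \<le> 1" using D0 by (simp add: pos_le_divide_eq)
  qed
  \<comment> \<open>Chosen so that \<open>A * t < d\<close> gives
    \<open>real r * t < c' * d / 2\<close>, the condition on the step at scale
    \<open>R\<close>.\<close>
  define A where "A = 2 * real r / c'"
  have A: "A \<ge> 1" using r c' by (simp add: A_def pos_le_divide_eq)
  \<comment> \<open>Shifts by at most \<open>real r * t\<close> lead from distance
    \<open>A * t\<close> to \<open>(A + real r) * t\<close>; the extra \<open>1\<close> makes the
    inequality strict.\<close>
  define A' where "A' = A + real r + 1"
  have A': "A' > 0" using A by (simp add: A'_def)
  define m where "m = measure lborel (ball (0::real^2) 1)"
  define \<gamma> where "\<gamma> = (s + 1/2) * \<tau>"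
  have \<gamma>: "0 \<le> \<gamma>" "\<gamma> < 2" using s \<tau> by (auto simp: \<gamma>_def)
  define J where "J = (LINT x|lborel. indicator \<Omega> x * infdist x V powr (- \<gamma>))"
  have Ji: "integrable lborel (\<lambda>x. indicator \<Omega> x * infdist x V powr (- \<gamma>))"
    by (rule integrable_infdist_powr[OF V(1,2) S.\<Omega>(2) _ \<gamma>]) (use S.\<Omega>(1) in simp)
  have J0: "J \<ge> 0" unfolding J_def by (intro integral_nonneg_AE) auto
  define E' where "E' = E * c' powr (- (real r + 1/2))"
  have E': "E' \<ge> 0" using E(1) by (simp add: E'_def)
  \<comment> \<open>\<open>2 ^ r\<close> bounds the binomial coefficients; the other factor comes
    from \<open>sum_powr_le\<close>.\<close>
  define a2 where "a2 = (2 ^ r) powr \<tau> * real (card {..r}) powr \<tau>"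
  have a2: "a2 \<ge> 0" by (simp add: a2_def)
  define near where "near t = {x. infdist x V < A' * t}" for t
  define K where "K = E' powr \<tau> * J + a2 * (real (card {..r}) * (real (card V) * (m * A'\<^sup>2 + C * A')))"
  have K: "K \<ge> 0" unfolding K_def using J0 a2 C(1) A' by (intro add_nonneg_nonneg mult_nonneg_nonneg) (auto simp: m_def)
  have "\<exists>G. integrable lborel G \<and> (\<forall>x. 0 \<le> G x) \<and>
     (\<forall>x\<in>diff_domain r h \<Omega>. \<bar>finite_difference r h U x\<bar> powr \<tau> \<le> G x) \<and>
     (LINT x|lborel. G x) \<le> K * (t powr (s * \<tau>) + t powr (2 - \<tau> / 2))" if t: "0 < t" and h: "norm h \<le> t" for t h
  proof -
    note nb = near_vertices_bound[OF V(1,2) Um w2U CU \<tau> t A', folded near_def m_def]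
    define N where "N x = \<bar>U x\<bar> powr \<tau> * indicator (near t) x" for x
    \<comment> \<open>The sum of the majorants for the two regions; both are nonnegative, so in
      either region the other one may be dropped.\<close>
    define G where "G x = E' powr \<tau> * t powr (s * \<tau>) * (indicator \<Omega> x * infdist x V powr (- \<gamma>)) + a2 * (\<Sum>k\<le>r. N (real k *\<^sub>R h + x))" for x
    have Ni: "integrable lborel N" unfolding N_def using nb(1) .
    have Nsi: "integrable lborel (\<lambda>x. N (real k *\<^sub>R h + x))" for k by (rule lborel_integrable_shift[OF Ni])
    have Gi: "integrable lborel G" unfolding G_def
      by (intro Bochner_Integration.integrable_add integrable_mult_right Ji Bochner_Integration.integrable_sum Nsi)
    have N0: "N x \<ge> 0" for x by (simp add: N_def)
    have G0: "0 \<le> G x" for x unfolding G_def using a2 N0 by (intro add_nonneg_nonneg mult_nonneg_nonneg sum_nonneg) auto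
    have bound: "\<bar>finite_difference r h U x\<bar> powr \<tau> \<le> G x" if x: "x \<in> diff_domain r h \<Omega>" for x
    proof -
      have pts: "x + real k *\<^sub>R h \<in> \<Omega>" if "k \<le> r" for k using diff_domain_points[OF x that r] .
      have x\<Omega>: "x \<in> \<Omega>" using pts[of 0] by simp
      define d where "d = infdist x V"
      have d: "d > 0" unfolding d_def by (rule dpos[OF x\<Omega>])
      show ?thesis
      proof (cases "A * t < d")
        case True
        define R where "R = c' * d"
        have R: "0 < R" "R \<le> 1"
        proof -
          show "0 < R" using c' d by (simp add: R_def)
          have "c' * d \<le> c' * D" using c' D[OF x\<Omega>] by (intro mult_left_mono) (auto simp: d_def)
          then show "R \<le> 1" unfolding R_def using c'(4) by linarith
        qed
        have fl: "flat_on \<Omega> x (4 * R)"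
        proof (rule flat_on_mono[OF c(2)[OF x\<Omega>]])
          have "4 * R \<le> c * infdist x V" using c' d mult_right_mono[of "4 * c'" c d] by (simp add: R_def d_def)
          then show "ball x (4 * R) \<subseteq> ball x (c * infdist x V)" by (rule subset_ball)
        qed
        have rh: "real r * norm h < R / 2"
        proof -
          have "real r * norm h \<le> real r * t" using h by (intro mult_left_mono) auto
          also have "real r * t = c' / 2 * (A * t)" using c' by (simp add: A_def)
          also have "\<dots> < c' / 2 * d" using True c' by (intro mult_strict_left_mono) auto
          finally show ?thesis by (simp add: R_def)
        qed
        have "finite_difference r h U x = finite_difference r h (K.smooth_rep w) x"
          unfolding finite_difference_def using pts by (intro sum.cong refl) (simp add: U_def)
        then have "\<bar>finite_difference r h U x\<bar> \<le> E * norm h ^ r * R powr (- (real r + 1/2))"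
          using E(2)[OF x\<Omega> R fl rh] pts by simp
        also have "\<dots> \<le> E * t ^ r * R powr (- (real r + 1/2))"
          using E(1) h by (intro mult_right_mono mult_left_mono power_mono) auto
        also have "R powr (- (real r + 1/2)) = c' powr (- (real r + 1/2)) * d powr (- (real r + 1/2))"
          unfolding R_def using c' d by (simp add: powr_mult)
        also have "E * t ^ r * (c' powr (- (real r + 1/2)) * d powr (- (real r + 1/2))) = E' * (t ^ r * d powr (- (real r + 1/2)))"
          by (simp add: E'_def mult_ac)
        also have "t ^ r * d powr (- (real r + 1/2)) = (t / d) powr real r * d powr (- (1/2))"
        proof -
          have "d powr (- (real r + 1/2)) = d powr (- real r) * d powr (- (1/2))"
            using powr_add[of d "- real r" "- (1/2)"] by (simp add: algebra_simps)
          moreover have "(t / d) powr real r = t powr real r * d powr (- real r)"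
            using t d by (simp add: powr_divide powr_minus_divide)
          then have "(t / d) powr real r = t ^ r * d powr (- real r)"
            by (simp only: powr_realpow[OF t])
          ultimately show ?thesis by (simp only: mult_ac)
        qed
        also have "E' * ((t / d) powr real r * d powr (- (1/2))) \<le> E' * ((t / d) powr s * d powr (- (1/2)))"
        proof -
          have "t \<le> A * t" using A t by simp
          then have "t / d \<le> 1" using True d by (simp add: pos_divide_le_eq)
          then have "(t / d) powr real r \<le> (t / d) powr s" using t d s by (intro powr_mono') auto
          then show ?thesis using E' by (intro mult_left_mono mult_right_mono) auto
        qed
        finally have "\<bar>finite_difference r h U x\<bar> powr \<tau> \<le> (E' * ((t / d) powr s * d powr (- (1/2)))) powr \<tau>"
          using \<tau> by (intro powr_mono2) auto
        also have "\<dots> = E' powr \<tau> * t powr (s * \<tau>) * d powr (- \<gamma>)"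
        proof -
          have "(t / d) powr s * d powr (- (1/2)) = t powr s * d powr (- (s + 1/2))"
          proof -
            have "d powr (- (s + 1/2)) = d powr (- s) * d powr (- (1/2))"
              using powr_add[of d "- s" "- (1/2)"] by (simp add: algebra_simps)
            moreover have "(t / d) powr s = t powr s * d powr (- s)"
              using t d by (simp add: powr_divide powr_minus_divide)
            ultimately show ?thesis by (simp only: mult_ac)
          qed
          then have "(E' * ((t / d) powr s * d powr (- (1/2)))) powr \<tau> = E' powr \<tau> * ((t powr s) powr \<tau> * (d powr (- (s + 1/2))) powr \<tau>)"
            using E' by (simp add: powr_mult)
          also have "(t powr s) powr \<tau> = t powr (s * \<tau>)" by (rule powr_powr)
          also have "(d powr (- (s + 1/2))) powr \<tau> = d powr (- \<gamma>)" by (simp add: powr_powr \<gamma>_def algebra_simps)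
          finally show ?thesis by (simp only: mult.assoc)
        qed
        also have "\<dots> \<le> G x"
          unfolding G_def using x\<Omega> a2 N0 by (simp add: d_def sum_nonneg)
        finally show ?thesis .
      next
        case False
        have near: "x + real k *\<^sub>R h \<in> near t" if "k \<le> r" for k
        proof -
          have "infdist (x + real k *\<^sub>R h) V \<le> infdist x V + dist (x + real k *\<^sub>R h) x"
            by (rule infdist_triangle)
          also have "dist (x + real k *\<^sub>R h) x = real k * norm h" by (simp add: dist_norm)
          also have "real k * norm h \<le> real r * t" using that h by (intro mult_mono) auto
          also have "infdist x V \<le> A * t" using False by (simp add: d_def)
          finally have "infdist (x + real k *\<^sub>R h) V \<le> A * t + real r * t" by simp
          also have "\<dots> < A' * t" using t by (simp add: A'_def distrib_right)
          finally show ?thesis by (simp add: near_def)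
        qed
        have "\<bar>finite_difference r h U x\<bar> \<le> (\<Sum>k\<le>r. 2 ^ r * \<bar>U (x + real k *\<^sub>R h)\<bar>)"
          unfolding finite_difference_def
        proof (rule order_trans[OF sum_abs], rule sum_mono)
          fix k assume "k \<in> {..r}"
          have "r choose k \<le> 2 ^ r" by (rule binomial_le_pow2)
          then have "real (r choose k) \<le> 2 ^ r" by (metis of_nat_le_iff of_nat_numeral of_nat_power)
          then have "real (r choose k) * \<bar>U (x + real k *\<^sub>R h)\<bar> \<le> 2 ^ r * \<bar>U (x + real k *\<^sub>R h)\<bar>" by (intro mult_right_mono) auto
          then show "\<bar>(-1) ^ (r - k) * real (r choose k) * U (x + real k *\<^sub>R h)\<bar> \<le> 2 ^ r * \<bar>U (x + real k *\<^sub>R h)\<bar>"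
            by (simp add: abs_mult power_abs)
        qed
        also have "\<dots> = 2 ^ r * (\<Sum>k\<le>r. \<bar>U (x + real k *\<^sub>R h)\<bar>)" by (simp add: sum_distrib_left)
        finally have "\<bar>finite_difference r h U x\<bar> powr \<tau> \<le> (2 ^ r * (\<Sum>k\<le>r. \<bar>U (x + real k *\<^sub>R h)\<bar>)) powr \<tau>"
          using \<tau> by (intro powr_mono2) auto
        also have "\<dots> = (2 ^ r) powr \<tau> * (\<Sum>k\<le>r. \<bar>U (x + real k *\<^sub>R h)\<bar>) powr \<tau>" by (simp add: powr_mult sum_nonneg)
        also have "\<dots> \<le> (2 ^ r) powr \<tau> * (real (card {..r}) powr \<tau> * (\<Sum>k\<le>r. \<bar>U (x + real k *\<^sub>R h)\<bar> powr \<tau>))"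
          by (intro mult_left_mono sum_powr_le \<tau>) auto
        also have "(\<Sum>k\<le>r. \<bar>U (x + real k *\<^sub>R h)\<bar> powr \<tau>) = (\<Sum>k\<le>r. N (real k *\<^sub>R h + x))"
          using near by (intro sum.cong refl) (simp add: N_def add.commute)
        also have "(2 ^ r) powr \<tau> * (real (card {..r}) powr \<tau> * (\<Sum>k\<le>r. N (real k *\<^sub>R h + x))) \<le> G x"
          unfolding G_def a2_def by (simp add: mult.assoc)
        finally show ?thesis .
      qed
    qed
    have "(LINT x|lborel. G x) = E' powr \<tau> * t powr (s * \<tau>) * J + a2 * (\<Sum>k\<le>r. LINT x|lborel. N (real k *\<^sub>R h + x))"
      unfolding G_def J_def using Ji Nsi
      by (subst Bochner_Integration.integral_add) (auto simp: Bochner_Integration.integral_sum)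
    also have "(\<Sum>k\<le>r. LINT x|lborel. N (real k *\<^sub>R h + x)) = (\<Sum>k\<le>r. LINT x|lborel. N x)"
      using borel_measurable_integrable[OF Ni] by (intro sum.cong refl lborel_integral_shift) simp
    also have "\<dots> \<le> (\<Sum>k\<le>r. real (card V) * (m * A'\<^sup>2 + C * A') * t powr (2 - \<tau> / 2))"
      unfolding N_def by (intro sum_mono nb(2))
    also have "\<dots> = real (card {..r}) * (real (card V) * (m * A'\<^sup>2 + C * A')) * t powr (2 - \<tau> / 2)" by simp
    finally have "(LINT x|lborel. G x) \<le> E' powr \<tau> * t powr (s * \<tau>) * J + a2 * (real (card {..r}) * (real (card V) * (m * A'\<^sup>2 + C * A')) * t powr (2 - \<tau> / 2))"
      using a2 by (simp add: mult_left_mono)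
    also have "\<dots> \<le> K * (t powr (s * \<tau>) + t powr (2 - \<tau> / 2))"
    proof -
      define X where "X = E' powr \<tau> * J"
      define Y where "Y = a2 * (real (card {..r}) * (real (card V) * (m * A'\<^sup>2 + C * A')))"
      have X: "X \<ge> 0" using J0 by (simp add: X_def)
      have Y: "Y \<ge> 0" unfolding Y_def using a2 C(1) A' by (intro mult_nonneg_nonneg) (auto simp: m_def)
      have "X * t powr (s * \<tau>) + Y * t powr (2 - \<tau> / 2) \<le> (X + Y) * (t powr (s * \<tau>) + t powr (2 - \<tau> / 2))"
        using X Y by (simp add: algebra_simps)
      then show ?thesis by (simp only: X_def Y_def K_def mult_ac)
    qed
    finally show ?thesis using Gi G0 bound by blast
  qed
  then show ?thesis using K unfolding U_def by blast
qed

subsection \<open>The modulus of smoothness\<close>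

lemma set_integrable_powr_unit:
  fixes e :: real
  assumes "e > 0"
  shows "set_integrable lborel {0<..1} (\<lambda>t. t powr (e - 1))"
proof -
  have "(\<lambda>t. t powr (e - 1)) integrable_on {0<..1}"
    by (rule integrable_on_powr_from_0') (use assms in auto)
  then have "(\<lambda>t. t powr (e - 1)) absolutely_integrable_on {0<..1}"
    by (rule nonnegative_absolutely_integrable_1) simp
  then have "integrable lebesgue (\<lambda>t. indicator {0<..1} t *\<^sub>R t powr (e - 1))" unfolding set_integrable_def .
  moreover have "(\<lambda>t::real. indicator {0<..1} t *\<^sub>R t powr (e - 1)) \<in> borel_measurable lborel" by simp
  ultimately show ?thesis unfolding set_integrable_def by (simp add: integrable_completion)
qed

text \<open>The domain has finite measure, so the threshold \<open>1\<close> in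
  \<open>powr_le_split\<close> suffices.\<close>

lemma Lp_space_if_L2:
  fixes u :: "'a::euclidean_space \<Rightarrow> real"
  assumes \<Omega>: "open \<Omega>" "bounded \<Omega>" and u: "u \<in> Lp_space 2 \<Omega>" and \<tau>: "0 < \<tau>" "\<tau> \<le> 2"
  shows "u \<in> Lp_space \<tau> \<Omega>"
proof -
  have um: "u \<in> borel_measurable (lebesgue_on \<Omega>)" and ui: "integrable (lebesgue_on \<Omega>) (\<lambda>x. (norm (u x))\<^sup>2)"
    using u by (auto simp: Lp_space_2_iff)
  interpret finite_measure "lebesgue_on \<Omega>"
    by (rule finite_measure_lebesgue_on) (use \<Omega> in \<open>auto intro: lmeasurable_open\<close>)
  have "integrable (lebesgue_on \<Omega>) (\<lambda>x. 1 + (norm (u x))\<^sup>2)" using ui by simp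
  then have "integrable (lebesgue_on \<Omega>) (\<lambda>x. norm (u x) powr \<tau>)"
  proof (rule Bochner_Integration.integrable_bound)
    show "(\<lambda>x. norm (u x) powr \<tau>) \<in> borel_measurable (lebesgue_on \<Omega>)"
      using um by (intro powr_real_measurable borel_measurable_norm) auto
    have "\<bar>u x\<bar> powr \<tau> \<le> 1 + (u x)\<^sup>2" for x using powr_le_split[of 1 \<tau> "\<bar>u x\<bar>"] \<tau> by simp
    then show "AE x in lebesgue_on \<Omega>. norm (norm (u x) powr \<tau>) \<le> norm (1 + (norm (u x))\<^sup>2)"
      by (intro always_eventually allI) (simp add: add_nonneg_nonneg)
  qed
  then show ?thesis using um by (simp add: Lp_space_def)
qed

lemma Lp_norm_nonneg: "Lp_norm p \<Omega> f \<ge> 0"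
  by (simp add: Lp_norm_def)

text \<open>By the energy identity a negative \<mu> would force \<open>w\<close> to vanish almost
  everywhere. The sign is what makes \<open>sqrt \<mu>\<close> in the kernels a genuine square
  root.\<close>

lemma eigenvalue_nonneg:
  assumes e: "dirichlet_eigenfunction \<Omega> \<mu> u" and \<Omega>: "open \<Omega>"
    and w: "w \<in> borel_measurable borel" "AE x in lebesgue. x \<in> \<Omega> \<longrightarrow> u x = w x" "integrable lborel (\<lambda>x. (w x)\<^sup>2)"
    and eq: "(LINT x|lborel. W x \<bullet> W x) = \<mu> * (LINT x|lborel. w x * w x)"
  shows "\<mu> \<ge> 0"
proof (rule ccontr)
  assume "\<not> \<mu> \<ge> 0"
  have i: "integrable lborel (\<lambda>x. w x * w x)" using w(3) by (simp add: power2_eq_square)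
  have "(LINT x|lborel. W x \<bullet> W x) \<ge> 0" "(LINT x|lborel. w x * w x) \<ge> 0" by (auto intro!: integral_nonneg_AE)
  then have "(LINT x|lborel. w x * w x) = 0" using eq \<open>\<not> \<mu> \<ge> 0\<close> by (simp add: zero_le_mult_iff)
  then have "AE x in lborel. w x * w x = 0"
    using integral_nonneg_eq_0_iff_AE[OF i] by simp
  then have "AE x in lebesgue. w x * w x = 0" by (rule AE_completion)
  with w(2) have "AE x in lebesgue. x \<in> \<Omega> \<longrightarrow> u x = 0" by eventually_elim auto
  then have "AE x in lebesgue_on \<Omega>. u x = 0" using \<Omega> by (subst AE_restrict_space_iff) auto
  then show False using e by (simp add: dirichlet_eigenfunction_def)
qed

text \<open>A supremum of reals is meaningful only over a set bounded above, which \<open>B\<close>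
  provides. Monotonicity in \<open>t\<close> is what later makes the modulus measurable.\<close>

lemma modulus_of_smoothness_le:
  assumes "\<And>h. norm h \<le> t \<Longrightarrow> Lp_norm p (diff_domain r h \<Omega>) (finite_difference r h f) \<le> B" and t: "t \<ge> 0"
  shows "0 \<le> modulus_of_smoothness r p \<Omega> f t" "modulus_of_smoothness r p \<Omega> f t \<le> B"
    and "0 \<le> t' \<Longrightarrow> t' \<le> t \<Longrightarrow> modulus_of_smoothness r p \<Omega> f t' \<le> modulus_of_smoothness r p \<Omega> f t"
proof -
  let ?L = "\<lambda>h. Lp_norm p (diff_domain r h \<Omega>) (finite_difference r h f)"
  have b: "bdd_above (?L ` {h. norm h \<le> t})" using assms(1) by (auto intro!: bdd_aboveI)
  have 0: "0 \<in> {h. norm h \<le> t}" using t by simp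
  show "0 \<le> modulus_of_smoothness r p \<Omega> f t"
    unfolding modulus_of_smoothness_def by (rule cSUP_upper2[OF b 0 Lp_norm_nonneg])
  show "modulus_of_smoothness r p \<Omega> f t \<le> B"
    unfolding modulus_of_smoothness_def by (rule cSUP_least) (use 0 assms(1) in blast)+
  show "modulus_of_smoothness r p \<Omega> f t' \<le> modulus_of_smoothness r p \<Omega> f t" if "0 \<le> t'" "t' \<le> t"
  proof -
    have "0 \<in> {h::'a. norm h \<le> t'}" using that by simp
    then have "{h::'a. norm h \<le> t'} \<noteq> {}" by blast
    then show ?thesis unfolding modulus_of_smoothness_def
      by (rule cSUP_subset_mono[OF _ b]) (use that in auto)
  qed
qed

lemma Lp_norm_finite_difference_le:
  fixes u U :: "'a::euclidean_space \<Rightarrow> real"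
  assumes \<Omega>: "open \<Omega>" and U: "U \<in> borel_measurable borel" and ae: "AE x in lebesgue. x \<in> \<Omega> \<longrightarrow> u x = U x"
    and r: "r > 0" and \<tau>: "\<tau> > 0"
    and G: "integrable lborel G" "\<And>x. 0 \<le> G x" "\<And>x. x \<in> diff_domain r h \<Omega> \<Longrightarrow> \<bar>finite_difference r h U x\<bar> powr \<tau> \<le> G x"
    and B: "(LINT x|lborel. G x) \<le> B"
  shows "Lp_norm \<tau> (diff_domain r h \<Omega>) (finite_difference r h u) \<le> B powr (1 / \<tau>)"
proof -
  let ?D = "diff_domain r h \<Omega>"
  let ?F = "\<lambda>x. norm (finite_difference r h u x) powr \<tau>"
  let ?F' = "\<lambda>x. indicator ?D x * \<bar>finite_difference r h U x\<bar> powr \<tau>"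
  have Db: "?D \<in> sets borel" using open_diff_domain[OF \<Omega>] by simp
  have "0 \<le> (LINT x|lborel. G x)" using G(2) by (intro integral_nonneg_AE) simp
  then have B0: "0 \<le> B" using B by (rule order_trans)
  have le: "(LINT x|lebesgue_on ?D. ?F x) \<le> B"
  proof (cases "integrable (lebesgue_on ?D) ?F")
    \<comment> \<open>A function that is not integrable has integral \<open>0\<close> by convention,
      so the bound is trivial; in the other case measurability comes with integrability.\<close>
    case False
    then show ?thesis using B0 by (simp add: not_integrable_integral_eq)
  next
    case True
    have "(\<lambda>x. U (x + real k *\<^sub>R h)) \<in> borel_measurable borel" for k
      by (rule measurable_compose[OF _ U]) simp
    then have fm: "finite_difference r h U \<in> borel_measurable borel"
      unfolding finite_difference_def[abs_def] by (intro borel_measurable_sum borel_measurable_times borel_measurable_const)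
    have m': "?F' \<in> borel_measurable borel"
      using fm Db by (intro borel_measurable_times borel_measurable_indicator powr_real_measurable borel_measurable_abs) auto
    \<comment> \<open>The exceptional sets for the \<open>r + 1\<close> shifted points are
      translates of one null set.\<close>
    have "AE x in lborel. x \<in> \<Omega> \<longrightarrow> u x = U x" using ae by (simp add: AE_lborel_iff_lebesgue)
    then have "AE x in lborel. real k *\<^sub>R h + x \<in> \<Omega> \<longrightarrow> u (real k *\<^sub>R h + x) = U (real k *\<^sub>R h + x)" for k
      by (rule AE_lborel_shift)
    then have "AE x in lborel. \<forall>k\<in>{..r}. real k *\<^sub>R h + x \<in> \<Omega> \<longrightarrow> u (real k *\<^sub>R h + x) = U (real k *\<^sub>R h + x)"
      by (intro AE_finite_allI) auto
    then have "AE x in lebesgue. \<forall>k\<in>{..r}. real k *\<^sub>R h + x \<in> \<Omega> \<longrightarrow> u (real k *\<^sub>R h + x) = U (real k *\<^sub>R h + x)"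
      by (rule AE_completion)
    then have ae': "AE x in lebesgue. x \<in> ?D \<longrightarrow> ?F x = ?F' x"
    proof eventually_elim
      case (elim x)
      show ?case
      proof
        assume x: "x \<in> ?D"
        have "finite_difference r h u x = finite_difference r h U x"
          unfolding finite_difference_def
        proof (intro sum.cong refl)
          fix k assume k: "k \<in> {..r}"
          then have "x + real k *\<^sub>R h \<in> \<Omega>" using diff_domain_points[OF x _ r] by simp
          then show "(-1) ^ (r - k) * real (r choose k) * u (x + real k *\<^sub>R h) = (-1) ^ (r - k) * real (r choose k) * U (x + real k *\<^sub>R h)"
            using elim k by (simp add: add.commute)
        qed
        then show "?F x = ?F' x" using x by simp
      qed
    qed
    have "(LINT x|lebesgue_on ?D. ?F x) = (LINT x|lborel. ?F' x)"
      by (rule lebesgue_on_lborel(2)[OF Db borel_measurable_integrable[OF True] m' _ ae']) simp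
    also have "\<dots> \<le> (LINT x|lborel. G x)"
      by (rule integral_mono'[OF G(1) _ G(2)]) (use G(2,3) in \<open>auto split: split_indicator\<close>)
    finally show ?thesis using B by linarith
  qed
  have "0 \<le> (LINT x|lebesgue_on ?D. ?F x)" by (intro integral_nonneg_AE) auto
  then show ?thesis unfolding Lp_norm_def using le \<tau> by (intro powr_mono2) auto
qed

theorem theorem17:
  fixes \<Omega> :: "(real^2) set" and d :: nat and x :: "nat \<Rightarrow> real^2" and \<theta> :: "nat \<Rightarrow> real"
    and u :: "real^2 \<Rightarrow> real" and \<mu> \<alpha> \<tau> :: real
  assumes "polygonal_domain \<Omega> d x \<theta>"
    and "\<And>i. i \<in> {1..d} \<Longrightarrow> 0 < \<theta> i \<and> \<theta> i < 2 * pi"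
    and "dirichlet_eigenfunction \<Omega> \<mu> u"
    and "\<alpha> \<ge> 0" and "1 / \<tau> = \<alpha> / 2 + 1 / 2"
  shows "u \<in> besov_space \<alpha> \<tau> \<tau> \<Omega>"
proof -
  have \<Omega>: "open \<Omega>" "bounded \<Omega>" using polygonal_domainD[OF assms(1)] by auto
  have u0: "u \<in> H1_0 \<Omega>" using assms(3) by (simp add: dirichlet_eigenfunction_def)
  obtain w W \<phi> where w: "w \<in> borel_measurable borel" "W \<in> borel_measurable borel"
    "\<And>x. x \<notin> \<Omega> \<Longrightarrow> w x = 0" "\<And>x. x \<notin> \<Omega> \<Longrightarrow> W x = 0"
    "AE x in lebesgue. x \<in> \<Omega> \<longrightarrow> u x = w x" "AE x in lebesgue. x \<in> \<Omega> \<longrightarrow> weak_grad \<Omega> u x = W x"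
    "integrable lborel (\<lambda>x. (w x)\<^sup>2)" "integrable lborel (\<lambda>x. (norm (W x))\<^sup>2)"
    "\<And>n::nat. \<phi> n \<in> test_functions \<Omega>"
    "(\<lambda>n. LINT x|lborel. (w x - \<phi> n x)\<^sup>2) \<longlonglongrightarrow> 0"
    "(\<lambda>n. LINT x|lborel. (norm (W x - grad (\<phi> n) x))\<^sup>2) \<longlonglongrightarrow> 0"
  proof (rule H1_0_representative[OF \<Omega>(1) u0], goal_cases)
    case (1 w W \<phi>)
    show ?case by (rule 1(1)[OF 1(2-12)])
  qed
  note eig = dirichlet_eigenfunction_test[OF \<Omega>(1) assms(3) w(1,3,5) w(2,4,6)]
  have \<mu>: "\<mu> \<ge> 0" by (rule eigenvalue_nonneg[OF assms(3) \<Omega>(1) w(1,5,7) eig(2)])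
  have sol: "H1_0_solution \<Omega> w W \<phi> \<mu>"
    by unfold_locales (use \<Omega> w eig(1) in auto)
  interpret S: H1_0_solution \<Omega> w W \<phi> \<mu> by (rule sol)
  interpret K: helmholtz_kernel \<mu> by unfold_locales (rule \<mu>)
  have \<tau>0: "\<tau> > 0"
  proof -
    have "1 / \<tau> > 0" unfolding assms(5) using assms(4) by simp
    then show ?thesis by simp
  qed
  then have \<alpha>\<tau>: "(\<alpha> + 1) * \<tau> = 2" using assms(5) by (simp add: field_simps)
  have \<tau>2: "\<tau> \<le> 2" using \<alpha>\<tau> mult_nonneg_nonneg[OF assms(4) less_imp_le[OF \<tau>0]] by (simp add: distrib_right)
  define r where "r = nat \<lfloor>\<alpha>\<rfloor> + 1"
  have r: "r > 0" "\<alpha> < real r" using assms(4) by (simp_all add: r_def) linarith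
  \<comment> \<open>Any exponent above \<alpha>, at most \<open>r\<close> and below
    \<open>\<alpha> + 1/2\<close> would do: the first condition makes the integral over
    \<open>t\<close> converge, the last one makes the power of the distance to the vertices
    integrable.\<close>
  define s where "s = min (real r) (\<alpha> + 1/4)"
  have s: "0 \<le> s" "s \<le> real r" "\<alpha> < s" using assms(4) r by (auto simp: s_def)
  have s2: "(s + 1/2) * \<tau> < 2"
  proof -
    have "s + 1/2 < \<alpha> + 1" by (simp add: s_def)
    then have "(s + 1/2) * \<tau> < (\<alpha> + 1) * \<tau>" using \<tau>0 by (rule mult_strict_right_mono)
    then show ?thesis using \<alpha>\<tau> by simp
  qed
  define V where "V = x ` {1..d}"
  have V: "finite V" "V \<noteq> {}" "V \<inter> \<Omega> = {}"
  proof -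
    show "finite V" by (simp add: V_def)
    show "V \<noteq> {}" unfolding V_def by (rule polygonal_vertices_nonempty[OF assms(1)])
    show "V \<inter> \<Omega> = {}"
      using polygonal_domainD(5)[OF assms(1)] \<Omega>(1) unfolding V_def by (auto simp: frontier_def interior_open)
  qed
  obtain c where c: "c > 0" "\<And>y. y \<in> \<Omega> \<Longrightarrow> flat_on \<Omega> y (c * infdist y V)"
    using polygonal_flat_on[OF assms(1)] unfolding V_def by blast
  define U where "U x = indicator \<Omega> x * K.smooth_rep w x" for x
  have Um: "U \<in> borel_measurable borel"
    unfolding U_def[abs_def] using K.smooth_rep_measurable[OF S.w_m] \<Omega>(1) by (intro borel_measurable_times borel_measurable_indicator) auto
  have uU: "AE x in lebesgue. x \<in> \<Omega> \<longrightarrow> u x = U x"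
    using K.smooth_rep_ae[OF S.weak_helmholtz_w \<Omega>(1)] w(5) by eventually_elim (auto simp: U_def)
  from integrated_difference_bound[OF sol \<mu> V c \<tau>0 \<tau>2 r(1) s(1,2) s2, folded U_def]
  obtain C where C0: "C \<ge> 0 \<and> (\<forall>t h. 0 < t \<longrightarrow> norm h \<le> t \<longrightarrow> (\<exists>G. integrable lborel G \<and> (\<forall>x. 0 \<le> G x) \<and>
     (\<forall>x\<in>diff_domain r h \<Omega>. \<bar>finite_difference r h U x\<bar> powr \<tau> \<le> G x) \<and>
     (LINT x|lborel. G x) \<le> C * (t powr (s * \<tau>) + t powr (2 - \<tau> / 2))))"
    by (rule exE)
  note C = C0[THEN conjunct1] C0[THEN conjunct2, rule_format]
  define B where "B t = C * (t powr (s * \<tau>) + t powr (2 - \<tau> / 2))" for t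
  have B0: "B t \<ge> 0" for t using C(1) by (simp add: B_def)
  let ?\<omega> = "modulus_of_smoothness r \<tau> \<Omega> u"
  have Lb: "Lp_norm \<tau> (diff_domain r h \<Omega>) (finite_difference r h u) \<le> B t powr (1 / \<tau>)" if t: "0 < t" and h: "norm h \<le> t" for t h
  proof -
    obtain G where G: "integrable lborel G" "\<forall>x. 0 \<le> G x"
      "\<forall>x\<in>diff_domain r h \<Omega>. \<bar>finite_difference r h U x\<bar> powr \<tau> \<le> G x" "(LINT x|lborel. G x) \<le> B t"
      using C(2)[OF t h] unfolding B_def by blast
    show ?thesis
      by (rule Lp_norm_finite_difference_le[OF \<Omega>(1) Um uU r(1) \<tau>0 G(1) _ _ G(4)]) (use G(2,3) in auto)
  qed
  have \<omega>: "0 \<le> ?\<omega> t" "?\<omega> t \<le> B t powr (1 / \<tau>)" "0 \<le> t' \<Longrightarrow> t' \<le> t \<Longrightarrow> ?\<omega> t' \<le> ?\<omega> t" if "0 < t" for t t'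
    using modulus_of_smoothness_le[OF Lb[OF that] less_imp_le[OF that]] by blast+
  let ?I = "{0<..1::real}"
  let ?F = "\<lambda>t. (t powr (- \<alpha>) * ?\<omega> t) powr \<tau> / t"
  \<comment> \<open>The exponents left after dividing by \<open>t\<close>:
    \<open>(s - \<alpha>) * \<tau> - 1\<close>, and
    \<open>- \<alpha> * \<tau> + (2 - \<tau> / 2) - 1\<close>, which is
    \<open>\<tau> / 2 - 1\<close> by \<open>(\<alpha> + 1) * \<tau> = 2\<close>. Both exceed
    \<open>- 1\<close>.\<close>
  let ?g = "\<lambda>t. C * (t powr ((s - \<alpha>) * \<tau> - 1) + t powr (\<tau> / 2 - 1))"
  have gi: "set_integrable lborel ?I ?g"
    using s \<tau>0 by (intro set_integrable_mult_right set_integral_add(1) set_integrable_powr_unit) auto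
  have Fg: "0 \<le> ?F t" "?F t \<le> ?g t" if "t \<in> ?I" for t
  proof -
    have t: "t > 0" using that by simp
    show "0 \<le> ?F t" using t by simp
    have "?\<omega> t powr \<tau> \<le> (B t powr (1 / \<tau>)) powr \<tau>" using \<omega>(1,2)[OF t] \<tau>0 by (intro powr_mono2) auto
    also have "\<dots> = B t" using \<tau>0 B0[of t] by (simp add: powr_powr)
    finally have b: "?\<omega> t powr \<tau> \<le> B t" .
    have "?F t = (t powr (- \<alpha>)) powr \<tau> * ?\<omega> t powr \<tau> / t" using \<omega>(1)[OF t] by (simp add: powr_mult)
    also have "\<dots> \<le> (t powr (- \<alpha>)) powr \<tau> * B t / t" using b t by (intro divide_right_mono mult_left_mono) auto
    also have "\<dots> = C * ((t powr (- \<alpha> * \<tau>) * t powr (s * \<tau>)) / t + (t powr (- \<alpha> * \<tau>) * t powr (2 - \<tau> / 2)) / t)"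
      by (simp only: B_def powr_powr) (simp add: distrib_left add_divide_distrib mult.left_commute)
    also have "(t powr (- \<alpha> * \<tau>) * t powr (s * \<tau>)) / t = t powr ((s - \<alpha>) * \<tau> - 1)"
    proof -
      have "(t powr (- \<alpha> * \<tau>) * t powr (s * \<tau>)) / t = t powr (- \<alpha> * \<tau> + s * \<tau>) / t powr 1"
        using t by (simp only: powr_add) simp
      also have "\<dots> = t powr ((- \<alpha> * \<tau> + s * \<tau>) - 1)" by (rule powr_diff[symmetric])
      also have "(- \<alpha> * \<tau> + s * \<tau>) - 1 = (s - \<alpha>) * \<tau> - 1" by (simp add: algebra_simps)
      finally show ?thesis .
    qed
    also have "(t powr (- \<alpha> * \<tau>) * t powr (2 - \<tau> / 2)) / t = t powr (\<tau> / 2 - 1)"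
    proof -
      have "(t powr (- \<alpha> * \<tau>) * t powr (2 - \<tau> / 2)) / t = t powr (- \<alpha> * \<tau> + (2 - \<tau> / 2)) / t powr 1"
        using t by (simp only: powr_add) simp
      also have "\<dots> = t powr ((- \<alpha> * \<tau> + (2 - \<tau> / 2)) - 1)" by (rule powr_diff[symmetric])
      also have "(- \<alpha> * \<tau> + (2 - \<tau> / 2)) - 1 = \<tau> / 2 - 1" using \<alpha>\<tau> by (simp add: algebra_simps)
      finally show ?thesis .
    qed
    finally show "?F t \<le> ?g t" .
  qed
  have "set_integrable lborel ?I ?F"
    unfolding set_integrable_def
  proof (rule Bochner_Integration.integrable_bound[OF gi[unfolded set_integrable_def]])
    \<comment> \<open>A supremum over uncountably many steps is not obviously measurable;
      monotonicity settles this.\<close>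
    have "mono_on ?I ?\<omega>" by (rule mono_onI) (use \<omega>(3) in auto)
    then have m: "?\<omega> \<in> borel_measurable (restrict_space borel ?I)" by (rule borel_measurable_mono_on_fnc)
    have "(\<lambda>t::real. t powr (- \<alpha>)) \<in> borel_measurable (restrict_space borel ?I)" "(\<lambda>t::real. t) \<in> borel_measurable (restrict_space borel ?I)"
      by (rule measurable_restrict_space1, simp)+
    then have "?F \<in> borel_measurable (restrict_space borel ?I)"
      by (intro borel_measurable_divide powr_real_measurable borel_measurable_times m borel_measurable_const)
    then show "(\<lambda>t. indicator ?I t *\<^sub>R ?F t) \<in> borel_measurable lborel"
      by (subst (asm) borel_measurable_restrict_space_iff) auto
    show "AE t in lborel. norm (indicator ?I t *\<^sub>R ?F t) \<le> norm (indicator ?I t *\<^sub>R ?g t)"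
    proof (intro always_eventually allI)
      fix t
      show "norm (indicator ?I t *\<^sub>R ?F t) \<le> norm (indicator ?I t *\<^sub>R ?g t)"
      proof (cases "t \<in> ?I")
        case True
        have "\<bar>?F t\<bar> \<le> \<bar>?g t\<bar>" using Fg[OF True] by linarith
        then show ?thesis using True by simp
      qed simp
    qed
  qed
  moreover have "u \<in> Lp_space \<tau> \<Omega>"
    using u0 by (intro Lp_space_if_L2[OF \<Omega> _ \<tau>0 \<tau>2]) (auto simp: H1_0_def H1_def)
  ultimately show ?thesis unfolding besov_space_def r_def by simp
qed

end
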